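(* Let $(M,g)$ be a compact Riemannian surface without boundary, with injectivity radius $i$ and strong convexity radius $\tau$, and let $0<\delta\le\min\{i/6,\tau\}$. If $\{p_1,\dots,p_n\}\subset M$ is $\delta$-dense, then $\{p_1,\dots,p_n\}$ forms a Delaunay triangulation (with decision radius $\delta$); that is, the natural map $R:|K_{\{p_1,\dots,p_n\}}|\to M$ is a homeomorphism.
   Context: The injectivity radius $i$ is the largest number such that $d(p,q)<i$ implies there is a unique geodesic of length less than $i$ between $p$ and $q$. The strong convexity radius $\tau$ is the largest number such that, for any disk of radius less than $\tau$, the interior of the unique minimal length geodesic connecting any pair of points in the disk's closure lies in the disk's interior. Disks are metric balls, and circles are their boundaries. A set $\{p_1,\dots,p_n\}$ is $\delta$-dense if each open ball of radius $\delta$ contains at least one $p_j$ and no four of the points lie on a circle of radius less than $\min\{i/6,\tau\}$. The abstract two-complex $K_{\{p_1,\dots,p_n\}}$ (with decision radius $\delta$) has vertices $p_1,\dots,p_n$; a pair is an edge (respectively a triple is a face) if the pair (respectively triple) lies on the boundary of a disk of radius less than $\delta$ whose interior contains none of the points $p_1,\dots,p_n$. $|K_{\{p_1,\dots,p_n\}}|$ is its polyhedral realization. The map $R$ is a continuous map sending each vertex to the corresponding point $p_j$, each edge $pq$ affinely onto the unique minimal geodesic from $p$ to $q$, and each face $\{q_1,q_2,q_3\}$ homeomorphically onto the geodesic triangle bounded by the three minimal geodesics $q_1q_2,q_1q_3,q_2q_3$ inside the disk on whose boundary $q_1,q_2,q_3$ lie. The points are said to form a Delaunay triangulation when $R$ is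 a homeomorphism. *)

theory Defs
  imports "HOL-Analysis.Analysis"
begin

section \<open>Smooth maps on open subsets of Euclidean space\<close>

primrec Ck_on :: "nat \<Rightarrow> 'a::real_normed_vector set \<Rightarrow> ('a \<Rightarrow> 'b::real_normed_vector) \<Rightarrow> bool" where
  "Ck_on 0 S f \<longleftrightarrow> continuous_on S f"
| "Ck_on (Suc k) S f \<longleftrightarrow>
     (\<forall>x\<in>S. f differentiable (at x)) \<and> (\<forall>v. Ck_on k S (\<lambda>x. frechet_derivative f (at x) v))"

definition smooth_on :: "'a::real_normed_vector set \<Rightarrow> ('a \<Rightarrow> 'b::real_normed_vector) \<Rightarrow> bool" where
  "smooth_on S f \<longleftrightarrow> (\<forall>k. Ck_on k S f)"


section \<open>Riemannian surfaces\<close>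

text \<open>A chart is a pair of its domain and its coordinate map; the values of the coordinate map
  outside the domain are irrelevant.\<close>

type_synonym 'a chart = "'a set \<times> ('a \<Rightarrow> real^2)"

abbreviation chart_dom :: "'a chart \<Rightarrow> 'a set" where
  "chart_dom c \<equiv> fst c"

abbreviation coords :: "'a chart \<Rightarrow> 'a \<Rightarrow> real^2" where
  "coords c \<equiv> snd c"

abbreviation chart_image :: "'a chart \<Rightarrow> (real^2) set" where
  "chart_image c \<equiv> coords c ` chart_dom c"

definition transition :: "'a chart \<Rightarrow> 'a chart \<Rightarrow> real^2 \<Rightarrow> real^2" where
  "transition c c' = coords c' \<circ> inv_into (chart_dom c) (coords c)"

text \<open>The metric is recorded by its Gram matrices: \<open>gram M c y\<close> is the matrix
  \<open>(g\<^sub>i\<^sub>j)\<close> of the metric in the chart \<open>c\<close> at the point with coordinates \<open>y\<close>.\<close>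

record 'a riemannian_data =
  surf :: "'a topology"
  atlas :: "'a chart set"
  gram :: "'a chart \<Rightarrow> real^2 \<Rightarrow> real^2^2"

abbreviation points :: "'a riemannian_data \<Rightarrow> 'a set" where
  "points M \<equiv> topspace (surf M)"

definition riemannian_surface :: "'a riemannian_data \<Rightarrow> bool" where
  "riemannian_surface M \<longleftrightarrow>
     Hausdorff_space (surf M) \<and> second_countable (surf M) \<and>
     points M = (\<Union>c\<in>atlas M. chart_dom c) \<and>
     (\<forall>c\<in>atlas M.
        openin (surf M) (chart_dom c) \<and> open (chart_image c) \<and>
        homeomorphic_map (subtopology (surf M) (chart_dom c)) (top_of_set (chart_image c)) (coords c)) \<and>
     (\<forall>c\<in>atlas M. \<forall>c'\<in>atlas M.
        smooth_on (coords c ` (chart_dom c \<inter> chart_dom c')) (transition c c')) \<and>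
     (\<forall>c\<in>atlas M.
        smooth_on (chart_image c) (gram M c) \<and>
        (\<forall>y\<in>chart_image c. transpose (gram M c y) = gram M c y \<and>
           (\<forall>v. v \<noteq> 0 \<longrightarrow> 0 < v \<bullet> (gram M c y *v v)))) \<and>
     (\<forall>c\<in>atlas M. \<forall>c'\<in>atlas M. \<forall>x\<in>chart_dom c \<inter> chart_dom c'.
        let J = frechet_derivative (transition c c') (at (coords c x)) in
        \<forall>v w. v \<bullet> (gram M c (coords c x) *v w) = J v \<bullet> (gram M c' (coords c' x) *v J w))"


section \<open>Curves, length and distance\<close>

text \<open>All curves between two points are parametrised by \<open>[0,1]\<close>; their values elsewhere are
  irrelevant. The derivatives at the ends of a parameter interval are one-sided.\<close>

definition velocity :: "'a chart \<Rightarrow> real set \<Rightarrow> (real \<Rightarrow> 'a) \<Rightarrow> real \<Rightarrow> real^2" where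
  "velocity c I \<gamma> t = vector_derivative (coords c \<circ> \<gamma>) (at t within I)"

definition C1_curve_on :: "'a riemannian_data \<Rightarrow> real set \<Rightarrow> (real \<Rightarrow> 'a) \<Rightarrow> bool" where
  "C1_curve_on M I \<gamma> \<longleftrightarrow>
     continuous_map (top_of_set I) (surf M) \<gamma> \<and>
     (\<forall>c\<in>atlas M.
        (\<forall>t\<in>I. \<gamma> t \<in> chart_dom c \<longrightarrow> (coords c \<circ> \<gamma>) differentiable (at t within I)) \<and>
        continuous_on {t \<in> I. \<gamma> t \<in> chart_dom c} (velocity c I \<gamma>))"

definition piecewise_C1_curve :: "'a riemannian_data \<Rightarrow> (real \<Rightarrow> 'a) \<Rightarrow> bool" where
  "piecewise_C1_curve M \<gamma> \<longleftrightarrow>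
     (\<exists>n s. s 0 = 0 \<and> s n = 1 \<and>
        (\<forall>k<n. s k < s (Suc k) \<and> C1_curve_on M {s k..s (Suc k)} \<gamma>))"

text \<open>The norm of the velocity does not depend on the chart. At the finitely many break points of
  a piecewise curve the value is arbitrary, which does not affect the length.\<close>

definition speed :: "'a riemannian_data \<Rightarrow> (real \<Rightarrow> 'a) \<Rightarrow> real \<Rightarrow> real" where
  "speed M \<gamma> t =
     (let c = (SOME c. c \<in> atlas M \<and> \<gamma> t \<in> chart_dom c); v = velocity c {0..1} \<gamma> t
      in sqrt (v \<bullet> (gram M c (coords c (\<gamma> t)) *v v)))"

definition curve_length :: "'a riemannian_data \<Rightarrow> (real \<Rightarrow> 'a) \<Rightarrow> real" where
  "curve_length M \<gamma> = integral {0..1} (speed M \<gamma>)"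

text \<open>Connectedness is not built into a surface, so points in different components have
  distance \<open>\<infinity>\<close>.\<close>

definition rdist :: "'a riemannian_data \<Rightarrow> 'a \<Rightarrow> 'a \<Rightarrow> ereal" where
  "rdist M p q = (INF \<gamma> \<in> {\<gamma>. piecewise_C1_curve M \<gamma> \<and> \<gamma> 0 = p \<and> \<gamma> 1 = q}. ereal (curve_length M \<gamma>))"


section \<open>Geodesics\<close>

definition partial_deriv :: "2 \<Rightarrow> (real^2 \<Rightarrow> real) \<Rightarrow> real^2 \<Rightarrow> real" where
  "partial_deriv i f y = frechet_derivative f (at y) (axis i 1)"

text \<open>The Christoffel symbol
  \<open>\<Gamma>\<^sup>k\<^sub>i\<^sub>j = 1/2 \<Sum>\<^sub>l g\<^sup>k\<^sup>l (\<partial>\<^sub>i g\<^sub>j\<^sub>l + \<partial>\<^sub>j g\<^sub>i\<^sub>l - \<partial>\<^sub>l g\<^sub>i\<^sub>j)\<close>.\<close>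

definition christoffel :: "'a riemannian_data \<Rightarrow> 'a chart \<Rightarrow> real^2 \<Rightarrow> 2 \<Rightarrow> 2 \<Rightarrow> 2 \<Rightarrow> real" where
  "christoffel M c y k i j =
     (\<Sum>l\<in>UNIV. matrix_inv (gram M c y) $ k $ l *
        (partial_deriv i (\<lambda>z. gram M c z $ j $ l) y
         + partial_deriv j (\<lambda>z. gram M c z $ i $ l) y
         - partial_deriv l (\<lambda>z. gram M c z $ i $ j) y)) / 2"

text \<open>Geodesics are the solutions of \<open>x\<^sub>k'' + \<Sum>\<^sub>i\<^sub>j \<Gamma>\<^sup>k\<^sub>i\<^sub>j x\<^sub>i' x\<^sub>j' = 0\<close>; they have constant
  speed, and constant curves are included.\<close>

definition geodesic :: "'a riemannian_data \<Rightarrow> (real \<Rightarrow> 'a) \<Rightarrow> bool" where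
  "geodesic M \<gamma> \<longleftrightarrow>
     continuous_map (top_of_set {0..1}) (surf M) \<gamma> \<and>
     (\<forall>c\<in>atlas M. \<forall>t\<in>{0..1}. \<gamma> t \<in> chart_dom c \<longrightarrow>
        (coords c \<circ> \<gamma>) differentiable (at t within {0..1}) \<and>
        (velocity c {0..1} \<gamma> has_vector_derivative
           (\<chi> k. - (\<Sum>i\<in>UNIV. \<Sum>j\<in>UNIV. christoffel M c (coords c (\<gamma> t)) k i j
                     * velocity c {0..1} \<gamma> t $ i * velocity c {0..1} \<gamma> t $ j)))
          (at t within {0..1}))"

definition geodesic_between :: "'a riemannian_data \<Rightarrow> 'a \<Rightarrow> 'a \<Rightarrow> (real \<Rightarrow> 'a) \<Rightarrow> bool" where
  "geodesic_between M p q \<gamma> \<longleftrightarrow> geodesic M \<gamma> \<and> \<gamma> 0 = p \<and> \<gamma> 1 = q"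

definition minimal_geodesic :: "'a riemannian_data \<Rightarrow> 'a \<Rightarrow> 'a \<Rightarrow> (real \<Rightarrow> 'a) \<Rightarrow> bool" where
  "minimal_geodesic M p q \<gamma> \<longleftrightarrow>
     geodesic_between M p q \<gamma> \<and> ereal (curve_length M \<gamma>) = rdist M p q"

definition is_unique_curve :: "((real \<Rightarrow> 'a) \<Rightarrow> bool) \<Rightarrow> (real \<Rightarrow> 'a) \<Rightarrow> bool" where
  "is_unique_curve Q \<gamma> \<longleftrightarrow> Q \<gamma> \<and> (\<forall>\<gamma>'. Q \<gamma>' \<longrightarrow> (\<forall>t\<in>{0..1}. \<gamma>' t = \<gamma> t))"

definition injectivity_radius :: "'a riemannian_data \<Rightarrow> real" where
  "injectivity_radius M =
     (GREATEST r. \<forall>p\<in>points M. \<forall>q\<in>points M. rdist M p q < ereal r \<longrightarrow>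
        (\<exists>\<gamma>. is_unique_curve (\<lambda>\<gamma>. geodesic_between M p q \<gamma> \<and> curve_length M \<gamma> < r) \<gamma>))"


section \<open>Disks, circles and the strong convexity radius\<close>

definition disk :: "'a riemannian_data \<Rightarrow> 'a \<Rightarrow> real \<Rightarrow> 'a set" where
  "disk M a r = {x \<in> points M. rdist M a x < ereal r}"

definition circle :: "'a riemannian_data \<Rightarrow> 'a \<Rightarrow> real \<Rightarrow> 'a set" where
  "circle M a r = surf M frontier_of disk M a r"

definition strong_convexity_radius :: "'a riemannian_data \<Rightarrow> real" where
  "strong_convexity_radius M =
     (GREATEST r. \<forall>a\<in>points M. \<forall>s<r.
        \<forall>p \<in> surf M closure_of disk M a s. \<forall>q \<in> surf M closure_of disk M a s. p \<noteq> q \<longrightarrow>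
          (\<exists>\<gamma>. is_unique_curve (minimal_geodesic M p q) \<gamma> \<and>
               \<gamma> ` {0<..<1} \<subseteq> surf M interior_of disk M a s))"


section \<open>Dense sets and the abstract two-complex\<close>

definition delta_dense :: "'a riemannian_data \<Rightarrow> real \<Rightarrow> 'a set \<Rightarrow> bool" where
  "delta_dense M \<delta> P \<longleftrightarrow>
     (\<forall>a\<in>points M. disk M a \<delta> \<inter> P \<noteq> {}) \<and>
     \<not> (\<exists>S\<subseteq>P. card S = 4 \<and>
          (\<exists>a\<in>points M. \<exists>r. r < min (injectivity_radius M / 6) (strong_convexity_radius M) \<and>
             S \<subseteq> circle M a r))"

definition empty_circumdisk :: "'a riemannian_data \<Rightarrow> real \<Rightarrow> 'a set \<Rightarrow> 'a set \<Rightarrow> 'a \<Rightarrow> real \<Rightarrow> bool" where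
  "empty_circumdisk M \<delta> P S a r \<longleftrightarrow>
     a \<in> points M \<and> r < \<delta> \<and> S \<subseteq> circle M a r \<and> P \<inter> (surf M interior_of disk M a r) = {}"

definition delaunay_edges :: "'a riemannian_data \<Rightarrow> real \<Rightarrow> 'a set \<Rightarrow> 'a set set" where
  "delaunay_edges M \<delta> P = {e. e \<subseteq> P \<and> card e = 2 \<and> (\<exists>a r. empty_circumdisk M \<delta> P e a r)}"

definition delaunay_faces :: "'a riemannian_data \<Rightarrow> real \<Rightarrow> 'a set \<Rightarrow> 'a set set" where
  "delaunay_faces M \<delta> P = {F. F \<subseteq> P \<and> card F = 3 \<and> (\<exists>a r. empty_circumdisk M \<delta> P F a r)}"

definition delaunay_complex :: "'a riemannian_data \<Rightarrow> real \<Rightarrow> 'a set \<Rightarrow> 'a set set" where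
  "delaunay_complex M \<delta> P = (\<lambda>p. {p}) ` P \<union> delaunay_edges M \<delta> P \<union> delaunay_faces M \<delta> P"

text \<open>The polyhedral realization in barycentric coordinates. It is topologised as a subspace of
  the product space \<open>'a \<Rightarrow> real\<close>; for a finite complex this is its usual topology.\<close>

definition realization :: "'a set set \<Rightarrow> ('a \<Rightarrow> real) set" where
  "realization K = {b. (\<forall>v. 0 \<le> b v) \<and> {v. b v \<noteq> 0} \<in> K \<and> sum b {v. b v \<noteq> 0} = 1}"

definition closed_simplex :: "'a set set \<Rightarrow> 'a set \<Rightarrow> ('a \<Rightarrow> real) set" where
  "closed_simplex K \<sigma> = {b \<in> realization K. {v. b v \<noteq> 0} \<subseteq> \<sigma>}"

definition vertex_point :: "'a \<Rightarrow> 'a \<Rightarrow> real" where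
  "vertex_point p = (\<lambda>v. if v = p then 1 else 0)"

definition edge_point :: "'a \<Rightarrow> 'a \<Rightarrow> real \<Rightarrow> 'a \<Rightarrow> real" where
  "edge_point p q t = (\<lambda>v. (1 - t) * vertex_point p v + t * vertex_point q v)"


section \<open>The natural map\<close>

text \<open>The union below has a single member when the minimal geodesic is unique.\<close>

definition minimal_segment :: "'a riemannian_data \<Rightarrow> 'a \<Rightarrow> 'a \<Rightarrow> 'a set" where
  "minimal_segment M p q = (\<Union>\<gamma>\<in>{\<gamma>. minimal_geodesic M p q \<gamma>}. \<gamma> ` {0..1})"

definition triangle_sides :: "'a riemannian_data \<Rightarrow> 'a set \<Rightarrow> 'a set" where
  "triangle_sides M F = (\<Union>p\<in>F. \<Union>q\<in>F - {p}. minimal_segment M p q)"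

text \<open>The sides form a Jordan curve; the region it bounds inside the disk \<open>D\<close> is the part of its
  complement whose components lie in \<open>D\<close>.\<close>

definition geodesic_triangle :: "'a riemannian_data \<Rightarrow> 'a set \<Rightarrow> 'a set \<Rightarrow> 'a set" where
  "geodesic_triangle M F D =
     triangle_sides M F \<union>
     \<Union>{U \<in> connected_components_of (subtopology (surf M) (points M - triangle_sides M F)). U \<subseteq> D}"

definition natural_map :: "'a riemannian_data \<Rightarrow> real \<Rightarrow> 'a set \<Rightarrow> (('a \<Rightarrow> real) \<Rightarrow> 'a) \<Rightarrow> bool" where
  "natural_map M \<delta> P R \<longleftrightarrow>
     (let K = delaunay_complex M \<delta> P in
      continuous_map (top_of_set (realization K)) (surf M) R \<and>
      (\<forall>p\<in>P. R (vertex_point p) = p) \<and>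
      (\<forall>p q. {p, q} \<in> delaunay_edges M \<delta> P \<longrightarrow>
         (\<exists>\<gamma>. is_unique_curve (minimal_geodesic M p q) \<gamma> \<and>
              (\<forall>t\<in>{0..1}. R (edge_point p q t) = \<gamma> t))) \<and>
      (\<forall>F\<in>delaunay_faces M \<delta> P. \<exists>a r. empty_circumdisk M \<delta> P F a r \<and>
         homeomorphic_map (top_of_set (closed_simplex K F))
           (subtopology (surf M) (geodesic_triangle M F (disk M a r))) R))"

text \<open>The conditions on \<open>R\<close> leave its values inside the faces open. So \<open>R\<close> being a homeomorphism
  is taken to mean that such maps exist and that every one of them is a homeomorphism.\<close>

definition forms_delaunay_triangulation :: "'a riemannian_data \<Rightarrow> real \<Rightarrow> 'a set \<Rightarrow> bool" where
  "forms_delaunay_triangulation M \<delta> P \<longleftrightarrow>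
     (\<exists>R. natural_map M \<delta> P R) \<and>
     (\<forall>R. natural_map M \<delta> P R \<longrightarrow>
        homeomorphic_map (top_of_set (realization (delaunay_complex M \<delta> P))) (surf M) R)"

end

theory Submission
  imports Defs
begin

text \<open>
  Only the strong convexity radius \<open>\<tau>\<close> matters. Let \<open>near x\<close> be the set of sites nearest to a point
  \<open>x\<close>; by density and genericity it has one, two or three elements. Minimal geodesics of length less than
  \<open>2\<tau>\<close> are unique, and strict convexity of disks of radius less than \<open>\<tau>\<close> gives two facts about an edge
  \<open>{p, q} \<subseteq> near a\<close>: its interior lies inside the empty disk about \<open>a\<close>, and it crosses no other edge.
  For the latter, the paths \<open>p a q\<close> and \<open>r b s\<close> along radii are disjoint and avoid the prolongations of
  the edges \<open>pq\<close> and \<open>rs\<close>; read in geodesic coordinates at a crossing point of the edges, this contradicts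
  planar topology (Fashoda's meet theorem).

  The boundary of the Voronoi cell of \<open>p\<close> meets each ray from \<open>p\<close> once, so it is parametrised by the angle.
  The points of the boundary that are nearest to \<open>q\<close> as well do not exhaust it, and at both ends of a gap of
  such points a third site appears. The two sites differ because three sites have only one circumcentre; so
  each edge lies on two faces.

  Joining \<open>p\<close> to the points of \<open>qr\<close> gives a homeomorphism from a simplex to the geodesic triangle \<open>pqr\<close>.
  Open triangles are components of the complement of their sides, and no edge meets them since its ends are
  sites; so different ones are disjoint. The union of all triangles is closed, and it is open off the sites
  because each edge lies on two triangles. As finitely many points do not disconnect a surface locally, the
  triangles cover the surface, and a continuous bijection from a compact space to a Hausdorff space is a
  homeomorphism.
\<close>

text \<open>The bound \<open>2 * \<tau>\<close> comes from midpoints: two points closer than that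
  lie in a disk of radius less than \<open>\<tau>\<close> about an approximate midpoint, which gives
  them a unique minimal geodesic; two nearest sites of one point are always that close. Geodesics
  are never produced by solving their equation. They come from convexity, and the equation serves
  for uniqueness and for a Taylor estimate. So the inverse \<open>lg a\<close> of the exponential
  map is defined first, as the initial velocity of the minimal geodesic; it is injective by
  uniqueness, continuous by the Taylor estimate, open by invariance of domain, and onto a round ball
  because its image is open and closed there. Neither smoothness of these coordinates nor the Gauss
  lemma is established. Therefore distances are compared by the triangle inequality and strict
  convexity, directions enter only through rays from one point, and the planar arguments concern
  continuous paths. The locale \<open>geosurf\<close> collects just these properties, and the
  Delaunay argument is carried out inside it.\<close>

locale rsurf =
  fixes M :: "'a riemannian_data"
  assumes rs: "riemannian_surface M"
begin

section \<open>Charts, velocities and speed\<close>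

definition gnorm :: "'a chart \<Rightarrow> real^2 \<Rightarrow> real^2 \<Rightarrow> real" where
  "gnorm c y v = sqrt (v \<bullet> (gram M c y *v v))"

abbreviation cinv :: "'a chart \<Rightarrow> real^2 \<Rightarrow> 'a" where
  "cinv c \<equiv> inv_into (chart_dom c) (coords c)"

lemma Hausdorff: "Hausdorff_space (surf M)"
  using rs by (simp add: riemannian_surface_def)

lemma points_eq: "points M = (\<Union>c\<in>atlas M. chart_dom c)"
  using rs by (simp add: riemannian_surface_def)

lemma in_chart: assumes "x \<in> points M" obtains c where "c \<in> atlas M" "x \<in> chart_dom c"
  using assms points_eq by auto

lemma dom_points: "c \<in> atlas M \<Longrightarrow> x \<in> chart_dom c \<Longrightarrow> x \<in> points M"
  using points_eq by auto

lemma dom_open: "c \<in> atlas M \<Longrightarrow> openin (surf M) (chart_dom c)"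
  using rs by (simp add: riemannian_surface_def)

lemma image_open: "c \<in> atlas M \<Longrightarrow> open (chart_image c)"
  using rs by (simp add: riemannian_surface_def)

lemma chart_homeo: "c \<in> atlas M \<Longrightarrow>
  homeomorphic_map (subtopology (surf M) (chart_dom c)) (top_of_set (chart_image c)) (coords c)"
  using rs by (simp add: riemannian_surface_def)

lemma dom_sub: "c \<in> atlas M \<Longrightarrow> points M \<inter> chart_dom c = chart_dom c"
  using dom_points by blast

lemma coords_inj: "c \<in> atlas M \<Longrightarrow> inj_on (coords c) (chart_dom c)"
  using homeomorphic_imp_injective_map[OF chart_homeo] by (simp add: dom_sub)

lemma cinv_coords: "c \<in> atlas M \<Longrightarrow> x \<in> chart_dom c \<Longrightarrow> cinv c (coords c x) = x"
  using coords_inj inv_into_f_f by metis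

lemma coords_cinv: "y \<in> chart_image c \<Longrightarrow> coords c (cinv c y) = y"
  by (rule f_inv_into_f)

lemma cinv_dom: "y \<in> chart_image c \<Longrightarrow> cinv c y \<in> chart_dom c"
  by (rule inv_into_into)

lemma coords_cont: "c \<in> atlas M \<Longrightarrow> continuous_map (subtopology (surf M) (chart_dom c)) euclidean (coords c)"
  using homeomorphic_imp_continuous_map[OF chart_homeo] continuous_map_into_fulltopology by blast

lemma cinv_cont: assumes c: "c \<in> atlas M"
  shows "continuous_map (top_of_set (chart_image c)) (surf M) (cinv c)"
proof -
  obtain g where g: "homeomorphic_maps (subtopology (surf M) (chart_dom c)) (top_of_set (chart_image c)) (coords c) g"
    using chart_homeo[OF c] homeomorphic_map_maps by blast
  then have cg: "continuous_map (top_of_set (chart_image c)) (subtopology (surf M) (chart_dom c)) g"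
    and gc: "\<And>y. y \<in> chart_image c \<Longrightarrow> coords c (g y) = y"
    by (auto simp: homeomorphic_maps_def)
  have gd: "g y \<in> chart_dom c" if "y \<in> chart_image c" for y
    using cg that by (auto simp: continuous_map_def Pi_iff)
  have "g y = cinv c y" if "y \<in> chart_image c" for y
    using gc[OF that] gd[OF that] cinv_coords[OF c] by metis
  then show ?thesis
    using cg continuous_map_into_fulltopology continuous_map_eq
    by (metis (no_types, lifting) topspace_euclidean_subtopology)
qed

lemma trans_smooth: "c \<in> atlas M \<Longrightarrow> c' \<in> atlas M \<Longrightarrow>
    smooth_on (coords c ` (chart_dom c \<inter> chart_dom c')) (transition c c')"
  using rs by (simp add: riemannian_surface_def)

lemma gram_smooth: "c \<in> atlas M \<Longrightarrow> smooth_on (chart_image c) (gram M c)"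
  using rs by (simp add: riemannian_surface_def)

lemma gram_sym: "c \<in> atlas M \<Longrightarrow> y \<in> chart_image c \<Longrightarrow> transpose (gram M c y) = gram M c y"
  using rs unfolding riemannian_surface_def by blast

lemma gram_pos: "c \<in> atlas M \<Longrightarrow> y \<in> chart_image c \<Longrightarrow> v \<noteq> 0 \<Longrightarrow> 0 < v \<bullet> (gram M c y *v v)"
  using rs unfolding riemannian_surface_def by blast

lemma gram_compat: "c \<in> atlas M \<Longrightarrow> c' \<in> atlas M \<Longrightarrow> x \<in> chart_dom c \<Longrightarrow> x \<in> chart_dom c' \<Longrightarrow>
   v \<bullet> (gram M c (coords c x) *v w) =
   frechet_derivative (transition c c') (at (coords c x)) v
    \<bullet> (gram M c' (coords c' x) *v frechet_derivative (transition c c') (at (coords c x)) w)"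
  using rs unfolding riemannian_surface_def Let_def by blast

lemma smooth_diff: "smooth_on S f \<Longrightarrow> x \<in> S \<Longrightarrow> f differentiable (at x)"
  unfolding smooth_on_def by (metis Ck_on.simps(2))

lemma smooth_dir_cont: "smooth_on S f \<Longrightarrow> continuous_on S (\<lambda>x. frechet_derivative f (at x) v)"
  unfolding smooth_on_def using Ck_on.simps by metis

lemma smooth_dir: "smooth_on S f \<Longrightarrow> smooth_on S (\<lambda>x. frechet_derivative f (at x) v)"
  unfolding smooth_on_def using Ck_on.simps(2) by metis

lemma smooth_cont: "smooth_on S f \<Longrightarrow> continuous_on S f"
  unfolding smooth_on_def using Ck_on.simps(1) by metis

lemma trans_coords: "c \<in> atlas M \<Longrightarrow> x \<in> chart_dom c \<Longrightarrow> transition c c' (coords c x) = coords c' x"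
  by (simp add: transition_def cinv_coords)

lemma trans_deriv: assumes "c \<in> atlas M" "c' \<in> atlas M" "x \<in> chart_dom c" "x \<in> chart_dom c'"
  shows "(transition c c' has_derivative frechet_derivative (transition c c') (at (coords c x))) (at (coords c x))"
  using assms smooth_diff[OF trans_smooth[OF assms(1,2)]] frechet_derivative_works
  by (metis (no_types, lifting) IntI imageI)

lemma curve_dom_open:
  fixes \<gamma> :: "real \<Rightarrow> 'a"
  assumes "continuous_map (top_of_set I) (surf M) \<gamma>" "c \<in> atlas M"
  shows "openin (top_of_set I) {t\<in>I. \<gamma> t \<in> chart_dom c}"
  using openin_continuous_map_preimage[OF assms(1) dom_open[OF assms(2)]] by simp

lemma curve_near:
  fixes \<gamma> :: "real \<Rightarrow> 'a"
  assumes "continuous_map (top_of_set I) (surf M) \<gamma>" "openin (surf M) U" "t \<in> I" "\<gamma> t \<in> U"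
  obtains e where "e > 0" "\<And>s. s \<in> I \<Longrightarrow> dist s t < e \<Longrightarrow> \<gamma> s \<in> U"
proof -
  have "openin (top_of_set I) {t\<in>I. \<gamma> t \<in> U}"
    using openin_continuous_map_preimage[OF assms(1,2)] by simp
  then show ?thesis using assms(3,4) that unfolding openin_euclidean_subtopology_iff by blast
qed

lemma curve_ev:
  fixes \<gamma> :: "real \<Rightarrow> 'a"
  assumes "continuous_map (top_of_set I) (surf M) \<gamma>" "openin (surf M) U" "t \<in> I" "\<gamma> t \<in> U"
  shows "\<forall>\<^sub>F s in at t within I. \<gamma> s \<in> U"
proof -
  obtain e where "e > 0" "\<And>s. s \<in> I \<Longrightarrow> dist s t < e \<Longrightarrow> \<gamma> s \<in> U"
    using curve_near[OF assms] by blast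
  then show ?thesis unfolding eventually_at by blast
qed

lemma curve_coords_cont:
  fixes \<gamma> :: "real \<Rightarrow> 'a"
  assumes "continuous_map (top_of_set I) (surf M) \<gamma>" "c \<in> atlas M"
  shows "continuous_on {t\<in>I. \<gamma> t \<in> chart_dom c} (coords c \<circ> \<gamma>)"
proof -
  have "continuous_map (top_of_set {t\<in>I. \<gamma> t \<in> chart_dom c}) (subtopology (surf M) (chart_dom c)) \<gamma>"
    using assms(1) by (auto simp: continuous_map_in_subtopology intro: continuous_map_from_subtopology_mono)
  from continuous_map_compose[OF this coords_cont[OF assms(2)]] show ?thesis by simp
qed

text \<open>The chain rule for the transition map. The identity between the two coordinate curves
  holds only near \<open>t\<close>, where the curve stays in the chart \<open>c\<close>; that
  suffices for the derivative.\<close>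

lemma velocity_trans:
  assumes g: "continuous_map (top_of_set I) (surf M) \<gamma>" and t: "t \<in> I"
    and c: "c \<in> atlas M" "c' \<in> atlas M" and d: "\<gamma> t \<in> chart_dom c" "\<gamma> t \<in> chart_dom c'"
    and v: "((coords c \<circ> \<gamma>) has_vector_derivative v) (at t within I)"
  shows "((coords c' \<circ> \<gamma>) has_vector_derivative frechet_derivative (transition c c') (at (coords c (\<gamma> t))) v) (at t within I)"
proof -
  let ?J = "frechet_derivative (transition c c') (at (coords c (\<gamma> t)))"
  have J: "(transition c c' has_derivative ?J) (at ((coords c \<circ> \<gamma>) t))"
    using trans_deriv[OF c d] by simp
  have "((transition c c' \<circ> (coords c \<circ> \<gamma>)) has_derivative (?J \<circ> (\<lambda>x. x *\<^sub>R v))) (at t within I)"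
    using v J unfolding has_vector_derivative_def
    by (intro diff_chain_within) (auto intro: has_derivative_at_withinI)
  moreover have "\<forall>\<^sub>F s in at t within I. (transition c c' \<circ> (coords c \<circ> \<gamma>)) s = (coords c' \<circ> \<gamma>) s"
    using curve_ev[OF g dom_open[OF c(1)] t d(1)] by eventually_elim (simp add: trans_coords c)
  ultimately have "((coords c' \<circ> \<gamma>) has_derivative (?J \<circ> (\<lambda>x. x *\<^sub>R v))) (at t within I)"
    by (rule has_derivative_transform_eventually) (auto simp: trans_coords c d t)
  moreover have "?J \<circ> (\<lambda>x. x *\<^sub>R v) = (\<lambda>x. x *\<^sub>R ?J v)"
    using has_derivative_bounded_linear[OF J] by (auto simp: linear_simps)
  ultimately show ?thesis by (simp add: has_vector_derivative_def)
qed

lemma gnorm_trans: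
  assumes "c \<in> atlas M" "c' \<in> atlas M" "x \<in> chart_dom c" "x \<in> chart_dom c'"
  shows "gnorm c' (coords c' x) (frechet_derivative (transition c c') (at (coords c x)) v) = gnorm c (coords c x) v"
  by (simp add: gnorm_def gram_compat[OF assms])

text \<open>\<open>speed\<close> takes derivatives within \<open>{0..1}\<close>. The pieces of a
  curve need one-sided derivatives at their own ends, so the interval becomes a parameter.\<close>

definition spd :: "real set \<Rightarrow> (real \<Rightarrow> 'a) \<Rightarrow> real \<Rightarrow> real" where
  "spd I \<gamma> t = (let c = (SOME c. c \<in> atlas M \<and> \<gamma> t \<in> chart_dom c) in gnorm c (coords c (\<gamma> t)) (velocity c I \<gamma> t))"

lemma speed_spd: "speed M \<gamma> = spd {0..1} \<gamma>"
  by (auto simp: fun_eq_iff speed_def spd_def gnorm_def Let_def)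

lemma ivl_nbot: "a < b \<Longrightarrow> t \<in> {a..b} \<Longrightarrow> at t within {a..b::real} \<noteq> bot"
  using islimpt_Icc trivial_limit_within by blast

lemma velocityI: "at t within I \<noteq> bot \<Longrightarrow> ((coords c \<circ> \<gamma>) has_vector_derivative v) (at t within I) \<Longrightarrow> velocity c I \<gamma> t = v"
  by (simp add: velocity_def vector_derivative_within)

lemma velocity_works: "(coords c \<circ> \<gamma>) differentiable (at t within I) \<Longrightarrow>
   ((coords c \<circ> \<gamma>) has_vector_derivative velocity c I \<gamma> t) (at t within I)"
  by (simp add: velocity_def vector_derivative_works)

text \<open>The chart chosen by \<open>SOME\<close> is harmless: velocities transform by the
  derivative of the transition map, and \<open>gnorm\<close> is invariant under it.\<close>

lemma spd_eq:
  assumes g: "continuous_map (top_of_set I) (surf M) \<gamma>" and t: "t \<in> I" "at t within I \<noteq> bot"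
    and c: "c \<in> atlas M" "\<gamma> t \<in> chart_dom c"
    and v: "((coords c \<circ> \<gamma>) has_vector_derivative v) (at t within I)"
  shows "spd I \<gamma> t = gnorm c (coords c (\<gamma> t)) v"
proof -
  define c' where "c' = (SOME c. c \<in> atlas M \<and> \<gamma> t \<in> chart_dom c)"
  have c': "c' \<in> atlas M" "\<gamma> t \<in> chart_dom c'"
    using someI_ex[of "\<lambda>c. c \<in> atlas M \<and> \<gamma> t \<in> chart_dom c"] c unfolding c'_def by blast+
  have "velocity c' I \<gamma> t = frechet_derivative (transition c c') (at (coords c (\<gamma> t))) v"
    by (rule velocityI[OF t(2) velocity_trans[OF g t(1) c(1) c'(1) c(2) c'(2) v]])
  then show ?thesis unfolding spd_def Let_def c'_def[symmetric]
    by (simp add: gnorm_trans[OF c(1) c'(1) c(2) c'(2)])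
qed

section \<open>Length and the Riemannian distance\<close>

lemma gnorm_cont: assumes c: "c \<in> atlas M" and x: "continuous_on S x" and v: "continuous_on S v"
   and S: "\<And>t. t \<in> S \<Longrightarrow> x t \<in> chart_image c"
  shows "continuous_on S (\<lambda>t. gnorm c (x t) (v t))"
proof -
  have "continuous_on S (\<lambda>t. gram M c (x t))"
    by (rule continuous_on_compose2[OF smooth_cont[OF gram_smooth[OF c]] x]) (use S in auto)
  then show ?thesis
    unfolding gnorm_def inner_vec_def matrix_vector_mult_def
    by (auto intro!: continuous_intros v)
qed

lemma gnorm_nonneg: "c \<in> atlas M \<Longrightarrow> y \<in> chart_image c \<Longrightarrow> 0 \<le> gnorm c y v"
  using gram_pos[of c y v] by (cases "v = 0") (auto simp: gnorm_def)

lemma gnorm_scale: "gnorm c y (a *\<^sub>R v) = \<bar>a\<bar> * gnorm c y v"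
proof -
  have "(a *\<^sub>R v) \<bullet> (gram M c y *v (a *\<^sub>R v)) = a\<^sup>2 * (v \<bullet> (gram M c y *v v))"
    by (simp add: matrix_vector_mult_scaleR power2_eq_square)
  then show ?thesis by (simp add: gnorm_def real_sqrt_mult)
qed

lemma spd_nonneg: assumes "\<gamma> t \<in> points M" shows "0 \<le> spd I \<gamma> t"
proof -
  have "\<exists>c. c \<in> atlas M \<and> \<gamma> t \<in> chart_dom c" using assms in_chart by metis
  from someI_ex[OF this] show ?thesis by (auto simp: spd_def Let_def intro!: gnorm_nonneg)
qed

lemma continuous_within_openin: fixes f :: "real \<Rightarrow> 'b::topological_space"
  assumes "openin (top_of_set I) U" "continuous_on U f" "t \<in> U"
  shows "continuous (at t within I) f"
proof -
  obtain T where T: "open T" "U = I \<inter> T" using assms(1) unfolding openin_open by auto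
  have "at t within I = at t within U"
    by (rule at_within_nhd[of t T]) (use T assms in auto)
  then show ?thesis using assms continuous_on_eq_continuous_within by metis
qed

lemma C1D: assumes "C1_curve_on M I \<gamma>"
  shows "continuous_map (top_of_set I) (surf M) \<gamma>"
    "\<And>c t. c \<in> atlas M \<Longrightarrow> t \<in> I \<Longrightarrow> \<gamma> t \<in> chart_dom c \<Longrightarrow> ((coords c \<circ> \<gamma>) has_vector_derivative velocity c I \<gamma> t) (at t within I)"
    "\<And>c. c \<in> atlas M \<Longrightarrow> continuous_on {t \<in> I. \<gamma> t \<in> chart_dom c} (velocity c I \<gamma>)"
  using assms velocity_works unfolding C1_curve_on_def by blast+

lemma curve_points: "continuous_map (top_of_set I) (surf M) \<gamma> \<Longrightarrow> t \<in> I \<Longrightarrow> \<gamma> t \<in> points M"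
  by (auto simp: continuous_map_def Pi_iff)

lemma C1_spd: assumes "C1_curve_on M {a..b} \<gamma>" "a < b" "t \<in> {a..b}" "c \<in> atlas M" "\<gamma> t \<in> chart_dom c"
  shows "spd {a..b} \<gamma> t = gnorm c (coords c (\<gamma> t)) (velocity c {a..b} \<gamma> t)"
  using assms C1D[OF assms(1)] by (intro spd_eq) (auto simp: ivl_nbot)

lemma C1_spd_cont: assumes C: "C1_curve_on M {a..b} \<gamma>" and "a < b"
  shows "continuous_on {a..b} (spd {a..b} \<gamma>)"
  unfolding continuous_on_eq_continuous_within
proof
  fix t assume t: "t \<in> {a..b}"
  obtain c where c: "c \<in> atlas M" "\<gamma> t \<in> chart_dom c"
    using in_chart curve_points[OF C1D(1)[OF C] t] by metis
  let ?U = "{t\<in>{a..b}. \<gamma> t \<in> chart_dom c}"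
  have "continuous_on ?U (\<lambda>t. gnorm c ((coords c \<circ> \<gamma>) t) (velocity c {a..b} \<gamma> t))"
    using C1D[OF C] c by (intro gnorm_cont curve_coords_cont) auto
  then have "continuous_on ?U (spd {a..b} \<gamma>)"
    by (rule continuous_on_eq) (use C1_spd[OF C \<open>a < b\<close>] c in auto)
  then show "continuous (at t within {a..b}) (spd {a..b} \<gamma>)"
    by (rule continuous_within_openin[OF curve_dom_open[OF C1D(1)[OF C] c(1)]]) (use c t in auto)
qed

lemma reparam_deriv:
  fixes f :: "real \<Rightarrow> 'b::real_normed_vector"
  assumes "(f has_vector_derivative v) (at (\<alpha> * t + \<beta>) within I)" "\<And>s. s \<in> I' \<Longrightarrow> \<alpha> * s + \<beta> \<in> I"
  shows "((\<lambda>s. f (\<alpha> * s + \<beta>)) has_vector_derivative \<alpha> *\<^sub>R v) (at t within I')"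
proof -
  have a: "((\<lambda>s. \<alpha> * s + \<beta>) has_vector_derivative \<alpha>) (at t within I')"
    by (auto intro!: derivative_eq_intros)
  have b: "(f has_vector_derivative v) (at ((\<lambda>s. \<alpha> * s + \<beta>) t) within (\<lambda>s. \<alpha> * s + \<beta>) ` I')"
    by (rule has_vector_derivative_within_subset[OF assms(1)]) (use assms(2) in auto)
  show ?thesis using vector_diff_chain_within[OF a b] by (simp add: o_def)
qed

lemma reparam_cont: fixes \<gamma> :: "real \<Rightarrow> 'a"
  assumes "continuous_map (top_of_set I) (surf M) \<gamma>" "\<And>s. s \<in> I' \<Longrightarrow> \<alpha> * s + \<beta> \<in> I"
  shows "continuous_map (top_of_set I') (surf M) (\<lambda>s. \<gamma> (\<alpha> * s + \<beta>))"
proof -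
  have "continuous_map (top_of_set I') (top_of_set I) (\<lambda>s. \<alpha> * s + \<beta>)"
    using assms(2) by (auto simp: continuous_map_in_subtopology intro!: continuous_intros)
  from continuous_map_compose[OF this assms(1)] show ?thesis by (simp add: o_def)
qed

lemma C1_reparam:
  assumes C: "C1_curve_on M {a..b} \<gamma>" and ab: "a' < b'" and m: "\<And>s. s \<in> {a'..b'} \<Longrightarrow> \<alpha> * s + \<beta> \<in> {a..b}"
  shows "C1_curve_on M {a'..b'} (\<lambda>s. \<gamma> (\<alpha> * s + \<beta>))"
    and "a < b \<Longrightarrow> t \<in> {a'..b'} \<Longrightarrow> spd {a'..b'} (\<lambda>s. \<gamma> (\<alpha> * s + \<beta>)) t = \<bar>\<alpha>\<bar> * spd {a..b} \<gamma> (\<alpha> * t + \<beta>)"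
proof -
  let ?\<sigma> = "\<lambda>s. \<gamma> (\<alpha> * s + \<beta>)"
  note D = C1D[OF C]
  have der: "((coords c \<circ> ?\<sigma>) has_vector_derivative \<alpha> *\<^sub>R velocity c {a..b} \<gamma> (\<alpha> * t + \<beta>)) (at t within {a'..b'})"
    if "c \<in> atlas M" "t \<in> {a'..b'}" "?\<sigma> t \<in> chart_dom c" for c t
    using reparam_deriv[OF D(2)[OF that(1) m[OF that(2)] that(3)], of "{a'..b'}"] m by (simp add: o_def)
  have vel: "velocity c {a'..b'} ?\<sigma> t = \<alpha> *\<^sub>R velocity c {a..b} \<gamma> (\<alpha> * t + \<beta>)"
    if "c \<in> atlas M" "t \<in> {a'..b'}" "?\<sigma> t \<in> chart_dom c" for c t
    using velocityI[OF ivl_nbot[OF ab that(2)] der[OF that]] .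
  show C': "C1_curve_on M {a'..b'} ?\<sigma>"
    unfolding C1_curve_on_def
  proof (intro conjI ballI impI)
    show "continuous_map (top_of_set {a'..b'}) (surf M) ?\<sigma>" by (rule reparam_cont[OF D(1) m])
  next
    fix c t assume "c \<in> atlas M" "t \<in> {a'..b'}" "?\<sigma> t \<in> chart_dom c"
    then show "coords c \<circ> ?\<sigma> differentiable at t within {a'..b'}"
      using der differentiableI_vector by blast
  next
    fix c assume c: "c \<in> atlas M"
    have "continuous_on {t \<in> {a'..b'}. ?\<sigma> t \<in> chart_dom c} (\<lambda>t. \<alpha> *\<^sub>R velocity c {a..b} \<gamma> (\<alpha> * t + \<beta>))"
      using m by (intro continuous_intros continuous_on_compose2[OF D(3)[OF c]]) auto
    then show "continuous_on {t \<in> {a'..b'}. ?\<sigma> t \<in> chart_dom c} (velocity c {a'..b'} ?\<sigma>)"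
      by (rule continuous_on_eq) (use vel c in auto)
  qed
  show "spd {a'..b'} ?\<sigma> t = \<bar>\<alpha>\<bar> * spd {a..b} \<gamma> (\<alpha> * t + \<beta>)" if "a < b" and t: "t \<in> {a'..b'}"
  proof -
    obtain c where c: "c \<in> atlas M" "?\<sigma> t \<in> chart_dom c"
      using in_chart curve_points[OF D(1) m[OF t]] by metis
    show ?thesis
      unfolding C1_spd[OF C' ab t c] C1_spd[OF C \<open>a<b\<close> m[OF t] c] vel[OF c(1) t c(2)] gnorm_scale ..
  qed
qed

definition clen :: "(real \<Rightarrow> 'a) \<Rightarrow> real \<Rightarrow> real \<Rightarrow> real" where
  "clen \<gamma> a b = integral {a..b} (spd {a..b} \<gamma>)"

lemma clen_has: "C1_curve_on M {a..b} \<gamma> \<Longrightarrow> a < b \<Longrightarrow> (spd {a..b} \<gamma> has_integral clen \<gamma> a b) {a..b}"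
  unfolding clen_def by (intro integrable_integral integrable_continuous_interval C1_spd_cont)

lemma clen_nonneg: "C1_curve_on M {a..b} \<gamma> \<Longrightarrow> a < b \<Longrightarrow> 0 \<le> clen \<gamma> a b"
  using clen_has has_integral_nonneg spd_nonneg curve_points[OF C1D(1)] by blast

text \<open>The factor \<open>\<alpha>\<close> may be negative, so that the reversal of a curve is
  an instance.\<close>

lemma clen_reparam_gen:
  assumes C: "C1_curve_on M {a..b} \<gamma>" and ab: "a < b" and al: "\<alpha> \<noteq> 0"
    and ab': "a' < b'" and im: "(\<lambda>x. (x - \<beta>) / \<alpha>) ` {a..b} = {a'..b'}"
  shows "C1_curve_on M {a'..b'} (\<lambda>s. \<gamma> (\<alpha> * s + \<beta>))" "clen (\<lambda>s. \<gamma> (\<alpha> * s + \<beta>)) a' b' = clen \<gamma> a b"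
proof -
  have m: "\<alpha> * s + \<beta> \<in> {a..b}" if "s \<in> {a'..b'}" for s
    using that al unfolding im[symmetric] by auto
  have R: "spd {a'..b'} (\<lambda>s. \<gamma> (\<alpha> * s + \<beta>)) t = \<bar>\<alpha>\<bar> * spd {a..b} \<gamma> (\<alpha> * t + \<beta>)" if "t \<in> {a'..b'}" for t
    using C1_reparam(2)[OF C ab' _ ab] m that by blast
  show C': "C1_curve_on M {a'..b'} (\<lambda>s. \<gamma> (\<alpha> * s + \<beta>))" using C1_reparam(1)[OF C ab'] m by blast
  have "((\<lambda>x. spd {a..b} \<gamma> (\<alpha> *\<^sub>R x + \<beta>)) has_integral (1 / (\<bar>\<alpha>\<bar> ^ DIM(real))) *\<^sub>R clen \<gamma> a b)
      ((\<lambda>x. (1 / \<alpha>) *\<^sub>R x + - ((1 / \<alpha>) *\<^sub>R \<beta>)) ` cbox a b)"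
    by (rule has_integral_affinity) (use clen_has[OF C ab] al in auto)
  moreover have "(\<lambda>x. (1 / \<alpha>) *\<^sub>R x + - ((1 / \<alpha>) *\<^sub>R \<beta>)) ` cbox a b = {a'..b'}"
    unfolding im[symmetric] by (auto simp: diff_divide_distrib)
  ultimately have "((\<lambda>x. spd {a..b} \<gamma> (\<alpha> * x + \<beta>)) has_integral clen \<gamma> a b / \<bar>\<alpha>\<bar>) {a'..b'}"
    by simp
  then have "((\<lambda>x. \<bar>\<alpha>\<bar> * spd {a..b} \<gamma> (\<alpha> * x + \<beta>)) has_integral \<bar>\<alpha>\<bar> * (clen \<gamma> a b / \<bar>\<alpha>\<bar>)) {a'..b'}"
    by (rule has_integral_mult_right)
  then have "(spd {a'..b'} (\<lambda>s. \<gamma> (\<alpha> * s + \<beta>)) has_integral clen \<gamma> a b) {a'..b'}"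
    using al R by (subst has_integral_cong[of _ _ "\<lambda>x. \<bar>\<alpha>\<bar> * spd {a..b} \<gamma> (\<alpha> * x + \<beta>)"]) auto
  then show "clen (\<lambda>s. \<gamma> (\<alpha> * s + \<beta>)) a' b' = clen \<gamma> a b"
    using clen_has[OF C' ab'] has_integral_unique by blast
qed

lemma clen_reparam:
  assumes C: "C1_curve_on M {a..b} \<gamma>" and ab: "a < b" and al: "\<alpha> > 0"
  shows "C1_curve_on M {(a-\<beta>)/\<alpha>..(b-\<beta>)/\<alpha>} (\<lambda>s. \<gamma> (\<alpha> * s + \<beta>))"
    "clen (\<lambda>s. \<gamma> (\<alpha> * s + \<beta>)) ((a-\<beta>)/\<alpha>) ((b-\<beta>)/\<alpha>) = clen \<gamma> a b"
proof -
  have "(a-\<beta>)/\<alpha> < (b-\<beta>)/\<alpha>" using ab al by (simp add: divide_strict_right_mono)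
  moreover have "(\<lambda>x. (x - \<beta>) / \<alpha>) ` {a..b} = {(a-\<beta>)/\<alpha>..(b-\<beta>)/\<alpha>}"
  proof -
    have "x \<in> (\<lambda>x. (x - \<beta>) / \<alpha>) ` {a..b}" if "x \<in> {(a-\<beta>)/\<alpha>..(b-\<beta>)/\<alpha>}" for x
      using that al by (intro image_eqI[of _ _ "\<alpha> * x + \<beta>"]) (auto simp: field_simps)
    then show ?thesis using al by (auto simp: divide_right_mono)
  qed
  ultimately show "C1_curve_on M {(a-\<beta>)/\<alpha>..(b-\<beta>)/\<alpha>} (\<lambda>s. \<gamma> (\<alpha> * s + \<beta>))"
    "clen (\<lambda>s. \<gamma> (\<alpha> * s + \<beta>)) ((a-\<beta>)/\<alpha>) ((b-\<beta>)/\<alpha>) = clen \<gamma> a b"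
    using clen_reparam_gen[OF C ab] al by auto
qed

lemma clen_reverse:
  assumes C: "C1_curve_on M {a..b} \<gamma>" and ab: "a < b"
  shows "C1_curve_on M {\<beta>-b..\<beta>-a} (\<lambda>s. \<gamma> (\<beta> - s))" "clen (\<lambda>s. \<gamma> (\<beta> - s)) (\<beta>-b) (\<beta>-a) = clen \<gamma> a b"
proof -
  have "(\<lambda>x. (x - \<beta>) / (-1)) ` {a..b} = {\<beta>-b..\<beta>-a}"
  proof -
    have "x \<in> (\<lambda>x. (x - \<beta>) / (-1)) ` {a..b}" if "x \<in> {\<beta>-b..\<beta>-a}" for x
      using that by (intro image_eqI[of _ _ "\<beta> - x"]) (auto simp: field_simps)
    then show ?thesis by auto
  qed
  from clen_reparam_gen[OF C ab _ _ this] ab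
  show "C1_curve_on M {\<beta>-b..\<beta>-a} (\<lambda>s. \<gamma> (\<beta> - s))" "clen (\<lambda>s. \<gamma> (\<beta> - s)) (\<beta>-b) (\<beta>-a) = clen \<gamma> a b"
    by auto
qed

lemma C1_subset: assumes C: "C1_curve_on M {a..b} \<gamma>" and "a \<le> a'" "a' < b'" "b' \<le> b"
  shows "C1_curve_on M {a'..b'} \<gamma>" "a < b \<Longrightarrow> t \<in> {a'..b'} \<Longrightarrow> spd {a'..b'} \<gamma> t = spd {a..b} \<gamma> t"
  using C1_reparam[OF C \<open>a' < b'\<close>, of 1 0] assms by auto

lemma velocity_cong: assumes "\<And>s. s \<in> I \<Longrightarrow> \<gamma> s = \<sigma> s" "t \<in> I"
  shows "velocity c I \<gamma> t = velocity c I \<sigma> t"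
proof -
  have "((coords c \<circ> \<gamma>) has_vector_derivative v) (at t within I) \<longleftrightarrow> ((coords c \<circ> \<sigma>) has_vector_derivative v) (at t within I)" for v
    using assms has_vector_derivative_transform[of t I "coords c \<circ> \<gamma>" "coords c \<circ> \<sigma>"]
     has_vector_derivative_transform[of t I "coords c \<circ> \<sigma>" "coords c \<circ> \<gamma>"] by (metis comp_def)
  then show ?thesis by (simp add: velocity_def vector_derivative_def)
qed

lemma spd_cong: assumes "\<And>s. s \<in> I \<Longrightarrow> \<gamma> s = \<sigma> s" "t \<in> I" shows "spd I \<gamma> t = spd I \<sigma> t"
  using velocity_cong[OF assms] assms by (simp add: spd_def)

lemma C1_cong: assumes eq: "\<And>s. s \<in> I \<Longrightarrow> \<gamma> s = \<sigma> s" and C: "C1_curve_on M I \<gamma>" shows "C1_curve_on M I \<sigma>"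
proof -
  have 1: "continuous_map (top_of_set I) (surf M) \<sigma>"
    using C1D(1)[OF C] eq continuous_map_eq by (metis topspace_euclidean_subtopology)
  have "(coords c \<circ> \<sigma>) differentiable (at t within I)" if "c \<in> atlas M" "t \<in> I" "\<sigma> t \<in> chart_dom c" for c t
    using has_vector_derivative_transform[OF that(2) _ C1D(2)[OF C that(1,2)], of "coords c \<circ> \<sigma>"] eq that
    by (metis comp_apply differentiableI_vector)
  moreover have "continuous_on {t \<in> I. \<sigma> t \<in> chart_dom c} (velocity c I \<sigma>)" if "c \<in> atlas M" for c
    by (rule continuous_on_eq[OF continuous_on_subset[OF C1D(3)[OF C that]]])
       (use eq velocity_cong[of I \<gamma> \<sigma>] in auto)
  ultimately show ?thesis using 1 unfolding C1_curve_on_def by auto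
qed

lemma clen_cong: assumes "\<And>s. s \<in> {a..b} \<Longrightarrow> \<gamma> s = \<sigma> s" shows "clen \<gamma> a b = clen \<sigma> a b"
  unfolding clen_def by (rule integral_cong) (use spd_cong assms in blast)

text \<open>A subdivision witnessing \<open>piecewise_C1_curve\<close>, over an arbitrary interval
  because concatenated curves first live on \<open>{0..2}\<close>.\<close>

definition pw :: "real \<Rightarrow> real \<Rightarrow> (real \<Rightarrow> 'a) \<Rightarrow> nat \<Rightarrow> (nat \<Rightarrow> real) \<Rightarrow> bool" where
  "pw a b \<gamma> n s \<longleftrightarrow> s 0 = a \<and> s n = b \<and> (\<forall>k<n. s k < s (Suc k) \<and> C1_curve_on M {s k..s (Suc k)} \<gamma>)"

definition pwlen :: "(real \<Rightarrow> 'a) \<Rightarrow> nat \<Rightarrow> (nat \<Rightarrow> real) \<Rightarrow> real" where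
  "pwlen \<gamma> n s = (\<Sum>k<n. clen \<gamma> (s k) (s (Suc k)))"

lemma pw_iff: "piecewise_C1_curve M \<gamma> \<longleftrightarrow> (\<exists>n s. pw 0 1 \<gamma> n s)"
  by (simp add: piecewise_C1_curve_def pw_def)

lemma pwD: assumes "pw a b \<gamma> n s"
  shows "s 0 = a" "s n = b" "\<And>k. k < n \<Longrightarrow> s k < s (Suc k)" "\<And>k. k < n \<Longrightarrow> C1_curve_on M {s k..s (Suc k)} \<gamma>"
  using assms by (simp_all add: pw_def)

lemma pw_mono: assumes "pw a b \<gamma> n s" "i \<le> j" "j \<le> n" shows "s i \<le> s j"
  using assms(2,3)
proof (induction j rule: dec_induct)
  case (step k)
  have "s k < s (Suc k)" by (rule pwD(3)[OF assms(1)]) (use step in simp)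
  then show ?case using step by simp
qed auto

lemma spd_interior: assumes "t \<in> interior I" "t \<in> interior J" shows "spd I \<gamma> t = spd J \<gamma> t"
  by (simp only: spd_def velocity_def at_within_interior[OF assms(1)] at_within_interior[OF assms(2)])

text \<open>The speed relative to the whole interval and the speed relative to a piece agree off the
  break points, and finitely many points do not affect the integral.\<close>

lemma pw_has: assumes "pw a b \<gamma> n s"
  shows "(spd {a..b} \<gamma> has_integral pwlen \<gamma> n s) {a..b}"
proof -
  have "m \<le> n \<Longrightarrow> (spd {a..b} \<gamma> has_integral pwlen \<gamma> m s) {s 0..s m}" for m
  proof (induction m)
    case 0 show ?case using has_integral_refl(2) by (simp add: pwlen_def)
  next
    case (Suc m)
    have k: "s m < s (Suc m)" "C1_curve_on M {s m..s (Suc m)} \<gamma>" using Suc assms by (auto simp: pw_def)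
    have le: "s 0 \<le> s m" "a \<le> s m" "s (Suc m) \<le> b"
      using pw_mono[OF assms, of 0 m] pw_mono[OF assms, of "Suc m" n] Suc assms by (auto simp: pw_def)
    have "(spd {a..b} \<gamma> has_integral clen \<gamma> (s m) (s (Suc m))) {s m..s (Suc m)}"
    proof (rule has_integral_spike_finite[OF _ _ clen_has[OF k(2,1)], of "{s m, s (Suc m)}"])
      fix x assume "x \<in> {s m..s (Suc m)} - {s m, s (Suc m)}"
      then show "spd {a..b} \<gamma> x = spd {s m..s (Suc m)} \<gamma> x"
        using le by (intro spd_interior) (auto simp: less_le)
    qed auto
    then show ?case
      using has_integral_combine[OF le(1) less_imp_le[OF k(1)]] Suc by (simp add: pwlen_def)
  qed
  then show ?thesis using assms unfolding pw_def by blast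
qed

lemma pw_length: "pw 0 1 \<gamma> n s \<Longrightarrow> curve_length M \<gamma> = pwlen \<gamma> n s"
  using pw_has[of 0 1 \<gamma> n s] by (simp add: curve_length_def speed_spd integral_unique)

lemma pwlen_nonneg: "pw a b \<gamma> n s \<Longrightarrow> 0 \<le> pwlen \<gamma> n s"
  unfolding pwlen_def pw_def by (auto intro!: sum_nonneg clen_nonneg)

lemma rdist_le_pw: assumes p: "pw a b \<gamma> n s" and ab: "a < b"
  shows "rdist M (\<gamma> a) (\<gamma> b) \<le> pwlen \<gamma> n s"
proof -
  define \<alpha> where "\<alpha> = b - a"
  have al: "\<alpha> > 0" using ab by (simp add: \<alpha>_def)
  define \<sigma> where "\<sigma> = (\<lambda>t. \<gamma> (\<alpha> * t + a))"
  define s' where "s' k = (s k - a) / \<alpha>" for k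
  have c: "C1_curve_on M {s' k..s' (Suc k)} \<sigma>" "clen \<sigma> (s' k) (s' (Suc k)) = clen \<gamma> (s k) (s (Suc k))" if "k < n" for k
    using clen_reparam[of "s k" "s (Suc k)" \<gamma> \<alpha> a] p that al unfolding \<sigma>_def s'_def pw_def by auto
  have pw': "pw 0 1 \<sigma> n s'" unfolding pw_def
    using p ab c(1) al by (auto simp: s'_def pw_def \<alpha>_def divide_strict_right_mono)
  have len: "pwlen \<sigma> n s' = pwlen \<gamma> n s" unfolding pwlen_def by (intro sum.cong) (use c in auto)
  have "ereal (curve_length M \<sigma>) = pwlen \<gamma> n s"
    using pw_length[OF pw'] len by simp
  moreover have "piecewise_C1_curve M \<sigma>" "\<sigma> 0 = \<gamma> a" "\<sigma> 1 = \<gamma> b" using pw' by (auto simp: pw_iff \<sigma>_def \<alpha>_def)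
  ultimately show ?thesis unfolding rdist_def by (metis (mono_tags, lifting) INF_lower mem_Collect_eq)
qed

lemma rdist_le_C1: "C1_curve_on M {a..b} \<gamma> \<Longrightarrow> a < b \<Longrightarrow> rdist M (\<gamma> a) (\<gamma> b) \<le> clen \<gamma> a b"
  using rdist_le_pw[of a b \<gamma> 1 "\<lambda>k. if k = 0 then a else b"] by (simp add: pw_def pwlen_def)

lemma rdist_less: assumes "rdist M p q < ereal e"
  obtains \<gamma> n s where "pw 0 1 \<gamma> n s" "\<gamma> 0 = p" "\<gamma> 1 = q" "pwlen \<gamma> n s < e"
proof -
  obtain \<gamma> where "piecewise_C1_curve M \<gamma>" "\<gamma> 0 = p" "\<gamma> 1 = q" "curve_length M \<gamma> < e"
    using assms unfolding rdist_def INF_less_iff by auto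
  then show ?thesis using that pw_iff pw_length by metis
qed

lemma rdist_nonneg: "0 \<le> rdist M p q"
  unfolding rdist_def by (rule INF_greatest) (use pw_iff pw_length pwlen_nonneg in force)

text \<open>A curve is run through backwards: piece \<open>k\<close> of the reversed curve is piece
  \<open>n - Suc k\<close> of the given one.\<close>

lemma rdist_sym_le: "rdist M q p \<le> rdist M p q"
proof (rule ccontr)
  assume "\<not> ?thesis"
  then obtain e where e: "rdist M p q < ereal e" "ereal e < rdist M q p"
    using ereal_dense2 by (metis not_le)
  obtain \<gamma> n s where g: "pw 0 1 \<gamma> n s" "\<gamma> 0 = p" "\<gamma> 1 = q" "pwlen \<gamma> n s < e" using rdist_less[OF e(1)] .
  define s' where "s' k = 1 - s (n - k)" for k
  have c: "s' k < s' (Suc k)" "C1_curve_on M {s' k..s' (Suc k)} (\<lambda>t. \<gamma> (1 - t))"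
     "clen (\<lambda>t. \<gamma> (1 - t)) (s' k) (s' (Suc k)) = clen \<gamma> (s (n - Suc k)) (s (Suc (n - Suc k)))" if k: "k < n" for k
  proof -
    have e: "n - k = Suc (n - Suc k)" using k by auto
    have "s (n - Suc k) < s (n - k)" "C1_curve_on M {s (n - Suc k)..s (n - k)} \<gamma>"
      using g(1) k unfolding pw_def e by auto
    from this clen_reverse[OF this(2,1), of 1]
    show "s' k < s' (Suc k)" "C1_curve_on M {s' k..s' (Suc k)} (\<lambda>t. \<gamma> (1 - t))"
     "clen (\<lambda>t. \<gamma> (1 - t)) (s' k) (s' (Suc k)) = clen \<gamma> (s (n - Suc k)) (s (Suc (n - Suc k)))"
      unfolding s'_def e by auto
  qed
  have "pw 0 1 (\<lambda>t. \<gamma> (1 - t)) n s'" unfolding pw_def using g c by (auto simp: s'_def pw_def)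
  moreover have "pwlen (\<lambda>t. \<gamma> (1 - t)) n s' = pwlen \<gamma> n s"
    unfolding pwlen_def using c(3) by (simp add: sum.nat_diff_reindex[of "\<lambda>k. clen \<gamma> (s k) (s (Suc k))"])
  ultimately have "rdist M q p < e" using rdist_le_pw[of 0 1 "\<lambda>t. \<gamma> (1 - t)" n s'] g
    by (simp add: le_less_trans)
  then show False using e by auto
qed

lemma rdist_sym: "rdist M p q = rdist M q p"
  by (intro antisym rdist_sym_le)

text \<open>The second curve is shifted to \<open>{1..2}\<close>, and \<open>rdist_le_pw\<close>
  takes care of the parameter interval.\<close>

lemma pw_concat:
  assumes 1: "pw 0 1 \<gamma>1 n1 s1" "\<gamma>1 0 = p" "\<gamma>1 1 = q" and 2: "pw 0 1 \<gamma>2 n2 s2" "\<gamma>2 0 = q" "\<gamma>2 1 = r"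
  shows "rdist M p r \<le> ereal (pwlen \<gamma>1 n1 s1 + pwlen \<gamma>2 n2 s2)"
proof -
      have p1: "s1 0 = 0" "s1 n1 = 1" and p1': "\<And>k. k < n1 \<Longrightarrow> s1 k < s1 (Suc k)" "\<And>k. k < n1 \<Longrightarrow> C1_curve_on M {s1 k..s1 (Suc k)} \<gamma>1"
        using pwD[OF 1(1)] by simp_all
      have p2: "s2 0 = 0" "s2 n2 = 1" and p2': "\<And>k. k < n2 \<Longrightarrow> s2 k < s2 (Suc k)" "\<And>k. k < n2 \<Longrightarrow> C1_curve_on M {s2 k..s2 (Suc k)} \<gamma>2"
        using pwD[OF 2(1)] by simp_all
      define \<gamma> where "\<gamma> t = (if t \<le> 1 then \<gamma>1 t else \<gamma>2 (t - 1))" for t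
      define s where "s k = (if k \<le> n1 then s1 k else 1 + s2 (k - n1))" for k
      have s2: "s (n1 + j) = 1 + s2 j" for j using p1 p2 by (cases "j = 0") (simp_all add: s_def)
      have A: "s k < s (Suc k)" "C1_curve_on M {s k..s (Suc k)} \<gamma>" "clen \<gamma> (s k) (s (Suc k)) = clen \<gamma>1 (s1 k) (s1 (Suc k))" if k: "k < n1" for k
      proof -
        have s: "s k = s1 k" "s (Suc k) = s1 (Suc k)" using k by (auto simp: s_def)
        have "s1 (Suc k) \<le> 1" using pw_mono[OF 1(1), of "Suc k" n1] k p1 by simp
        then have eq: "\<gamma>1 t = \<gamma> t" if "t \<in> {s k..s (Suc k)}" for t using that s by (auto simp: \<gamma>_def)
        show "s k < s (Suc k)" using p1' k s by simp
        show "C1_curve_on M {s k..s (Suc k)} \<gamma>" using C1_cong[of "{s k..s (Suc k)}" \<gamma>1 \<gamma>] eq p1'(2)[OF k] s by simp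
        show "clen \<gamma> (s k) (s (Suc k)) = clen \<gamma>1 (s1 k) (s1 (Suc k))" using clen_cong[of "s k" "s (Suc k)" \<gamma>1 \<gamma>] eq s by auto
      qed
      have B: "s (n1 + k) < s (Suc (n1 + k))" "C1_curve_on M {s (n1 + k)..s (Suc (n1 + k))} \<gamma>"
         "clen \<gamma> (s (n1 + k)) (s (Suc (n1 + k))) = clen \<gamma>2 (s2 k) (s2 (Suc k))" if k: "k < n2" for k
      proof -
        have s: "s (n1 + k) = s2 k + 1" "s (Suc (n1 + k)) = s2 (Suc k) + 1" using s2[of k] s2[of "Suc k"] by auto
        have "s2 k \<ge> 0" using pw_mono[OF 2(1), of 0 k] k p2 by simp
        then have eq: "\<gamma>2 (t - 1) = \<gamma> t" if "t \<in> {s2 k + 1..s2 (Suc k) + 1}" for t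
          using that 1(3) 2(2) \<open>s2 k \<ge> 0\<close> by (cases "t = 1") (auto simp: \<gamma>_def)
        have o: "s2 k < s2 (Suc k)" "C1_curve_on M {s2 k..s2 (Suc k)} \<gamma>2" using p2' k by auto
        note R = clen_reparam[OF o(2,1), of 1 "-1"]
        show "s (n1 + k) < s (Suc (n1 + k))" using o s by auto
        show "C1_curve_on M {s (n1 + k)..s (Suc (n1 + k))} \<gamma>" using C1_cong[of "{s2 k + 1..s2 (Suc k) + 1}" "\<lambda>t. \<gamma>2 (t - 1)" \<gamma>] eq R(1) s by auto
        show "clen \<gamma> (s (n1 + k)) (s (Suc (n1 + k))) = clen \<gamma>2 (s2 k) (s2 (Suc k))" using clen_cong[of "s2 k + 1" "s2 (Suc k) + 1" "\<lambda>t. \<gamma>2 (t - 1)" \<gamma>] eq R(2) s by auto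
      qed
      have C: "s k < s (Suc k) \<and> C1_curve_on M {s k..s (Suc k)} \<gamma>" if "k < n1 + n2" for k
        using A[of k] B[of "k - n1"] that by (cases "k < n1") auto
      have pw: "pw 0 2 \<gamma> (n1 + n2) s"
        unfolding pw_def using C s2[of n2] p1 p2 by (simp add: s_def)
      have "pwlen \<gamma> (n1 + n2) s = (\<Sum>k<n1. clen \<gamma> (s k) (s (Suc k))) + (\<Sum>k<n2. clen \<gamma> (s (n1 + k)) (s (Suc (n1 + k))))"
        unfolding pwlen_def by (induction n2) auto
      also have "\<dots> = pwlen \<gamma>1 n1 s1 + pwlen \<gamma>2 n2 s2" using A(3) B(3) by (simp add: pwlen_def)
      finally have l: "pwlen \<gamma> (n1 + n2) s = pwlen \<gamma>1 n1 s1 + pwlen \<gamma>2 n2 s2" .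
      have "rdist M (\<gamma> 0) (\<gamma> 2) \<le> ereal (pwlen \<gamma> (n1 + n2) s)" using rdist_le_pw[OF pw] by simp
      moreover have "\<gamma> 0 = p" "\<gamma> 2 = r" using 1 2 by (auto simp: \<gamma>_def)
      ultimately show ?thesis using l by simp
qed

lemma rdist_triangle: "rdist M p r \<le> rdist M p q + rdist M q r"
proof (rule ccontr)
  assume n: "\<not> ?thesis"
  obtain a where a: "rdist M p q = ereal a" using n rdist_nonneg[of p q] by (cases "rdist M p q") auto
  obtain b where b: "rdist M q r = ereal b" using n a rdist_nonneg[of q r] by (cases "rdist M q r") auto
  have "ereal (a + b) < rdist M p r" using n a b by simp
  then obtain c where c: "ereal (a + b) < ereal c" "ereal c < rdist M p r" using ereal_dense2 by blast
  define e where "e = c - a - b"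
  have e: "e > 0" using c by (simp add: e_def)
  obtain \<gamma>1 n1 s1 where 1: "pw 0 1 \<gamma>1 n1 s1" "\<gamma>1 0 = p" "\<gamma>1 1 = q" "pwlen \<gamma>1 n1 s1 < a + e/2"
    using rdist_less[of p q "a + e/2"] a e by auto
  obtain \<gamma>2 n2 s2 where 2: "pw 0 1 \<gamma>2 n2 s2" "\<gamma>2 0 = q" "\<gamma>2 1 = r" "pwlen \<gamma>2 n2 s2 < b + e/2"
    using rdist_less[of q r "b + e/2"] b e by auto
  have "rdist M p r \<le> ereal (pwlen \<gamma>1 n1 s1 + pwlen \<gamma>2 n2 s2)" using pw_concat[OF 1(1-3) 2(1-3)] .
  also have "\<dots> \<le> ereal c" using 1(4) 2(4) by (simp add: e_def field_simps)
  finally show False using c(2) by simp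
qed

section \<open>Comparison of the distance with the Euclidean distance in a chart\<close>

text \<open>\<open>l\<close> and \<open>u\<close> are the extrema of the norm on the compact product
  of \<open>K\<close> with the unit circle; homogeneity extends the bounds to all vectors.\<close>

lemma gnorm_bounds: assumes c: "c \<in> atlas M" and K: "compact K" "K \<subseteq> chart_image c"
  obtains l u where "l > 0" "u > 0" "\<And>y v. y \<in> K \<Longrightarrow> l * norm v \<le> gnorm c y v" "\<And>y v. y \<in> K \<Longrightarrow> gnorm c y v \<le> u * norm v"
proof (cases "K = {}")
  case True then show ?thesis using that[of 1 1] by auto
next
  case False
  let ?S = "K \<times> sphere (0::real^2) 1"
  have ne: "?S \<noteq> {}" using False by (auto intro!: exI[of _ "axis 1 1"])
  have co: "compact ?S" using K by (intro compact_Times compact_sphere)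
  have ct: "continuous_on ?S (\<lambda>z. gnorm c (fst z) (snd z))"
    using K by (intro gnorm_cont[OF c] continuous_intros) auto
  obtain z where z: "z \<in> ?S" "\<And>w. w \<in> ?S \<Longrightarrow> gnorm c (fst z) (snd z) \<le> gnorm c (fst w) (snd w)"
    using continuous_attains_inf[OF co ne ct] by auto
  obtain z' where z': "z' \<in> ?S" "\<And>w. w \<in> ?S \<Longrightarrow> gnorm c (fst w) (snd w) \<le> gnorm c (fst z') (snd z')"
    using continuous_attains_sup[OF co ne ct] by auto
  define l where "l = gnorm c (fst z) (snd z)"
  define u where "u = gnorm c (fst z') (snd z')"
  have "snd z \<noteq> 0" "fst z \<in> chart_image c" using z(1) K by auto
  then have l: "l > 0" unfolding l_def gnorm_def using gram_pos[OF c] by auto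
  have u: "u > 0" using l z(2)[OF z'(1)] by (simp add: l_def u_def)
  have "l * norm v \<le> gnorm c y v \<and> gnorm c y v \<le> u * norm v" if "y \<in> K" for y v
  proof (cases "v = 0")
    case True then show ?thesis by (simp add: gnorm_def)
  next
    case v: False
    have w: "(y, (1 / norm v) *\<^sub>R v) \<in> ?S" using that v by auto
    have "gnorm c y v = norm v * gnorm c y ((1 / norm v) *\<^sub>R v)" using v by (simp add: gnorm_scale)
    then show ?thesis using z(2)[OF w] z'(2)[OF w] v by (auto simp: l_def u_def mult.commute)
  qed
  then show ?thesis using that l u by blast
qed

definition nball :: "'a chart \<Rightarrow> real^2 \<Rightarrow> real \<Rightarrow> 'a set" where
  "nball c x e = {q \<in> chart_dom c. coords c q \<in> ball x e}"

lemma nball_open: assumes c: "c \<in> atlas M" shows "openin (surf M) (nball c x e)"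
proof -
  have "openin (subtopology (surf M) (chart_dom c)) {q \<in> topspace (subtopology (surf M) (chart_dom c)). coords c q \<in> ball x e}"
    by (rule openin_continuous_map_preimage[OF coords_cont[OF c]]) auto
  moreover have "{q \<in> topspace (subtopology (surf M) (chart_dom c)). coords c q \<in> ball x e} = nball c x e"
    using dom_points[OF c] by (auto simp: nball_def)
  ultimately show ?thesis using openin_trans_full dom_open[OF c] by metis
qed

lemma ncball_closed: assumes c: "c \<in> atlas M" and e: "cball x e \<subseteq> chart_image c"
  shows "closedin (surf M) {q \<in> chart_dom c. coords c q \<in> cball x e}"
proof -
  have "compactin (surf M) (cinv c ` cball x e)"
    by (rule image_compactin[OF _ cinv_cont[OF c]]) (use e in \<open>auto simp: compactin_subtopology\<close>)
  moreover have "cinv c ` cball x e = {q \<in> chart_dom c. coords c q \<in> cball x e}"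
    using e cinv_coords[OF c] coords_cinv[of _ c] cinv_dom[of _ c] by (force simp: image_iff)
  ultimately show ?thesis using compactin_imp_closedin[OF Hausdorff] by simp
qed

text \<open>The chart distance from \<open>x\<close>, capped at \<open>e\<close> so that it makes
  sense on the whole surface. Along any curve \<open>l * phi\<close> grows no faster than the
  length, whether or not the curve stays in the chart (\<open>phi_C1\<close>).\<close>

definition phi :: "'a chart \<Rightarrow> real^2 \<Rightarrow> real \<Rightarrow> 'a \<Rightarrow> real" where
  "phi c x e q = (if q \<in> nball c x e then dist x (coords c q) else e)"

text \<open>The displacement in the chart is the integral of the velocity, and \<open>l\<close>
  times the Euclidean norm of the velocity is at most the speed.\<close>

lemma C1_lower:
  assumes c: "c \<in> atlas M" and C: "C1_curve_on M {a..b} \<gamma>" and ab: "a < b" "a \<le> T" "T \<le> b"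
    and inK: "\<And>t. t \<in> {a..T} \<Longrightarrow> \<gamma> t \<in> chart_dom c \<and> coords c (\<gamma> t) \<in> K"
    and l: "\<And>y v. y \<in> K \<Longrightarrow> l * norm v \<le> gnorm c y v" "l > 0"
  shows "l * dist (coords c (\<gamma> a)) (coords c (\<gamma> T)) \<le> clen \<gamma> a b"
proof -
  note D = C1D[OF C]
  let ?v = "velocity c {a..b} \<gamma>"
  have D2: "((coords c \<circ> \<gamma>) has_vector_derivative ?v t) (at t within {a..T})" if "t \<in> {a..T}" for t
    by (rule has_vector_derivative_within_subset[OF D(2)[OF c, of t]]) (use inK[OF that] that ab in auto)
  have "(?v has_integral (coords c \<circ> \<gamma>) T - (coords c \<circ> \<gamma>) a) {a..T}"
    by (rule fundamental_theorem_of_calculus[OF ab(2) D2])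
  then have vi: "((\<lambda>t. l *\<^sub>R ?v t) has_integral l *\<^sub>R (coords c (\<gamma> T) - coords c (\<gamma> a))) {a..T}"
    using has_integral_cmul[of ?v _ _ l] unfolding o_def by blast
  have si: "spd {a..b} \<gamma> integrable_on {a..b}" using clen_has[OF C ab(1)] by blast
  then have si': "spd {a..b} \<gamma> integrable_on {a..T}"
    by (rule integrable_on_subinterval) (use ab in auto)
  have "norm (integral {a..T} (\<lambda>t. l *\<^sub>R ?v t)) \<le> integral {a..T} (spd {a..b} \<gamma>)"
  proof (rule integral_norm_bound_integral)
    fix t assume t: "t \<in> {a..T}"
    have "spd {a..b} \<gamma> t = gnorm c (coords c (\<gamma> t)) (?v t)"
      using C1_spd[OF C ab(1) _ c] t inK ab by auto
    then show "norm (l *\<^sub>R ?v t) \<le> spd {a..b} \<gamma> t" using l inK[OF t] by simp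
  qed (use vi si' in auto)
  also have "\<dots> \<le> integral {a..b} (spd {a..b} \<gamma>)"
    by (rule integral_subset_le) (use ab si si' spd_nonneg curve_points[OF D(1)] in auto)
  finally show ?thesis using integral_unique[OF vi] l(2)
    by (simp add: clen_def dist_norm norm_minus_commute)
qed

text \<open>A curve starting in the ball is followed up to the first time it leaves the ball. Until
  then \<open>C1_lower\<close> applies, and at that time the chart distance is \<open>e\<close>, the
  largest value of \<open>phi\<close>.\<close>

lemma phi_C1:
  assumes c: "c \<in> atlas M" and C: "C1_curve_on M {a..b} \<gamma>" and ab: "a < b"
    and K: "cball x e \<subseteq> chart_image c"
    and l: "\<And>y v. y \<in> cball x e \<Longrightarrow> l * norm v \<le> gnorm c y v" "l > 0"
  shows "l * phi c x e (\<gamma> b) \<le> l * phi c x e (\<gamma> a) + clen \<gamma> a b"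
proof -
  have ple: "phi c x e q \<le> e" for q by (auto simp: phi_def nball_def)
  note D = C1D[OF C]
  have cn: "0 \<le> clen \<gamma> a b" by (rule clen_nonneg[OF C ab])
  have fin: "l * phi c x e (\<gamma> b) \<le> l * phi c x e (\<gamma> a) + clen \<gamma> a b"
    if T: "a \<le> T" "T \<le> b" "\<And>t. t \<in> {a..T} \<Longrightarrow> \<gamma> t \<in> chart_dom c \<and> coords c (\<gamma> t) \<in> cball x e"
      and a: "\<gamma> a \<in> nball c x e" and le: "phi c x e (\<gamma> b) \<le> dist x (coords c (\<gamma> T))" for T
  proof -
    have "l * phi c x e (\<gamma> b) \<le> l * dist x (coords c (\<gamma> T))" using le l by simp
    also have "\<dots> \<le> l * (dist x (coords c (\<gamma> a)) + dist (coords c (\<gamma> a)) (coords c (\<gamma> T)))"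
      using l by (intro mult_left_mono dist_triangle) auto
    also have "\<dots> = l * phi c x e (\<gamma> a) + l * dist (coords c (\<gamma> a)) (coords c (\<gamma> T))"
      using a by (simp add: phi_def algebra_simps)
    also have "\<dots> \<le> l * phi c x e (\<gamma> a) + clen \<gamma> a b"
      using C1_lower[OF c C ab T l] by simp
    finally show ?thesis .
  qed
  show ?thesis
  proof (cases "\<gamma> a \<in> nball c x e")
    case False
    then have "l * phi c x e (\<gamma> b) \<le> l * phi c x e (\<gamma> a)" using ple[of "\<gamma> b"] l by (simp add: phi_def)
    then show ?thesis using cn by simp
  next
    case a: True
    define S where "S = {t\<in>{a..b}. \<gamma> t \<notin> nball c x e}"
    show ?thesis
    proof (cases "S = {}")
      case True
      then have all: "\<gamma> t \<in> nball c x e" if "t \<in> {a..b}" for t using that by (auto simp: S_def)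
      then have "\<And>t. t \<in> {a..b} \<Longrightarrow> \<gamma> t \<in> chart_dom c \<and> coords c (\<gamma> t) \<in> cball x e"
        unfolding nball_def by fastforce
      with all[of b] ab show ?thesis by (intro fin[of b] a) (auto simp: phi_def)
    next
      case False
      have "openin (top_of_set {a..b}) {t\<in>{a..b}. \<gamma> t \<in> nball c x e}"
        using openin_continuous_map_preimage[OF D(1) nball_open[OF c]] by simp
      moreover have "S = {a..b} - {t\<in>{a..b}. \<gamma> t \<in> nball c x e}" by (auto simp: S_def)
      ultimately have "closedin (top_of_set {a..b}) S" by (simp add: closedin_diff)
      then have cS: "closed S" using closedin_closed_eq by blast
      have bb: "bdd_below S" by (rule bdd_belowI[of _ a]) (auto simp: S_def)
      define T where "T = Inf S"
      have T: "T \<in> S" unfolding T_def using closed_contains_Inf[OF False bb cS] .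
      have lt: "\<gamma> t \<in> nball c x e" if "t \<in> {a..b}" "t < T" for t
        using that cInf_lower[OF _ bb, of t] unfolding T_def S_def by force
      have "a < T" using T a by (cases "a = T") (auto simp: S_def)
      have Tb: "T \<le> b" using T by (auto simp: S_def)
      let ?K = "{q \<in> chart_dom c. coords c q \<in> cball x e}"
      have "closedin (top_of_set {a..b}) {t\<in>{a..b}. \<gamma> t \<in> ?K}"
        using closedin_continuous_map_preimage[OF D(1) ncball_closed[OF c K]] by simp
      then have cK: "closed {t\<in>{a..b}. \<gamma> t \<in> ?K}" using closedin_closed_eq by blast
      have sub: "{a<..<T} \<subseteq> {t\<in>{a..b}. \<gamma> t \<in> ?K}"
      proof
        fix t assume "t \<in> {a<..<T}"
        with lt[of t] Tb show "t \<in> {t\<in>{a..b}. \<gamma> t \<in> ?K}" by (simp add: nball_def)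
      qed
      \<comment> \<open>Up to and including \<open>T\<close> the curve lies in the closed chart
        ball, because that ball is closed in the surface and not only in the chart.\<close>
      have "{a..T} = closure {a<..<T}" using \<open>a < T\<close> by simp
      also have "\<dots> \<subseteq> {t\<in>{a..b}. \<gamma> t \<in> ?K}" using sub cK by (rule closure_minimal)
      finally have inK: "\<And>t. t \<in> {a..T} \<Longrightarrow> \<gamma> t \<in> chart_dom c \<and> coords c (\<gamma> t) \<in> cball x e" by blast
      then have "\<gamma> T \<in> chart_dom c" "coords c (\<gamma> T) \<in> cball x e" using \<open>a < T\<close> by auto
      then have "dist x (coords c (\<gamma> T)) = e" using T by (auto simp: S_def nball_def)
      then show ?thesis using inK \<open>a < T\<close> Tb ple[of "\<gamma> b"] by (intro fin[of T] a) auto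
    qed
  qed
qed

text \<open>\<open>phi_C1\<close> is summed over the pieces of a curve that would be too short;
  \<open>phi\<close> vanishes at \<open>p\<close>. This keeps the points outside a chart ball at a
  positive distance from its centre.\<close>

lemma rdist_lower:
  assumes c: "c \<in> atlas M" and p: "p \<in> chart_dom c" and e: "e > 0" "cball (coords c p) e \<subseteq> chart_image c"
    and l: "\<And>y v. y \<in> cball (coords c p) e \<Longrightarrow> l * norm v \<le> gnorm c y v" "l > 0"
  shows "ereal (l * phi c (coords c p) e q) \<le> rdist M p q"
proof (rule ccontr)
  assume "\<not> ?thesis"
  then have lt: "rdist M p q < ereal (l * phi c (coords c p) e q)" by simp
  obtain \<gamma> n s where g: "pw 0 1 \<gamma> n s" "\<gamma> 0 = p" "\<gamma> 1 = q" "pwlen \<gamma> n s < l * phi c (coords c p) e q"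
    using rdist_less[OF lt] .
  have "m \<le> n \<Longrightarrow> l * phi c (coords c p) e (\<gamma> (s m)) \<le> l * phi c (coords c p) e (\<gamma> (s 0)) + pwlen \<gamma> m s" for m
  proof (induction m)
    case (Suc m)
    have "l * phi c (coords c p) e (\<gamma> (s (Suc m))) \<le> l * phi c (coords c p) e (\<gamma> (s m)) + clen \<gamma> (s m) (s (Suc m))"
      using pwD(3,4)[OF g(1), of m] Suc.prems by (intro phi_C1[OF c _ _ e(2) l]) auto
    then show ?case using Suc by (simp add: pwlen_def)
  qed (simp add: pwlen_def)
  from this[of n] have "l * phi c (coords c p) e q \<le> l * phi c (coords c p) e p + pwlen \<gamma> n s"
    using pwD(1,2)[OF g(1)] g(2,3) by simp
  moreover have "phi c (coords c p) e p = 0" using p e by (simp add: phi_def nball_def)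
  ultimately show False using g(4) by simp
qed

text \<open>The straight segment in the chart competes in the infimum. Its velocity has to be
  continuous in every chart that it meets, which is where the smoothness of the transition maps
  enters.\<close>

lemma line_C1:
  assumes c: "c \<in> atlas M" and seg: "\<And>t. t \<in> {0..1} \<Longrightarrow> x + t *\<^sub>R (y - x) \<in> K" and K: "K \<subseteq> chart_image c"
    and u: "\<And>y v. y \<in> K \<Longrightarrow> gnorm c y v \<le> u * norm v"
  shows "rdist M (cinv c x) (cinv c y) \<le> ereal (u * dist x y)"
proof -
  let ?g = "\<lambda>t::real. cinv c (x + t *\<^sub>R (y - x))"
  have im: "x + t *\<^sub>R (y - x) \<in> chart_image c" if "t \<in> {0..1}" for t using seg[OF that] K by auto
  have "continuous_map (top_of_set {0..1}) (top_of_set (chart_image c)) (\<lambda>t::real. x + t *\<^sub>R (y - x))"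
    using im by (auto simp: continuous_map_in_subtopology intro!: continuous_intros)
  from continuous_map_compose[OF this cinv_cont[OF c]]
  have cont: "continuous_map (top_of_set {0..1}) (surf M) ?g" by (simp add: o_def)
  have gc: "?g t \<in> chart_dom c" "coords c (?g t) = x + t *\<^sub>R (y - x)" if "t \<in> {0..1}" for t
    using im[OF that] cinv_dom coords_cinv by auto
  have der: "((coords c \<circ> ?g) has_vector_derivative (y - x)) (at t within {0..1})" if "t \<in> {0..1}" for t
  proof (rule has_vector_derivative_transform[OF that])
    show "((\<lambda>t. x + t *\<^sub>R (y - x)) has_vector_derivative (y - x)) (at t within {0..1})"
      by (auto intro!: derivative_eq_intros)
  qed (use gc in auto)
  let ?J = "\<lambda>c' z. frechet_derivative (transition c c') (at z) (y - x)"
  have der': "((coords c' \<circ> ?g) has_vector_derivative ?J c' (x + t *\<^sub>R (y - x))) (at t within {0..1})"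
    if "c' \<in> atlas M" "t \<in> {0..1}" "?g t \<in> chart_dom c'" for c' t
    using velocity_trans[OF cont that(2) c that(1) gc(1)[OF that(2)] that(3) der[OF that(2)]] gc(2)[OF that(2)] by simp
  have C: "C1_curve_on M {0..1} ?g" unfolding C1_curve_on_def
  proof (intro conjI ballI impI cont)
    fix c' t assume "c' \<in> atlas M" "t \<in> {0..1::real}" "?g t \<in> chart_dom c'"
    then show "coords c' \<circ> ?g differentiable at t within {0..1}" using der' differentiableI_vector by blast
  next
    fix c' assume c': "c' \<in> atlas M"
    have "continuous_on {t \<in> {0..1}. ?g t \<in> chart_dom c'} (\<lambda>t. ?J c' (x + t *\<^sub>R (y - x)))"
    proof (rule continuous_on_compose2[OF smooth_dir_cont[OF trans_smooth[OF c c']]])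
      show "(\<lambda>t. x + t *\<^sub>R (y - x)) ` {t \<in> {0..1}. ?g t \<in> chart_dom c'} \<subseteq> coords c ` (chart_dom c \<inter> chart_dom c')"
        using gc by (auto intro!: image_eqI[where x="?g _"])
    qed (auto intro!: continuous_intros)
    then show "continuous_on {t \<in> {0..1}. ?g t \<in> chart_dom c'} (velocity c' {0..1} ?g)"
      by (rule continuous_on_eq) (use velocityI[OF ivl_nbot der'] c' in auto)
  qed
  have "clen ?g 0 1 \<le> integral {0..1} (\<lambda>t::real. u * dist x y)"
    unfolding clen_def
  proof (rule integral_le)
    show "spd {0..1} ?g integrable_on {0..1}" using clen_has[OF C] by auto
    show "(\<lambda>t::real. u * dist x y) integrable_on {0..1}" by (rule integrable_const_ivl)
    fix t :: real assume t: "t \<in> {0..1}"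
    have "spd {0..1} ?g t = gnorm c (coords c (?g t)) (y - x)"
      using t gc[OF t] by (intro spd_eq[OF cont] c der ivl_nbot) auto
    then show "spd {0..1} ?g t \<le> u * dist x y"
      using u[OF seg[OF t], of "y - x"] gc[OF t] by (simp add: dist_norm norm_minus_commute)
  qed
  then have "clen ?g 0 1 \<le> u * dist x y" by simp
  moreover have "rdist M (?g 0) (?g 1) \<le> clen ?g 0 1" by (rule rdist_le_C1[OF C]) simp
  ultimately show ?thesis by (auto intro: order_trans)
qed

lemma chart_cball: assumes "c \<in> atlas M" "p \<in> chart_dom c" "openin (surf M) U" "p \<in> U"
  obtains e where "e > 0" "cball (coords c p) e \<subseteq> chart_image c" "nball c (coords c p) e \<subseteq> U"
proof -
  have "openin (subtopology (surf M) (chart_dom c)) (chart_dom c \<inter> U)"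
    using assms openin_subtopology_Int2 by metis
  then have "openin (top_of_set (chart_image c)) (coords c ` (chart_dom c \<inter> U))"
    using homeomorphic_imp_open_map[OF chart_homeo[OF assms(1)]] open_map_def by blast
  then have "open (coords c ` (chart_dom c \<inter> U))" using image_open[OF assms(1)] openin_open_eq by blast
  moreover have "coords c p \<in> coords c ` (chart_dom c \<inter> U)" using assms by auto
  ultimately obtain e where e: "e > 0" "cball (coords c p) e \<subseteq> coords c ` (chart_dom c \<inter> U)"
    using open_contains_cball by blast
  have "q \<in> U" if "q \<in> nball c (coords c p) e" for q
  proof -
    have "coords c q \<in> coords c ` (chart_dom c \<inter> U)" "q \<in> chart_dom c" using that e by (auto simp: nball_def)
    then show ?thesis using coords_inj[OF assms(1)] by (auto dest: inj_onD)
  qed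
  then show ?thesis using that e by blast
qed

lemma disk_in_open: assumes U: "openin (surf M) U" "p \<in> U"
  obtains r where "r > 0" "disk M p r \<subseteq> U"
proof -
  have "p \<in> points M" using U openin_subset by blast
  then obtain c where c: "c \<in> atlas M" "p \<in> chart_dom c" using in_chart by metis
  obtain e where e: "e > 0" "cball (coords c p) e \<subseteq> chart_image c" "nball c (coords c p) e \<subseteq> U"
    using chart_cball[OF c U] .
  obtain l u where l: "l > 0" "\<And>y v. y \<in> cball (coords c p) e \<Longrightarrow> l * norm v \<le> gnorm c y v"
    using gnorm_bounds[OF c(1) compact_cball e(2)] by metis
  have "q \<in> U" if "q \<in> disk M p (l * e)" for q
  proof (rule ccontr)
    assume "q \<notin> U"
    then have "phi c (coords c p) e q = e" using e by (auto simp: phi_def)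
    then show False using rdist_lower[OF c e(1,2) l(2,1), of q] that by (simp add: disk_def leD)
  qed
  then show ?thesis using that[of "l * e"] l e by auto
qed

lemma rdist_near: assumes p: "p \<in> points M" and e: "e > 0"
  obtains U where "openin (surf M) U" "p \<in> U" "\<And>q. q \<in> U \<Longrightarrow> rdist M p q < ereal e"
proof -
  obtain c where c: "c \<in> atlas M" "p \<in> chart_dom c" using in_chart p by metis
  obtain d where d: "d > 0" "cball (coords c p) d \<subseteq> chart_image c"
    using chart_cball[OF c openin_topspace p] by metis
  obtain u where u: "u > 0" "\<And>y v. y \<in> cball (coords c p) d \<Longrightarrow> gnorm c y v \<le> u * norm v"
    using gnorm_bounds[OF c(1) compact_cball d(2)] by metis
  define r where "r = min d (e / u)"
  have r: "r > 0" "r \<le> d" "r \<le> e / u" using d u e by (auto simp: r_def)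
  have "rdist M p q < ereal e" if q: "q \<in> nball c (coords c p) r" for q
  proof -
    have qc: "q \<in> chart_dom c" and qd: "dist (coords c p) (coords c q) < r" using q by (auto simp: nball_def)
    have "coords c p + t *\<^sub>R (coords c q - coords c p) \<in> cball (coords c p) d" if "t \<in> {0..1}" for t
    proof -
      have "\<bar>t\<bar> * norm (coords c q - coords c p) \<le> 1 * norm (coords c q - coords c p)"
        using that by (intro mult_right_mono) auto
      then show ?thesis using qd r by (simp add: dist_norm norm_minus_commute)
    qed
    then have "rdist M (cinv c (coords c p)) (cinv c (coords c q)) \<le> ereal (u * dist (coords c p) (coords c q))"
      by (intro line_C1[OF c(1) _ d(2) u(2)])
    moreover have "u * dist (coords c p) (coords c q) < e"
    proof -
      have "dist (coords c p) (coords c q) < e / u" using qd r by linarith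
      then show ?thesis using u(1) by (simp add: pos_less_divide_eq mult.commute)
    qed
    ultimately show ?thesis using cinv_coords[OF c(1)] c(2) qc by (simp add: le_less_trans)
  qed
  moreover have "p \<in> nball c (coords c p) r" using c r by (simp add: nball_def)
  ultimately show ?thesis using that nball_open[OF c(1)] by blast
qed

lemma rdist_refl: assumes "p \<in> points M" shows "rdist M p p = 0"
proof -
  have small: "rdist M p p \<le> ereal e" if "e > 0" for e
    using rdist_near[OF assms that] by (metis less_imp_le)
  have "rdist M p p \<le> 0"
  proof (rule ccontr)
    assume "\<not> rdist M p p \<le> 0"
    then have "0 < rdist M p p" by (simp add: not_le)
    then obtain e where "0 < ereal e" "ereal e < rdist M p p" using ereal_dense2 by blast
    then show False using small[of e] by (simp add: leD)
  qed
  then show ?thesis using rdist_nonneg[of p p] by simp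
qed

lemma disk_open: "openin (surf M) (disk M a r)"
proof (subst openin_subopen, intro ballI)
  fix q assume q: "q \<in> disk M a r"
  then have qp: "q \<in> points M" and "rdist M a q < ereal r" by (auto simp: disk_def)
  then obtain d where d: "rdist M a q = ereal d" using rdist_nonneg[of a q] by (cases "rdist M a q") auto
  then have e: "r - d > 0" using \<open>rdist M a q < ereal r\<close> by simp
  obtain U where U: "openin (surf M) U" "q \<in> U" "\<And>z. z \<in> U \<Longrightarrow> rdist M q z < ereal (r - d)"
    using rdist_near[OF qp e] by metis
  have "z \<in> disk M a r" if "z \<in> U" for z
  proof -
    have "rdist M a z \<le> ereal d + rdist M q z" using rdist_triangle[of a z q] d by simp
    also have "\<dots> < ereal d + ereal (r - d)" using U(3)[OF that] by (intro ereal_less_add) auto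
    finally show ?thesis using U(1) that openin_subset by (force simp: disk_def)
  qed
  then show "\<exists>T. openin (surf M) T \<and> q \<in> T \<and> T \<subseteq> disk M a r" using U by blast
qed

lemma rdist_pos: assumes "p \<in> points M" "q \<in> points M" "p \<noteq> q" shows "0 < rdist M p q"
proof -
  obtain U where U: "openin (surf M) U" "p \<in> U" "q \<notin> U"
    using Hausdorff assms unfolding Hausdorff_space_def disjnt_def by blast
  obtain r where "r > 0" "disk M p r \<subseteq> U" using disk_in_open[OF U(1,2)] .
  then have "ereal r \<le> rdist M p q" using U assms by (auto simp: disk_def)
  then show ?thesis using \<open>r > 0\<close> by (meson ereal_less(2) less_le_trans)
qed

text \<open>The topology of the surface is that of the Riemannian distance: one inclusion rests on
  \<open>rdist_lower\<close>, the other, through \<open>disk_open\<close>, on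
  \<open>line_C1\<close>.\<close>

lemma openin_disk: "openin (surf M) U \<longleftrightarrow> U \<subseteq> points M \<and> (\<forall>p\<in>U. \<exists>r>0. disk M p r \<subseteq> U)"
proof
  assume r: "U \<subseteq> points M \<and> (\<forall>p\<in>U. \<exists>r>0. disk M p r \<subseteq> U)"
  show "openin (surf M) U"
  proof (subst openin_subopen, intro ballI)
    fix p assume "p \<in> U"
    then obtain r where "r > 0" "disk M p r \<subseteq> U" "p \<in> points M" using r by blast
    then show "\<exists>T. openin (surf M) T \<and> p \<in> T \<and> T \<subseteq> U"
      using disk_open[of p r] rdist_refl by (intro exI[of _ "disk M p r"]) (auto simp: disk_def)
  qed
qed (use disk_in_open openin_subset in metis)

section \<open>Geodesics\<close>

text \<open>The geodesic equation solved for the acceleration.\<close>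

definition geoF :: "'a chart \<Rightarrow> real^2 \<Rightarrow> real^2 \<Rightarrow> real^2" where
  "geoF c x v = (\<chi> k. - (\<Sum>i\<in>UNIV. \<Sum>j\<in>UNIV. christoffel M c x k i j * v $ i * v $ j))"

abbreviation vel :: "'a chart \<Rightarrow> (real \<Rightarrow> 'a) \<Rightarrow> real \<Rightarrow> real^2" where
  "vel c \<gamma> \<equiv> velocity c {0..1} \<gamma>"

lemma geodesic_iff: "geodesic M \<gamma> \<longleftrightarrow> continuous_map (top_of_set {0..1}) (surf M) \<gamma> \<and>
     (\<forall>c\<in>atlas M. \<forall>t\<in>{0..1}. \<gamma> t \<in> chart_dom c \<longrightarrow>
        ((coords c \<circ> \<gamma>) has_vector_derivative vel c \<gamma> t) (at t within {0..1}) \<and>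
        (vel c \<gamma> has_vector_derivative geoF c (coords c (\<gamma> t)) (vel c \<gamma> t)) (at t within {0..1}))"
  unfolding geodesic_def geoF_def velocity_def vector_derivative_works ..

lemma geodesicD: assumes "geodesic M \<gamma>"
  shows "continuous_map (top_of_set {0..1}) (surf M) \<gamma>"
    "\<And>c t. c \<in> atlas M \<Longrightarrow> t \<in> {0..1} \<Longrightarrow> \<gamma> t \<in> chart_dom c \<Longrightarrow> ((coords c \<circ> \<gamma>) has_vector_derivative vel c \<gamma> t) (at t within {0..1})"
    "\<And>c t. c \<in> atlas M \<Longrightarrow> t \<in> {0..1} \<Longrightarrow> \<gamma> t \<in> chart_dom c \<Longrightarrow> (vel c \<gamma> has_vector_derivative geoF c (coords c (\<gamma> t)) (vel c \<gamma> t)) (at t within {0..1})"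
  using assms unfolding geodesic_iff by blast+

lemma geodesic_C1: assumes "geodesic M \<gamma>" shows "C1_curve_on M {0..1} \<gamma>"
proof -
  note D = geodesicD[OF assms]
  have "continuous_on {t \<in> {0..1}. \<gamma> t \<in> chart_dom c} (vel c \<gamma>)" if c: "c \<in> atlas M" for c
    unfolding continuous_on_eq_continuous_within
  proof
    fix t assume t: "t \<in> {t \<in> {0..1}. \<gamma> t \<in> chart_dom c}"
    then have "continuous (at t within {0..1}) (vel c \<gamma>)"
      using has_vector_derivative_continuous D(3)[OF c] by blast
    then show "continuous (at t within {t \<in> {0..1}. \<gamma> t \<in> chart_dom c}) (vel c \<gamma>)"
      by (rule continuous_within_subset) auto
  qed
  moreover have "coords c \<circ> \<gamma> differentiable at t within {0..1}"
    if "c \<in> atlas M" "t \<in> {0..1}" "\<gamma> t \<in> chart_dom c" for c t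
    using D(2)[OF that] by (rule differentiableI_vector)
  ultimately show ?thesis unfolding C1_curve_on_def using D(1) by blast
qed

lemma gram_inv: assumes c: "c \<in> atlas M" "y \<in> chart_image c"
  shows "gram M c y ** matrix_inv (gram M c y) = mat 1"
proof -
  have "x = 0" if "gram M c y *v x = 0" for x
  proof (rule ccontr)
    assume "x \<noteq> 0"
    from gram_pos[OF c this] that show False by simp
  qed
  then have "\<exists>B. B ** gram M c y = mat 1" by (subst matrix_left_invertible_ker) blast
  then obtain B where B: "B ** gram M c y = mat 1" ..
  then have "gram M c y ** B = mat 1" by (simp only: matrix_left_right_inverse)
  with B have "\<exists>B. gram M c y ** B = mat 1 \<and> B ** gram M c y = mat 1" by blast
  from someI_ex[OF this] show ?thesis unfolding matrix_inv_def by blast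
qed

lemma gram_sym_nth: assumes "c \<in> atlas M" "y \<in> chart_image c" shows "gram M c y $ i $ j = gram M c y $ j $ i"
proof -
  have "gram M c y $ i $ j = transpose (gram M c y) $ i $ j" by (simp only: gram_sym[OF assms])
  then show ?thesis by (simp add: transpose_def)
qed

text \<open>Lowering the index cancels the inverse Gram matrix and leaves the Christoffel symbols of
  the first kind.\<close>

lemma christoffel_lower: assumes c: "c \<in> atlas M" "y \<in> chart_image c"
  shows "(\<Sum>k\<in>UNIV. gram M c y $ m $ k * christoffel M c y k i j) =
    (partial_deriv i (\<lambda>z. gram M c z $ j $ m) y + partial_deriv j (\<lambda>z. gram M c z $ i $ m) y
         - partial_deriv m (\<lambda>z. gram M c z $ i $ j) y) / 2"
proof -
  define S where "S l = (partial_deriv i (\<lambda>z. gram M c z $ j $ l) y + partial_deriv j (\<lambda>z. gram M c z $ i $ l) y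
         - partial_deriv l (\<lambda>z. gram M c z $ i $ j) y) / 2" for l
  let ?g = "gram M c y" let ?h = "matrix_inv (gram M c y)"
  have "(\<Sum>k\<in>UNIV. ?g $ m $ k * ?h $ k $ l) = (if m = l then 1 else 0)" for l
    using gram_inv[OF c] by (auto simp: matrix_matrix_mult_def mat_def vec_eq_iff)
  then have h: "?g $ m $ 1 * ?h $ 1 $ l + ?g $ m $ 2 * ?h $ 2 $ l = (if m = l then 1 else 0)" for l
    by (simp add: sum_2)
  have "(\<Sum>k\<in>UNIV. ?g $ m $ k * christoffel M c y k i j) =
    (?g $ m $ 1 * ?h $ 1 $ 1 + ?g $ m $ 2 * ?h $ 2 $ 1) * S 1 + (?g $ m $ 1 * ?h $ 1 $ 2 + ?g $ m $ 2 * ?h $ 2 $ 2) * S 2"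
    unfolding christoffel_def S_def by (simp add: sum_2 field_simps)
  also have "\<dots> = S m" unfolding h using exhaust_2[of m] by auto
  finally show ?thesis by (simp add: S_def)
qed

lemma gram_comp_deriv: assumes c: "c \<in> atlas M" "y \<in> chart_image c"
  shows "((\<lambda>z. gram M c z $ i $ j) has_derivative (\<lambda>v. \<Sum>k\<in>UNIV. v $ k * partial_deriv k (\<lambda>z. gram M c z $ i $ j) y)) (at y)"
proof -
  let ?f = "\<lambda>z. gram M c z $ i $ j"
  have "(gram M c has_derivative frechet_derivative (gram M c) (at y)) (at y)"
    using smooth_diff[OF gram_smooth] c frechet_derivative_works by blast
  from bounded_linear.has_derivative[OF bounded_linear_vec_nth bounded_linear.has_derivative[OF bounded_linear_vec_nth this]]
  have "(?f has_derivative (\<lambda>v. frechet_derivative (gram M c) (at y) v $ i $ j)) (at y)" .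
  then have F: "(?f has_derivative frechet_derivative ?f (at y)) (at y)"
    using differentiableI frechet_derivative_works by blast
  then have lin: "linear (frechet_derivative ?f (at y))" by (rule has_derivative_linear)
  have "frechet_derivative ?f (at y) v = (\<Sum>k\<in>UNIV. v $ k * partial_deriv k ?f y)" for v
  proof -
    have "frechet_derivative ?f (at y) v = frechet_derivative ?f (at y) (\<Sum>k\<in>UNIV. (v $ k) *\<^sub>R axis k 1)"
      by (simp add: basis_expansion flip: scalar_mult_eq_scaleR)
    also have "\<dots> = (\<Sum>k\<in>UNIV. v $ k * partial_deriv k ?f y)"
      by (simp add: linear_sum[OF lin] linear_cmul[OF lin] partial_deriv_def)
    finally show ?thesis .
  qed
  then have "frechet_derivative ?f (at y) = (\<lambda>v. \<Sum>k\<in>UNIV. v $ k * partial_deriv k ?f y)" by blast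
  with F show ?thesis by simp
qed

definition energy :: "'a chart \<Rightarrow> real^2 \<Rightarrow> real^2 \<Rightarrow> real" where
  "energy c x v = (\<Sum>i\<in>UNIV. \<Sum>j\<in>UNIV. v $ i * gram M c x $ i $ j * v $ j)"

lemma energy_eq: "energy c x v = v \<bullet> (gram M c x *v v)"
  by (simp add: energy_def inner_vec_def matrix_vector_mult_def sum_2 algebra_simps)

text \<open>The sum is the derivative of the squared norm of the velocity along a solution of the
  geodesic equation, by the product rule. After lowering the index, the Christoffel terms cancel the
  derivatives of the metric because the Gram matrix is symmetric.\<close>

lemma energy_identity: assumes c: "c \<in> atlas M" "y \<in> chart_image c"
  shows "(\<Sum>i\<in>UNIV. \<Sum>j\<in>UNIV. geoF c y v $ i * gram M c y $ i $ j * v $ j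
      + v $ i * (\<Sum>k\<in>UNIV. v $ k * partial_deriv k (\<lambda>z. gram M c z $ i $ j) y) * v $ j
      + v $ i * gram M c y $ i $ j * geoF c y v $ j) = 0"
proof -
  define P where "P k i j = partial_deriv k (\<lambda>z. gram M c z $ i $ j) y" for k i j
  let ?g = "gram M c y"
  have Ps: "P k i j = P k j i" for k i j
  proof -
    have "((\<lambda>z. gram M c z $ i $ j) has_derivative D) (at y) \<longleftrightarrow> ((\<lambda>z. gram M c z $ j $ i) has_derivative D) (at y)" for D
      by (intro iffI; erule has_derivative_transform_within_open[OF _ image_open[OF c(1)] c(2)])
         (erule gram_sym_nth[OF c(1)])+
    then show ?thesis unfolding P_def partial_deriv_def frechet_derivative_def by simp
  qed
  have low: "(\<Sum>k\<in>UNIV. ?g $ m $ k * christoffel M c y k i j) = (P i j m + P j i m - P m i j) / 2" for m i j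
    unfolding P_def by (rule christoffel_lower[OF c])
  have a: "?g $ m $ 1 * geoF c y v $ 1 + ?g $ m $ 2 * geoF c y v $ 2 =
     - (\<Sum>i\<in>UNIV. \<Sum>j\<in>UNIV. (P i j m + P j i m - P m i j) / 2 * v $ i * v $ j)" for m
    unfolding low[symmetric] by (simp add: geoF_def sum_2 algebra_simps)
  have sym: "?g $ 2 $ 1 = ?g $ 1 $ 2" using gram_sym_nth[OF c] .
  have "(\<Sum>i\<in>UNIV. \<Sum>j\<in>UNIV. geoF c y v $ i * ?g $ i $ j * v $ j + v $ i * (\<Sum>k\<in>UNIV. v $ k * P k i j) * v $ j
      + v $ i * ?g $ i $ j * geoF c y v $ j)
     = 2 * (v $ 1 * (?g $ 1 $ 1 * geoF c y v $ 1 + ?g $ 1 $ 2 * geoF c y v $ 2) + v $ 2 * (?g $ 2 $ 1 * geoF c y v $ 1 + ?g $ 2 $ 2 * geoF c y v $ 2))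
      + (\<Sum>i\<in>UNIV. \<Sum>j\<in>UNIV. v $ i * (\<Sum>k\<in>UNIV. v $ k * P k i j) * v $ j)"
    by (simp add: sum_2 sym algebra_simps)
  also have "\<dots> = 0" unfolding a using Ps[of 1 2 1] Ps[of 2 2 1]
    by (simp add: sum_2 algebra_simps diff_divide_distrib add_divide_distrib)
  finally show ?thesis by (simp add: P_def)
qed

lemma vec_nth_deriv: "(f has_vector_derivative f') F \<Longrightarrow> ((\<lambda>t. f t $ i) has_vector_derivative f' $ i) F"
  by (rule bounded_linear.has_vector_derivative[OF bounded_linear_vec_nth])

lemma energy_deriv: assumes g: "geodesic M \<gamma>" and c: "c \<in> atlas M" and t: "t \<in> {0..1}" "\<gamma> t \<in> chart_dom c"
  shows "((\<lambda>s. energy c (coords c (\<gamma> s)) (vel c \<gamma> s)) has_vector_derivative 0) (at t within {0..1})"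
proof -
  note D = geodesicD(2,3)[OF g c t]
  let ?y = "coords c (\<gamma> t)" let ?v = "vel c \<gamma> t"
  have y: "?y \<in> chart_image c" using t by auto
  have G: "((\<lambda>s. gram M c (coords c (\<gamma> s)) $ i $ j) has_real_derivative
       (\<Sum>k\<in>UNIV. ?v $ k * partial_deriv k (\<lambda>z. gram M c z $ i $ j) ?y)) (at t within {0..1})" for i j
  proof -
    have "((\<lambda>z. gram M c z $ i $ j) \<circ> (coords c \<circ> \<gamma>) has_derivative
       (\<lambda>v. \<Sum>k\<in>UNIV. v $ k * partial_deriv k (\<lambda>z. gram M c z $ i $ j) ?y) \<circ> (\<lambda>h. h *\<^sub>R ?v)) (at t within {0..1})"
      using D(1) gram_comp_deriv[OF c y] unfolding has_vector_derivative_def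
      by (intro diff_chain_within) (auto intro: has_derivative_at_withinI)
    then show ?thesis unfolding has_real_derivative_iff_has_vector_derivative has_vector_derivative_def o_def
      by (rule has_derivative_eq_rhs) (simp add: fun_eq_iff sum_2 algebra_simps)
  qed
  have V: "((\<lambda>s. vel c \<gamma> s $ i) has_real_derivative geoF c ?y ?v $ i) (at t within {0..1})" for i
    unfolding has_real_derivative_iff_has_vector_derivative by (rule vec_nth_deriv[OF D(2)])
  have "((\<lambda>s. energy c (coords c (\<gamma> s)) (vel c \<gamma> s)) has_real_derivative
     (\<Sum>i\<in>UNIV. \<Sum>j\<in>UNIV. geoF c ?y ?v $ i * gram M c ?y $ i $ j * ?v $ j
      + ?v $ i * (\<Sum>k\<in>UNIV. ?v $ k * partial_deriv k (\<lambda>z. gram M c z $ i $ j) ?y) * ?v $ j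
      + ?v $ i * gram M c ?y $ i $ j * geoF c ?y ?v $ j)) (at t within {0..1})"
    unfolding energy_def
    by (intro DERIV_sum) (auto intro!: derivative_eq_intros V G simp: algebra_simps)
  then show ?thesis unfolding energy_identity[OF c y] has_real_derivative_iff_has_vector_derivative .
qed

lemma geodesic_spd_sq: assumes g: "geodesic M \<gamma>" and c: "c \<in> atlas M" and t: "t \<in> {0..1}" "\<gamma> t \<in> chart_dom c"
  shows "spd {0..1} \<gamma> t = gnorm c (coords c (\<gamma> t)) (vel c \<gamma> t)" "(spd {0..1} \<gamma> t)\<^sup>2 = energy c (coords c (\<gamma> t)) (vel c \<gamma> t)"
proof -
  show 1: "spd {0..1} \<gamma> t = gnorm c (coords c (\<gamma> t)) (vel c \<gamma> t)"
    by (rule C1_spd[OF geodesic_C1[OF g] _ t(1) c t(2)]) simp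
  have "0 \<le> energy c (coords c (\<gamma> t)) (vel c \<gamma> t)"
    using gram_pos[OF c, of "coords c (\<gamma> t)" "vel c \<gamma> t"] t by (cases "vel c \<gamma> t = 0") (auto simp: energy_eq)
  then show "(spd {0..1} \<gamma> t)\<^sup>2 = energy c (coords c (\<gamma> t)) (vel c \<gamma> t)"
    unfolding 1 gnorm_def energy_eq by simp
qed

text \<open>The squared speed does not depend on the chart and has derivative zero in each of them.
  Over a parameter interval of length one the constant speed is the length.\<close>

lemma geodesic_const: assumes g: "geodesic M \<gamma>"
  obtains k where "k \<ge> 0" "\<And>t. t \<in> {0..1} \<Longrightarrow> spd {0..1} \<gamma> t = k" "curve_length M \<gamma> = k"
proof -
  note D = geodesicD[OF g]
  have "((\<lambda>s. (spd {0..1} \<gamma> s)\<^sup>2) has_vector_derivative 0) (at t within {0..1})" if t: "t \<in> {0..1}" for t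
  proof -
    obtain c where c: "c \<in> atlas M" "\<gamma> t \<in> chart_dom c" using in_chart curve_points[OF D(1) t] by metis
    obtain e where e: "e > 0" "\<And>s. s \<in> {0..1} \<Longrightarrow> dist s t < e \<Longrightarrow> \<gamma> s \<in> chart_dom c"
      using curve_near[OF D(1) dom_open[OF c(1)] t c(2)] by metis
    show ?thesis
      by (rule has_vector_derivative_transform_within[OF energy_deriv[OF g c(1) t c(2)] e(1) t])
         (use geodesic_spd_sq(2)[OF g c(1)] e(2) in auto)
  qed
  then obtain k2 where k2: "\<And>t. t \<in> {0..1} \<Longrightarrow> (spd {0..1} \<gamma> t)\<^sup>2 = k2"
    using has_vector_derivative_zero_constant[of "{0..1::real}"] by (metis convex_real_interval(5))
  have k: "spd {0..1} \<gamma> t = sqrt k2" if "t \<in> {0..1}" for t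
    using k2[OF that] spd_nonneg[of \<gamma> t "{0..1}", OF curve_points[OF D(1) that]] by (metis real_sqrt_unique)
  have "(speed M \<gamma> has_integral sqrt k2 * (1 - 0)) {0..1}"
    using has_integral_const_real[of "sqrt k2" 0 1] k by (subst has_integral_cong[of _ _ "\<lambda>_. sqrt k2"]) (auto simp: speed_spd)
  then have "curve_length M \<gamma> = sqrt k2" by (simp add: curve_length_def integral_unique)
  moreover have "0 \<le> sqrt k2" using k[of 0] spd_nonneg[of \<gamma> 0 "{0..1}", OF curve_points[OF D(1)]] by simp
  ultimately show ?thesis using that k by blast
qed

lemma geodesic_rdist: assumes g: "geodesic M \<gamma>" and st: "0 \<le> s" "s \<le> t" "t \<le> 1"
  shows "rdist M (\<gamma> s) (\<gamma> t) \<le> ereal (curve_length M \<gamma> * (t - s))"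
proof (cases "s = t")
  case True
  then show ?thesis using rdist_refl curve_points[OF geodesicD(1)[OF g]] st by (simp add: zero_ereal_def)
next
  case False
  then have lt: "s < t" using st by simp
  obtain k where k: "\<And>t. t \<in> {0..1} \<Longrightarrow> spd {0..1} \<gamma> t = k" "curve_length M \<gamma> = k" using geodesic_const[OF g] by metis
  note S = C1_subset[OF geodesic_C1[OF g] st(1) lt st(3)]
  have "(spd {s..t} \<gamma> has_integral k * (t - s)) {s..t}"
    using has_integral_const_real[of k s t] k(1) S(2) st by (subst has_integral_cong[of _ _ "\<lambda>_. k"]) (auto simp: mult.commute)
  then have "clen \<gamma> s t = k * (t - s)" by (simp add: clen_def integral_unique)
  then show ?thesis using rdist_le_C1[OF S(1) lt] k(2) by simp
qed

text \<open>Both sides of the geodesic equation scale with the square of \<open>\<alpha>\<close>,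
  since \<open>geoF\<close> is quadratic in the velocity. Negative factors are included, which gives
  reversed geodesics.\<close>

lemma geodesic_reparam: assumes g: "geodesic M \<gamma>" and m: "\<And>s. s \<in> {0..1} \<Longrightarrow> \<alpha> * s + \<beta> \<in> {0..1}"
  shows "geodesic M (\<lambda>s. \<gamma> (\<alpha> * s + \<beta>))"
    "\<And>c t. c \<in> atlas M \<Longrightarrow> t \<in> {0..1} \<Longrightarrow> \<gamma> (\<alpha> * t + \<beta>) \<in> chart_dom c \<Longrightarrow> vel c (\<lambda>s. \<gamma> (\<alpha> * s + \<beta>)) t = \<alpha> *\<^sub>R vel c \<gamma> (\<alpha> * t + \<beta>)"
proof -
  let ?\<sigma> = "\<lambda>s. \<gamma> (\<alpha> * s + \<beta>)"
  note D = geodesicD[OF g]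
  have cont: "continuous_map (top_of_set {0..1}) (surf M) ?\<sigma>" by (rule reparam_cont[OF D(1) m])
  have der: "((coords c \<circ> ?\<sigma>) has_vector_derivative \<alpha> *\<^sub>R vel c \<gamma> (\<alpha> * t + \<beta>)) (at t within {0..1})"
    if "c \<in> atlas M" "t \<in> {0..1}" "?\<sigma> t \<in> chart_dom c" for c t
    using reparam_deriv[OF D(2)[OF that(1) m[OF that(2)] that(3)], of "{0..1}"] m by (simp add: o_def)
  show vl: "vel c ?\<sigma> t = \<alpha> *\<^sub>R vel c \<gamma> (\<alpha> * t + \<beta>)"
    if "c \<in> atlas M" "t \<in> {0..1}" "?\<sigma> t \<in> chart_dom c" for c t
    by (rule velocityI[OF ivl_nbot[OF _ that(2)] der[OF that]]) simp
  have der2: "(vel c ?\<sigma> has_vector_derivative geoF c (coords c (?\<sigma> t)) (vel c ?\<sigma> t)) (at t within {0..1})"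
    if A: "c \<in> atlas M" "t \<in> {0..1}" "?\<sigma> t \<in> chart_dom c" for c t
  proof -
    obtain e where e: "e > 0" "\<And>s. s \<in> {0..1} \<Longrightarrow> dist s t < e \<Longrightarrow> ?\<sigma> s \<in> chart_dom c"
      using curve_near[OF cont dom_open[OF A(1)] A(2,3)] by metis
    have "((\<lambda>s. vel c \<gamma> (\<alpha> * s + \<beta>)) has_vector_derivative \<alpha> *\<^sub>R geoF c (coords c (?\<sigma> t)) (vel c \<gamma> (\<alpha> * t + \<beta>))) (at t within {0..1})"
      by (rule reparam_deriv[OF D(3)[OF A(1) m[OF A(2)] A(3)]]) (use m in auto)
    from bounded_linear.has_vector_derivative[OF bounded_linear_scaleR_right[of \<alpha>] this]
    have "((\<lambda>s. \<alpha> *\<^sub>R vel c \<gamma> (\<alpha> * s + \<beta>)) has_vector_derivative \<alpha> *\<^sub>R \<alpha> *\<^sub>R geoF c (coords c (?\<sigma> t)) (vel c \<gamma> (\<alpha> * t + \<beta>))) (at t within {0..1})" .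
    moreover have "\<alpha> *\<^sub>R \<alpha> *\<^sub>R geoF c (coords c (?\<sigma> t)) (vel c \<gamma> (\<alpha> * t + \<beta>)) = geoF c (coords c (?\<sigma> t)) (vel c ?\<sigma> t)"
      unfolding vl[OF A] geoF_def by (simp add: vec_eq_iff sum_2 algebra_simps)
    ultimately have "((\<lambda>s. \<alpha> *\<^sub>R vel c \<gamma> (\<alpha> * s + \<beta>)) has_vector_derivative geoF c (coords c (?\<sigma> t)) (vel c ?\<sigma> t)) (at t within {0..1})" by simp
    then show ?thesis
      by (rule has_vector_derivative_transform_within[OF _ e(1) A(2)]) (use vl[OF A(1)] e(2) in auto)
  qed
  have der1: "((coords c \<circ> ?\<sigma>) has_vector_derivative vel c ?\<sigma> t) (at t within {0..1})"
    if "c \<in> atlas M" "t \<in> {0..1}" "?\<sigma> t \<in> chart_dom c" for c t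
    using der[OF that] vl[OF that] by simp
  show "geodesic M ?\<sigma>" unfolding geodesic_iff using cont der1 der2 by blast
qed

lemma minimal_finite: "minimal_geodesic M p q \<gamma> \<Longrightarrow> rdist M p q = ereal (curve_length M \<gamma>)"
  by (simp add: minimal_geodesic_def)

text \<open>If the part from \<open>s\<close> to \<open>t\<close> could be shortened, the triangle
  inequality would bring the two ends closer together than the length.\<close>

lemma minimal_rdist: assumes m: "minimal_geodesic M p q \<gamma>" and st: "0 \<le> s" "s \<le> t" "t \<le> 1"
  shows "rdist M (\<gamma> s) (\<gamma> t) = ereal (curve_length M \<gamma> * (t - s))"
proof (rule antisym)
  have g: "geodesic M \<gamma>" and e: "\<gamma> 0 = p" "\<gamma> 1 = q" using m by (auto simp: minimal_geodesic_def geodesic_between_def)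
  let ?L = "curve_length M \<gamma>"
  show 1: "rdist M (\<gamma> s) (\<gamma> t) \<le> ereal (?L * (t - s))" by (rule geodesic_rdist[OF g st])
  then obtain r where r: "rdist M (\<gamma> s) (\<gamma> t) = ereal r" using rdist_nonneg[of "\<gamma> s" "\<gamma> t"]
    by (cases "rdist M (\<gamma> s) (\<gamma> t)") auto
  have "ereal ?L = rdist M (\<gamma> 0) (\<gamma> 1)" using minimal_finite[OF m] e by simp
  also have "\<dots> \<le> rdist M (\<gamma> 0) (\<gamma> s) + rdist M (\<gamma> s) (\<gamma> 1)" by (rule rdist_triangle)
  also have "\<dots> \<le> rdist M (\<gamma> 0) (\<gamma> s) + (rdist M (\<gamma> s) (\<gamma> t) + rdist M (\<gamma> t) (\<gamma> 1))" by (intro add_left_mono rdist_triangle)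
  also have "\<dots> \<le> ereal (?L * (s - 0)) + (ereal r + ereal (?L * (1 - t)))"
    unfolding r by (intro add_mono geodesic_rdist[OF g] order_refl) (use st in auto)
  finally have "?L \<le> ?L * s + (r + ?L * (1 - t))" by simp
  then show "ereal (?L * (t - s)) \<le> rdist M (\<gamma> s) (\<gamma> t)" unfolding r by (simp add: algebra_simps)
qed

end

section \<open>Locally Lipschitz maps and uniqueness for ordinary differential equations\<close>

definition llip :: "('b::real_normed_vector \<Rightarrow> 'c::real_normed_vector) \<Rightarrow> 'b \<Rightarrow> bool" where
  "llip f x \<longleftrightarrow> (\<exists>e>0. \<exists>B\<ge>0. \<forall>y\<in>ball x e. \<forall>z\<in>ball x e. norm (f y - f z) \<le> B * norm (y - z))"

lemma llipI: assumes "e > 0" "B \<ge> 0" "\<And>y z. y \<in> ball x e \<Longrightarrow> z \<in> ball x e \<Longrightarrow> norm (f y - f z) \<le> B * norm (y - z)"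
  shows "llip f x" using assms unfolding llip_def by blast

lemma llipE: assumes "llip f x"
  obtains e B where "e > 0" "B \<ge> 0" "\<And>y z. y \<in> ball x e \<Longrightarrow> z \<in> ball x e \<Longrightarrow> norm (f y - f z) \<le> B * norm (y - z)"
    "\<And>y. y \<in> ball x e \<Longrightarrow> norm (f y) \<le> norm (f x) + B"
proof -
  obtain e B where eB: "e > 0" "B \<ge> 0" "\<And>y z. y \<in> ball x e \<Longrightarrow> z \<in> ball x e \<Longrightarrow> norm (f y - f z) \<le> B * norm (y - z)"
    using assms unfolding llip_def by blast
  have "norm (f y) \<le> norm (f x) + B" if "y \<in> ball x (min e 1)" for y
  proof -
    have "norm (f y - f x) \<le> B * norm (y - x)" using eB that by auto
    also have "\<dots> \<le> B * 1" using eB that by (intro mult_left_mono) (auto simp: dist_norm norm_minus_commute)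
    finally show ?thesis using norm_triangle_sub[of "f y" "f x"] by simp
  qed
  then show ?thesis using eB that[of "min e 1" B] by auto
qed

lemma llip_const: "llip (\<lambda>y. a) x" by (rule llipI[of 1 0]) auto

lemma llip_linear: assumes "bounded_linear f" shows "llip f x"
proof -
  obtain B where "B \<ge> 0" "\<And>y. norm (f y) \<le> norm y * B" using bounded_linear.nonneg_bounded[OF assms] by blast
  then show ?thesis by (intro llipI[of 1 B]) (auto simp: mult.commute simp flip: linear_diff[OF bounded_linear.linear[OF assms]])
qed

lemma llip_add: assumes "llip f x" "llip g x" shows "llip (\<lambda>y. f y + g y) x"
proof -
  obtain e B where f: "e > 0" "B \<ge> 0" "\<And>y z. y \<in> ball x e \<Longrightarrow> z \<in> ball x e \<Longrightarrow> norm (f y - f z) \<le> B * norm (y - z)"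
    using llipE[OF assms(1)] by metis
  obtain d C where g: "d > 0" "C \<ge> 0" "\<And>y z. y \<in> ball x d \<Longrightarrow> z \<in> ball x d \<Longrightarrow> norm (g y - g z) \<le> C * norm (y - z)"
    using llipE[OF assms(2)] by metis
  show ?thesis
  proof (rule llipI[of "min e d" "B + C"])
    fix y z assume "y \<in> ball x (min e d)" "z \<in> ball x (min e d)"
    then have "norm (f y - f z) \<le> B * norm (y - z)" "norm (g y - g z) \<le> C * norm (y - z)" using f g by auto
    moreover have "norm (f y + g y - (f z + g z)) \<le> norm (f y - f z) + norm (g y - g z)"
      using norm_triangle_ineq[of "f y - f z" "g y - g z"] by (simp add: algebra_simps)
    ultimately show "norm (f y + g y - (f z + g z)) \<le> (B + C) * norm (y - z)" by (simp add: distrib_right)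
  qed (use f g in auto)
qed

lemma llip_mult: fixes f g :: "'b::real_normed_vector \<Rightarrow> real"
  assumes "llip f x" "llip g x" shows "llip (\<lambda>y. f y * g y) x"
proof -
  obtain e B where f: "e > 0" "B \<ge> 0" "\<And>y z. y \<in> ball x e \<Longrightarrow> z \<in> ball x e \<Longrightarrow> norm (f y - f z) \<le> B * norm (y - z)"
     "\<And>y. y \<in> ball x e \<Longrightarrow> norm (f y) \<le> norm (f x) + B"
    using llipE[OF assms(1)] by metis
  obtain d C where g: "d > 0" "C \<ge> 0" "\<And>y z. y \<in> ball x d \<Longrightarrow> z \<in> ball x d \<Longrightarrow> norm (g y - g z) \<le> C * norm (y - z)"
     "\<And>y. y \<in> ball x d \<Longrightarrow> norm (g y) \<le> norm (g x) + C"
    using llipE[OF assms(2)] by metis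
  define K where "K = (norm (f x) + B) * C + (norm (g x) + C) * B"
  show ?thesis
  proof (rule llipI[of "min e d" K])
    show "K \<ge> 0" unfolding K_def using f g by simp
    fix y z assume yz: "y \<in> ball x (min e d)" "z \<in> ball x (min e d)"
    have "norm (f y * g y - f z * g z) = norm (f y * (g y - g z) + g z * (f y - f z))" by (simp add: algebra_simps)
    also have "\<dots> \<le> norm (f y) * norm (g y - g z) + norm (g z) * norm (f y - f z)"
      by (rule norm_triangle_le) (simp add: abs_mult)
    also have "\<dots> \<le> (norm (f x) + B) * (C * norm (y - z)) + (norm (g x) + C) * (B * norm (y - z))"
      using yz f g by (intro add_mono mult_mono) auto
    finally show "norm (f y * g y - f z * g z) \<le> K * norm (y - z)" by (simp add: K_def algebra_simps)
  qed (use f g in auto)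
qed

lemma llip_inverse: fixes f :: "'b::real_normed_vector \<Rightarrow> real"
  assumes "llip f x" "f x \<noteq> 0" shows "llip (\<lambda>y. 1 / f y) x"
proof -
  obtain e B where f: "e > 0" "B \<ge> 0" "\<And>y z. y \<in> ball x e \<Longrightarrow> z \<in> ball x e \<Longrightarrow> norm (f y - f z) \<le> B * norm (y - z)"
    using llipE[OF assms(1)] by metis
  \<comment> \<open>On this ball \<open>f\<close> varies by at most half of its absolute value at
    \<open>x\<close>, hence stays away from zero. The summand one covers the case
    \<open>B = 0\<close>.\<close>
  define d where "d = min e (\<bar>f x\<bar> / 2 / (B + 1))"
  have d: "d > 0" "d \<le> e" "d \<le> \<bar>f x\<bar> / 2 / (B + 1)" using f assms by (auto simp: d_def)
  have lb: "\<bar>f y\<bar> \<ge> \<bar>f x\<bar> / 2" if "y \<in> ball x d" for y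
  proof -
    have "\<bar>f y - f x\<bar> \<le> B * norm (y - x)" using f(3)[of y x] that d by auto
    also have "\<dots> \<le> (B + 1) * d" using that f by (intro mult_mono) (auto simp: dist_norm norm_minus_commute)
    also have "\<dots> \<le> \<bar>f x\<bar> / 2" using d f by (simp add: field_simps)
    finally show ?thesis by linarith
  qed
  define m where "m = \<bar>f x\<bar> / 2"
  have m: "m > 0" using assms by (simp add: m_def)
  show ?thesis
  proof (rule llipI[of d "B / (m * m)"])
    fix y z assume yz: "y \<in> ball x d" "z \<in> ball x d"
    have l: "m \<le> \<bar>f y\<bar>" "m \<le> \<bar>f z\<bar>" using lb yz by (auto simp: m_def)
    then have nz: "f y \<noteq> 0" "f z \<noteq> 0" using m by auto
    have "norm (1 / f y - 1 / f z) = \<bar>f y - f z\<bar> / (\<bar>f y\<bar> * \<bar>f z\<bar>)"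
      using nz by (simp add: diff_frac_eq abs_mult abs_minus_commute)
    also have "\<dots> \<le> (B * norm (y - z)) / (m * m)"
      using f(3)[of y z] yz d l m f(2) by (intro frac_le mult_mono) auto
    finally show "norm (1 / f y - 1 / f z) \<le> B / (m * m) * norm (y - z)" by simp
  qed (use d f m in auto)
qed

lemma llip_fst: assumes "llip f x" shows "llip (\<lambda>p. f (fst p)) (x, v)"
proof -
  obtain e B where f: "e > 0" "B \<ge> 0" "\<And>y z. y \<in> ball x e \<Longrightarrow> z \<in> ball x e \<Longrightarrow> norm (f y - f z) \<le> B * norm (y - z)"
    using llipE[OF assms(1)] by metis
  show ?thesis
  proof (rule llipI[of e B])
    fix p q assume p: "p \<in> ball (x, v) e" "q \<in> ball (x, v) e"
    then have "fst p \<in> ball x e" "fst q \<in> ball x e"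
      using dist_fst_le[of "(x,v)" p] dist_fst_le[of "(x,v)" q] by simp_all
    then have "norm (f (fst p) - f (fst q)) \<le> B * norm (fst p - fst q)" by (rule f)
    also have "\<dots> \<le> B * norm (p - q)" using f dist_fst_le[of p q] unfolding dist_norm by (intro mult_left_mono) auto
    finally show "norm (f (fst p) - f (fst q)) \<le> B * norm (p - q)" .
  qed (use f in auto)
qed

lemma llip_cong: assumes "llip f x" "open S" "x \<in> S" "\<And>y. y \<in> S \<Longrightarrow> f y = g y" shows "llip g x"
proof -
  obtain e B where f: "e > 0" "B \<ge> 0" "\<And>y z. y \<in> ball x e \<Longrightarrow> z \<in> ball x e \<Longrightarrow> norm (f y - f z) \<le> B * norm (y - z)"
    using llipE[OF assms(1)] by metis
  obtain d where d: "d > 0" "ball x d \<subseteq> S" using assms(2,3) open_contains_ball by blast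
  show ?thesis
  proof (rule llipI[of "min e d" B])
    fix y z assume "y \<in> ball x (min e d)" "z \<in> ball x (min e d)"
    then have "y \<in> S" "z \<in> S" "y \<in> ball x e" "z \<in> ball x e" using d by auto
    then show "norm (g y - g z) \<le> B * norm (y - z)" using f(3)[of y z] assms(4)[of y] assms(4)[of z] by simp
  qed (use f d in auto)
qed

lemma Ck_cong: "open S \<Longrightarrow> (\<And>x. x \<in> S \<Longrightarrow> f x = g x) \<Longrightarrow> Ck_on k S f \<Longrightarrow> Ck_on k S g"
proof (induction k arbitrary: f g)
  case 0 then show ?case by (metis Ck_on.simps(1) continuous_on_eq)
next
  case (Suc k)
  have d: "(f has_derivative D) (at x) \<longleftrightarrow> (g has_derivative D) (at x)" if "x \<in> S" for x D
    by (intro iffI; erule has_derivative_transform_within_open[OF _ Suc.prems(1) that]) (simp_all add: Suc.prems(2))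
  have fd: "frechet_derivative f (at x) = frechet_derivative g (at x)" if "x \<in> S" for x
    by (simp only: frechet_derivative_def d[OF that])
  have "Ck_on k S (\<lambda>x. frechet_derivative g (at x) v)" for v
  proof (rule Suc.IH[OF Suc.prems(1)])
    show "Ck_on k S (\<lambda>x. frechet_derivative f (at x) v)" using Suc.prems(3) by simp
  qed (simp add: fd)
  moreover have "\<forall>x\<in>S. g differentiable (at x)" using Suc.prems(3) d by (auto simp: differentiable_def)
  ultimately show ?case by simp
qed

lemma Ck_bl: assumes h: "bounded_linear h" and S: "open S"
  shows "Ck_on k S f \<Longrightarrow> Ck_on k S (\<lambda>x. h (f x))"
proof (induction k arbitrary: f)
  case 0 then show ?case using bounded_linear.continuous_on[OF h] by auto
next
  case (Suc k)
  have d: "((\<lambda>x. h (f x)) has_derivative (\<lambda>v. h (frechet_derivative f (at x) v))) (at x)" if "x \<in> S" for x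
    using Suc.prems that frechet_derivative_works by (auto intro!: bounded_linear.has_derivative[OF h])
  then have e: "frechet_derivative (\<lambda>x. h (f x)) (at x) = (\<lambda>v. h (frechet_derivative f (at x) v))" if "x \<in> S" for x
    using frechet_derivative_at that by metis
  have "Ck_on k S (\<lambda>x. frechet_derivative (\<lambda>x. h (f x)) (at x) v)" for v
    by (rule Ck_cong[OF S _ Suc.IH[of "\<lambda>x. frechet_derivative f (at x) v"]]) (use Suc.prems e in auto)
  moreover have "(\<lambda>x. h (f x)) differentiable (at x)" if "x \<in> S" for x using d[OF that] differentiableI by blast
  ultimately show ?case by simp
qed

lemma smooth_nth: "open S \<Longrightarrow> smooth_on S f \<Longrightarrow> smooth_on S (\<lambda>x. f x $ i)"
  unfolding smooth_on_def using Ck_bl[OF bounded_linear_vec_nth] by blast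

text \<open>The partial derivatives are bounded on a compact ball, and the mean value inequality
  holds on it because balls are convex.\<close>

lemma smooth_llip: fixes f :: "real^2 \<Rightarrow> real"
  assumes S: "open S" "x \<in> S" and f: "\<And>y. y \<in> S \<Longrightarrow> f differentiable (at y)"
    and fc: "\<And>v. continuous_on S (\<lambda>y. frechet_derivative f (at y) v)"
  shows "llip f x"
proof -
  obtain e where e: "e > 0" "cball x e \<subseteq> S" using S open_contains_cball by blast
  have D: "(f has_derivative frechet_derivative f (at y)) (at y)" if "y \<in> S" for y
    using f[OF that] frechet_derivative_works by blast
  have "\<exists>B. \<forall>y\<in>cball x e. norm (frechet_derivative f (at y) (axis k 1)) \<le> B" for k
    using compact_continuous_image[OF continuous_on_subset[OF fc e(2)] compact_cball, THEN compact_imp_bounded]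
    unfolding bounded_iff by (metis (no_types, lifting) imageI)
  then obtain B where B: "\<And>k y. y \<in> cball x e \<Longrightarrow> norm (frechet_derivative f (at y) (axis k 1)) \<le> B k" by metis
  have B0: "0 \<le> B k" for k using B[of x k] e by (metis centre_in_cball less_imp_le norm_ge_zero order_trans)
  have on: "norm (frechet_derivative f (at y) v) \<le> (B 1 + B 2) * norm v" if y: "y \<in> cball x e" for y v
  proof -
    have lin: "linear (frechet_derivative f (at y))" using D[of y] y e has_derivative_linear by blast
    have "v = (v $ 1) *\<^sub>R axis 1 1 + (v $ 2) *\<^sub>R axis 2 1" by (simp add: vec_eq_iff axis_def forall_2)
    then have "frechet_derivative f (at y) v = frechet_derivative f (at y) ((v $ 1) *\<^sub>R axis 1 1 + (v $ 2) *\<^sub>R axis 2 1)" by simp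
    also have "\<dots> = v $ 1 * frechet_derivative f (at y) (axis 1 1) + v $ 2 * frechet_derivative f (at y) (axis 2 1)"
      by (simp add: linear_add[OF lin] linear_cmul[OF lin])
    also have "norm \<dots> \<le> \<bar>v $ 1\<bar> * norm (frechet_derivative f (at y) (axis 1 1)) + \<bar>v $ 2\<bar> * norm (frechet_derivative f (at y) (axis 2 1))"
      by (rule norm_triangle_le) (simp add: abs_mult)
    also have "\<dots> \<le> norm v * B 1 + norm v * B 2"
      by (intro add_mono mult_mono component_le_norm_cart B y) auto
    finally show ?thesis by (simp add: algebra_simps)
  qed
  show ?thesis
  proof (rule llipI[OF e(1), of "B 1 + B 2"])
    fix y z assume "y \<in> ball x e" "z \<in> ball x e"
    then show "norm (f y - f z) \<le> (B 1 + B 2) * norm (y - z)"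
    proof (intro differentiable_bound[OF convex_ball, of x e f "\<lambda>y. frechet_derivative f (at y)"])
      fix y assume y: "y \<in> ball x e"
      then have "y \<in> S" "y \<in> cball x e" using e by auto
      then show "(f has_derivative frechet_derivative f (at y)) (at y within ball x e)"
        using D has_derivative_at_withinI by blast
      show "onorm (frechet_derivative f (at y)) \<le> B 1 + B 2"
        by (rule onorm_bound[OF _ on]) (use B0 \<open>y \<in> cball x e\<close> in auto)
    qed
  qed (use B0 in auto)
qed

lemma llip_vec: fixes f :: "'b::real_normed_vector \<Rightarrow> real^2"
  assumes "\<And>i. llip (\<lambda>y. f y $ i) x" shows "llip f x"
proof -
  obtain e B where f: "e > 0" "B \<ge> 0" "\<And>y z. y \<in> ball x e \<Longrightarrow> z \<in> ball x e \<Longrightarrow> norm (f y $ 1 - f z $ 1) \<le> B * norm (y - z)"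
    using llipE[OF assms(1)[of 1]] by metis
  obtain d C where g: "d > 0" "C \<ge> 0" "\<And>y z. y \<in> ball x d \<Longrightarrow> z \<in> ball x d \<Longrightarrow> norm (f y $ 2 - f z $ 2) \<le> C * norm (y - z)"
    using llipE[OF assms(1)[of 2]] by metis
  show ?thesis
  proof (rule llipI[of "min e d" "B + C"])
    fix y z assume "y \<in> ball x (min e d)" "z \<in> ball x (min e d)"
    then have "norm (f y $ 1 - f z $ 1) \<le> B * norm (y - z)" "norm (f y $ 2 - f z $ 2) \<le> C * norm (y - z)" using f g by auto
    moreover have "norm (f y - f z) \<le> norm (f y $ 1 - f z $ 1) + norm (f y $ 2 - f z $ 2)"
      using norm_le_l1_cart[of "f y - f z"] by (simp add: sum_2)
    ultimately show "norm (f y - f z) \<le> (B + C) * norm (y - z)" by (simp add: distrib_right)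
  qed (use f g in auto)
qed

lemma llip_pair: assumes "llip f x" "llip g x" shows "llip (\<lambda>y. (f y, g y)) x"
proof -
  obtain e B where f: "e > 0" "B \<ge> 0" "\<And>y z. y \<in> ball x e \<Longrightarrow> z \<in> ball x e \<Longrightarrow> norm (f y - f z) \<le> B * norm (y - z)"
    using llipE[OF assms(1)] by metis
  obtain d C where g: "d > 0" "C \<ge> 0" "\<And>y z. y \<in> ball x d \<Longrightarrow> z \<in> ball x d \<Longrightarrow> norm (g y - g z) \<le> C * norm (y - z)"
    using llipE[OF assms(2)] by metis
  show ?thesis
  proof (rule llipI[of "min e d" "B + C"])
    fix y z assume "y \<in> ball x (min e d)" "z \<in> ball x (min e d)"
    then have "norm (f y - f z) \<le> B * norm (y - z)" "norm (g y - g z) \<le> C * norm (y - z)" using f g by auto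
    moreover have "norm ((f y, g y) - (f z, g z)) \<le> norm (f y - f z) + norm (g y - g z)"
      using norm_Pair_le[of "f y - f z" "g y - g z"] by simp
    ultimately show "norm ((f y, g y) - (f z, g z)) \<le> (B + C) * norm (y - z)" by (simp add: distrib_right)
  qed (use f g in auto)
qed

text \<open>The derivative of \<open>z - w\<close> is at most \<open>B m\<close>, \<open>m\<close> being the maximum of \<open>z - w\<close> on an interval of
  length less than \<open>1/B\<close>; so \<open>m = 0\<close>.\<close>

lemma ode_local_unique:
  fixes z w :: "real \<Rightarrow> 'b::real_normed_vector"
  assumes t0: "t0 \<in> {0..1}" and L: "llip G (z t0)" and eq: "z t0 = w t0" and d: "d > 0"
    and z: "\<And>t. t \<in> {0..1} \<Longrightarrow> \<bar>t - t0\<bar> < d \<Longrightarrow> (z has_vector_derivative G (z t)) (at t within {0..1})"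
    and w: "\<And>t. t \<in> {0..1} \<Longrightarrow> \<bar>t - t0\<bar> < d \<Longrightarrow> (w has_vector_derivative G (w t)) (at t within {0..1})"
  obtains h where "h > 0" "\<And>t. t \<in> {0..1} \<Longrightarrow> \<bar>t - t0\<bar> < h \<Longrightarrow> z t = w t"
proof -
  obtain e B where e: "e > 0" "B \<ge> 0" "\<And>y y'. y \<in> ball (z t0) e \<Longrightarrow> y' \<in> ball (z t0) e \<Longrightarrow> norm (G y - G y') \<le> B * norm (y - y')"
    using llipE[OF L] by metis
  have "continuous (at t0 within {0..1}) z" "continuous (at t0 within {0..1}) w"
    using z[OF t0] w[OF t0] d has_vector_derivative_continuous by auto
  then obtain h1 h2 where h: "h1 > 0" "\<And>t. t \<in> {0..1} \<Longrightarrow> dist t t0 < h1 \<Longrightarrow> dist (z t) (z t0) < e"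
     "h2 > 0" "\<And>t. t \<in> {0..1} \<Longrightarrow> dist t t0 < h2 \<Longrightarrow> dist (w t) (w t0) < e"
    using e(1) unfolding continuous_within_eps_delta by metis
  have "0 < min (min h1 h2) (min d (1 / (2 * (B + 1))))" using h(1,3) d e(2) by simp
  then obtain h where h': "h > 0" "h < h1" "h < h2" "h < d" "h < 1 / (2 * (B + 1))"
    using dense by (metis min_less_iff_conj)
  define J where "J = {0..1} \<inter> cball t0 h"
  have J: "compact J" "convex J" "t0 \<in> J" "J \<subseteq> {0..1}"
    using t0 h' by (auto simp: J_def intro!: convex_Int compact_Int)
  define u where "u t = z t - w t" for t
  have zd: "(z has_vector_derivative G (z t)) (at t within J)" "(w has_vector_derivative G (w t)) (at t within J)"
     "z t \<in> ball (z t0) e" "w t \<in> ball (z t0) e" if "t \<in> J" for t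
  proof -
    have t: "t \<in> {0..1}" "\<bar>t - t0\<bar> \<le> h" using that by (auto simp: J_def dist_real_def)
    have "\<bar>t - t0\<bar> < d" using t(2) h'(4) by simp
    then show "(z has_vector_derivative G (z t)) (at t within J)" "(w has_vector_derivative G (w t)) (at t within J)"
      using has_vector_derivative_within_subset[OF z[OF t(1)] J(4)] has_vector_derivative_within_subset[OF w[OF t(1)] J(4)] by blast+
    show "z t \<in> ball (z t0) e" "w t \<in> ball (z t0) e"
      using h(2)[OF t(1)] h(4)[OF t(1)] t(2) h' eq by (auto simp: dist_commute dist_real_def)
  qed
  have ud: "(u has_vector_derivative G (z t) - G (w t)) (at t within J)" if "t \<in> J" for t
    unfolding u_def using zd(1,2)[OF that] by (rule has_vector_derivative_diff)
  then have "continuous_on J u"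
    using has_vector_derivative_continuous continuous_on_eq_continuous_within by blast
  then have "continuous_on J (\<lambda>t. norm (u t))" by (rule continuous_on_norm)
  moreover have "J \<noteq> {}" using J by auto
  ultimately obtain s where s: "s \<in> J" "\<And>t. t \<in> J \<Longrightarrow> norm (u t) \<le> norm (u s)"
    using continuous_attains_sup[OF J(1)] by metis
  have "norm (u s - u t0) \<le> B * norm (u s) * norm (s - t0)"
  proof (rule differentiable_bound[OF J(2), of u "\<lambda>t h. h *\<^sub>R (G (z t) - G (w t))"])
    fix t assume t: "t \<in> J"
    show "(u has_derivative (\<lambda>h. h *\<^sub>R (G (z t) - G (w t)))) (at t within J)"
      using ud[OF t] by (simp add: has_vector_derivative_def)
    have "norm (G (z t) - G (w t)) \<le> B * norm (u t)" using e(3) zd[OF t] by (simp add: u_def)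
    also have "\<dots> \<le> B * norm (u s)" using s(2)[OF t] e by (intro mult_left_mono) auto
    finally have "norm (G (z t) - G (w t)) \<le> B * norm (u s)" .
    then show "onorm (\<lambda>h. h *\<^sub>R (G (z t) - G (w t))) \<le> B * norm (u s)"
      by (intro onorm_bound) (use e in \<open>auto simp: mult.commute[of _ "\<bar>_\<bar>"] intro!: mult_left_mono\<close>)
  qed (use s J in auto)
  also have "\<dots> \<le> B * norm (u s) * h"
    using s(1) e by (intro mult_left_mono) (auto simp: J_def dist_norm norm_minus_commute abs_minus_commute)
  also have "\<dots> \<le> norm (u s) / 2"
  proof -
    have "(B + 1) * h < 1 / 2" using h'(5) e by (simp add: field_simps)
    then have "B * h \<le> 1 / 2" using h' by (simp add: algebra_simps)
    then have "B * h * norm (u s) \<le> 1 / 2 * norm (u s)" by (intro mult_right_mono) auto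
    then show ?thesis by (simp add: algebra_simps)
  qed
  finally have "norm (u s) \<le> norm (u s) / 2" using eq by (simp add: u_def)
  then have "norm (u s) \<le> 0" by simp
  then have "z t = w t" if "t \<in> J" for t using s(2)[OF that] by (simp add: u_def)
  then show ?thesis using that[of h] h' by (auto simp: J_def dist_real_def abs_minus_commute)
qed

section \<open>Uniqueness and Taylor estimate for geodesics\<close>

context rsurf begin

text \<open>Cramer's rule. The quotient as a separate factor and the product with \<open>-1\<close>
  have the shape that \<open>llip_inverse\<close>, \<open>llip_mult\<close> and
  \<open>llip_const\<close> produce.\<close>

lemma gram_inv_formula: assumes c: "c \<in> atlas M" "y \<in> chart_image c"
  defines "g \<equiv> gram M c y" and "h \<equiv> matrix_inv (gram M c y)"
  shows "g $ 1 $ 1 * g $ 2 $ 2 - g $ 1 $ 2 * g $ 2 $ 1 \<noteq> 0"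
    "h $ 1 $ 1 = 1 / (g $ 1 $ 1 * g $ 2 $ 2 - g $ 1 $ 2 * g $ 2 $ 1) * g $ 2 $ 2"
    "h $ 2 $ 1 = 1 / (g $ 1 $ 1 * g $ 2 $ 2 - g $ 1 $ 2 * g $ 2 $ 1) * (-1 * g $ 2 $ 1)"
    "h $ 1 $ 2 = 1 / (g $ 1 $ 1 * g $ 2 $ 2 - g $ 1 $ 2 * g $ 2 $ 1) * (-1 * g $ 1 $ 2)"
    "h $ 2 $ 2 = 1 / (g $ 1 $ 1 * g $ 2 $ 2 - g $ 1 $ 2 * g $ 2 $ 1) * g $ 1 $ 1"
proof -
  define D where "D = g $ 1 $ 1 * g $ 2 $ 2 - g $ 1 $ 2 * g $ 2 $ 1"
  have gh: "g ** h = mat 1" unfolding g_def h_def by (rule gram_inv[OF c])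
  then have e: "g $ 1 $ 1 * h $ 1 $ 1 + g $ 1 $ 2 * h $ 2 $ 1 = 1" "g $ 1 $ 1 * h $ 1 $ 2 + g $ 1 $ 2 * h $ 2 $ 2 = 0"
    "g $ 2 $ 1 * h $ 1 $ 1 + g $ 2 $ 2 * h $ 2 $ 1 = 0" "g $ 2 $ 1 * h $ 1 $ 2 + g $ 2 $ 2 * h $ 2 $ 2 = 1"
    by (auto simp: matrix_matrix_mult_def mat_def vec_eq_iff sum_2 forall_2)
  have "det g * det h = 1" using gh det_mul[of g h] by simp
  then have "D * det h = 1" by (simp add: det_2 D_def)
  then have D: "D \<noteq> 0" by auto
  have "D * h $ 1 $ 1 = g $ 2 $ 2 * (g $ 1 $ 1 * h $ 1 $ 1 + g $ 1 $ 2 * h $ 2 $ 1) - g $ 1 $ 2 * (g $ 2 $ 1 * h $ 1 $ 1 + g $ 2 $ 2 * h $ 2 $ 1)"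
    by (simp add: D_def algebra_simps)
  then have 1: "D * h $ 1 $ 1 = g $ 2 $ 2" by (simp add: e)
  have "D * h $ 2 $ 1 = - g $ 2 $ 1 * (g $ 1 $ 1 * h $ 1 $ 1 + g $ 1 $ 2 * h $ 2 $ 1) + g $ 1 $ 1 * (g $ 2 $ 1 * h $ 1 $ 1 + g $ 2 $ 2 * h $ 2 $ 1)"
    by (simp add: D_def algebra_simps)
  then have 2: "D * h $ 2 $ 1 = - g $ 2 $ 1" by (simp add: e)
  have "D * h $ 1 $ 2 = g $ 2 $ 2 * (g $ 1 $ 1 * h $ 1 $ 2 + g $ 1 $ 2 * h $ 2 $ 2) - g $ 1 $ 2 * (g $ 2 $ 1 * h $ 1 $ 2 + g $ 2 $ 2 * h $ 2 $ 2)"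
    by (simp add: D_def algebra_simps)
  then have 3: "D * h $ 1 $ 2 = - g $ 1 $ 2" by (simp add: e)
  have "D * h $ 2 $ 2 = - g $ 2 $ 1 * (g $ 1 $ 1 * h $ 1 $ 2 + g $ 1 $ 2 * h $ 2 $ 2) + g $ 1 $ 1 * (g $ 2 $ 1 * h $ 1 $ 2 + g $ 2 $ 2 * h $ 2 $ 2)"
    by (simp add: D_def algebra_simps)
  then have 4: "D * h $ 2 $ 2 = g $ 1 $ 1" by (simp add: e)
  show "g $ 1 $ 1 * g $ 2 $ 2 - g $ 1 $ 2 * g $ 2 $ 1 \<noteq> 0" using D by (simp add: D_def)
  show "h $ 1 $ 1 = 1 / (g $ 1 $ 1 * g $ 2 $ 2 - g $ 1 $ 2 * g $ 2 $ 1) * g $ 2 $ 2"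
    "h $ 2 $ 1 = 1 / (g $ 1 $ 1 * g $ 2 $ 2 - g $ 1 $ 2 * g $ 2 $ 1) * (-1 * g $ 2 $ 1)"
    "h $ 1 $ 2 = 1 / (g $ 1 $ 1 * g $ 2 $ 2 - g $ 1 $ 2 * g $ 2 $ 1) * (-1 * g $ 1 $ 2)"
    "h $ 2 $ 2 = 1 / (g $ 1 $ 1 * g $ 2 $ 2 - g $ 1 $ 2 * g $ 2 $ 1) * g $ 1 $ 1"
    unfolding D_def[symmetric] using 1 2 3 4 D by (auto simp: field_simps)
qed

lemma smooth_llip': fixes f :: "real^2 \<Rightarrow> real"
  assumes "open S" "x \<in> S" "smooth_on S f" shows "llip f x"
  using smooth_llip[OF assms(1,2) smooth_diff[OF assms(3)] smooth_dir_cont[OF assms(3)]] .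

lemma gram_comp_smooth: "c \<in> atlas M \<Longrightarrow> smooth_on (chart_image c) (\<lambda>z. gram M c z $ i $ j)"
  using smooth_nth[OF image_open smooth_nth[OF image_open gram_smooth]] by blast

lemma llip_gram: assumes "c \<in> atlas M" "y \<in> chart_image c"
  shows "llip (\<lambda>z. gram M c z $ i $ j) y" "llip (\<lambda>z. partial_deriv k (\<lambda>z. gram M c z $ i $ j) z) y"
  unfolding partial_deriv_def
  using smooth_llip'[OF image_open assms(2)] gram_comp_smooth[OF assms(1)] smooth_dir assms(1) by blast+

lemma llip_minus: fixes f g :: "'b::real_normed_vector \<Rightarrow> real"
  assumes "llip f x" "llip g x" shows "llip (\<lambda>y. f y - g y) x"
  using llip_add[OF assms(1) llip_mult[OF llip_const assms(2)], of "-1"] by simp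

lemma llip_inv: assumes c: "c \<in> atlas M" "y \<in> chart_image c"
  shows "llip (\<lambda>z. matrix_inv (gram M c z) $ k $ l) y"
proof -
  note F = gram_inv_formula[OF c(1)]
  note L = llip_mult[OF llip_inverse[OF llip_minus[OF llip_mult[OF llip_gram(1)[OF c, of 1 1] llip_gram(1)[OF c, of 2 2]]
      llip_mult[OF llip_gram(1)[OF c, of 1 2] llip_gram(1)[OF c, of 2 1]]] F(1)[OF c(2)]]]
  note M = L[OF llip_gram(1)[OF c]] L[OF llip_mult[OF llip_const llip_gram(1)[OF c]]]
  have "llip (\<lambda>z. matrix_inv (gram M c z) $ 1 $ 1) y"
    by (rule llip_cong[OF M(1)[of 2 2] image_open[OF c(1)] c(2)]) (rule F(2)[symmetric])
  moreover have "llip (\<lambda>z. matrix_inv (gram M c z) $ 2 $ 1) y"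
    by (rule llip_cong[OF M(2)[of "-1" 2 1] image_open[OF c(1)] c(2)]) (rule F(3)[symmetric])
  moreover have "llip (\<lambda>z. matrix_inv (gram M c z) $ 1 $ 2) y"
    by (rule llip_cong[OF M(2)[of "-1" 1 2] image_open[OF c(1)] c(2)]) (rule F(4)[symmetric])
  moreover have "llip (\<lambda>z. matrix_inv (gram M c z) $ 2 $ 2) y"
    by (rule llip_cong[OF M(1)[of 1 1] image_open[OF c(1)] c(2)]) (rule F(5)[symmetric])
  ultimately show ?thesis using exhaust_2[of k] exhaust_2[of l] by auto
qed

lemma llip_christoffel: assumes c: "c \<in> atlas M" "y \<in> chart_image c"
  shows "llip (\<lambda>z. christoffel M c z k i j) y"
  unfolding christoffel_def sum_2 divide_inverse
  by (intro llip_mult llip_add llip_minus llip_inv llip_gram llip_const c)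

lemma llip_geoF: assumes c: "c \<in> atlas M" "y \<in> chart_image c"
  shows "llip (\<lambda>p. geoF c (fst p) (snd p)) (y, v)"
proof (rule llip_vec)
  fix k
  have s: "llip (\<lambda>p::(real^2)\<times>(real^2). snd p $ i) (y, v)" for i
    by (rule llip_linear) (intro bounded_linear_compose[OF bounded_linear_vec_nth bounded_linear_snd])
  have "llip (\<lambda>p. 0 - (\<Sum>i\<in>UNIV. \<Sum>j\<in>UNIV. christoffel M c (fst p) k i j * snd p $ i * snd p $ j)) (y, v)"
    unfolding sum_2
    by (intro llip_minus llip_add llip_mult llip_const s llip_fst[OF llip_christoffel[OF c]])
  then show "llip (\<lambda>p. geoF c (fst p) (snd p) $ k) (y, v)" by (simp add: geoF_def)
qed

text \<open>This is \<open>ode_local_unique\<close> for the first-order system formed by position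
  and velocity in one chart.\<close>

lemma geodesic_local_unique:
  assumes g: "geodesic M \<gamma>" "geodesic M \<sigma>" and t: "t \<in> {0..1}" and eq: "\<gamma> t = \<sigma> t"
    and c: "c \<in> atlas M" "\<gamma> t \<in> chart_dom c" and v: "vel c \<gamma> t = vel c \<sigma> t"
  obtains h where "h > 0" "\<And>s. s \<in> {0..1} \<Longrightarrow> \<bar>s - t\<bar> < h \<Longrightarrow>
      \<gamma> s = \<sigma> s \<and> \<gamma> s \<in> chart_dom c \<and> vel c \<gamma> s = vel c \<sigma> s"
proof -
  note D = geodesicD[OF g(1)] and E = geodesicD[OF g(2)]
  obtain e where e: "e > 0" "\<And>s. s \<in> {0..1} \<Longrightarrow> dist s t < e \<Longrightarrow> \<gamma> s \<in> chart_dom c"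
    using curve_near[OF D(1) dom_open[OF c(1)] t c(2)] by metis
  obtain e' where e': "e' > 0" "\<And>s. s \<in> {0..1} \<Longrightarrow> dist s t < e' \<Longrightarrow> \<sigma> s \<in> chart_dom c"
    using curve_near[OF E(1) dom_open[OF c(1)] t c(2)[unfolded eq]] by metis
  let ?z = "\<lambda>s. (coords c (\<gamma> s), vel c \<gamma> s)" let ?w = "\<lambda>s. (coords c (\<sigma> s), vel c \<sigma> s)"
  let ?G = "\<lambda>p. (snd p, geoF c (fst p) (snd p))"
  have L: "llip ?G (?z t)"
    by (rule llip_pair[OF llip_linear[OF bounded_linear_snd] llip_geoF[OF c(1)]]) (use c in auto)
  have dz: "(?z has_vector_derivative ?G (?z s)) (at s within {0..1})" if "s \<in> {0..1}" "\<bar>s - t\<bar> < min e e'" for s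
    using D(2,3)[OF c(1) that(1)] e(2)[OF that(1)] that(2)
    by (auto simp: dist_real_def o_def intro!: has_vector_derivative_Pair)
  have dw: "(?w has_vector_derivative ?G (?w s)) (at s within {0..1})" if "s \<in> {0..1}" "\<bar>s - t\<bar> < min e e'" for s
    using E(2,3)[OF c(1) that(1)] e'(2)[OF that(1)] that(2)
    by (auto simp: dist_real_def o_def intro!: has_vector_derivative_Pair)
  have zw: "?z t = ?w t" using eq v by simp
  have ee: "min e e' > 0" using e e' by simp
  obtain h where h: "h > 0" "\<And>s. s \<in> {0..1} \<Longrightarrow> \<bar>s - t\<bar> < h \<Longrightarrow> ?z s = ?w s"
    using ode_local_unique[OF t L zw ee dz dw] by metis
  show ?thesis
  proof (rule that[of "min h (min e e')"])
    fix s assume s: "s \<in> {0..1}" "\<bar>s - t\<bar> < min h (min e e')"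
    then have "\<gamma> s \<in> chart_dom c" "\<sigma> s \<in> chart_dom c" using e(2) e'(2) by (auto simp: dist_real_def)
    moreover have "coords c (\<gamma> s) = coords c (\<sigma> s)" "vel c \<gamma> s = vel c \<sigma> s" using h(2)[OF s(1)] s(2) by auto
    ultimately show "\<gamma> s = \<sigma> s \<and> \<gamma> s \<in> chart_dom c \<and> vel c \<gamma> s = vel c \<sigma> s"
      using coords_inj[OF c(1)] by (auto dest: inj_onD)
  qed (use h ee in auto)
qed

lemma vel_trans_eq:
  assumes g: "geodesic M \<gamma>" "geodesic M \<sigma>" and t: "t \<in> {0..1}" and eq: "\<gamma> t = \<sigma> t"
    and c: "c \<in> atlas M" "\<gamma> t \<in> chart_dom c" and v: "vel c \<gamma> t = vel c \<sigma> t" and c': "c' \<in> atlas M" "\<gamma> t \<in> chart_dom c'"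
  shows "vel c' \<gamma> t = vel c' \<sigma> t"
proof -
  note D = geodesicD[OF g(1)] and E = geodesicD[OF g(2)]
  have nb: "at t within {0..1} \<noteq> bot" using ivl_nbot t by simp
  have "vel c' \<gamma> t = frechet_derivative (transition c c') (at (coords c (\<gamma> t))) (vel c \<gamma> t)"
    by (rule velocityI[OF nb velocity_trans[OF D(1) t c(1) c'(1) c(2) c'(2) D(2)[OF c(1) t c(2)]]])
  moreover have "vel c' \<sigma> t = frechet_derivative (transition c c') (at (coords c (\<sigma> t))) (vel c \<sigma> t)"
    using c c' eq by (intro velocityI[OF nb velocity_trans[OF E(1) t c(1) c'(1) _ _ E(2)[OF c(1) t]]]) auto
  ultimately show ?thesis using eq v by simp
qed

text \<open>The parameters at which positions and velocities agree form an open set by local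
  uniqueness and a closed one by continuity and the Hausdorff property; \<open>{0..1}\<close> is
  connected.\<close>

lemma geodesic_unique:
  assumes g: "geodesic M \<gamma>" "geodesic M \<sigma>" and eq: "\<gamma> 0 = \<sigma> 0"
    and c: "c \<in> atlas M" "\<gamma> 0 \<in> chart_dom c" and v: "vel c \<gamma> 0 = vel c \<sigma> 0" and t: "t \<in> {0..1}"
  shows "\<gamma> t = \<sigma> t"
proof -
  note D = geodesicD[OF g(1)] and E = geodesicD[OF g(2)]
  \<comment> \<open>Velocities are compared in all charts at once, so that the set involves no
    choice of charts along the curve.\<close>
  define S where "S = {t\<in>{0..1::real}. \<gamma> t = \<sigma> t \<and> (\<forall>c\<in>atlas M. \<gamma> t \<in> chart_dom c \<longrightarrow> vel c \<gamma> t = vel c \<sigma> t)}"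
  have "0 \<in> S" unfolding S_def using eq vel_trans_eq[OF g _ eq c v] by auto
  have op: "openin (top_of_set {0..1}) S"
    unfolding openin_euclidean_subtopology_iff
  proof (intro conjI ballI)
    fix t assume t: "t \<in> S"
    then have t1: "t \<in> {0..1}" "\<gamma> t = \<sigma> t" by (auto simp: S_def)
    obtain c where c: "c \<in> atlas M" "\<gamma> t \<in> chart_dom c" using in_chart curve_points[OF D(1) t1(1)] by metis
    have v: "vel c \<gamma> t = vel c \<sigma> t" using t c by (auto simp: S_def)
    obtain h where h: "h > 0" "\<And>s. s \<in> {0..1} \<Longrightarrow> \<bar>s - t\<bar> < h \<Longrightarrow> \<gamma> s = \<sigma> s \<and> \<gamma> s \<in> chart_dom c \<and> vel c \<gamma> s = vel c \<sigma> s"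
      using geodesic_local_unique[OF g t1 c v] by metis
    have "s \<in> S" if "s \<in> {0..1}" "dist s t < h" for s
      using h(2)[of s] that vel_trans_eq[OF g that(1) _ c(1)] unfolding S_def by (auto simp: dist_real_def)
    then show "\<exists>e>0. \<forall>x'\<in>{0..1}. dist x' t < e \<longrightarrow> x' \<in> S" using h(1) by blast
  qed (auto simp: S_def)
  have "openin (top_of_set {0..1}) ({0..1} - S)"
    unfolding openin_euclidean_subtopology_iff
  proof (intro conjI ballI)
    fix t assume t: "t \<in> {0..1} - S"
    then have t1: "t \<in> {0..1}" by auto
    show "\<exists>e>0. \<forall>x'\<in>{0..1}. dist x' t < e \<longrightarrow> x' \<in> {0..1} - S"
    proof (cases "\<gamma> t = \<sigma> t")
      case False
      obtain U V where U: "openin (surf M) U" "openin (surf M) V" "\<gamma> t \<in> U" "\<sigma> t \<in> V" "U \<inter> V = {}"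
        using Hausdorff False curve_points[OF D(1) t1] curve_points[OF E(1) t1] unfolding Hausdorff_space_def disjnt_def by metis
      obtain e where e: "e > 0" "\<And>s. s \<in> {0..1} \<Longrightarrow> dist s t < e \<Longrightarrow> \<gamma> s \<in> U"
        using curve_near[OF D(1) U(1) t1 U(3)] by metis
      obtain d where d: "d > 0" "\<And>s. s \<in> {0..1} \<Longrightarrow> dist s t < d \<Longrightarrow> \<sigma> s \<in> V"
        using curve_near[OF E(1) U(2) t1 U(4)] by metis
      show ?thesis
      proof (intro exI[of _ "min e d"] conjI ballI impI)
        fix s assume s: "s \<in> {0..1}" "dist s t < min e d"
        then have "\<gamma> s \<in> U" "\<sigma> s \<in> V" using e d by auto
        then have "\<gamma> s \<noteq> \<sigma> s" using U(5) by auto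
        then show "s \<in> {0..1} - S" using s by (auto simp: S_def)
      qed (use e d in auto)
    next
      case True
      then obtain c where c: "c \<in> atlas M" "\<gamma> t \<in> chart_dom c" "vel c \<gamma> t \<noteq> vel c \<sigma> t"
        using t by (auto simp: S_def)
      obtain e where e: "e > 0" "\<And>s. s \<in> {0..1} \<Longrightarrow> dist s t < e \<Longrightarrow> \<gamma> s \<in> chart_dom c"
        using curve_near[OF D(1) dom_open[OF c(1)] t1 c(2)] by metis
      have "\<sigma> t \<in> chart_dom c" using c True by simp
      then have "continuous (at t within {0..1}) (\<lambda>s. vel c \<gamma> s - vel c \<sigma> s)"
        using has_vector_derivative_continuous[OF D(3)[OF c(1) t1 c(2)]] has_vector_derivative_continuous[OF E(3)[OF c(1) t1]]
        by (intro continuous_diff) auto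
      moreover have "norm (vel c \<gamma> t - vel c \<sigma> t) > 0" using c by simp
      ultimately obtain d where d: "d > 0" "\<And>s. s \<in> {0..1} \<Longrightarrow> dist s t < d \<Longrightarrow>
          dist (vel c \<gamma> s - vel c \<sigma> s) (vel c \<gamma> t - vel c \<sigma> t) < norm (vel c \<gamma> t - vel c \<sigma> t)"
        unfolding continuous_within_eps_delta by metis
      show ?thesis
      proof (intro exI[of _ "min e d"] conjI ballI impI)
        fix s assume s: "s \<in> {0..1}" "dist s t < min e d"
        then have "\<gamma> s \<in> chart_dom c" using e by auto
        moreover have "vel c \<gamma> s \<noteq> vel c \<sigma> s" using d(2)[OF s(1)] s(2) by (auto simp: dist_norm norm_minus_commute)
        ultimately show "s \<in> {0..1} - S" using s c(1) by (auto simp: S_def)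
      qed (use e d in auto)
    qed
  qed auto
  then have cl: "closedin (top_of_set {0..1}) S" using op
    by (auto simp: closedin_def S_def)
  have "connected {0..1::real}" by simp
  then have "S = {} \<or> S = {0..1}" unfolding connected_clopen using op cl by blast
  then show ?thesis using \<open>0 \<in> S\<close> t by (auto simp: S_def)
qed

lemma geoF_scale: "geoF c y (a *\<^sub>R v) = a\<^sup>2 *\<^sub>R geoF c y v"
  by (simp add: geoF_def vec_eq_iff sum_2 power2_eq_square algebra_simps)

text \<open>The Lipschitz property at velocity zero bounds \<open>geoF\<close> for small velocities
  only. As \<open>geoF\<close> is quadratic in the velocity, scaling by \<open>k\<close> carries the
  bound to all velocities up to \<open>V\<close>.\<close>

lemma geoF_bound: assumes c: "c \<in> atlas M" "x \<in> chart_image c" and V: "V > 0"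
  obtains e C where "e > 0" "C \<ge> 0" "\<And>y v. y \<in> cball x e \<Longrightarrow> norm v \<le> V \<Longrightarrow> norm (geoF c y v) \<le> C"
proof -
  obtain e B where e: "e > 0" "B \<ge> 0"
    "\<And>p. p \<in> ball (x, 0) e \<Longrightarrow> norm (geoF c (fst p) (snd p)) \<le> norm (geoF c x 0) + B"
    using llipE[OF llip_geoF[OF c, of 0]] by (metis fst_conv snd_conv)
  have 0: "geoF c x 0 = 0" using geoF_scale[of c x 0 0] by simp
  define k where "k = e / 4 / V"
  have k: "k > 0" using e V by (simp add: k_def)
  have "norm (geoF c y v) \<le> B / k\<^sup>2" if y: "y \<in> cball x (e / 4)" and v: "norm v \<le> V" for y v
  proof -
    have "norm (k *\<^sub>R v) \<le> k * V" using v k by simp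
    then have "norm (k *\<^sub>R v) \<le> e / 4" using V by (simp add: k_def)
    moreover have "dist (x, 0) (y, k *\<^sub>R v) \<le> dist x y + norm (k *\<^sub>R v)"
      unfolding dist_Pair_Pair by (rule order_trans[OF sqrt_sum_squares_le_sum_abs]) simp
    ultimately have "(y, k *\<^sub>R v) \<in> ball (x, 0) e" using y e by simp
    from e(3)[OF this] have "norm (geoF c y (k *\<^sub>R v)) \<le> B" using 0 by simp
    then show ?thesis using k by (simp add: geoF_scale field_simps)
  qed
  then show ?thesis using that[of "e / 4" "B / k\<^sup>2"] e k by auto
qed

text \<open>What matters is that \<open>t0\<close> and \<open>C\<close> serve all geodesics from
  \<open>p\<close> of length at most \<open>R\<close>. Up to time \<open>t0\<close> they are
  confined to one chart ball by \<open>rdist_lower\<close>; there constant speed bounds the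
  velocity, \<open>geoF_bound\<close> the acceleration, and the mean value inequality is used
  twice.\<close>

lemma geodesic_taylor:
  assumes c: "c \<in> atlas M" "p \<in> chart_dom c" and R: "R > 0"
  obtains t0 C where "0 < t0" "t0 \<le> 1" "C \<ge> 0"
    "\<And>\<gamma> t. geodesic M \<gamma> \<Longrightarrow> \<gamma> 0 = p \<Longrightarrow> curve_length M \<gamma> \<le> R \<Longrightarrow> t \<in> {0..t0} \<Longrightarrow>
       \<gamma> t \<in> chart_dom c \<and> norm (coords c (\<gamma> t) - coords c p - t *\<^sub>R vel c \<gamma> 0) \<le> C * t\<^sup>2"
proof -
  let ?x = "coords c p"
  have xi: "?x \<in> chart_image c" using c by auto
  obtain e1 where e1: "e1 > 0" "cball ?x e1 \<subseteq> chart_image c"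
    using chart_cball[OF c openin_topspace dom_points[OF c]] by metis
  obtain l where l: "l > 0" "\<And>y v. y \<in> cball ?x e1 \<Longrightarrow> l * norm v \<le> gnorm c y v"
    using gnorm_bounds[OF c(1) compact_cball e1(2)] by metis
  obtain e2 C where e2: "e2 > 0" "C \<ge> 0" "\<And>y v. y \<in> cball ?x e2 \<Longrightarrow> norm v \<le> R / l \<Longrightarrow> norm (geoF c y v) \<le> C"
    using geoF_bound[OF c(1) xi, of "R / l"] R l(1) by auto
  define e where "e = min e1 e2"
  have e: "e > 0" "cball ?x e \<subseteq> chart_image c" "\<And>y v. y \<in> cball ?x e \<Longrightarrow> l * norm v \<le> gnorm c y v"
    "\<And>y v. y \<in> cball ?x e \<Longrightarrow> norm v \<le> R / l \<Longrightarrow> norm (geoF c y v) \<le> C"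
    using e1 e2 l by (auto simp: e_def subset_iff)
  \<comment> \<open>By time \<open>t0\<close> such a geodesic has covered at most
    \<open>R * t0 < l * e\<close>, too little to leave the chart ball of radius
    \<open>e\<close>.\<close>
  define t0 where "t0 = min 1 (l * e / (2 * R))"
  have t0: "0 < t0" "t0 \<le> 1" "R * t0 < l * e"
    using l e R by (auto simp: t0_def min_def field_simps)
  show ?thesis
  proof (rule that[OF t0(1,2) e2(2)])
    fix \<gamma> t assume g: "geodesic M \<gamma>" "\<gamma> 0 = p" "curve_length M \<gamma> \<le> R" and t: "t \<in> {0..t0}"
    note D = geodesicD[OF g(1)]
    obtain k where k: "k \<ge> 0" "\<And>t. t \<in> {0..1} \<Longrightarrow> spd {0..1} \<gamma> t = k" "curve_length M \<gamma> = k"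
      using geodesic_const[OF g(1)] by metis
    have in_ball: "\<gamma> s \<in> chart_dom c" "coords c (\<gamma> s) \<in> cball ?x e" "s \<in> {0..1}" if s: "s \<in> {0..t0}" for s
    proof -
      show s1: "s \<in> {0..1}" using s t0 by auto
      have "rdist M p (\<gamma> s) \<le> ereal (curve_length M \<gamma> * (s - 0))"
        using geodesic_rdist[OF g(1), of 0 s] g(2) s1 by auto
      also have "curve_length M \<gamma> * (s - 0) \<le> R * t0" using g(3) s k R by (auto intro!: mult_mono)
      also have "R * t0 < l * e" by (rule t0)
      finally have lt: "rdist M p (\<gamma> s) < ereal (l * e)" by simp
      have "ereal (l * phi c ?x e (\<gamma> s)) \<le> rdist M p (\<gamma> s)"
        using rdist_lower[OF c e(1,2,3) l(1), of "\<gamma> s"] by simp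
      from le_less_trans[OF this lt] have "ereal (l * phi c ?x e (\<gamma> s)) < ereal (l * e)" .
      then have "phi c ?x e (\<gamma> s) < e" using l by simp
      then have "\<gamma> s \<in> nball c ?x e" by (auto simp: phi_def split: if_splits)
      then show "\<gamma> s \<in> chart_dom c" "coords c (\<gamma> s) \<in> cball ?x e" by (auto simp: nball_def)
    qed
    have vb: "norm (vel c \<gamma> s) \<le> R / l" if s: "s \<in> {0..t0}" for s
    proof -
      have "l * norm (vel c \<gamma> s) \<le> gnorm c (coords c (\<gamma> s)) (vel c \<gamma> s)" by (rule e(3)[OF in_ball(2)[OF s]])
      also have "\<dots> = k" using geodesic_spd_sq(1)[OF g(1) c(1) in_ball(3,1)[OF s]] k(2)[OF in_ball(3)[OF s]] by simp
      finally show ?thesis using g(3) k(3) l(1) by (simp add: field_simps)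
    qed
    have sub: "{0..t} \<subseteq> {0..1}" using t t0 by auto
    have vt: "norm (vel c \<gamma> s - vel c \<gamma> 0) \<le> C * t" if s: "s \<in> {0..t}" for s
    proof -
      have "norm (vel c \<gamma> s - vel c \<gamma> 0) \<le> C * norm (s - 0)"
      proof (rule differentiable_bound[OF convex_real_interval(5), of 0 t _ "\<lambda>u h. h *\<^sub>R geoF c (coords c (\<gamma> u)) (vel c \<gamma> u)"])
        fix u assume u: "u \<in> {0..t}"
        then have u0: "u \<in> {0..t0}" using t by auto
        show "(vel c \<gamma> has_derivative (\<lambda>h. h *\<^sub>R geoF c (coords c (\<gamma> u)) (vel c \<gamma> u))) (at u within {0..t})"
          using has_vector_derivative_within_subset[OF D(3)[OF c(1) in_ball(3,1)[OF u0]] sub]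
          by (simp add: has_vector_derivative_def)
        have "norm (geoF c (coords c (\<gamma> u)) (vel c \<gamma> u)) \<le> C" by (rule e(4)[OF in_ball(2)[OF u0] vb[OF u0]])
        then show "onorm (\<lambda>h. h *\<^sub>R geoF c (coords c (\<gamma> u)) (vel c \<gamma> u)) \<le> C"
          by (intro onorm_bound) (use e2 in \<open>auto simp: mult.commute[of _ "\<bar>_\<bar>"] intro!: mult_left_mono\<close>)
      qed (use s t in auto)
      also have "\<dots> \<le> C * t" using s e2(2) by (intro mult_left_mono) auto
      finally show ?thesis .
    qed
    have "norm ((coords c (\<gamma> t) - t *\<^sub>R vel c \<gamma> 0) - (coords c (\<gamma> 0) - 0 *\<^sub>R vel c \<gamma> 0)) \<le> C * t * norm (t - 0)"
    proof (rule differentiable_bound[OF convex_real_interval(5), of 0 t "\<lambda>s. coords c (\<gamma> s) - s *\<^sub>R vel c \<gamma> 0" "\<lambda>u h. h *\<^sub>R (vel c \<gamma> u - vel c \<gamma> 0)"])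
      fix u assume u: "u \<in> {0..t}"
      then have u0: "u \<in> {0..t0}" using t by auto
      have "((coords c \<circ> \<gamma>) has_vector_derivative vel c \<gamma> u) (at u within {0..t})"
        by (rule has_vector_derivative_within_subset[OF D(2)[OF c(1) in_ball(3,1)[OF u0]] sub])
      moreover have "((\<lambda>s. s *\<^sub>R vel c \<gamma> 0) has_vector_derivative vel c \<gamma> 0) (at u within {0..t})"
        by (auto intro!: derivative_eq_intros)
      ultimately have "((\<lambda>s. coords c (\<gamma> s) - s *\<^sub>R vel c \<gamma> 0) has_vector_derivative (vel c \<gamma> u - vel c \<gamma> 0)) (at u within {0..t})"
        unfolding o_def by (rule has_vector_derivative_diff)
      then show "((\<lambda>s. coords c (\<gamma> s) - s *\<^sub>R vel c \<gamma> 0) has_derivative (\<lambda>h. h *\<^sub>R (vel c \<gamma> u - vel c \<gamma> 0))) (at u within {0..t})"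
        by (simp add: has_vector_derivative_def)
      show "onorm (\<lambda>h. h *\<^sub>R (vel c \<gamma> u - vel c \<gamma> 0)) \<le> C * t"
        by (rule onorm_bound) (use vt[OF u] e2 t in \<open>auto simp: mult.commute[of _ "\<bar>_\<bar>"] intro!: mult_left_mono\<close>)
    qed (use t in auto)
    then have "norm (coords c (\<gamma> t) - coords c p - t *\<^sub>R vel c \<gamma> 0) \<le> C * t\<^sup>2"
      using t g(2) by (simp add: power2_eq_square algebra_simps)
    then show "\<gamma> t \<in> chart_dom c \<and> norm (coords c (\<gamma> t) - coords c p - t *\<^sub>R vel c \<gamma> 0) \<le> C * t\<^sup>2"
      using in_ball(1)[OF t] by simp
  qed
qed

section \<open>Approximate midpoints\<close>

lemma pw_rdist: assumes p: "pw 0 1 \<gamma> n s" shows "i \<le> j \<Longrightarrow> j \<le> n \<Longrightarrow> rdist M (\<gamma> (s i)) (\<gamma> (s j)) \<le> ereal (pwlen \<gamma> j s - pwlen \<gamma> i s)"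
proof (induction j rule: dec_induct)
  case base
  have "\<gamma> (s i) \<in> points M"
  proof (cases "i < n")
    case True
    then show ?thesis using pwD(3,4)[OF p True] curve_points[OF C1D(1)] by fastforce
  next
    case False
    then obtain k where "n = Suc k" "i = Suc k" using base pwD(1,2)[OF p] by (cases n) auto
    then show ?thesis using pwD(3,4)[OF p, of k] curve_points[OF C1D(1), of _ \<gamma> "s i"] by fastforce
  qed
  then show ?case using rdist_refl by (simp add: zero_ereal_def)
next
  case (step j)
  have "rdist M (\<gamma> (s j)) (\<gamma> (s (Suc j))) \<le> clen \<gamma> (s j) (s (Suc j))"
    using pwD(3,4)[OF p, of j] step.prems by (intro rdist_le_C1) auto
  moreover have "rdist M (\<gamma> (s i)) (\<gamma> (s j)) \<le> ereal (pwlen \<gamma> j s - pwlen \<gamma> i s)" using step by auto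
  ultimately have "rdist M (\<gamma> (s i)) (\<gamma> (s j)) + rdist M (\<gamma> (s j)) (\<gamma> (s (Suc j))) \<le> ereal (pwlen \<gamma> j s - pwlen \<gamma> i s) + ereal (clen \<gamma> (s j) (s (Suc j)))"
    by (intro add_mono)
  then show ?case using rdist_triangle[of "\<gamma> (s i)" "\<gamma> (s (Suc j))" "\<gamma> (s j)"] by (simp add: pwlen_def algebra_simps)
qed

text \<open>Arc length is continuous, so the intermediate value theorem finds the point at which the
  length \<open>h\<close> is reached.\<close>

lemma C1_split: assumes C: "C1_curve_on M {a..b} \<gamma>" and ab: "a < b" and h: "0 \<le> h" "h \<le> clen \<gamma> a b"
  obtains z where "z \<in> points M" "rdist M (\<gamma> a) z \<le> ereal h" "rdist M z (\<gamma> b) \<le> ereal (clen \<gamma> a b - h)"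
proof -
  let ?S = "spd {a..b} \<gamma>"
  have int: "?S integrable_on {a..b}" using clen_has[OF C ab] by blast
  have "continuous_on {a..b} (\<lambda>t. integral {a..t} ?S)" by (rule indefinite_integral_continuous_1[OF int])
  moreover have "integral {a..a} ?S \<le> h" "h \<le> integral {a..b} ?S" using h by (auto simp: clen_def)
  ultimately obtain t where t: "a \<le> t" "t \<le> b" "integral {a..t} ?S = h"
    using IVT'[of "\<lambda>t. integral {a..t} ?S" a h b] ab by auto
  have comb: "integral {a..t} ?S + integral {t..b} ?S = clen \<gamma> a b"
    unfolding clen_def by (rule Henstock_Kurzweil_Integration.integral_combine[OF t(1,2) int])
  have gp: "\<gamma> s \<in> points M" if "s \<in> {a..b}" for s using curve_points[OF C1D(1)[OF C] that] .
  show ?thesis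
  proof (rule that)
    show "\<gamma> t \<in> points M" using gp t by auto
    show "rdist M (\<gamma> a) (\<gamma> t) \<le> ereal h"
    proof (cases "a = t")
      case True then show ?thesis using rdist_refl gp[of t] t h by simp
    next
      case False
      then have lt: "a < t" using t by simp
      have "clen \<gamma> a t = integral {a..t} ?S"
        unfolding clen_def by (rule integral_cong) (use C1_subset(2)[OF C _ lt t(2) ab] in auto)
      then show ?thesis using rdist_le_C1[OF C1_subset(1)[OF C _ lt t(2)] lt] t(3) by simp
    qed
    show "rdist M (\<gamma> t) (\<gamma> b) \<le> ereal (clen \<gamma> a b - h)"
    proof (cases "b = t")
      case True
      then have "clen \<gamma> a b - h = 0" using t(3) by (simp add: clen_def)
      then show ?thesis using True rdist_refl gp[of t] t by simp
    next
      case False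
      then have lt: "t < b" using t by simp
      have "clen \<gamma> t b = integral {t..b} ?S"
        unfolding clen_def by (rule integral_cong) (use C1_subset(2)[OF C t(1) lt _ ab] in auto)
      moreover have "integral {t..b} ?S = clen \<gamma> a b - h" using t(3) comb by simp
      ultimately show ?thesis using rdist_le_C1[OF C1_subset(1)[OF C t(1) lt] lt] by simp
    qed
  qed
qed

text \<open>A curve shorter than \<open>L\<close> is cut at half its length. The cut falls into the
  first piece at whose end half the length is reached, and \<open>C1_split\<close> divides that
  piece.\<close>

lemma near_midpoint: assumes x: "rdist M x y < ereal L"
  obtains z where "z \<in> points M" "rdist M x z < ereal (L / 2)" "rdist M z y < ereal (L / 2)"
proof -
  obtain \<gamma> n s where p: "pw 0 1 \<gamma> n s" "\<gamma> 0 = x" "\<gamma> 1 = y" "pwlen \<gamma> n s < L" using rdist_less[OF x] .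
  define A where "A k = pwlen \<gamma> k s" for k
  define k where "k = (LEAST k. A n / 2 \<le> A (Suc k))"
  have n0: "n > 0" using pwD(1,2)[OF p(1)] by (cases n) auto
  have An: "A n \<ge> 0" unfolding A_def by (rule pwlen_nonneg[OF p(1)])
  then have ex: "A n / 2 \<le> A (Suc (n - 1))" using n0 by simp
  have k1: "A n / 2 \<le> A (Suc k)" unfolding k_def by (rule LeastI[of "\<lambda>k. A n / 2 \<le> A (Suc k)", OF ex])
  have "k \<le> n - 1" unfolding k_def by (rule Least_le[of "\<lambda>k. A n / 2 \<le> A (Suc k)", OF ex])
  then have kn: "k < n" using n0 by simp
  have k2: "A k \<le> A n / 2"
  proof (cases k)
    case 0 then show ?thesis using An by (simp add: A_def pwlen_def)
  next
    case (Suc j)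
    then have "\<not> A n / 2 \<le> A (Suc j)" using not_less_Least[of j "\<lambda>k. A n / 2 \<le> A (Suc k)"] by (simp add: k_def)
    then show ?thesis using Suc by simp
  qed
  have c: "clen \<gamma> (s k) (s (Suc k)) = A (Suc k) - A k" by (simp add: A_def pwlen_def)
  obtain z where z: "z \<in> points M" "rdist M (\<gamma> (s k)) z \<le> ereal (A n / 2 - A k)"
     "rdist M z (\<gamma> (s (Suc k))) \<le> ereal (A (Suc k) - A k - (A n / 2 - A k))"
    using C1_split[OF pwD(4)[OF p(1) kn] pwD(3)[OF p(1) kn], of "A n / 2 - A k"] k1 k2 c by auto
  have "rdist M (\<gamma> (s 0)) (\<gamma> (s k)) \<le> ereal (A k)" using pw_rdist[OF p(1), of 0 k] kn by (simp add: A_def pwlen_def)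
  then have "rdist M (\<gamma> (s 0)) (\<gamma> (s k)) + rdist M (\<gamma> (s k)) z \<le> ereal (A k) + ereal (A n / 2 - A k)" using z(2) by (rule add_mono)
  then have 1: "rdist M x z \<le> ereal (A n / 2)" using rdist_triangle[of x z "\<gamma> (s k)"] pwD(1)[OF p(1)] p(2) by simp
  have "rdist M (\<gamma> (s (Suc k))) (\<gamma> (s n)) \<le> ereal (A n - A (Suc k))" using pw_rdist[OF p(1), of "Suc k" n] kn by (simp add: A_def)
  then have "rdist M z (\<gamma> (s (Suc k))) + rdist M (\<gamma> (s (Suc k))) (\<gamma> (s n)) \<le> ereal (A (Suc k) - A k - (A n / 2 - A k)) + ereal (A n - A (Suc k))"
    using z(3) by (intro add_mono)
  then have 2: "rdist M z y \<le> ereal (A n / 2)" using rdist_triangle[of z y "\<gamma> (s (Suc k))"] pwD(2)[OF p(1)] p(3) by simp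
  have "ereal (A n / 2) < ereal (L / 2)" using p(4) by (simp add: A_def)
  then show ?thesis using that[OF z(1)] 1 2 by (meson le_less_trans)
qed

section \<open>Minimal geodesics within the strong convexity radius\<close>

text \<open>The property maximised in \<open>strong_convexity_radius\<close>, isolated so that its
  consequences can be drawn for any good radius before a greatest one is known to exist.\<close>

definition conv_good :: "real \<Rightarrow> bool" where
  "conv_good r \<longleftrightarrow> (\<forall>a\<in>points M. \<forall>s<r.
        \<forall>p \<in> surf M closure_of disk M a s. \<forall>q \<in> surf M closure_of disk M a s. p \<noteq> q \<longrightarrow>
          (\<exists>\<gamma>. is_unique_curve (minimal_geodesic M p q) \<gamma> \<and>
               \<gamma> ` {0<..<1} \<subseteq> surf M interior_of disk M a s))"

text \<open>Both points lie in a disk of radius \<open>L / 2 < r\<close> about an approximate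
  midpoint, and the convexity of that disk provides the geodesic. This is where the factor two comes
  from.\<close>

lemma unique_minimal: assumes r: "conv_good r" and xy: "x \<in> points M" "y \<in> points M" "x \<noteq> y" "rdist M x y < ereal (2 * r)"
  shows "\<exists>\<gamma>. is_unique_curve (minimal_geodesic M x y) \<gamma>"
proof -
  obtain L where L: "rdist M x y < ereal L" "ereal L < ereal (2 * r)" using ereal_dense2[OF xy(4)] by blast
  obtain z where z: "z \<in> points M" "rdist M x z < ereal (L / 2)" "rdist M z y < ereal (L / 2)" using near_midpoint[OF L(1)] .
  have "x \<in> disk M z (L / 2)" "y \<in> disk M z (L / 2)" using z xy rdist_sym[of x z] by (auto simp: disk_def)
  then have "x \<in> surf M closure_of disk M z (L / 2)" "y \<in> surf M closure_of disk M z (L / 2)"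
    using closure_of_subset_Int[of "surf M" "disk M z (L/2)"] xy by auto
  moreover have "L / 2 < r" using L(2) by simp
  ultimately show ?thesis using r z(1) xy(3) unfolding conv_good_def by blast
qed

end

locale rsurf_conv = rsurf +
  fixes r :: real
  assumes r0: "0 < r" and good: "conv_good r"
begin

text \<open>\<open>conv_good\<close> asserts nothing about coinciding end points, hence the separate
  constant case.\<close>

definition G :: "'a \<Rightarrow> 'a \<Rightarrow> real \<Rightarrow> 'a" where
  "G x y = (if x = y then (\<lambda>_. x) else (SOME \<gamma>. minimal_geodesic M x y \<gamma>))"

text \<open>The distance is cut off because points in different components are at distance \<open>\<infinity>\<close>.\<close>

definition dd :: "'a \<Rightarrow> 'a \<Rightarrow> real" where
  "dd x y = real_of_ereal (min (rdist M x y) (ereal (2 * r)))"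

lemma dd_ereal: "ereal (dd x y) = min (rdist M x y) (ereal (2 * r))"
  unfolding dd_def using rdist_nonneg[of x y] r0 by (cases "rdist M x y") (auto simp: min_def)

lemma dd_less: "e \<le> 2 * r \<Longrightarrow> dd x y < e \<longleftrightarrow> rdist M x y < ereal e"
proof -
  assume e: "e \<le> 2 * r"
  have "dd x y < e \<longleftrightarrow> ereal (dd x y) < ereal e" by simp
  also have "\<dots> \<longleftrightarrow> rdist M x y < ereal e" unfolding dd_ereal using e by (auto simp: min_less_iff_disj)
  finally show ?thesis .
qed

lemma dd_rdist: "dd x y < 2 * r \<Longrightarrow> rdist M x y = ereal (dd x y)"
  using dd_less[of "2 * r" x y] dd_ereal[of x y] by (simp add: min_def split: if_splits)

lemma rdist_dd: "rdist M x y = ereal e \<Longrightarrow> e \<le> 2 * r \<Longrightarrow> dd x y = e"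
  by (simp add: dd_def min_def)

lemma dd_metric: "Metric_space (points M) dd"
proof
  fix x y z
  show "0 \<le> dd x y"
    using dd_ereal[of x y] rdist_nonneg[of x y] r0 by (metis ereal_less_eq(5) ereal_less_eq(3) min_def mult_nonneg_nonneg less_imp_le zero_le_numeral zero_ereal_def)
  show "dd x y = dd y x" by (simp add: dd_def rdist_sym)
  assume xy: "x \<in> points M" "y \<in> points M"
  show "dd x y = 0 \<longleftrightarrow> x = y"
  proof
    assume "dd x y = 0"
    then have "rdist M x y = 0" using dd_rdist[of x y] r0 by (simp add: zero_ereal_def)
    then show "x = y" using rdist_pos[OF xy] by auto
  next
    assume "x = y"
    then show "dd x y = 0" using rdist_refl[OF xy(1)] r0 by (simp add: dd_def min_def)
  qed
  assume z: "z \<in> points M"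
  have nn: "0 \<le> dd u v" for u v
  proof -
    have "0 \<le> ereal (dd u v)" unfolding dd_ereal using rdist_nonneg r0 by simp
    then show ?thesis by simp
  qed
  show "dd x z \<le> dd x y + dd y z"
  proof (cases "dd x y < 2 * r \<and> dd y z < 2 * r")
    case True
    have "ereal (dd x z) \<le> rdist M x z" unfolding dd_ereal by simp
    also have "\<dots> \<le> rdist M x y + rdist M y z" by (rule rdist_triangle)
    also have "\<dots> = ereal (dd x y + dd y z)" using True dd_rdist by simp
    finally show ?thesis by simp
  next
    case False
    have "ereal (dd x z) \<le> ereal (2 * r)" unfolding dd_ereal by simp
    then have "dd x z \<le> 2 * r" by simp
    then show ?thesis using False nn[of x y] nn[of y z] by linarith
  qed
qed

text \<open>Balls of radius at most \<open>2 * r\<close> are the same for \<open>dd\<close> and for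
  the Riemannian distance, and small balls determine the topology.\<close>

lemma dd_topology: "Metric_space.mtopology (points M) dd = surf M"
proof -
  interpret D: Metric_space "points M" dd by (rule dd_metric)
  have ball: "D.mball p e = disk M p e" if "e \<le> 2 * r" "p \<in> points M" for p e
    using dd_less[OF that(1)] that(2) by (auto simp: D.mball_def disk_def)
  have "openin D.mtopology U \<longleftrightarrow> openin (surf M) U" for U
  proof
    assume U: "openin D.mtopology U"
    show "openin (surf M) U" unfolding openin_disk
    proof (intro conjI ballI)
      show sub: "U \<subseteq> points M" using U openin_subset by fastforce
      fix p assume p: "p \<in> U"
      then obtain e where e: "e > 0" "D.mball p e \<subseteq> U" using U D.openin_mtopology by blast
      have "disk M p (min e (2 * r)) = D.mball p (min e (2 * r))" using ball[of "min e (2*r)" p] p sub by auto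
      also have "\<dots> \<subseteq> U" using e(2) D.mball_subset_concentric[of "min e (2*r)" e p] by auto
      finally show "\<exists>r>0. disk M p r \<subseteq> U" using e r0 by (intro exI[of _ "min e (2 * r)"]) auto
    qed
  next
    assume U: "openin (surf M) U"
    show "openin D.mtopology U" unfolding D.openin_mtopology
    proof (intro conjI allI impI)
      show sub: "U \<subseteq> points M" using U openin_subset by fastforce
      fix p assume p: "p \<in> U"
      then obtain e where e: "e > 0" "disk M p e \<subseteq> U" using U openin_disk by blast
      have "D.mball p (min e (2 * r)) = disk M p (min e (2 * r))" using ball[of "min e (2*r)" p] p sub by auto
      also have "\<dots> \<subseteq> disk M p e" by (auto simp: disk_def intro: less_le_trans)
      also have "\<dots> \<subseteq> U" by (rule e)
      finally show "\<exists>r>0. D.mball p r \<subseteq> U" using e r0 by (intro exI[of _ "min e (2 * r)"]) auto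
    qed
  qed
  then show ?thesis by (simp add: topology_eq)
qed

lemma G_refl [simp]: "G x x t = x" by (simp add: G_def)

lemma G_minimal: assumes "x \<in> points M" "y \<in> points M" "x \<noteq> y" "dd x y < 2 * r"
  shows "minimal_geodesic M x y (G x y)" "is_unique_curve (minimal_geodesic M x y) (G x y)"
    "\<And>\<gamma> t. minimal_geodesic M x y \<gamma> \<Longrightarrow> t \<in> {0..1} \<Longrightarrow> \<gamma> t = G x y t"
proof -
  have "rdist M x y < ereal (2 * r)" using dd_less[of "2 * r" x y] assms(4) by simp
  from unique_minimal[OF good assms(1-3) this] obtain \<sigma> where s: "is_unique_curve (minimal_geodesic M x y) \<sigma>" by blast
  then have "minimal_geodesic M x y \<sigma>" by (simp add: is_unique_curve_def)
  then show m: "minimal_geodesic M x y (G x y)" unfolding G_def using assms(3) by (simp add: someI)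
  show u: "\<gamma> t = G x y t" if "minimal_geodesic M x y \<gamma>" "t \<in> {0..1}" for \<gamma> t
    using s m that unfolding is_unique_curve_def by metis
  show "is_unique_curve (minimal_geodesic M x y) (G x y)" using m u unfolding is_unique_curve_def by blast
qed

lemma G_ends: assumes "x \<in> points M" "y \<in> points M" "dd x y < 2 * r"
  shows "G x y 0 = x" "G x y 1 = y"
  using G_minimal(1)[OF assms(1,2) _ assms(3)] by (cases "x = y"; auto simp: minimal_geodesic_def geodesic_between_def)+

lemma G_geod: assumes "x \<in> points M" "y \<in> points M" "x \<noteq> y" "dd x y < 2 * r"
  shows "geodesic M (G x y)" "curve_length M (G x y) = dd x y"
proof -
  show "geodesic M (G x y)" using G_minimal(1)[OF assms] by (simp add: minimal_geodesic_def geodesic_between_def)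
  show "curve_length M (G x y) = dd x y" using minimal_finite[OF G_minimal(1)[OF assms]] dd_rdist[OF assms(4)] by simp
qed

lemma dd_self: "x \<in> points M \<Longrightarrow> dd x x = 0"
  using dd_metric by (simp add: Metric_space.mdist_zero)

lemma dd_sym: "dd x y = dd y x" by (simp add: dd_def rdist_sym)

lemma G_points: assumes "x \<in> points M" "y \<in> points M" "dd x y < 2 * r" "t \<in> {0..1}"
  shows "G x y t \<in> points M"
proof (cases "x = y")
  case False
  show ?thesis using curve_points[OF geodesicD(1)[OF G_geod(1)[OF assms(1,2) False assms(3)]] assms(4)] .
qed (use assms in auto)

lemma G_dist: assumes "x \<in> points M" "y \<in> points M" "dd x y < 2 * r" "s \<in> {0..1}" "t \<in> {0..1}"
  shows "dd (G x y s) (G x y t) = \<bar>s - t\<bar> * dd x y"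
proof (cases "x = y")
  case True then show ?thesis using assms dd_self by simp
next
  case False
  have *: "dd (G x y s) (G x y t) = \<bar>s - t\<bar> * dd x y" if "s \<le> t" "s \<in> {0..1}" "t \<in> {0..1}" for s t
  proof (rule rdist_dd)
    have nn: "0 \<le> dd x y" using Metric_space.nonneg[OF dd_metric] .
    show "rdist M (G x y s) (G x y t) = ereal (\<bar>s - t\<bar> * dd x y)"
      using minimal_rdist[OF G_minimal(1)[OF assms(1,2) False assms(3)], of s t] that G_geod(2)[OF assms(1,2) False assms(3)]
      by (simp add: mult.commute)
    have "\<bar>s - t\<bar> * dd x y \<le> 1 * dd x y" using that nn by (intro mult_right_mono) auto
    then show "\<bar>s - t\<bar> * dd x y \<le> 2 * r" using assms by simp
  qed
  show ?thesis using *[of s t] *[of t s] assms dd_sym by (cases "s \<le> t") (auto simp: abs_minus_commute)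
qed

lemma reparam_in: fixes s t u :: real assumes "s \<in> {0..1}" "t \<in> {0..1}" "u \<in> {0..1}" shows "(t - s) * u + s \<in> {0..1}"
proof -
  have "(t - s) * u + s = (1 - u) * s + u * t" by (simp add: algebra_simps)
  moreover have "0 \<le> (1 - u) * s + u * t" using assms by simp
  moreover have "(1 - u) * s + u * t \<le> (1 - u) * 1 + u * 1" using assms by (intro add_mono mult_left_mono) auto
  ultimately show ?thesis by simp
qed

lemma geodesic_reparam_length: assumes g: "geodesic M \<gamma>" and m: "\<And>s. s \<in> {0..1} \<Longrightarrow> \<alpha> * s + \<beta> \<in> {0..1}"
  shows "curve_length M (\<lambda>s. \<gamma> (\<alpha> * s + \<beta>)) = \<bar>\<alpha>\<bar> * curve_length M \<gamma>"
proof -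
  obtain k where k: "\<And>t. t \<in> {0..1} \<Longrightarrow> spd {0..1} \<gamma> t = k" "curve_length M \<gamma> = k" using geodesic_const[OF g] by metis
  have g': "geodesic M (\<lambda>s. \<gamma> (\<alpha> * s + \<beta>))" using geodesic_reparam(1)[OF g] m by blast
  obtain k' where k': "\<And>t. t \<in> {0..1} \<Longrightarrow> spd {0..1} (\<lambda>s. \<gamma> (\<alpha> * s + \<beta>)) t = k'" "curve_length M (\<lambda>s. \<gamma> (\<alpha> * s + \<beta>)) = k'"
    using geodesic_const[OF g'] by metis
  have "spd {0..1} (\<lambda>s. \<gamma> (\<alpha> * s + \<beta>)) 0 = \<bar>\<alpha>\<bar> * spd {0..1} \<gamma> (\<alpha> * 0 + \<beta>)"
    by (rule C1_reparam(2)[OF geodesic_C1[OF g]]) (use m in auto)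
  moreover have "\<beta> \<in> {0..1}" using m[of 0] by simp
  ultimately show ?thesis using k k' by simp
qed

text \<open>An affinely reparametrised piece of a minimal geodesic, possibly reversed, is a geodesic
  as long as the distance of its ends; uniqueness identifies it with the chosen one.\<close>

lemma G_sub: assumes "x \<in> points M" "y \<in> points M" "dd x y < 2 * r" and st: "s \<in> {0..1}" "t \<in> {0..1}" "u \<in> {0..1}"
  shows "G (G x y s) (G x y t) u = G x y ((t - s) * u + s)"
proof (cases "x = y \<or> s = t")
  case False
  then have xy: "x \<noteq> y" and "s \<noteq> t" by auto
  have pos: "dd x y > 0" using xy assms(1,2) Metric_space.mdist_pos_eq[OF dd_metric] by blast
  let ?\<sigma> = "\<lambda>u. G x y ((t - s) * u + s)"
  note g = G_geod[OF assms(1,2) xy assms(3)]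
  have in1: "\<And>u. u \<in> {0..1} \<Longrightarrow> (t - s) * u + s \<in> {0..1}" using reparam_in[OF st(1,2)] .
  have dst: "dd (G x y s) (G x y t) = \<bar>t - s\<bar> * dd x y" using G_dist[OF assms(1-3) st(1,2)] by (simp add: abs_minus_commute)
  have pts: "G x y s \<in> points M" "G x y t \<in> points M" using G_points[OF assms(1-3)] st by auto
  have "\<bar>t - s\<bar> * dd x y \<le> 1 * dd x y" using st pos by (intro mult_right_mono) auto
  then have lt: "dd (G x y s) (G x y t) < 2 * r" using dst assms(3) by simp
  have ne: "G x y s \<noteq> G x y t" using dst pos \<open>s \<noteq> t\<close> dd_self[OF pts(2)] by auto
  have "geodesic M ?\<sigma>" using geodesic_reparam(1)[OF g(1)] in1 by blast
  moreover have "curve_length M ?\<sigma> = \<bar>t - s\<bar> * dd x y" using geodesic_reparam_length[OF g(1)] in1 g(2) by metis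
  ultimately have "minimal_geodesic M (G x y s) (G x y t) ?\<sigma>"
    using dd_rdist[OF lt] dst by (simp add: minimal_geodesic_def geodesic_between_def)
  from G_minimal(3)[OF pts ne lt this st(3)] show ?thesis by simp
qed auto

text \<open>The points of the geodesic from \<open>a\<close> to \<open>x\<close> shortly before
  \<open>x\<close> lie in the open disk. Convexity, which is stated for closures of disks, therefore
  applies to closed balls.\<close>

lemma in_closure_disk: assumes a: "a \<in> points M" and x: "x \<in> points M" "dd a x \<le> s" and s: "0 < s" "s < 2 * r"
  shows "x \<in> surf M closure_of disk M a s"
  unfolding in_closure_of
proof (intro conjI allI impI x)
  fix T assume T: "x \<in> T \<and> openin (surf M) T"
  interpret D: Metric_space "points M" dd by (rule dd_metric)
  obtain e where e: "e > 0" "D.mball x e \<subseteq> T" using T dd_topology D.openin_mtopology by metis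
  have lt: "dd a x < 2 * r" using x s by simp
  define h where "h = min 1 (e / 2 / (2 * r))"
  have h: "0 < h" "h \<le> 1" "h * dd a x < e"
  proof -
    show "0 < h" "h \<le> 1" using e r0 by (auto simp: h_def)
    have "h * dd a x \<le> (e / 2 / (2 * r)) * (2 * r)" using lt e r0 by (intro mult_mono) (auto simp: h_def D.nonneg)
    then show "h * dd a x < e" using e r0 by simp
  qed
  let ?y = "G a x (1 - h)"
  have t: "1 - h \<in> {0..1}" using h by auto
  have y: "?y \<in> points M" using G_points[OF a x(1) lt t] .
  have "dd ?y x = h * dd a x" using G_dist[OF a x(1) lt t, of 1] G_ends[OF a x(1) lt] h by simp
  then have "?y \<in> T" using e h y x dd_sym by (intro subsetD[OF e(2)]) (simp add: D.mball_def)
  moreover have "dd a ?y = (1 - h) * dd a x" using G_dist[OF a x(1) lt _ t, of 0] G_ends[OF a x(1) lt] h by simp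
  then have "dd a ?y < s"
  proof -
    assume e: "dd a ?y = (1 - h) * dd a x"
    show ?thesis
    proof (cases "dd a x = 0")
      case False
      then have "dd a x > 0" using D.nonneg[of a x] by linarith
      then have "(1 - h) * dd a x < 1 * dd a x" using h by (intro mult_strict_right_mono) auto
      then show ?thesis using e x(2) by simp
    qed (use e s in simp)
  qed
  then have "?y \<in> disk M a s" using y dd_less[of s a ?y] s by (simp add: disk_def)
  ultimately show "\<exists>y. y \<in> disk M a s \<and> y \<in> T" by blast
qed

lemma G_convex: assumes a: "a \<in> points M" and x: "x \<in> points M" "y \<in> points M" "x \<noteq> y" and s: "s < r"
   and d: "dd a x \<le> s" "dd a y \<le> s" and t: "0 < t" "t < 1"
  shows "dd a (G x y t) < s"
proof -
  interpret D: Metric_space "points M" dd by (rule dd_metric)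
  have s0: "0 < s"
  proof (rule ccontr)
    assume "\<not> 0 < s"
    then have "dd a x = 0 \<and> dd a y = 0" using d D.nonneg[of a x] D.nonneg[of a y] by linarith
    then show False using a x by auto
  qed
  have s2: "s < 2 * r" using s r0 by simp
  have "x \<in> surf M closure_of disk M a s" "y \<in> surf M closure_of disk M a s"
    using in_closure_disk[OF a x(1) d(1) s0 s2] in_closure_disk[OF a x(2) d(2) s0 s2] by auto
  then obtain \<gamma> where g: "is_unique_curve (minimal_geodesic M x y) \<gamma>" "\<gamma> ` {0<..<1} \<subseteq> surf M interior_of disk M a s"
    using good a s x(3) unfolding conv_good_def by blast
  have "dd x y \<le> dd x a + dd a y" using D.triangle a x by blast
  then have lt: "dd x y < 2 * r" using d s dd_sym[of x a] by linarith
  have "\<gamma> t = G x y t" using g(1) G_minimal(3)[OF x lt] t by (simp add: is_unique_curve_def)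
  moreover have "\<gamma> t \<in> surf M interior_of disk M a s" using g(2) t by auto
  ultimately have "G x y t \<in> disk M a s" using interior_of_subset by fastforce
  then show ?thesis using dd_less[of s a "G x y t"] s2 by (simp add: disk_def)
qed

section \<open>The inverse of the exponential map\<close>

definition ca :: "'a \<Rightarrow> 'a chart" where "ca a = (SOME c. c \<in> atlas M \<and> a \<in> chart_dom c)"

lemma ca: assumes "a \<in> points M" shows "ca a \<in> atlas M" "a \<in> chart_dom (ca a)"
proof -
  have "\<exists>c. c \<in> atlas M \<and> a \<in> chart_dom c" using in_chart[OF assms] by metis
  from someI_ex[OF this] show "ca a \<in> atlas M" "a \<in> chart_dom (ca a)" unfolding ca_def by auto
qed

text \<open>The Cholesky factor of the Gram matrix at \<open>a\<close>: an isometry of the tangent plane onto \<open>\<complex>\<close>.\<close>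

definition tiso :: "'a \<Rightarrow> real^2 \<Rightarrow> complex" where
  "tiso a v = (let g = gram M (ca a) (coords (ca a) a); q = sqrt (g $ 1 $ 1) in
     Complex (q * v $ 1 + g $ 1 $ 2 / q * v $ 2) (sqrt (g $ 2 $ 2 - (g $ 1 $ 2)\<^sup>2 / g $ 1 $ 1) * v $ 2))"

lemma tiso_linear: "bounded_linear (tiso a)"
proof -
  have "linear (tiso a)"
    by (rule linearI) (simp_all add: tiso_def Let_def complex_eq_iff algebra_simps)
  then show ?thesis by (rule linear_conv_bounded_linear[THEN iffD1])
qed

lemma tiso_norm: assumes a: "a \<in> points M" shows "cmod (tiso a v) = gnorm (ca a) (coords (ca a) a) v"
proof -
  note c = ca[OF a]
  define g where "g = gram M (ca a) (coords (ca a) a)"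
  have y: "coords (ca a) a \<in> chart_image (ca a)" using c by auto
  have pos: "v \<noteq> 0 \<Longrightarrow> 0 < v \<bullet> (g *v v)" for v using gram_pos[OF c(1) y] by (simp add: g_def)
  have sym: "g $ 2 $ 1 = g $ 1 $ 2" using gram_sym_nth[OF c(1) y] by (simp add: g_def)
  have q: "v \<bullet> (g *v v) = g $ 1 $ 1 * (v $ 1)\<^sup>2 + 2 * g $ 1 $ 2 * v $ 1 * v $ 2 + g $ 2 $ 2 * (v $ 2)\<^sup>2" for v
    by (simp add: inner_vec_def matrix_vector_mult_def sum_2 sym power2_eq_square algebra_simps)
  have g1: "g $ 1 $ 1 > 0" using pos[of "axis 1 1"] unfolding q by (simp add: axis_def vec_eq_iff)
  \<comment> \<open>\<open>w\<close> is orthogonal to the first axis with respect to the metric; its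
    squared norm is the Schur complement under the second root in \<open>tiso\<close>.\<close>
  define w :: "real^2" where "w = vector [- g $ 1 $ 2 / g $ 1 $ 1, 1]"
  have "w \<noteq> 0" by (auto simp: w_def vec_eq_iff forall_2)
  from pos[OF this] have D: "g $ 2 $ 2 - (g $ 1 $ 2)\<^sup>2 / g $ 1 $ 1 > 0"
    using g1 unfolding q w_def by (simp add: power2_eq_square field_simps)
  have "(cmod (tiso a v))\<^sup>2 = v \<bullet> (g *v v)"
    using g1 D unfolding q tiso_def Let_def g_def[symmetric] cmod_power2
    by (simp add: power_mult_distrib power_divide power2_sum field_simps) (simp add: power2_eq_square)
  moreover have "gnorm (ca a) (coords (ca a) a) v = sqrt (v \<bullet> (g *v v))" by (simp add: gnorm_def g_def)
  ultimately show ?thesis by (metis norm_ge_zero real_sqrt_unique)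
qed

lemma tiso_inj: assumes a: "a \<in> points M" and "tiso a v = tiso a w" shows "v = w"
proof (rule ccontr)
  assume "v \<noteq> w"
  then have "0 < gnorm (ca a) (coords (ca a) a) (v - w)"
    using gram_pos[OF ca(1)[OF a], of "coords (ca a) a" "v - w"] ca(2)[OF a] by (simp add: gnorm_def)
  then show False using tiso_norm[OF a, of "v - w"] assms(2) linear_diff[OF bounded_linear.linear[OF tiso_linear]] by simp
qed

text \<open>The inverse of the exponential map at \<open>a\<close>, with the tangent plane identified with \<open>\<complex>\<close>.\<close>

definition lg :: "'a \<Rightarrow> 'a \<Rightarrow> complex" where
  "lg a x = (if x = a then 0 else tiso a (vel (ca a) (G a x) 0))"

text \<open>The initial speed of a geodesic on \<open>{0..1}\<close> is its length, and a minimal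
  geodesic is as long as the distance of its ends.\<close>

lemma lg_norm: assumes a: "a \<in> points M" "x \<in> points M" "dd a x < 2 * r" shows "cmod (lg a x) = dd a x"
proof (cases "x = a")
  case True then show ?thesis using dd_self a by (simp add: lg_def)
next
  case False
  note g = G_geod[OF a(1,2) False[symmetric] a(3)]
  obtain k where k: "\<And>t. t \<in> {0..1} \<Longrightarrow> spd {0..1} (G a x) t = k" "curve_length M (G a x) = k" using geodesic_const[OF g(1)] by metis
  have "gnorm (ca a) (coords (ca a) (G a x 0)) (vel (ca a) (G a x) 0) = k"
    using geodesic_spd_sq(1)[OF g(1) ca(1)[OF a(1)], of 0] ca(2)[OF a(1)] G_ends[OF a] k(1)[of 0] by simp
  then show ?thesis using False tiso_norm[OF a(1)] g(2) k(2) G_ends[OF a] by (simp add: lg_def)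
qed

text \<open>Equal initial velocities force equal geodesics, hence equal end points.\<close>

lemma lg_inj: assumes a: "a \<in> points M" "x \<in> points M" "dd a x < 2 * r" and y: "y \<in> points M" "dd a y < 2 * r"
  and eq: "lg a x = lg a y" shows "x = y"
proof (cases "x = a \<or> y = a")
  case True
  then have "lg a x = 0"
  proof
    assume "y = a" then have "lg a y = 0" by (simp add: lg_def)
    then show ?thesis using eq by simp
  qed (simp add: lg_def)
  then have "dd a x = 0" "dd a y = 0" using lg_norm[OF a] lg_norm[OF a(1) y] eq by simp_all
  then have "a = x" "a = y"
    using Metric_space.zero[OF dd_metric a(1,2)] Metric_space.zero[OF dd_metric a(1) y(1)] by blast+
  then show ?thesis by simp
next
  case False
  then have ne: "a \<noteq> x" "a \<noteq> y" by auto
  have "tiso a (vel (ca a) (G a x) 0) = tiso a (vel (ca a) (G a y) 0)" using eq False by (simp add: lg_def)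
  then have v: "vel (ca a) (G a x) 0 = vel (ca a) (G a y) 0" by (rule tiso_inj[OF a(1)])
  have z: "G a x 0 = G a y 0" "G a x 0 \<in> chart_dom (ca a)"
    using G_ends(1)[OF a] G_ends(1)[OF a(1) y] ca(2)[OF a(1)] by simp_all
  have "G a x 1 = G a y 1"
    by (rule geodesic_unique[OF G_geod(1)[OF a(1,2) ne(1) a(3)] G_geod(1)[OF a(1) y(1) ne(2) y(2)] z(1) ca(1)[OF a(1)] z(2) v]) simp
  then show ?thesis using G_ends[OF a] G_ends[OF a(1) y] by simp
qed

text \<open>Seen from one of its points, a geodesic lies on a straight line through the origin: the
  geodesics from that point to the others are reparametrised pieces of the given one, so their
  initial velocities are multiples of its velocity there.\<close>

lemma lg_sub: assumes a: "x \<in> points M" "y \<in> points M" "x \<noteq> y" "dd x y < 2 * r" and st: "s \<in> {0..1}" "t \<in> {0..1}"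
  shows "lg (G x y s) (G x y t) = (t - s) *\<^sub>R tiso (G x y s) (vel (ca (G x y s)) (G x y) s)"
proof (cases "s = t")
  case True then show ?thesis by (simp add: lg_def)
next
  case False
  let ?m = "G x y s"
  have pts: "?m \<in> points M" "G x y t \<in> points M" using G_points[OF a(1,2,4)] st by auto
  have "dd x y > 0" using a Metric_space.mdist_pos_eq[OF dd_metric] by blast
  then have ne: "G x y t \<noteq> ?m" using G_dist[OF a(1,2,4) st] dd_self[OF pts(1)] False by auto
  have "vel (ca ?m) (G ?m (G x y t)) 0 = vel (ca ?m) (\<lambda>u. G x y ((t - s) * u + s)) 0"
    by (rule velocity_cong) (use G_sub[OF a(1,2,4) st] in auto)
  also have "\<dots> = (t - s) *\<^sub>R vel (ca ?m) (G x y) ((t - s) * 0 + s)"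
    by (rule geodesic_reparam(2)[OF G_geod(1)[OF a] reparam_in[OF st]]) (use ca[OF pts(1)] in auto)
  finally show ?thesis using ne linear_cmul[OF bounded_linear.linear[OF tiso_linear]] by (simp add: lg_def)
qed

lemma lg_ray: assumes a: "a \<in> points M" "x \<in> points M" "dd a x < 2 * r" and t: "t \<in> {0..1}"
  shows "lg a (G a x t) = t *\<^sub>R lg a x"
proof (cases "x = a")
  case True then show ?thesis by (simp add: lg_def)
next
  case False
  have "lg a (G a x t) = (t - 0) *\<^sub>R tiso a (vel (ca a) (G a x) 0)"
    using lg_sub[OF a(1,2) False[symmetric] a(3), of 0 t] G_ends[OF a] t by simp
  then show ?thesis using False by (simp add: lg_def)
qed

text \<open>From an inner point of a geodesic the two ends appear in opposite directions. Multiplied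
  out, the relation needs no exception at \<open>t = 0\<close> and \<open>t = 1\<close>.\<close>

lemma lg_opp: assumes a: "x \<in> points M" "y \<in> points M" "dd x y < 2 * r" and t: "t \<in> {0..1}"
  shows "t *\<^sub>R lg (G x y t) y = - ((1 - t) *\<^sub>R lg (G x y t) x)"
proof (cases "x = y")
  case True then show ?thesis by (simp add: lg_def)
next
  case False
  show ?thesis
    using lg_sub[OF a(1,2) False a(3) t, of 1] lg_sub[OF a(1,2) False a(3) t, of 0] G_ends[OF a] by simp
qed

text \<open>\<open>\<phi>\<close> is the chart at \<open>a\<close> followed by the isometry
  \<open>tiso a\<close>. Since neither \<open>\<phi>\<close> nor \<open>C\<close> depends on
  \<open>x\<close>, the continuity of \<open>lg a\<close> can be derived from that of
  \<open>\<phi>\<close>.\<close>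

lemma lg_approx: assumes a: "a \<in> points M"
  obtains U \<phi> t0 C where "continuous_map (subtopology (surf M) U) euclidean (\<phi> :: 'a \<Rightarrow> complex)" "0 < t0" "t0 \<le> 1"
    "openin (surf M) U"
    "\<And>x t. x \<in> points M \<Longrightarrow> dd a x < 2 * r \<Longrightarrow> t \<in> {0..t0} \<Longrightarrow> G a x t \<in> U \<and> cmod (\<phi> (G a x t) - t *\<^sub>R lg a x) \<le> C * t\<^sup>2"
proof -
  note c = ca[OF a]
  obtain t0 C where t0: "0 < t0" "t0 \<le> 1" "C \<ge> 0" and T:
    "\<And>\<gamma> t. geodesic M \<gamma> \<Longrightarrow> \<gamma> 0 = a \<Longrightarrow> curve_length M \<gamma> \<le> 2 * r \<Longrightarrow> t \<in> {0..t0} \<Longrightarrow>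
       \<gamma> t \<in> chart_dom (ca a) \<and> norm (coords (ca a) (\<gamma> t) - coords (ca a) a - t *\<^sub>R vel (ca a) \<gamma> 0) \<le> C * t\<^sup>2"
    using geodesic_taylor[OF c, of "2 * r"] r0 by (metis mult_pos_pos zero_less_numeral)
  obtain B where B: "B \<ge> 0" "\<And>v. cmod (tiso a v) \<le> norm v * B" using bounded_linear.nonneg_bounded[OF tiso_linear] by blast
  note lin = bounded_linear.linear[OF tiso_linear]
  define \<phi> where "\<phi> x = tiso a (coords (ca a) x - coords (ca a) a)" for x
  show ?thesis
  proof (rule that[of "chart_dom (ca a)" \<phi> t0 "B * C"])
    have "continuous_map euclidean euclidean (\<lambda>v. tiso a (v - coords (ca a) a))"
      by (simp add: bounded_linear.continuous_on[OF tiso_linear] continuous_on_diff)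
    from continuous_map_compose[OF coords_cont[OF c(1)] this]
    show "continuous_map (subtopology (surf M) (chart_dom (ca a))) euclidean \<phi>" by (simp add: o_def \<phi>_def[abs_def])
  next
    fix x t assume x: "x \<in> points M" "dd a x < 2 * r" and t: "t \<in> {0..t0}"
    show "G a x t \<in> chart_dom (ca a) \<and> cmod (\<phi> (G a x t) - t *\<^sub>R lg a x) \<le> B * C * t\<^sup>2"
    proof (cases "x = a")
      case True then show ?thesis using B t0 c linear_0[OF lin] by (simp add: lg_def \<phi>_def)
    next
      case False
      note g = G_geod[OF a x(1) False[symmetric] x(2)]
      have 1: "G a x t \<in> chart_dom (ca a)" "norm (coords (ca a) (G a x t) - coords (ca a) a - t *\<^sub>R vel (ca a) (G a x) 0) \<le> C * t\<^sup>2"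
        using T[OF g(1) _ _ t] G_ends[OF a x] g(2) x by auto
      have "\<phi> (G a x t) - t *\<^sub>R lg a x = tiso a (coords (ca a) (G a x t) - coords (ca a) a - t *\<^sub>R vel (ca a) (G a x) 0)"
        using False by (simp add: lg_def \<phi>_def linear_diff[OF lin] linear_cmul[OF lin])
      then have "cmod (\<phi> (G a x t) - t *\<^sub>R lg a x) \<le> norm (coords (ca a) (G a x t) - coords (ca a) a - t *\<^sub>R vel (ca a) (G a x) 0) * B"
        using B(2) by simp
      also have "\<dots> \<le> C * t\<^sup>2 * B" using 1 B by (intro mult_right_mono) auto
      finally show ?thesis using 1(1) by (simp add: mult_ac)
    qed
  qed (use t0 dom_open[OF c(1)] in auto)
qed

lemma complex_chart: assumes a: "a \<in> points M"
  obtains U h where "openin (surf M) U" "a \<in> U" "open (h ` U :: complex set)"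
    "homeomorphic_map (subtopology (surf M) U) (top_of_set (h ` U)) h"
proof -
  note c = ca[OF a]
  let ?i = "\<lambda>v::real^2. Complex (v $ 1) (v $ 2)" let ?j = "\<lambda>z. vector [Re z, Im z] :: real^2"
  have li: "linear ?i" by (rule linearI) (simp_all add: complex_eq_iff)
  have lj: "linear ?j" by (rule linearI) (simp_all add: vec_eq_iff forall_2)
  have ij: "?i (?j z) = z" "?j (?i v) = v" for z v by (simp_all add: complex_eq_iff vec_eq_iff forall_2)
  have ci: "continuous_on S ?i" "continuous_on T ?j" for S T
    using linear_continuous_on li lj linear_conv_bounded_linear by blast+
  let ?W = "chart_image (ca a)"
  have "homeomorphic_maps (top_of_set ?W) (top_of_set (?i ` ?W)) ?i ?j"
    unfolding homeomorphic_maps_def continuous_map_in_subtopology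
    using ij ci by (auto simp del: vector_2)
  then have h: "homeomorphic_map (top_of_set ?W) (top_of_set (?i ` ?W)) ?i"
    unfolding homeomorphic_map_maps by blast
  have "?i ` ?W = ?j -` ?W"
  proof
    show "?j -` ?W \<subseteq> ?i ` ?W"
    proof
      fix z assume "z \<in> ?j -` ?W"
      then show "z \<in> ?i ` ?W" using ij(1)[of z] by (intro image_eqI[of _ _ "?j z"]) auto
    qed
  qed (use ij(2) in auto)
  moreover have "open (?j -` ?W)" by (rule open_vimage[OF image_open[OF c(1)] ci(2)])
  ultimately have "open (?i ` ?W)" by simp
  moreover have "homeomorphic_map (subtopology (surf M) (chart_dom (ca a))) (top_of_set (?i ` ?W)) (?i \<circ> coords (ca a))"
    by (rule homeomorphic_map_compose[OF chart_homeo[OF c(1)] h])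
  moreover have "?i ` ?W = (?i \<circ> coords (ca a)) ` chart_dom (ca a)" by (simp add: image_comp)
  ultimately show ?thesis using that[of "chart_dom (ca a)" "?i \<circ> coords (ca a)"] dom_open[OF c(1)] c(2) by simp
qed

end

section \<open>Segments and rays\<close>

text \<open>The surface as a metric space: \<open>G x y\<close> is the minimal geodesic from \<open>x\<close> to \<open>y\<close> and \<open>lg a\<close> the
  inverse of the exponential map at \<open>a\<close>.\<close>

locale geosurf =
  fixes X :: "'a topology" and d :: "'a \<Rightarrow> 'a \<Rightarrow> real" and \<tau> :: real
    and G :: "'a \<Rightarrow> 'a \<Rightarrow> real \<Rightarrow> 'a" and lg :: "'a \<Rightarrow> 'a \<Rightarrow> complex"
  assumes metric: "Metric_space (topspace X) d"
    and mtop: "Metric_space.mtopology (topspace X) d = X"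
    and comp: "compact_space X"
    and tau: "0 < \<tau>"
    and G_mem: "\<And>x y t. x \<in> topspace X \<Longrightarrow> y \<in> topspace X \<Longrightarrow> d x y < 2 * \<tau> \<Longrightarrow> t \<in> {0..1} \<Longrightarrow> G x y t \<in> topspace X"
    and G_d: "\<And>x y s t. x \<in> topspace X \<Longrightarrow> y \<in> topspace X \<Longrightarrow> d x y < 2 * \<tau> \<Longrightarrow> s \<in> {0..1} \<Longrightarrow> t \<in> {0..1} \<Longrightarrow>
       d (G x y s) (G x y t) = \<bar>s - t\<bar> * d x y"
    and G0: "\<And>x y. x \<in> topspace X \<Longrightarrow> y \<in> topspace X \<Longrightarrow> d x y < 2 * \<tau> \<Longrightarrow> G x y 0 = x"
    and G1: "\<And>x y. x \<in> topspace X \<Longrightarrow> y \<in> topspace X \<Longrightarrow> d x y < 2 * \<tau> \<Longrightarrow> G x y 1 = y"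
    and G_sub: "\<And>x y s t u. x \<in> topspace X \<Longrightarrow> y \<in> topspace X \<Longrightarrow> d x y < 2 * \<tau> \<Longrightarrow> s \<in> {0..1} \<Longrightarrow> t \<in> {0..1} \<Longrightarrow> u \<in> {0..1} \<Longrightarrow>
       G (G x y s) (G x y t) u = G x y ((t - s) * u + s)"
    and G_convex: "\<And>a x y s t. a \<in> topspace X \<Longrightarrow> x \<in> topspace X \<Longrightarrow> y \<in> topspace X \<Longrightarrow> x \<noteq> y \<Longrightarrow> s < \<tau> \<Longrightarrow>
       d a x \<le> s \<Longrightarrow> d a y \<le> s \<Longrightarrow> 0 < t \<Longrightarrow> t < 1 \<Longrightarrow> d a (G x y t) < s"
    and lg_norm: "\<And>a x. a \<in> topspace X \<Longrightarrow> x \<in> topspace X \<Longrightarrow> d a x < 2 * \<tau> \<Longrightarrow> cmod (lg a x) = d a x"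
    and lg_inj: "\<And>a x y. a \<in> topspace X \<Longrightarrow> x \<in> topspace X \<Longrightarrow> d a x < 2 * \<tau> \<Longrightarrow> y \<in> topspace X \<Longrightarrow> d a y < 2 * \<tau> \<Longrightarrow>
       lg a x = lg a y \<Longrightarrow> x = y"
    and lg_ray: "\<And>a x t. a \<in> topspace X \<Longrightarrow> x \<in> topspace X \<Longrightarrow> d a x < 2 * \<tau> \<Longrightarrow> t \<in> {0..1} \<Longrightarrow> lg a (G a x t) = t *\<^sub>R lg a x"
    and lg_opp: "\<And>x y t. x \<in> topspace X \<Longrightarrow> y \<in> topspace X \<Longrightarrow> d x y < 2 * \<tau> \<Longrightarrow> t \<in> {0..1} \<Longrightarrow>
       t *\<^sub>R lg (G x y t) y = - ((1 - t) *\<^sub>R lg (G x y t) x)"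
    and lg_approx: "\<And>a. a \<in> topspace X \<Longrightarrow> \<exists>U (\<phi> :: 'a \<Rightarrow> complex) t0 C. continuous_map (subtopology X U) euclidean \<phi> \<and> 0 < t0 \<and> t0 \<le> 1 \<and>
       openin X U \<and> (\<forall>x t. x \<in> topspace X \<longrightarrow> d a x < 2 * \<tau> \<longrightarrow> t \<in> {0..t0} \<longrightarrow>
          G a x t \<in> U \<and> cmod (\<phi> (G a x t) - t *\<^sub>R lg a x) \<le> C * t\<^sup>2)"
    and chart: "\<And>a. a \<in> topspace X \<Longrightarrow> \<exists>U (h :: 'a \<Rightarrow> complex). openin X U \<and> a \<in> U \<and> open (h ` U) \<and>
       homeomorphic_map (subtopology X U) (top_of_set (h ` U)) h"
begin

abbreviation S :: "'a set" where "S \<equiv> topspace X"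

lemma dsym: "d x y = d y x" using Metric_space.commute[OF metric] .
lemma dnn: "0 \<le> d x y" using Metric_space.nonneg[OF metric] .
lemma d0: "x \<in> S \<Longrightarrow> y \<in> S \<Longrightarrow> d x y = 0 \<longleftrightarrow> x = y" using Metric_space.zero[OF metric] .
lemma tri: "x \<in> S \<Longrightarrow> y \<in> S \<Longrightarrow> z \<in> S \<Longrightarrow> d x z \<le> d x y + d y z" using Metric_space.triangle[OF metric] .
lemma dpos: "x \<in> S \<Longrightarrow> y \<in> S \<Longrightarrow> x \<noteq> y \<Longrightarrow> 0 < d x y" using d0 dnn[of x y] by (simp add: less_le)
lemma dself: "x \<in> S \<Longrightarrow> d x x = 0" using d0 by simp

lemma G_dl: "x \<in> S \<Longrightarrow> y \<in> S \<Longrightarrow> d x y < 2 * \<tau> \<Longrightarrow> t \<in> {0..1} \<Longrightarrow> d x (G x y t) = t * d x y"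
  using G_d[of x y 0 t] G0 by simp

lemma G_dr: "x \<in> S \<Longrightarrow> y \<in> S \<Longrightarrow> d x y < 2 * \<tau> \<Longrightarrow> t \<in> {0..1} \<Longrightarrow> d (G x y t) y = (1 - t) * d x y"
  using G_d[of x y t 1] G1 by simp

lemma G_rev: assumes "x \<in> S" "y \<in> S" "d x y < 2 * \<tau>" "t \<in> {0..1}" shows "G y x t = G x y (1 - t)"
  using G_sub[OF assms(1-3), of 1 0 t] G0[OF assms(1-3)] G1[OF assms(1-3)] assms(4) by simp

text \<open>If \<open>y\<close> differed from the point of the geodesic at the same distances from
  \<open>x\<close> and \<open>z\<close>, then by strict convexity the midpoint of the two would be
  closer to both \<open>x\<close> and \<open>z\<close> than \<open>y\<close> is, against the
  triangle inequality.\<close>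

lemma between_small: assumes x: "x \<in> S" "y \<in> S" "z \<in> S" and e: "d x y + d y z = d x z" and l: "d x y < \<tau>" "d y z < \<tau>" and ne: "x \<noteq> z"
  shows "y = G x z (d x y / d x z)"
proof (rule ccontr)
  assume n: "y \<noteq> G x z (d x y / d x z)"
  let ?t = "d x y / d x z" let ?y = "G x z (d x y / d x z)"
  have L: "d x z > 0" "d x z < 2 * \<tau>" using dpos x ne e l by auto
  have t: "?t \<in> {0..1}" using e dnn[of y z] dnn[of x y] L by (simp add: divide_simps)
  have y': "?y \<in> S" using G_mem[OF x(1,3) L(2) t] .
  have d1: "d x ?y = d x y" using G_dl[OF x(1,3) L(2) t] L by simp
  have "d ?y z = d x z - d x y" using G_dr[OF x(1,3) L(2) t] L by (simp add: left_diff_distrib)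
  then have d2: "d ?y z = d y z" using e by simp
  have "d y ?y \<le> d y x + d x ?y" using tri[OF x(2,1) y'] .
  then have yy: "d y ?y < 2 * \<tau>" using d1 l dsym[of y x] by simp
  let ?w = "G y ?y (1/2)"
  have w: "?w \<in> S" by (rule G_mem[OF x(2) y' yy]) simp
  have "d x ?w < d x y" by (rule G_convex[OF x(1,2) y' n l(1)]) (use d1 in auto)
  moreover have "d z ?w < d y z" by (rule G_convex[OF x(3,2) y' n l(2)]) (use d2 dsym in auto)
  ultimately show False using tri[OF x(1) w x(3)] e dsym[of z ?w] by simp
qed

text \<open>Convexity is available only for radii below \<open>\<tau>\<close>, so the distance is
  halved: the point \<open>?w\<close> at distance \<open>L / 2\<close> on the geodesic from
  \<open>x\<close> to \<open>y\<close> is the midpoint of \<open>x\<close> and \<open>z\<close> by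
  \<open>between_small\<close>, and a second application places \<open>y\<close> between
  \<open>?w\<close> and \<open>z\<close>.\<close>

lemma between_long: assumes x: "x \<in> S" "y \<in> S" "z \<in> S" and e: "d x y + d y z = d x z" and l: "\<tau> \<le> d x y" "d x z < 2 * \<tau>"
  shows "y = G x z (d x y / d x z)"
proof -
  define L where "L = d x z"
  have L: "0 < L" "L < 2 * \<tau>" "d x y \<le> L" "L / 2 < d x y" using e l tau dnn[of y z] by (auto simp: L_def)
  have ne: "x \<noteq> z" using L x dself by (auto simp: L_def)
  have xy: "d x y < 2 * \<tau>" using L by simp
  let ?s = "L / 2 / d x y" let ?w = "G x y (L / 2 / d x y)"
  have s: "?s \<in> {0..1}" using L by (simp add: divide_simps)
  have w: "?w \<in> S" using G_mem[OF x(1,2) xy s] .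
  have d1: "d x ?w = L / 2" using G_dl[OF x(1,2) xy s] L by simp
  have d2: "d ?w y = d x y - L / 2" using G_dr[OF x(1,2) xy s] L by (simp add: left_diff_distrib)
  have "d ?w z \<le> L / 2" using tri[OF w x(2,3)] d2 e by (simp add: L_def)
  moreover have "L \<le> L / 2 + d ?w z" using tri[OF x(1) w x(3)] d1 by (simp add: L_def)
  ultimately have d3: "d ?w z = L / 2" by simp
  have F: "?w = G x z (d x ?w / d x z)"
    by (rule between_small[OF x(1) w x(3) _ _ _ ne]) (use d1 d3 L in \<open>auto simp: L_def\<close>)
  have h: "d x ?w / d x z = 1/2" using d1 L by (simp add: L_def[symmetric])
  have wG: "?w = G x z (1/2)" using F unfolding h .
  have wz: "?w \<noteq> z" using d3 L dself[OF w] by auto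
  have "y = G ?w z (d ?w y / d ?w z)"
    by (rule between_small[OF w x(2,3) _ _ _ wz]) (use d2 d3 e L dnn[of y z] dnn[of x y] in \<open>auto simp: L_def\<close>)
  also have "\<dots> = G (G x z (1/2)) (G x z 1) (d ?w y / d ?w z)"
    using wG G1[OF x(1,3) l(2)] by simp
  also have "\<dots> = G x z ((1 - 1/2) * (d ?w y / d ?w z) + 1/2)"
    by (rule G_sub[OF x(1,3) l(2)]) (use d2 d3 L in auto)
  also have "(1 - 1/2) * (d ?w y / d ?w z) + 1/2 = d x y / d x z"
    unfolding d2 d3 using L by (simp add: L_def[symmetric] field_simps)
  finally show ?thesis .
qed

lemma between: assumes x: "x \<in> S" "y \<in> S" "z \<in> S" and e: "d x y + d y z = d x z" and l: "d x z < 2 * \<tau>" and ne: "x \<noteq> z"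
  shows "y = G x z (d x y / d x z)"
proof (cases "\<tau> \<le> d x y")
  case True then show ?thesis using between_long[OF x e _ l] by simp
next
  case 1: False
  show ?thesis
  proof (cases "\<tau> \<le> d y z")
    case False then show ?thesis using between_small[OF x e _ _ ne] 1 by simp
  next
    case True
    have "y = G z x (d z y / d z x)"
      by (rule between_long[OF x(3,2,1)]) (use e l True dsym in \<open>auto simp: add.commute\<close>)
    also have "\<dots> = G x z (1 - d z y / d z x)"
      using e dnn[of x y] dnn[of y z] dsym[of z y] dsym[of z x] dpos[OF x(1,3) ne]
      by (intro G_rev[OF x(1,3) l]) (simp add: divide_simps)
    also have "1 - d z y / d z x = d x y / d x z"
      using e dsym[of z y] dsym[of z x] dpos[OF x(1,3) ne] by (simp add: divide_simps)
    finally show ?thesis .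
  qed
qed

text \<open>Metric betweenness. Below distance \<open>2 * \<tau>\<close> it says that
  \<open>y\<close> lies on the minimal geodesic from \<open>a\<close> to \<open>x\<close>
  (\<open>bt_G\<close>, \<open>bt_obtain\<close>), without naming a parameter.\<close>

definition bt :: "'a \<Rightarrow> 'a \<Rightarrow> 'a \<Rightarrow> bool" where
  "bt a y x \<longleftrightarrow> d a y + d y x = d a x"

lemma bt_G: assumes "x \<in> S" "y \<in> S" "d x y < 2 * \<tau>" "t \<in> {0..1}" shows "bt x (G x y t) y"
  using G_dl[OF assms] G_dr[OF assms] by (simp add: bt_def algebra_simps)

lemma bt_sym: "bt a y x \<longleftrightarrow> bt x y a"
  by (auto simp: bt_def dsym add.commute)

lemma bt_le: "bt a y x \<Longrightarrow> d a y \<le> d a x" "bt a y x \<Longrightarrow> d y x \<le> d a x"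
  using dnn[of y x] dnn[of a y] unfolding bt_def by linarith+

lemma bt_obtain: assumes "a \<in> S" "y \<in> S" "x \<in> S" "d a x < 2 * \<tau>" "bt a y x"
  obtains t where "t \<in> {0..1}" "y = G a x t" "t * d a x = d a y"
proof (cases "a = x")
  case True
  then have "d a y = 0" using assms bt_le(1)[OF assms(5)] dself[of x] dnn[of a y] by simp
  then have "y = a" using d0 assms by auto
  then show ?thesis using that[of 0] G0 assms True dself by auto
next
  case False
  have p: "d a x > 0" using dpos assms False by blast
  show ?thesis
  proof (rule that[of "d a y / d a x"])
    show "d a y / d a x \<in> {0..1}" using bt_le[OF assms(5)] p dnn[of a y] by (simp add: divide_simps)
    show "y = G a x (d a y / d a x)" using between[OF assms(1-3) _ assms(4) False] assms(5) by (simp add: bt_def)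
  qed (use p in simp)
qed

lemma bt_lg: assumes "a \<in> S" "y \<in> S" "x \<in> S" "d a x < 2 * \<tau>" "bt a y x"
  obtains t where "t \<in> {0..1}" "lg a y = t *\<^sub>R lg a x" "t * d a x = d a y"
  using bt_obtain[OF assms] lg_ray[OF assms(1,3,4)] by metis

text \<open>A converse to \<open>bt_lg\<close>: the point of the geodesic with the same tangent
  vector as \<open>y\<close> is \<open>y\<close> itself by \<open>lg_inj\<close>.\<close>

lemma lg_bt: assumes "a \<in> S" "y \<in> S" "x \<in> S" "d a x < 2 * \<tau>" "d a y \<le> d a x" "lg a y = k *\<^sub>R lg a x" "0 \<le> k"
  shows "bt a y x"
proof (cases "a = x")
  case True
  then have "d a y = 0" using assms dself dnn[of a y] by simp
  then show ?thesis using True d0 assms dself by (auto simp: bt_def)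
next
  case False
  have p: "d a x > 0" using dpos assms False by blast
  have n: "d a y = k * d a x" using lg_norm[of a y] lg_norm[of a x] assms by simp
  then have k: "k \<in> {0..1}" using assms p by (simp add: mult_le_cancel_right1)
  have "y = G a x k" by (rule lg_inj[of a]) (use assms G_mem[OF assms(1,3,4) k] G_dl[OF assms(1,3,4) k] lg_ray[OF assms(1,3,4) k] n in auto)
  then show ?thesis using bt_G[OF assms(1,3,4) k] by simp
qed

text \<open>Through the common point \<open>n\<close> the tangent vectors of \<open>x\<close> and
  \<open>y\<close> at \<open>a\<close> are positive multiples of each other, and they have equal
  norms.\<close>

lemma same_ray: assumes "a \<in> S" "x \<in> S" "y \<in> S" "d a x < 2 * \<tau>" "d a y = d a x" "n \<in> S" "n \<noteq> a" "bt a n x" "bt a n y"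
  shows "x = y"
proof -
  obtain t where t: "lg a n = t *\<^sub>R lg a x" "t * d a x = d a n" using bt_lg[OF assms(1,6,2,4,8)] by metis
  obtain s where s: "lg a n = s *\<^sub>R lg a y" "s * d a y = d a n" using bt_lg[OF assms(1,6,3) _ assms(9)] assms(4,5) by metis
  have p: "d a n > 0" using assms dpos by blast
  then have "d a x \<noteq> 0" using t by auto
  moreover have "s * d a x = t * d a x" using s(2) t(2) assms(5) by simp
  ultimately have "s = t" by simp
  have "t \<noteq> 0" using t(2) p by auto
  moreover have "t *\<^sub>R lg a x = t *\<^sub>R lg a y" using s(1) t(1) \<open>s = t\<close> by simp
  ultimately have eq: "lg a x = lg a y" by simp
  have "d a y < 2 * \<tau>" using assms(4,5) by simp
  from lg_inj[OF assms(1,2,4,3) this eq] show ?thesis .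
qed

text \<open>The exchange argument that keeps the radii of two Delaunay disks apart.\<close>

lemma radii_disjoint:
  assumes m: "a \<in> S" "b \<in> S" "p \<in> S" "q \<in> S" "n \<in> S"
    and n: "bt a n p" "bt b n q" and le: "d a p \<le> d a q" "d b q \<le> d b p" and sm: "d a p < 2 * \<tau>" "d b q < 2 * \<tau>"
  shows "p = q \<or> a = b"
proof (rule ccontr)
  assume c: "\<not> (p = q \<or> a = b)"
  have 1: "d n p \<le> d n q" using n le tri[OF m(1,5,4)] by (simp add: bt_def)
  have 2: "d n q \<le> d n p" using n le tri[OF m(2,5,3)] by (simp add: bt_def)
  have e: "d n p = d n q" using 1 2 by simp
  have ea: "d a q = d a p" using n e le tri[OF m(1,5,4)] by (simp add: bt_def)
  have eb: "d b p = d b q" using n e le tri[OF m(2,5,3)] by (simp add: bt_def)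
  have "n = a" using same_ray[OF m(1,3,4) sm(1) ea m(5)] n(1) e ea c by (auto simp: bt_def)
  moreover have "n = b" using same_ray[OF m(2,4,3) sm(2) eb m(5)] n(2) e eb c by (auto simp: bt_def)
  ultimately show False using c by simp
qed

section \<open>Continuity of geodesics and of tangent vectors in the end point\<close>

lemma openin_d: "openin X U \<longleftrightarrow> U \<subseteq> S \<and> (\<forall>x\<in>U. \<exists>r>0. \<forall>y\<in>S. d x y < r \<longrightarrow> y \<in> U)"
proof -
  have "openin X U \<longleftrightarrow> U \<subseteq> S \<and> (\<forall>x. x \<in> U \<longrightarrow> (\<exists>r>0. Metric_space.mball S d x r \<subseteq> U))"
    using Metric_space.openin_mtopology[OF metric, of U] mtop by simp
  also have "\<dots> \<longleftrightarrow> U \<subseteq> S \<and> (\<forall>x\<in>U. \<exists>r>0. \<forall>y\<in>S. d x y < r \<longrightarrow> y \<in> U)"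
    unfolding Metric_space.mball_def[OF metric] by blast
  finally show ?thesis .
qed

lemma dist_abs: assumes "a \<in> S" "x \<in> S" "y \<in> S" shows "\<bar>d a x - d a y\<bar> \<le> d x y"
  using tri[of a y x] tri[of a x y] dsym[of x y] assms by linarith

lemma openin_dball: assumes "a \<in> S" shows "openin X {x\<in>S. d a x < r}"
  unfolding openin_d
proof (intro conjI ballI)
  fix x assume x: "x \<in> {x\<in>S. d a x < r}"
  then show "\<exists>e>0. \<forall>y\<in>S. d x y < e \<longrightarrow> y \<in> {x\<in>S. d a x < r}"
    using tri[of a x] assms by (intro exI[of _ "r - d a x"]) fastforce
qed auto

lemma cont_from: fixes f :: "'a \<Rightarrow> 'b::metric_space"
  assumes U: "U \<subseteq> S"
  shows "continuous_map (subtopology X U) euclidean f \<longleftrightarrow> (\<forall>x\<in>U. \<forall>e>0. \<exists>r>0. \<forall>y\<in>U. d x y < r \<longrightarrow> dist (f x) (f y) < e)"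
proof
  assume c: "continuous_map (subtopology X U) euclidean f"
  show "\<forall>x\<in>U. \<forall>e>0. \<exists>r>0. \<forall>y\<in>U. d x y < r \<longrightarrow> dist (f x) (f y) < e"
  proof (intro ballI allI impI)
    fix x and e :: real assume x: "x \<in> U" and e: "e > 0"
    have "openin (subtopology X U) {y \<in> topspace (subtopology X U). f y \<in> ball (f x) e}"
      by (rule openin_continuous_map_preimage[OF c]) auto
    then obtain T where T: "openin X T" "{y \<in> topspace (subtopology X U). f y \<in> ball (f x) e} = T \<inter> U"
      unfolding openin_subtopology by auto
    have "x \<in> T \<inter> U" unfolding T(2)[symmetric] using x e U by auto
    then obtain r where r: "r > 0" "\<And>y. y \<in> S \<Longrightarrow> d x y < r \<Longrightarrow> y \<in> T" using T(1) unfolding openin_d by blast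
    have "dist (f x) (f y) < e" if "y \<in> U" "d x y < r" for y
    proof -
      have "y \<in> T \<inter> U" using r(2) that U by auto
      then show ?thesis unfolding T(2)[symmetric] by auto
    qed
    then show "\<exists>r>0. \<forall>y\<in>U. d x y < r \<longrightarrow> dist (f x) (f y) < e" using r(1) by blast
  qed
next
  assume c: "\<forall>x\<in>U. \<forall>e>0. \<exists>r>0. \<forall>y\<in>U. d x y < r \<longrightarrow> dist (f x) (f y) < e"
  show "continuous_map (subtopology X U) euclidean f"
    unfolding continuous_map_def
  proof (intro conjI allI impI)
    fix V :: "'b set" assume V: "openin euclidean V"
    define T where "T = {y\<in>S. \<exists>x\<in>U. \<exists>r>0. d x y < r \<and> (\<forall>z\<in>U. d x z < r \<longrightarrow> f z \<in> V)}"
    have "openin X T" unfolding openin_d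
    proof (intro conjI ballI)
      fix y assume "y \<in> T"
      then obtain x r where x: "y \<in> S" "x \<in> U" "r > 0" "d x y < r" "\<forall>z\<in>U. d x z < r \<longrightarrow> f z \<in> V" by (auto simp: T_def)
      have "z \<in> T" if "z \<in> S" "d y z < r - d x y" for z
      proof -
        have "d x z < r" using tri[of x y z] x(1,2) U that by auto
        then show ?thesis using x(2,3,5) that(1) unfolding T_def by blast
      qed
      then show "\<exists>r>0. \<forall>z\<in>S. d y z < r \<longrightarrow> z \<in> T" using x(4) by (intro exI[of _ "r - d x y"]) auto
    qed (auto simp: T_def)
    moreover have "{x \<in> topspace (subtopology X U). f x \<in> V} = T \<inter> U"
    proof (intro equalityI subsetI)
      fix x assume x: "x \<in> {x \<in> topspace (subtopology X U). f x \<in> V}"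
      then have xU: "x \<in> U" "x \<in> S" "f x \<in> V" by auto
      have "open V" using V by simp
      then obtain e where e: "e > 0" "ball (f x) e \<subseteq> V" using xU(3) open_contains_ball by blast
      then obtain r where r: "r > 0" "\<forall>y\<in>U. d x y < r \<longrightarrow> dist (f x) (f y) < e" using c xU(1) by blast
      then have "\<forall>z\<in>U. d x z < r \<longrightarrow> f z \<in> V" using e(2) by auto
      moreover have "d x x < r" using r(1) dself[OF xU(2)] by simp
      ultimately have "x \<in> T" unfolding T_def using r(1) xU by blast
      then show "x \<in> T \<inter> U" using xU by simp
    next
      fix x assume "x \<in> T \<inter> U"
      then show "x \<in> {x \<in> topspace (subtopology X U). f x \<in> V}" using U by (auto simp: T_def)
    qed
    ultimately show "openin (subtopology X U) {x \<in> topspace (subtopology X U). f x \<in> V}"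
      unfolding openin_subtopology by auto
  qed auto
qed

lemma cont_into: fixes f :: "'b::metric_space \<Rightarrow> 'a"
  assumes "\<And>x. x \<in> T \<Longrightarrow> f x \<in> S"
   and "\<And>x e. x \<in> T \<Longrightarrow> e > 0 \<Longrightarrow> \<exists>r>0. \<forall>y\<in>T. dist y x < r \<longrightarrow> d (f x) (f y) < e"
  shows "continuous_map (top_of_set T) X f"
  unfolding continuous_map_def
proof (intro conjI allI impI)
  fix U assume U: "openin X U"
  show "openin (top_of_set T) {x \<in> topspace (top_of_set T). f x \<in> U}"
    unfolding openin_euclidean_subtopology_iff
  proof (intro conjI ballI)
    fix x assume x: "x \<in> {x \<in> topspace (top_of_set T). f x \<in> U}"
    then obtain e where e: "e > 0" "\<And>y. y \<in> S \<Longrightarrow> d (f x) y < e \<Longrightarrow> y \<in> U" using U unfolding openin_d by auto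
    from assms(2)[OF _ e(1), of x] x obtain r where "r > 0" "\<forall>y\<in>T. dist y x < r \<longrightarrow> d (f x) (f y) < e" by auto
    then show "\<exists>r>0. \<forall>x'\<in>T. dist x' x < r \<longrightarrow> x' \<in> {x \<in> topspace (top_of_set T). f x \<in> U}"
      using e(2) assms(1) by auto
  qed auto
qed (use assms in auto)

lemma dist_cont: assumes "a \<in> S" shows "continuous_map X euclideanreal (d a)"
proof -
  have "continuous_map (subtopology X S) euclideanreal (d a)"
    unfolding cont_from[OF subset_refl]
  proof (intro ballI allI impI)
    fix x and e :: real assume x: "x \<in> S" and e: "e > 0"
    have "dist (d a x) (d a y) < e" if "y \<in> S" "d x y < e" for y
      using dist_abs[OF assms x that(1)] that(2) by (simp add: dist_real_def)
    then show "\<exists>r>0. \<forall>y\<in>S. d x y < r \<longrightarrow> dist (d a x) (d a y) < e" using e by blast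
  qed
  then show ?thesis by simp
qed

lemma seq_compact: assumes "\<And>n::nat. f n \<in> S"
  obtains l and s :: "nat \<Rightarrow> nat" where "l \<in> S" "strict_mono s" "\<And>e. e > 0 \<Longrightarrow> \<exists>N. \<forall>n\<ge>N. d l (f (s n)) < e"
proof -
  have "compactin X S" using comp by (simp add: compact_space_def)
  then obtain l s where l: "l \<in> S" "strict_mono s" "limitin X (f \<circ> s) l sequentially"
    using Metric_space.compactin_sequentially[OF metric, of S] assms unfolding mtop by blast
  have "\<exists>N. \<forall>n\<ge>N. d l (f (s n)) < e" if "e > 0" for e
    using l(3) Metric_space.limit_metric_sequentially[OF metric, of "f \<circ> s" l] that unfolding mtop
    by (simp add: dsym[of l]) blast
  then show ?thesis using that l by blast
qed

text \<open>By compactness: a limit of the points \<open>G a y t\<close> has the distances from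
  \<open>a\<close> and \<open>x\<close> that, by \<open>between\<close>, only \<open>G a x t\<close>
  has.\<close>

lemma G_cont: assumes a: "a \<in> S" "x \<in> S" "d a x < 2 * \<tau>" and t: "t \<in> {0..1}" and e: "e > 0"
  shows "\<exists>r>0. \<forall>y\<in>S. d x y < r \<longrightarrow> d a y < 2 * \<tau> \<longrightarrow> d (G a x t) (G a y t) < e"
proof (rule ccontr)
  assume n: "\<not> ?thesis"
  have "\<exists>y\<in>S. d x y < 1 / Suc n \<and> d a y < 2 * \<tau> \<and> \<not> d (G a x t) (G a y t) < e" for n
  proof -
    have "(0::real) < 1 / Suc n" by simp
    then show ?thesis using n by blast
  qed
  then obtain y where y: "\<And>n. y n \<in> S" "\<And>n. d x (y n) < 1 / Suc n" "\<And>n. d a (y n) < 2 * \<tau>" "\<And>n. \<not> d (G a x t) (G a (y n) t) < e"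
    by metis
  have zS: "G a (y n) t \<in> S" for n using G_mem[OF a(1) y(1,3) t] .
  obtain l and s :: "nat \<Rightarrow> nat" where l: "l \<in> S" "strict_mono s" "\<And>e. e > 0 \<Longrightarrow> \<exists>N. \<forall>n\<ge>N. d l (G a (y (s n)) t) < e"
    using seq_compact[of "\<lambda>n. G a (y n) t"] zS by metis
  have approx: "\<exists>z w. z \<in> S \<and> w \<in> S \<and> d x z < \<epsilon> \<and> d l w < \<epsilon> \<and> d a w = t * d a z \<and> d w z = (1 - t) * d a z \<and> \<not> d (G a x t) w < e"
    if ep: "\<epsilon> > 0" for \<epsilon>
  proof -
    obtain N where N: "\<forall>n\<ge>N. d l (G a (y (s n)) t) < \<epsilon>" using l(3)[OF ep] by blast
    obtain K where K: "1 / Suc K < \<epsilon>" using ep by (metis nat_approx_posE)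
    let ?n = "s (max N K)"
    have "K \<le> ?n" using seq_suble[OF l(2), of "max N K"] by linarith
    then have "1 / real (Suc ?n) \<le> 1 / Suc K" by (simp add: frac_le)
    then have "d x (y ?n) < \<epsilon>" using y(2)[of ?n] K by linarith
    then show ?thesis using y(1)[of ?n] zS[of ?n] N G_dl[OF a(1) y(1,3) t, of ?n] G_dr[OF a(1) y(1,3) t, of ?n] y(4)[of ?n]
      by (intro exI[of _ "y ?n"] exI[of _ "G a (y ?n) t"]) auto
  qed
  have lim: "\<bar>d a l - t * d a x\<bar> \<le> \<epsilon> \<and> \<bar>d l x - (1 - t) * d a x\<bar> \<le> \<epsilon>" if ep: "\<epsilon> > 0" for \<epsilon>
  proof -
    obtain z w where zw: "z \<in> S" "w \<in> S" "d x z < \<epsilon> / 3" "d l w < \<epsilon> / 3" "d a w = t * d a z" "d w z = (1 - t) * d a z"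
      using approx[of "\<epsilon> / 3"] ep by auto
    have 1: "\<bar>d a x - d a z\<bar> \<le> \<epsilon> / 3" using dist_abs[OF a(1,2) zw(1)] zw by simp
    have "t * \<bar>d a x - d a z\<bar> \<le> 1 * (\<epsilon> / 3)" by (rule mult_mono) (use 1 t in auto)
    moreover have "(1 - t) * \<bar>d a x - d a z\<bar> \<le> 1 * (\<epsilon> / 3)" by (rule mult_mono) (use 1 t in auto)
    ultimately have 2: "\<bar>t * d a x - t * d a z\<bar> \<le> \<epsilon> / 3" "\<bar>(1 - t) * d a x - (1 - t) * d a z\<bar> \<le> \<epsilon> / 3"
      using t by (simp_all add: abs_mult flip: right_diff_distrib)
    have 3: "\<bar>d a l - d a w\<bar> \<le> d l w" using dist_abs[OF a(1) l(1) zw(2)] .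
    have 4: "\<bar>d l x - d w z\<bar> \<le> d l w + d x z"
      using dist_abs[OF l(1) a(2) zw(1)] dist_abs[OF zw(1) l(1) zw(2)] dsym[of z l] dsym[of z w] by linarith
    show ?thesis using 2 3 4 zw by linarith
  qed
  have e1: "d a l = t * d a x" "d l x = (1 - t) * d a x"
    using lim by (metis abs_le_zero_iff field_le_epsilon add_0 diff_eq_eq eq_iff_diff_eq_0)+
  have lG: "l = G a x t"
  proof (cases "a = x")
    case True
    then have "d a l = 0" using e1 dself a by simp
    then have "l = a" using d0 a l by auto
    moreover have "d a (G a x t) = 0" using G_dl[OF a t] True dself a by simp
    ultimately show ?thesis using d0 a G_mem[OF a t] by auto
  next
    case False
    have "bt a l x" using e1 by (simp add: bt_def algebra_simps)
    then have "l = G a x (d a l / d a x)" using between[OF a(1) l(1) a(2) _ a(3) False] by (simp add: bt_def)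
    then show ?thesis using e1 dpos[OF a(1,2) False] by simp
  qed
  obtain z w where "d l w < e" "\<not> d (G a x t) w < e" using approx[OF e] by blast
  then show False using lG by simp
qed

definition B :: "'a \<Rightarrow> 'a set" where "B a = {x\<in>S. d a x < 2 * \<tau>}"

lemma B_iff: "x \<in> B a \<longleftrightarrow> x \<in> S \<and> d a x < 2 * \<tau>" by (auto simp: B_def)

text \<open>Up to an error of order \<open>t\<close>, uniform in \<open>x\<close>, the vector
  \<open>lg a x\<close> is \<open>\<phi> (G a x t) / t\<close>, which is continuous in
  \<open>x\<close> for fixed \<open>t\<close> by \<open>G_cont\<close>.\<close>

lemma lg_cont: assumes a: "a \<in> S" shows "continuous_map (subtopology X (B a)) euclidean (lg a)"
proof -
  have BS: "B a \<subseteq> S" by (auto simp: B_def)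
  show ?thesis unfolding cont_from[OF BS]
  proof (intro ballI allI impI)
    fix x and e :: real assume x: "x \<in> B a" and e: "e > 0"
    obtain U and \<phi> :: "'a \<Rightarrow> complex" and t0 C where \<phi>: "continuous_map (subtopology X U) euclidean \<phi>" and t0: "0 < t0" "t0 \<le> 1" and U: "openin X U"
      and ap: "\<And>x t. x \<in> S \<Longrightarrow> d a x < 2 * \<tau> \<Longrightarrow> t \<in> {0..t0} \<Longrightarrow> G a x t \<in> U \<and> cmod (\<phi> (G a x t) - t *\<^sub>R lg a x) \<le> C * t\<^sup>2"
      using lg_approx[OF a] by blast
    define K where "K = \<bar>C\<bar> + 1"
    have K: "K > 0" "C \<le> K" by (auto simp: K_def)
    \<comment> \<open>After division by \<open>t\<close> the two approximation errors add up to at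
      most \<open>2 * K * t\<close>, which this choice makes at most \<open>e / 2\<close>.\<close>
    define t where "t = min t0 (e / (4 * K))"
    have t: "0 < t" "t \<le> t0" "t \<le> e / (4 * K)" using t0 e K by (simp_all add: t_def)
    then have t: "0 < t" "t \<le> t0" "t \<le> 1" "4 * K * t \<le> e" using t0 K by (simp_all add: field_simps)
    have t1: "t \<in> {0..t0}" "t \<in> {0..1}" using t by auto
    have ap': "G a x t \<in> U" "cmod (\<phi> (G a x t) - t *\<^sub>R lg a x) \<le> K * t\<^sup>2" if "x \<in> B a" for x
    proof -
      have "C * t\<^sup>2 \<le> K * t\<^sup>2" using K by (intro mult_right_mono) auto
      then show "G a x t \<in> U" "cmod (\<phi> (G a x t) - t *\<^sub>R lg a x) \<le> K * t\<^sup>2"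
        using ap[of x t] that t1 by (auto simp: B_iff)
    qed
    have "t * e / 2 > 0" using t e by simp
    then obtain r1 where r1: "r1 > 0" "\<And>z. z \<in> U \<Longrightarrow> d (G a x t) z < r1 \<Longrightarrow> dist (\<phi> (G a x t)) (\<phi> z) < t * e / 2"
      using \<phi> ap'(1)[OF x] unfolding cont_from[OF openin_subset[OF U]] by blast
    obtain r where r: "r > 0" "\<And>y. y \<in> S \<Longrightarrow> d x y < r \<Longrightarrow> d a y < 2 * \<tau> \<Longrightarrow> d (G a x t) (G a y t) < r1"
      using G_cont[OF a _ _ t1(2) r1(1), of x] x unfolding B_iff by blast
    have "dist (lg a x) (lg a y) < e" if y: "y \<in> B a" "d x y < r" for y
    proof -
      have 1: "cmod (\<phi> (G a x t) - \<phi> (G a y t)) < t * e / 2"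
        using r1(2)[OF ap'(1)[OF y(1)] r(2)] y by (auto simp: B_iff dist_norm)
      have "t * cmod (lg a x - lg a y) = cmod ((\<phi> (G a x t) - \<phi> (G a y t)) - (\<phi> (G a x t) - t *\<^sub>R lg a x) + (\<phi> (G a y t) - t *\<^sub>R lg a y))"
      proof -
        have "(\<phi> (G a x t) - \<phi> (G a y t)) - (\<phi> (G a x t) - t *\<^sub>R lg a x) + (\<phi> (G a y t) - t *\<^sub>R lg a y) = t *\<^sub>R (lg a x - lg a y)"
          by (simp add: algebra_simps)
        then show ?thesis using t by simp
      qed
      also have "\<dots> \<le> cmod (\<phi> (G a x t) - \<phi> (G a y t)) + cmod (\<phi> (G a x t) - t *\<^sub>R lg a x) + cmod (\<phi> (G a y t) - t *\<^sub>R lg a y)"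
        by (intro norm_triangle_le add_mono norm_triangle_ineq4 order_refl)
      also have "\<dots> < t * e / 2 + K * t\<^sup>2 + K * t\<^sup>2" using 1 ap'(2)[OF x] ap'(2)[OF y(1)] by linarith
      also have "\<dots> = t * (e / 2 + 2 * K * t)" by (simp add: power2_eq_square algebra_simps)
      also have "\<dots> \<le> t * e" using t by (intro mult_left_mono) auto
      finally show ?thesis using t by (simp add: dist_norm)
    qed
    then show "\<exists>r>0. \<forall>y\<in>B a. d x y < r \<longrightarrow> dist (lg a x) (lg a y) < e" using r(1) by blast
  qed
qed

text \<open>Invariance of domain is local, so a chart around each image point transfers it from the
  plane.\<close>

lemma invariance_of_domain_X: fixes f :: "complex \<Rightarrow> 'a"
  assumes f: "continuous_map (top_of_set W) X f" and W: "open W" and inj: "inj_on f W"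
  shows "openin X (f ` W)"
proof (subst openin_subopen, intro ballI)
  fix y assume "y \<in> f ` W"
  then obtain z where z: "z \<in> W" "y = f z" by blast
  have yS: "y \<in> S" using f z by (auto simp: continuous_map_def Pi_iff)
  obtain U and h :: "'a \<Rightarrow> complex" where U: "openin X U" "y \<in> U" "open (h ` U)" and h: "homeomorphic_map (subtopology X U) (top_of_set (h ` U)) h"
    using chart[OF yS] by blast
  have US: "topspace (subtopology X U) = U" using U(1) openin_subset by fastforce
  have hc: "continuous_map (subtopology X U) euclidean h"
    using homeomorphic_imp_continuous_map[OF h] continuous_map_into_fulltopology by blast
  have hi: "inj_on h U" using homeomorphic_imp_injective_map[OF h] US by simp
  define V where "V = {w\<in>W. f w \<in> U}"
  have "openin (top_of_set W) V" unfolding V_def using openin_continuous_map_preimage[OF f U(1)] by simp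
  then have V: "open V" "V \<subseteq> W" using W openin_open_eq by (auto simp: V_def)
  have "continuous_map (top_of_set V) (subtopology X U) f"
    using f V(2) by (auto simp: continuous_map_in_subtopology V_def intro: continuous_map_from_subtopology_mono)
  from continuous_map_compose[OF this hc] have "continuous_on V (h \<circ> f)" by simp
  moreover have "inj_on (h \<circ> f) V" using inj hi V(2) by (intro comp_inj_on) (auto simp: V_def inj_on_def)
  ultimately have o: "open ((h \<circ> f) ` V)" using V(1) by (intro invariance_of_domain)
  have "openin (subtopology X U) {x \<in> topspace (subtopology X U). h x \<in> (h \<circ> f) ` V}"
    by (rule openin_continuous_map_preimage[OF hc]) (use o in simp)
  moreover have "{x \<in> topspace (subtopology X U). h x \<in> (h \<circ> f) ` V} = f ` V"
    using hi US by (auto simp: V_def inj_on_def)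
  ultimately have "openin X (f ` V)" using openin_trans_full U(1) by metis
  moreover have "y \<in> f ` V" using z U(2) by (auto simp: V_def)
  ultimately show "\<exists>T. openin X T \<and> y \<in> T \<and> T \<subseteq> f ` W" using V(2) by blast
qed

lemma lg_inj_on: "a \<in> S \<Longrightarrow> inj_on (lg a) (B a)"
  by (rule inj_onI) (use lg_inj in \<open>auto simp: B_iff\<close>)

lemma lg_open: assumes a: "a \<in> S" and V: "V \<subseteq> B a" "openin X V" shows "open (lg a ` V)"
proof (subst open_subopen, intro ballI)
  fix y assume "y \<in> lg a ` V"
  then obtain x where x: "x \<in> V" "y = lg a x" by blast
  have xS: "x \<in> S" using x V by (auto simp: B_def)
  obtain U and h :: "'a \<Rightarrow> complex" where U: "openin X U" "x \<in> U" "open (h ` U)" and h: "homeomorphic_map (subtopology X U) (top_of_set (h ` U)) h"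
    using chart[OF xS] by blast
  have US: "topspace (subtopology X U) = U" using U(1) openin_subset by fastforce
  obtain k where k: "homeomorphic_maps (subtopology X U) (top_of_set (h ` U)) h k"
    using h homeomorphic_map_maps by blast
  then have kc: "continuous_map (top_of_set (h ` U)) (subtopology X U) k" and kh: "\<And>z. z \<in> U \<Longrightarrow> k (h z) = z"
    using US by (auto simp: homeomorphic_maps_def)
  have "openin (subtopology X U) (U \<inter> V)" using V(2) by (rule openin_subtopology_Int2)
  then have "openin (top_of_set (h ` U)) (h ` (U \<inter> V))"
    using homeomorphic_imp_open_map[OF h] by (simp add: open_map_def)
  then have o: "open (h ` (U \<inter> V))" using U(3) openin_open_eq by blast
  have "continuous_map (top_of_set (h ` (U \<inter> V))) (subtopology X (B a)) k"
    unfolding continuous_map_in_subtopology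
  proof
    show "continuous_map (top_of_set (h ` (U \<inter> V))) X k"
      by (rule continuous_map_from_subtopology_mono[OF continuous_map_into_fulltopology[OF kc]]) auto
    show "k \<in> topspace (top_of_set (h ` (U \<inter> V))) \<rightarrow> B a" using kh V(1) by auto
  qed
  from continuous_map_compose[OF this lg_cont[OF a]]
  have c: "continuous_on (h ` (U \<inter> V)) (lg a \<circ> k)" by simp
  have "inj_on (lg a \<circ> k) (h ` (U \<inter> V))"
  proof (rule inj_onI)
    fix u v assume uv: "u \<in> h ` (U \<inter> V)" "v \<in> h ` (U \<inter> V)" "(lg a \<circ> k) u = (lg a \<circ> k) v"
    then obtain x y where xy: "x \<in> U" "x \<in> V" "u = h x" "y \<in> U" "y \<in> V" "v = h y" by blast
    then have "lg a x = lg a y" using uv(3) kh by simp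
    then have "x = y" using inj_onD[OF lg_inj_on[OF a]] xy V(1) by blast
    then show "u = v" using xy by simp
  qed
  with c o have "open ((lg a \<circ> k) ` h ` (U \<inter> V))" by (intro invariance_of_domain) auto
  moreover have "(lg a \<circ> k) ` h ` (U \<inter> V) = lg a ` (U \<inter> V)" using kh by (auto simp: image_iff)
  ultimately show "\<exists>T. open T \<and> y \<in> T \<and> T \<subseteq> lg a ` V" using x U(2) by (intro exI[of _ "lg a ` (U \<inter> V)"]) auto
qed

lemma B_open: "a \<in> S \<Longrightarrow> openin X (B a)" unfolding B_def by (rule openin_dball)

lemma a_in_B: "a \<in> S \<Longrightarrow> a \<in> B a" using dself tau by (simp add: B_iff)

lemma lg_self: "a \<in> S \<Longrightarrow> lg a a = 0" using lg_norm[of a a] dself tau by simp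

text \<open>The image is open by \<open>lg_open\<close> and relatively closed because
  \<open>X\<close> is compact; the ball is connected. This provides geodesics in every direction
  with every length below \<open>2 * \<tau>\<close>.\<close>

lemma lg_image: assumes a: "a \<in> S" shows "lg a ` B a = ball 0 (2 * \<tau>)"
proof -
  let ?I = "lg a ` B a" let ?b = "ball (0::complex) (2 * \<tau>)"
  have BS: "B a \<subseteq> S" by (auto simp: B_def)
  have sub: "?I \<subseteq> ?b" using lg_norm a by (auto simp: B_iff)
  have o: "openin (top_of_set ?b) ?I" using lg_open[OF a subset_refl B_open[OF a]] sub by (simp add: openin_open_eq)
  have "closedin (top_of_set ?b) ?I"
  proof -
    have "z \<in> ?I" if z: "z \<in> ?b" and lim: "z \<in> closure ?I" for z
    proof -
      obtain f where f: "\<And>n::nat. f n \<in> ?I" "f \<longlonglongrightarrow> z" using lim closure_sequential by metis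
      have "\<exists>x. \<forall>n. x n \<in> B a \<and> f n = lg a (x n)" using f(1) by (intro choice) auto
      then obtain x where x: "\<And>n. x n \<in> B a" "\<And>n. f n = lg a (x n)" by blast
      have xS: "x n \<in> S" for n using x(1) by (simp add: B_iff)
      obtain l and s :: "nat \<Rightarrow> nat" where l: "l \<in> S" "strict_mono s" "\<And>e. e > 0 \<Longrightarrow> \<exists>N. \<forall>n\<ge>N. d l (x (s n)) < e"
        using seq_compact[of x] xS by blast
      have fz: "(f \<circ> s) \<longlonglongrightarrow> z" using LIMSEQ_subseq_LIMSEQ[OF f(2) l(2)] .
      have "(\<lambda>n. d a (x (s n))) \<longlonglongrightarrow> d a l"
      proof (rule LIMSEQ_I)
        fix e :: real assume "0 < e"
        then obtain N where "\<forall>n\<ge>N. d l (x (s n)) < e" using l(3) by blast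
        then show "\<exists>N. \<forall>n\<ge>N. norm (d a (x (s n)) - d a l) < e"
          using dist_abs[OF a l(1) xS] by (auto simp: abs_minus_commute intro!: exI[of _ N] elim!: le_less_trans[rotated])
      qed
      moreover have "(\<lambda>n. d a (x (s n))) \<longlonglongrightarrow> cmod z"
        using tendsto_norm[OF fz] x lg_norm[OF a] by (simp add: o_def B_iff)
      ultimately have "d a l = cmod z" by (rule LIMSEQ_unique)
      then have lB: "l \<in> B a" using z l(1) by (simp add: B_iff)
      have "(f \<circ> s) \<longlonglongrightarrow> lg a l"
      proof (rule LIMSEQ_I)
        fix e :: real assume "0 < e"
        then obtain r where r: "r > 0" "\<forall>y\<in>B a. d l y < r \<longrightarrow> dist (lg a l) (lg a y) < e"
          using lg_cont[OF a] lB unfolding cont_from[OF BS] by blast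
        obtain N where "\<forall>n\<ge>N. d l (x (s n)) < r" using l(3)[OF r(1)] by blast
        then show "\<exists>N. \<forall>n\<ge>N. norm ((f \<circ> s) n - lg a l) < e"
          using r(2) x by (intro exI[of _ N]) (auto simp: dist_norm norm_minus_commute)
      qed
      then have "z = lg a l" using fz LIMSEQ_unique by blast
      then show ?thesis using lB by blast
    qed
    then have "?b \<inter> closure ?I \<subseteq> ?I" by blast
    moreover have "?I \<subseteq> closure ?I" by (rule closure_subset)
    ultimately have e: "?I = ?b \<inter> closure ?I" using sub by blast
    have "closedin (top_of_set ?b) (?b \<inter> closure ?I)" by (rule closedin_closed_Int) (rule closed_closure)
    then show ?thesis using e by simp
  qed
  moreover have "connected ?b" by simp
  moreover have "?I \<noteq> {}" using a_in_B[OF a] by blast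
  ultimately show ?thesis using o unfolding connected_clopen by blast
qed

text \<open>The exponential map at \<open>a\<close>, meaningful on the ball of radius
  \<open>2 * \<tau>\<close>.\<close>

definition ex :: "'a \<Rightarrow> complex \<Rightarrow> 'a" where "ex a = inv_into (B a) (lg a)"

lemma ex: assumes a: "a \<in> S" and z: "cmod z < 2 * \<tau>"
  shows "ex a z \<in> S" "lg a (ex a z) = z" "d a (ex a z) = cmod z" "ex a z \<in> B a"
proof -
  have "z \<in> lg a ` B a" using lg_image[OF a] z by simp
  then show "lg a (ex a z) = z" "ex a z \<in> B a" unfolding ex_def by (auto intro: f_inv_into_f inv_into_into)
  then show "ex a z \<in> S" "d a (ex a z) = cmod z" using lg_norm[OF a, of "ex a z"] by (simp_all add: B_iff)
qed

lemma ex_lg: "a \<in> S \<Longrightarrow> x \<in> S \<Longrightarrow> d a x < 2 * \<tau> \<Longrightarrow> ex a (lg a x) = x"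
  unfolding ex_def by (rule inv_into_f_f[OF lg_inj_on]) (auto simp: B_iff)

lemma ex_cont: assumes a: "a \<in> S" shows "continuous_map (top_of_set (ball 0 (2 * \<tau>))) X (ex a)"
  unfolding continuous_map_def
proof (intro conjI allI impI)
  fix U assume U: "openin X U"
  have "{z \<in> topspace (top_of_set (ball 0 (2 * \<tau>))). ex a z \<in> U} = lg a ` (U \<inter> B a)"
  proof
    show "{z \<in> topspace (top_of_set (ball 0 (2 * \<tau>))). ex a z \<in> U} \<subseteq> lg a ` (U \<inter> B a)"
    proof
      fix z assume z: "z \<in> {z \<in> topspace (top_of_set (ball 0 (2 * \<tau>))). ex a z \<in> U}"
      then have "cmod z < 2 * \<tau>" by simp
      from ex[OF a this] z show "z \<in> lg a ` (U \<inter> B a)" by (intro image_eqI[of _ _ "ex a z"]) auto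
    qed
    show "lg a ` (U \<inter> B a) \<subseteq> {z \<in> topspace (top_of_set (ball 0 (2 * \<tau>))). ex a z \<in> U}"
      using ex_lg[OF a] lg_norm[OF a] by (auto simp: B_iff)
  qed
  moreover have "open (lg a ` (U \<inter> B a))" by (rule lg_open[OF a]) (use U B_open[OF a] in auto)
  ultimately show "openin (top_of_set (ball 0 (2 * \<tau>))) {z \<in> topspace (top_of_set (ball 0 (2 * \<tau>))). ex a z \<in> U}"
    using lg_image[OF a] by (auto simp: openin_open_eq)
qed (use ex[OF a] in auto)

lemma G_ex: assumes "a \<in> S" "x \<in> S" "d a x < 2 * \<tau>" "t \<in> {0..1}" shows "G a x t = ex a (t *\<^sub>R lg a x)"
proof -
  have "d a (G a x t) \<le> 1 * d a x" unfolding G_dl[OF assms] using assms(4) dnn[of a x] by (intro mult_right_mono) auto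
  then have "ex a (lg a (G a x t)) = G a x t" using G_mem[OF assms] assms by (intro ex_lg) auto
  then show ?thesis using lg_ray[OF assms] by simp
qed

end

text \<open>Both paths are prolonged along their lines to the boundary of a large square, in
  coordinates for the basis \<open>v\<close>, \<open>w\<close>. Then they join opposite sides, so
  Fashoda's theorem makes them meet. Two added segments cannot meet each other, as they lie on
  different axes away from the origin; the disjuncts list the other possibilities.\<close>

lemma rays_cross:
  fixes v w :: complex
  assumes ind: "Im (cnj v * w) \<noteq> 0" and f: "path f" and g: "path g"
    and fs: "pathstart f = - (\<beta> *\<^sub>R v)" and ff: "pathfinish f = \<alpha> *\<^sub>R v"
    and gs: "pathstart g = - (\<beta>' *\<^sub>R w)" and gf: "pathfinish g = \<alpha>' *\<^sub>R w"
    and pos: "0 < \<alpha>" "0 < \<beta>" "0 < \<alpha>'" "0 < \<beta>'"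
  shows "path_image f \<inter> path_image g \<noteq> {} \<or> (\<exists>k\<ge>\<alpha>'. k *\<^sub>R w \<in> path_image f) \<or> (\<exists>k\<ge>\<beta>'. - (k *\<^sub>R w) \<in> path_image f)
    \<or> (\<exists>k\<ge>\<alpha>. k *\<^sub>R v \<in> path_image g) \<or> (\<exists>k\<ge>\<beta>. - (k *\<^sub>R v) \<in> path_image g)"
proof -
  define D where "D = Im (cnj v * w)"
  \<comment> \<open>Cramer's rule: \<open>\<Phi>\<close> gives the coordinates in the basis
    \<open>v\<close>, \<open>w\<close>, and \<open>\<Psi>\<close> is its inverse.\<close>
  define \<Phi> :: "complex \<Rightarrow> real^2" where "\<Phi> z = vector [- Im (cnj w * z) / D, Im (cnj v * z) / D]" for z
  define \<Psi> :: "real^2 \<Rightarrow> complex" where "\<Psi> u = (u $ 1) *\<^sub>R v + (u $ 2) *\<^sub>R w" for u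
  have D: "D \<noteq> 0" using ind by (simp add: D_def)
  have \<Psi>\<Phi>: "\<Psi> (\<Phi> z) = z" for z
  proof -
    have "D * Re (\<Psi> (\<Phi> z)) = D * Re z" "D * Im (\<Psi> (\<Phi> z)) = D * Im z"
      using D by (simp_all add: \<Phi>_def \<Psi>_def field_simps) (simp_all add: D_def algebra_simps)
    then show ?thesis using D by (simp add: complex_eq_iff)
  qed
  have lin: "linear \<Phi>" by (rule linearI) (simp_all add: \<Phi>_def vec_eq_iff forall_2 algebra_simps add_divide_distrib diff_divide_distrib)
  then have cont: "continuous_on A \<Phi>" for A by (simp add: linear_continuous_on linear_conv_bounded_linear)
  have \<Phi>v: "\<Phi> (k *\<^sub>R v) = vector [k, 0]" "\<Phi> (- (k *\<^sub>R v)) = vector [-k, 0]" for k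
  proof -
    have A: "Im (cnj w * (k *\<^sub>R v)) = - (k * D)" "Im (cnj v * (k *\<^sub>R v)) = 0"
      "Im (cnj w * - (k *\<^sub>R v)) = k * D" "Im (cnj v * - (k *\<^sub>R v)) = 0" by (simp_all add: D_def algebra_simps)
    show "\<Phi> (k *\<^sub>R v) = vector [k, 0]" "\<Phi> (- (k *\<^sub>R v)) = vector [-k, 0]"
      unfolding \<Phi>_def A using D by (simp_all add: vec_eq_iff forall_2)
  qed
  have \<Phi>w: "\<Phi> (k *\<^sub>R w) = vector [0, k]" "\<Phi> (- (k *\<^sub>R w)) = vector [0, -k]" for k
  proof -
    have A: "Im (cnj v * (k *\<^sub>R w)) = k * D" "Im (cnj w * (k *\<^sub>R w)) = 0"
      "Im (cnj v * - (k *\<^sub>R w)) = - (k * D)" "Im (cnj w * - (k *\<^sub>R w)) = 0" by (simp_all add: D_def algebra_simps)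
    show "\<Phi> (k *\<^sub>R w) = vector [0, k]" "\<Phi> (- (k *\<^sub>R w)) = vector [0, -k]"
      unfolding \<Phi>_def A using D by (simp_all add: vec_eq_iff forall_2)
  qed
  let ?F = "\<Phi> \<circ> f" and ?G = "\<Phi> \<circ> g"
  have pF: "path ?F" "path ?G" using f g cont by (auto intro: path_continuous_image)
  have "bounded (path_image ?F \<union> path_image ?G)" using pF by (simp add: bounded_path_image)
  then obtain N0 where N0: "\<And>z. z \<in> path_image ?F \<union> path_image ?G \<Longrightarrow> norm z \<le> N0" unfolding bounded_iff by blast
  define N where "N = Max {N0, \<alpha>, \<beta>, \<alpha>', \<beta>'}"
  have N: "N0 \<le> N" "\<alpha> \<le> N" "\<beta> \<le> N" "\<alpha>' \<le> N" "\<beta>' \<le> N" by (simp_all add: N_def)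
  have Np: "0 < N" using N pos by linarith
  let ?v = "\<lambda>x y. vector [x, y] :: real^2"
  let ?L1 = "linepath (?v (-N) 0) (?v (-\<beta>) 0)" and ?L2 = "linepath (?v \<alpha> 0) (?v N 0)"
  let ?M1 = "linepath (?v 0 (-N)) (?v 0 (-\<beta>'))" and ?M2 = "linepath (?v 0 \<alpha>') (?v 0 N)"
  let ?f = "?L1 +++ (?F +++ ?L2)" and ?g = "?M1 +++ (?G +++ ?M2)"
  have e1: "pathstart ?F = ?v (-\<beta>) 0" "pathfinish ?F = ?v \<alpha> 0" "pathstart ?G = ?v 0 (-\<beta>')" "pathfinish ?G = ?v 0 \<alpha>'"
    using fs ff gs gf \<Phi>v \<Phi>w by (simp_all add: pathstart_compose pathfinish_compose)
  have p1: "path ?f" "path ?g" using pF e1 by simp_all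
  have im: "path_image ?f = path_image ?L1 \<union> (path_image ?F \<union> path_image ?L2)"
    "path_image ?g = path_image ?M1 \<union> (path_image ?G \<union> path_image ?M2)"
    using e1 by (simp_all add: path_image_join)
  have box: "z \<in> cbox (?v (-N) (-N)) (?v N N) \<longleftrightarrow> \<bar>z $ 1\<bar> \<le> N \<and> \<bar>z $ 2\<bar> \<le> N" for z
    by (auto simp: mem_box_cart forall_2 abs_le_iff)
  have inb: "z \<in> cbox (?v (-N) (-N)) (?v N N)" if "z \<in> path_image ?F \<union> path_image ?G" for z
    using N0[OF that] N(1) component_le_norm_cart[of z 1] component_le_norm_cart[of z 2] unfolding box by linarith
  have seg1: "\<exists>k. \<beta> \<le> k \<and> k \<le> N \<and> z = ?v (-k) 0" if h: "z \<in> path_image ?L1" for z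
  proof -
    obtain u where u: "0 \<le> u" "u \<le> 1" "z = (1 - u) *\<^sub>R ?v (-N) 0 + u *\<^sub>R ?v (-\<beta>) 0" using h by (auto simp: closed_segment_def)
    have "0 \<le> u * (N - \<beta>)" "u * (N - \<beta>) \<le> 1 * (N - \<beta>)" using u N by (simp, intro mult_right_mono) auto
    then show ?thesis by (intro exI[of _ "N - u * (N - \<beta>)"]) (auto simp: u vec_eq_iff forall_2 algebra_simps)
  qed
  have seg2: "\<exists>k. \<alpha> \<le> k \<and> k \<le> N \<and> z = ?v k 0" if h: "z \<in> path_image ?L2" for z
  proof -
    obtain u where u: "0 \<le> u" "u \<le> 1" "z = (1 - u) *\<^sub>R ?v \<alpha> 0 + u *\<^sub>R ?v N 0" using h by (auto simp: closed_segment_def)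
    have "0 \<le> u * (N - \<alpha>)" "u * (N - \<alpha>) \<le> 1 * (N - \<alpha>)" using u N by (simp, intro mult_right_mono) auto
    then show ?thesis by (intro exI[of _ "\<alpha> + u * (N - \<alpha>)"]) (auto simp: u vec_eq_iff forall_2 algebra_simps)
  qed
  have seg3: "\<exists>k. \<beta>' \<le> k \<and> k \<le> N \<and> z = ?v 0 (-k)" if h: "z \<in> path_image ?M1" for z
  proof -
    obtain u where u: "0 \<le> u" "u \<le> 1" "z = (1 - u) *\<^sub>R ?v 0 (-N) + u *\<^sub>R ?v 0 (-\<beta>')" using h by (auto simp: closed_segment_def)
    have "0 \<le> u * (N - \<beta>')" "u * (N - \<beta>') \<le> 1 * (N - \<beta>')" using u N by (simp, intro mult_right_mono) auto
    then show ?thesis by (intro exI[of _ "N - u * (N - \<beta>')"]) (auto simp: u vec_eq_iff forall_2 algebra_simps)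
  qed
  have seg4: "\<exists>k. \<alpha>' \<le> k \<and> k \<le> N \<and> z = ?v 0 k" if h: "z \<in> path_image ?M2" for z
  proof -
    obtain u where u: "0 \<le> u" "u \<le> 1" "z = (1 - u) *\<^sub>R ?v 0 \<alpha>' + u *\<^sub>R ?v 0 N" using h by (auto simp: closed_segment_def)
    have "0 \<le> u * (N - \<alpha>')" "u * (N - \<alpha>') \<le> 1 * (N - \<alpha>')" using u N by (simp, intro mult_right_mono) auto
    then show ?thesis by (intro exI[of _ "\<alpha>' + u * (N - \<alpha>')"]) (auto simp: u vec_eq_iff forall_2 algebra_simps)
  qed
  have sub: "path_image ?f \<subseteq> cbox (?v (-N) (-N)) (?v N N)" "path_image ?g \<subseteq> cbox (?v (-N) (-N)) (?v N N)"
    unfolding im using inb seg1 seg2 seg3 seg4 pos Np by (fastforce simp: box)+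
  obtain z where z: "z \<in> path_image ?f" "z \<in> path_image ?g"
    by (rule fashoda[OF p1 sub]) auto
  have dis: False if "z = ?v x 0" "z = ?v 0 y" "x \<noteq> 0" for x y using that by (simp add: vec_eq_iff forall_2)
  have backF: "\<Psi> z \<in> path_image f" if "z \<in> path_image ?F" using that \<Psi>\<Phi> by (auto simp: path_image_compose)
  have backG: "\<Psi> z \<in> path_image g" if "z \<in> path_image ?G" using that \<Psi>\<Phi> by (auto simp: path_image_compose)
  have \<Psi>v: "\<Psi> (?v k 0) = k *\<^sub>R v" "\<Psi> (?v 0 k) = k *\<^sub>R w" for k by (simp_all add: \<Psi>_def)
  consider (FG) "z \<in> path_image ?F" "z \<in> path_image ?G" | (M1) "z \<in> path_image ?F" "z \<in> path_image ?M1"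
    | (M2) "z \<in> path_image ?F" "z \<in> path_image ?M2" | (L1) "z \<in> path_image ?L1" "z \<in> path_image ?G"
    | (L2) "z \<in> path_image ?L2" "z \<in> path_image ?G" | (X) "z \<in> path_image ?L1 \<union> path_image ?L2" "z \<in> path_image ?M1 \<union> path_image ?M2"
    using z unfolding im by blast
  then show ?thesis
  proof cases
    case FG then show ?thesis using backF backG by blast
  next
    case M1
    then obtain k where "\<beta>' \<le> k" "z = ?v 0 (-k)" using seg3 by blast
    then show ?thesis using backF[OF M1(1)] \<Psi>v(2)[of "-k"] by auto
  next
    case M2
    then obtain k where "\<alpha>' \<le> k" "z = ?v 0 k" using seg4 by blast
    then show ?thesis using backF[OF M2(1)] \<Psi>v(2)[of k] by auto
  next
    case L1
    then obtain k where "\<beta> \<le> k" "z = ?v (-k) 0" using seg1 by blast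
    then show ?thesis using backG[OF L1(2)] \<Psi>v(1)[of "-k"] by auto
  next
    case L2
    then obtain k where "\<alpha> \<le> k" "z = ?v k 0" using seg2 by blast
    then show ?thesis using backG[OF L2(2)] \<Psi>v(1)[of k] by auto
  next
    case X
    then obtain x where x: "z = ?v x 0" "x \<noteq> 0" using seg1 seg2 pos by fastforce
    obtain y where "z = ?v 0 y" using X(2) seg3 seg4 by blast
    then show ?thesis using dis x by blast
  qed
qed

lemma real_multiple: fixes v w :: complex assumes "Im (cnj v * w) = 0" "v \<noteq> 0"
  obtains k :: real where "w = k *\<^sub>R v"
proof (rule that)
  have h: "Re v * Im w = Im v * Re w" using assms(1) by (simp add: algebra_simps)
  have "((Re v)\<^sup>2 + (Im v)\<^sup>2) * Re w = (Re v * Re w + Im v * Im w) * Re v"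
    "((Re v)\<^sup>2 + (Im v)\<^sup>2) * Im w = (Re v * Re w + Im v * Im w) * Im v" using h by algebra+
  then have "(cmod v)\<^sup>2 *\<^sub>R w = Re (cnj v * w) *\<^sub>R v"
    unfolding cmod_power2 by (simp add: complex_eq_iff)
  then show "w = (Re (cnj v * w) / (cmod v)\<^sup>2) *\<^sub>R v"
    using assms(2) by (simp add: complex_eq_iff field_simps)
qed

section \<open>Sites and Delaunay edges\<close>

locale sites = geosurf +
  fixes P :: "'a set" and \<delta> :: real
  assumes finP: "finite P" and PS: "P \<subseteq> topspace X" and delta: "0 < \<delta>" "\<delta> \<le> \<tau>"
    and dense: "\<And>x. x \<in> topspace X \<Longrightarrow> \<exists>p\<in>P. d x p < \<delta>"
    and generic: "\<And>T a r. T \<subseteq> P \<Longrightarrow> card T = 4 \<Longrightarrow> a \<in> topspace X \<Longrightarrow> r < \<delta> \<Longrightarrow> \<not> (\<forall>p\<in>T. d a p = r)"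
begin

text \<open>The edges and faces of the complex are the sets of two and three sites contained in some \<open>near x\<close>.\<close>

definition near :: "'a \<Rightarrow> 'a set" where "near x = {p\<in>P. \<forall>q\<in>P. d x p \<le> d x q}"

lemma near_P: "p \<in> near x \<Longrightarrow> p \<in> P" by (simp add: near_def)
lemma near_S: "p \<in> near x \<Longrightarrow> p \<in> S" using near_P PS by blast
lemma near_le: "p \<in> near x \<Longrightarrow> q \<in> P \<Longrightarrow> d x p \<le> d x q" by (simp add: near_def)
lemma near_eq: "p \<in> near x \<Longrightarrow> q \<in> near x \<Longrightarrow> d x p = d x q" by (auto simp: near_def intro: antisym)
lemma near_fin: "finite (near x)" using finP by (simp add: near_def)

lemma near_lt: assumes "x \<in> S" "p \<in> near x" shows "d x p < \<delta>" "d x p < \<tau>" "d x p < 2 * \<tau>"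
proof -
  obtain q where "q \<in> P" "d x q < \<delta>" using dense[OF assms(1)] by blast
  then show "d x p < \<delta>" using near_le[OF assms(2)] by fastforce
  then show "d x p < \<tau>" "d x p < 2 * \<tau>" using delta tau by linarith+
qed

lemma near_ne: assumes "x \<in> S" obtains p where "p \<in> near x"
proof -
  have "P \<noteq> {}" using dense[OF assms] by blast
  then obtain p where "p \<in> P" "\<And>q. q \<in> P \<Longrightarrow> d x p \<le> d x q" using ex_min_if_finite[of "d x ` P"] finP
    by (metis (no_types, lifting) arg_min_if_finite(1) arg_min_least)
  then show ?thesis using that by (auto simp: near_def)
qed

lemma near_card: assumes "x \<in> S" shows "card (near x) \<le> 3"
proof (rule ccontr)
  assume "\<not> card (near x) \<le> 3"
  then have "4 \<le> card (near x)" by simp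
  then obtain T where T: "T \<subseteq> near x" "card T = 4" by (rule obtain_subset_with_card_n)
  obtain p where p: "p \<in> near x" using near_ne[OF assms] by blast
  have "T \<subseteq> P" using T near_P by blast
  then show False using generic[OF _ T(2) assms near_lt(1)[OF assms p]] T(1) near_eq[OF _ p] by blast
qed

text \<open>If another site \<open>q\<close> were as near to \<open>y\<close>, the triangle
  inequality would place \<open>y\<close> between \<open>x\<close> and \<open>q\<close> too, with
  \<open>q\<close> as far from \<open>x\<close> as \<open>p\<close>; then \<open>same_ray\<close>
  gives \<open>p = q\<close>. This is the strict form of the fact that Voronoi cells are
  star-shaped.\<close>

lemma near_strict: assumes x: "x \<in> S" and p: "p \<in> near x" and y: "y \<in> S" "bt p y x" "y \<noteq> x"
  shows "near y = {p}" "\<And>q. q \<in> P \<Longrightarrow> q \<noteq> p \<Longrightarrow> d y p < d y q"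
proof -
  have xy: "bt x y p" using y(2) bt_sym by blast
  show lt: "d y p < d y q" if q: "q \<in> P" "q \<noteq> p" for q
  proof (rule ccontr)
    assume "\<not> d y p < d y q"
    then have le: "d y q \<le> d y p" by simp
    have qS: "q \<in> S" using q PS by blast
    have 1: "d x q \<le> d x y + d y q" using tri[OF x y(1) qS] .
    have 2: "d x p \<le> d x q" using near_le[OF p q(1)] .
    have e: "d x q = d x p" "bt x y q" using 1 2 le xy by (auto simp: bt_def)
    have "p = q" by (rule same_ray[OF x near_S[OF p] qS near_lt(3)[OF x p] e(1) y(1,3) xy e(2)])
    then show False using q by simp
  qed
  have "p \<in> near y" unfolding near_def using near_P[OF p] lt by (auto intro: less_imp_le)
  moreover have "q = p" if "q \<in> near y" for q using lt[of q] near_le[OF that near_P[OF p]] near_P[OF that] by force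
  ultimately show "near y = {p}" by blast
qed

text \<open>There are finitely many sites, and one that is not nearest to \<open>x\<close> is
  farther away by a positive gap. A move by less than half the gap cannot make it nearest.\<close>

lemma near_local: assumes x: "x \<in> S"
  obtains r where "r > 0" "\<And>y. y \<in> S \<Longrightarrow> d x y < r \<Longrightarrow> near y \<subseteq> near x"
proof -
  obtain p where p: "p \<in> near x" using near_ne[OF x] .
  define g where "g q = (d x q - d x p) / 2" for q
  have gp: "g q > 0" if "q \<in> P - near x" for q
  proof (rule ccontr)
    assume "\<not> g q > 0"
    then have "d x q \<le> d x p" by (simp add: g_def)
    then have "q \<in> near x" using that near_le[OF p] by (force simp: near_def)
    then show False using that by simp
  qed
  define r where "r = Min (insert 1 (g ` (P - near x)))"
  have fin: "finite (insert 1 (g ` (P - near x)))" using finP by simp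
  have r: "r > 0" unfolding r_def using gp fin by (subst Min_gr_iff) auto
  have rl: "r \<le> g q" if "q \<in> P - near x" for q unfolding r_def using that fin by (intro Min_le) auto
  have "near y \<subseteq> near x" if y: "y \<in> S" "d x y < r" for y
  proof
    fix q assume q: "q \<in> near y"
    show "q \<in> near x"
    proof (rule ccontr)
      assume "q \<notin> near x"
      then have "r \<le> g q" using rl near_P[OF q] by simp
      moreover have "d y q \<le> d y p" using near_le[OF q near_P[OF p]] .
      moreover have "d x q \<le> d x y + d y q" "d y p \<le> d y x + d x p" using tri x y near_S p q by blast+
      ultimately show False using y(2) dsym[of x y] by (simp add: g_def)
    qed
  qed
  then show ?thesis using that r by blast
qed

lemma edge_inside: assumes a: "a \<in> S" and p: "p \<in> near a" "q \<in> near a" and y: "y \<in> S" "bt p y q" "y \<noteq> p" "y \<noteq> q"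
  shows "d a y < d a p" "y \<notin> P"
proof -
  have e: "d a q = d a p" using near_eq[OF p(2,1)] .
  have pq: "d p q < 2 * \<tau>" using tri[OF near_S[OF p(1)] a near_S[OF p(2)]] dsym[of p a] near_lt(2)[OF a p(1)] near_lt(2)[OF a p(2)] by simp
  obtain t where t: "t \<in> {0..1}" "y = G p q t" using bt_obtain[OF near_S[OF p(1)] y(1) near_S[OF p(2)] pq y(2)] by metis
  have "t \<noteq> 0" "t \<noteq> 1" using t(2) y G0[OF near_S[OF p(1)] near_S[OF p(2)] pq] G1[OF near_S[OF p(1)] near_S[OF p(2)] pq] by auto
  then have t': "0 < t" "t < 1" using t by auto
  have "p \<noteq> q"
  proof
    assume "p = q"
    then have "d p y = 0" using y(2) bt_le(1)[OF y(2)] dself[OF near_S[OF p(1)]] dnn[of p y] by simp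
    then show False using d0 y near_S[OF p(1)] by simp
  qed
  then show "d a y < d a p"
    unfolding t(2) using e by (intro G_convex[OF a near_S[OF p(1)] near_S[OF p(2)] _ near_lt(2)[OF a p(1)] _ _ t']) auto
  then show "y \<notin> P" using near_le[OF p(1), of y] by auto
qed

lemma near_dist2: assumes a: "a \<in> S" and p: "p \<in> near a" "q \<in> near a" shows "d p q < 2 * \<tau>" "d p q < 2 * \<delta>"
  using tri[OF near_S[OF p(1)] a near_S[OF p(2)]] dsym[of p a] near_lt[OF a p(1)] near_lt[OF a p(2)] by linarith+

lemma G_path_cont: assumes "x \<in> S" "y \<in> S" "d x y < 2 * \<tau>"
  shows "continuous_map (top_of_set {0..1}) X (G x y)"
proof (rule cont_into)
  fix s e :: real assume s: "s \<in> {0..1}" and e: "e > 0"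
  have "d (G x y s) (G x y t) < e" if "t \<in> {0..1}" "dist t s < e / (2 * \<tau>)" for t
  proof -
    have "\<bar>s - t\<bar> * d x y \<le> (e / (2 * \<tau>)) * d x y" using that dnn[of x y] by (intro mult_right_mono) (auto simp: dist_real_def)
    also have "\<dots> < (e / (2 * \<tau>)) * (2 * \<tau>)" using assms e tau by (intro mult_strict_left_mono) auto
    finally show ?thesis using G_d[OF assms s that(1)] tau by simp
  qed
  then show "\<exists>r>0. \<forall>t\<in>{0..1}. dist t s < r \<longrightarrow> d (G x y s) (G x y t) < e" using e tau by (intro exI[of _ "e / (2 * \<tau>)"]) auto
qed (rule G_mem[OF assms])

lemma lg_path: assumes m: "m \<in> S" and x: "x \<in> S" "y \<in> S" "d x y < 2 * \<tau>" and lt: "\<And>t. t \<in> {0..1} \<Longrightarrow> d m (G x y t) < 2 * \<tau>"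
  shows "path (\<lambda>t. lg m (G x y t))"
proof -
  have "continuous_map (top_of_set {0..1}) (subtopology X (B m)) (G x y)"
    unfolding continuous_map_in_subtopology using G_path_cont[OF x] lt G_mem[OF x] by (auto simp: B_iff)
  from continuous_map_compose[OF this lg_cont[OF m]] show ?thesis by (simp add: path_def o_def)
qed

lemma opposite: assumes x: "x \<in> S" "y \<in> S" "d x y < 2 * \<tau>" and m: "m \<in> S" "bt x m y" "m \<noteq> x" "m \<noteq> y"
  obtains k where "k > 0" "lg m x = - (k *\<^sub>R lg m y)"
proof -
  obtain t where t: "t \<in> {0..1}" "m = G x y t" using bt_obtain[OF x(1) m(1) x(2,3) m(2)] by metis
  have "t \<noteq> 0" "t \<noteq> 1" using t(2) m G0[OF x] G1[OF x] by auto
  then have t': "0 < t" "t < 1" using t by auto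
  have "(1 - t) *\<^sub>R lg m x = - (t *\<^sub>R lg m y)" using lg_opp[OF x t(1)] t(2) by simp
  then have "(1 / (1 - t)) *\<^sub>R (1 - t) *\<^sub>R lg m x = (1 / (1 - t)) *\<^sub>R - (t *\<^sub>R lg m y)" by simp
  then have "lg m x = - ((t / (1 - t)) *\<^sub>R lg m y)" using t' by simp
  then show ?thesis using that[of "t / (1 - t)"] t' by simp
qed

text \<open>If two such ends on the same ray from \<open>m\<close> were different, the nearer would
  be a site in the interior of the edge that ends in the other, which \<open>edge_inside\<close>
  forbids.\<close>

lemma same_ray_site:
  assumes a: "a \<in> S" "p \<in> near a" "q \<in> near a" and b: "b \<in> S" "r \<in> near b" "s \<in> near b"
    and m: "m \<in> S" "bt p m q" "bt r m s" "m \<noteq> q" "m \<noteq> s" and k: "lg m s = k *\<^sub>R lg m q" "k > 0"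
  shows "s = q"
proof -
  have pS: "p \<in> S" "q \<in> S" "r \<in> S" "s \<in> S" using near_S a b by blast+
  have dq: "d m q < 2 * \<tau>" using bt_le(2)[OF m(2)] near_dist2(1)[OF a] by simp
  have ds: "d m s < 2 * \<tau>" using bt_le(2)[OF m(3)] near_dist2(1)[OF b] by simp
  have aux: False if a: "a \<in> S" "p \<in> near a" "q \<in> near a" and s: "s \<in> P" "s \<noteq> q" "s \<noteq> m" "bt p m q" "bt m s q" for a p q s
  proof -
    have S: "p \<in> S" "q \<in> S" "s \<in> S" using near_S a s PS by blast+
    have le: "d p s \<le> d p m + d m s" "d p q \<le> d p s + d s q" using tri S m(1) by blast+
    then have "bt p s q" using s(4,5) by (simp add: bt_def)
    moreover have "s \<noteq> p"
    proof
      assume "s = p"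
      then have "d m p + d p q = d m q" "d p m + d m q = d p q" using s(4,5) by (auto simp: bt_def)
      then have "d p m = 0" using dnn[of p m] dsym[of p m] by simp
      then show False using d0 S m(1) \<open>s = p\<close> s(3) by simp
    qed
    ultimately show False using edge_inside(2)[OF a S(3) _ _ s(2)] s(1) by blast
  qed
  consider "d m s < d m q" | "d m s = d m q" | "d m q < d m s" by linarith
  then show ?thesis
  proof cases
    case 1
    have "bt m s q" by (rule lg_bt[OF m(1) pS(4,2) dq _ k(1)]) (use 1 k in auto)
    moreover have "s \<noteq> q" using 1 by auto
    ultimately show ?thesis using aux[OF a near_P[OF b(3)] _ _ m(2)] m(5) by blast
  next
    case 2
    have "cmod (lg m s) = cmod (lg m q)" using 2 lg_norm m(1) pS dq by simp
    moreover have "lg m q \<noteq> 0" using lg_norm[OF m(1) pS(2) dq] dpos[OF m(1) pS(2) m(4)] by auto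
    ultimately have "k = 1" using k by simp
    then show ?thesis using lg_inj[OF m(1) pS(4) ds pS(2) dq] k by simp
  next
    case 3
    have "lg m q = (1 / k) *\<^sub>R lg m s" using k by simp
    then have "bt m q s" by (rule lg_bt[OF m(1) pS(2,4) ds, rotated]) (use 3 k in auto)
    moreover have "q \<noteq> s" using 3 by auto
    ultimately show ?thesis using aux[OF b near_P[OF a(3)] _ _ m(3)] m(4) by blast
  qed
qed

text \<open>A point \<open>y\<close> of the radius lying on the prolongation of the edge beyond
  \<open>e\<close> would have \<open>e\<close> between \<open>m\<close> and \<open>y\<close>. Both
  lie in the closed disk about \<open>a\<close>, with \<open>m\<close> strictly inside, so strict
  convexity would place the site \<open>e\<close> in the empty open disk.\<close>

lemma prolongation_outside:
  assumes a: "a \<in> S" "x \<in> near a" and e: "e \<in> P" "e \<noteq> x" and m: "m \<in> S" "d a m < d a x" "m \<noteq> e"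
    and y: "y \<in> S" "bt a y x" "lg m y = c *\<^sub>R lg m e" "c \<ge> 1" "d m y < 2 * \<tau>" "d m e < 2 * \<tau>"
  shows False
proof -
  have eS: "e \<in> S" using e PS by blast
  have "d m e = cmod (lg m e)" "d m y = cmod (lg m y)"
    using lg_norm[OF m(1) eS y(6)] lg_norm[OF m(1) y(1,5)] by (simp_all only:)
  then have le: "d m y = c * d m e" using y(3,4) by simp
  then have le': "d m e \<le> d m y" using y(4) dnn[of m e] by (simp add: mult_le_cancel_right1)
  have "lg m e = (1 / c) *\<^sub>R lg m y" using y(3,4) by simp
  then have bt: "bt m e y" by (rule lg_bt[OF m(1) eS y(1,5) le']) (use y(4) in simp)
  have ay: "d a y \<le> d a x" using bt_le(1)[OF y(2)] .
  have ge: "d a x \<le> d a e" using near_le[OF a(2) e(1)] .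
  show False
  proof (cases "e = y")
    case True
    then have "d a y = d a x" using ay ge by simp
    then have "d y x = 0" using y(2) by (simp add: bt_def)
    then show False using d0 y(1) near_S[OF a(2)] True e by auto
  next
    case False
    obtain t where t: "t \<in> {0..1}" "e = G m y t" using bt_obtain[OF m(1) eS y(1,5) bt] by metis
    have "t \<noteq> 0" "t \<noteq> 1" using t(2) m(3) False G0[OF m(1) y(1,5)] G1[OF m(1) y(1,5)] by auto
    then have t': "0 < t" "t < 1" using t by auto
    have "m \<noteq> y" using le' dself[OF m(1)] dpos[OF m(1) eS m(3)] by auto
    then have "d a e < d a x" unfolding t(2)
      using m(2) ay by (intro G_convex[OF a(1) m(1) y(1) _ near_lt(2)[OF a] _ _ t']) auto
    then show False using ge by simp
  qed
qed

text \<open>The two radii are read in the geodesic coordinates at \<open>m\<close>. These are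
  defined along the whole path because \<open>m\<close> lies in the disk about \<open>a\<close>,
  whose radius is less than \<open>\<tau>\<close>.\<close>

lemma radial_path:
  assumes a: "a \<in> S" "p \<in> near a" "q \<in> near a" and m: "m \<in> S" "d a m < d a p"
  obtains f where "path f" "pathstart f = lg m p" "pathfinish f = lg m q"
    "\<And>z. z \<in> path_image f \<Longrightarrow> \<exists>y x. y \<in> S \<and> x \<in> {p,q} \<and> bt a y x \<and> lg m y = z \<and> d m y < 2 * \<tau>"
proof -
  have S: "p \<in> S" "q \<in> S" using near_S a by blast+
  have l: "d a p < 2 * \<tau>" "d a q < 2 * \<tau>" "d a p < \<tau>" "d a q = d a p" using near_lt a near_eq by blast+
  have near_m: "d m (G a x t) < 2 * \<tau>" if "x \<in> S" "d a x = d a p" "t \<in> {0..1}" for x t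
  proof -
    have x2: "d a x < 2 * \<tau>" using that l by simp
    have "d m (G a x t) \<le> d m a + d a (G a x t)" using tri[OF m(1) a(1) G_mem[OF a(1) that(1) x2 that(3)]] .
    also have "d a (G a x t) \<le> 1 * d a x" unfolding G_dl[OF a(1) that(1) x2 that(3)] using that dnn[of a x] by (intro mult_right_mono) auto
    finally show ?thesis using m(2) l dsym[of m a] that by simp
  qed
  have p1: "path (\<lambda>t. lg m (G a p t))" by (rule lg_path[OF m(1) a(1) S(1) l(1)]) (use near_m[OF S(1)] in auto)
  have p2: "path (\<lambda>t. lg m (G a q t))" by (rule lg_path[OF m(1) a(1) S(2) l(2)]) (use near_m[OF S(2)] l in auto)
  let ?f = "reversepath (\<lambda>t. lg m (G a p t)) +++ (\<lambda>t. lg m (G a q t))"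
  have im: "\<exists>y x. y \<in> S \<and> x \<in> {p,q} \<and> bt a y x \<and> lg m y = z \<and> d m y < 2 * \<tau>"
    if z: "z \<in> path_image (\<lambda>t. lg m (G a x t))" and x: "x \<in> {p, q}" for z x
  proof -
    obtain t where t: "t \<in> {0..1}" "z = lg m (G a x t)" using z by (auto simp: path_image_def)
    have xx: "x \<in> S" "d a x = d a p" "d a x < 2 * \<tau>" using x S l by auto
    show ?thesis using bt_G[OF a(1) xx(1,3) t(1)] G_mem[OF a(1) xx(1,3) t(1)] near_m[OF xx(1,2) t(1)] x t(2)
      by (intro exI[of _ "G a x t"] exI[of _ x]) auto
  qed
  show ?thesis
  proof (rule that[of ?f])
    show "path ?f" using p1 p2 G0[OF a(1) S(1) l(1)] G0[OF a(1) S(2) l(2)]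
      by (intro path_join_imp) (simp_all add: pathstart_def)
    show "pathstart ?f = lg m p" unfolding pathstart_join pathstart_reversepath pathfinish_def using G1[OF a(1) S(1) l(1)] by simp
    have "pathfinish ?f = pathfinish (\<lambda>t. lg m (G a q t))" by (rule pathfinish_join)
    then show "pathfinish ?f = lg m q" using G1[OF a(1) S(2) l(2)] by (simp add: pathfinish_def)
    fix z assume "z \<in> path_image ?f"
    then have "z \<in> path_image (\<lambda>t. lg m (G a p t)) \<or> z \<in> path_image (\<lambda>t. lg m (G a q t))"
      using path_image_join_subset by fastforce
    then show "\<exists>y x. y \<in> S \<and> x \<in> {p,q} \<and> bt a y x \<and> lg m y = z \<and> d m y < 2 * \<tau>" using im by blast
  qed
qed

text \<open>If the edges are tangent at \<open>m\<close>, they run along one line and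
  \<open>same_ray_site\<close> matches their ends. Otherwise \<open>rays_cross\<close> leaves five
  cases: a common point of the two paths contradicts \<open>radii_disjoint\<close> or, when
  \<open>a = b\<close>, the bound of three nearest sites; the other four contradict
  \<open>prolongation_outside\<close>.\<close>

lemma edges_cross:
  assumes a: "a \<in> S" "p \<in> near a" "q \<in> near a" and b: "b \<in> S" "r \<in> near b" "s \<in> near b"
    and m: "m \<in> S" "bt p m q" "bt r m s" "m \<notin> {p, q, r, s}"
  shows "{p, q} = {r, s}"
proof -
  have S: "p \<in> S" "q \<in> S" "r \<in> S" "s \<in> S" using near_S a b by blast+
  have pq: "d p q < 2 * \<tau>" using near_dist2[OF a] by simp
  have rs: "d r s < 2 * \<tau>" using near_dist2[OF b] by simp
  have mn: "m \<noteq> p" "m \<noteq> q" "m \<noteq> r" "m \<noteq> s" using m(4) by auto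
  have m': "bt q m p" "bt s m r" using m bt_sym by blast+
  have dm: "d m p < 2 * \<tau>" "d m q < 2 * \<tau>" "d m r < 2 * \<tau>" "d m s < 2 * \<tau>"
    using bt_le(2)[OF m(2)] bt_le(2)[OF m(3)] bt_le(2)[OF m'(1)] bt_le(2)[OF m'(2)] pq rs dsym[of q p] dsym[of s r] by auto
  define v where "v = lg m q" define w where "w = lg m s"
  obtain k where k: "k > 0" "lg m p = - (k *\<^sub>R v)" using opposite[OF S(1,2) pq m(1,2) mn(1,2)] unfolding v_def by blast
  obtain l where l: "l > 0" "lg m r = - (l *\<^sub>R w)" using opposite[OF S(3,4) rs m(1,3) mn(3,4)] unfolding w_def by blast
  have v0: "v \<noteq> 0" using lg_norm[OF m(1) S(2) dm(2)] dpos[OF m(1) S(2) mn(2)] by (auto simp: v_def)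
  have w0: "w \<noteq> 0" using lg_norm[OF m(1) S(4) dm(4)] dpos[OF m(1) S(4) mn(4)] by (auto simp: w_def)
  show ?thesis
  proof (cases "Im (cnj v * w) = 0")
    case True
    then obtain c where c: "w = c *\<^sub>R v" using real_multiple v0 by blast
    then have "c \<noteq> 0" using w0 by auto
    then consider "c > 0" | "c < 0" by linarith
    then show ?thesis
    proof cases
      case 1
      have "s = q" by (rule same_ray_site[OF a b m(1-3) mn(2,4) _ 1]) (use c in \<open>simp add: v_def w_def\<close>)
      moreover have "lg m r = (l * c / k) *\<^sub>R lg m p" using k l c by simp
      then have "r = p" by (rule same_ray_site[OF a(1,3,2) b(1,3,2) m(1) m' mn(1,3)]) (use k l 1 in simp)
      ultimately show ?thesis by auto
    next
      case 2
      have "lg m s = (- c / k) *\<^sub>R lg m p" using k c by (simp add: w_def)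
      then have "s = p" by (rule same_ray_site[OF a(1,3,2) b m(1) m'(1) m(3) mn(1,4)]) (use k 2 in \<open>simp add: divide_neg_pos\<close>)
      moreover have "lg m r = (- l * c) *\<^sub>R lg m q" using l c by (simp add: v_def)
      then have "r = q" by (rule same_ray_site[OF a b(1,3,2) m(1,2) m'(2) mn(2,3)]) (use l 2 in \<open>simp add: mult_pos_neg\<close>)
      ultimately show ?thesis by auto
    qed
  next
    case ind: False
    have ne: "p \<noteq> r" "p \<noteq> s" "q \<noteq> r" "q \<noteq> s" "p \<noteq> q" "r \<noteq> s"
    proof -
      have z: "Im (cnj v * (c *\<^sub>R v)) = 0" for c by (simp add: algebra_simps)
      have "w \<noteq> c *\<^sub>R v" for c using z[of c] ind by metis
      then have nv: "w \<noteq> c *\<^sub>R v" "w \<noteq> - (c *\<^sub>R v)" for c by (metis, metis scaleR_minus_left)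
      show "q \<noteq> s" using nv(1)[of 1] by (auto simp: v_def w_def)
      show "p \<noteq> s" using nv(2)[of k] k(2) by (auto simp: w_def)
      show "q \<noteq> r"
      proof
        assume "q = r"
        then have "v = - (l *\<^sub>R w)" using l(2) by (simp add: v_def)
        then have "(1 / l) *\<^sub>R v = - w" using l(1) by (simp add: field_simps)
        then have "w = - ((1 / l) *\<^sub>R v)" by simp
        then show False using nv by blast
      qed
      show "p \<noteq> r"
      proof
        assume "p = r"
        then have "k *\<^sub>R v = l *\<^sub>R w" using k(2) l(2) by simp
        then have "(1 / l) *\<^sub>R k *\<^sub>R v = (1 / l) *\<^sub>R l *\<^sub>R w" by simp
        then have "w = (k / l) *\<^sub>R v" using l(1) by simp
        then show False using nv by blast
      qed
      show "p \<noteq> q" using bt_le(1)[OF m(2)] dself[OF S(1)] dpos[OF S(1) m(1)] mn by auto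
      show "r \<noteq> s" using bt_le(1)[OF m(3)] dself[OF S(3)] dpos[OF S(3) m(1)] mn by auto
    qed
    have ma: "d a m < d a p" "d a m < d a q" using edge_inside(1)[OF a m(1,2) mn(1,2)] near_eq[OF a(2,3)] by auto
    have mb: "d b m < d b r" "d b m < d b s" using edge_inside(1)[OF b m(1,3) mn(3,4)] near_eq[OF b(2,3)] by auto
    obtain f where f: "path f" "pathstart f = lg m p" "pathfinish f = lg m q"
      "\<And>z. z \<in> path_image f \<Longrightarrow> \<exists>y x. y \<in> S \<and> x \<in> {p,q} \<and> bt a y x \<and> lg m y = z \<and> d m y < 2 * \<tau>"
      using radial_path[OF a m(1) ma(1)] by blast
    obtain g where g: "path g" "pathstart g = lg m r" "pathfinish g = lg m s"
      "\<And>z. z \<in> path_image g \<Longrightarrow> \<exists>y x. y \<in> S \<and> x \<in> {r,s} \<and> bt b y x \<and> lg m y = z \<and> d m y < 2 * \<tau>"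
      using radial_path[OF b m(1) mb(1)] by blast
    have ends: "pathstart f = - (k *\<^sub>R v)" "pathfinish f = 1 *\<^sub>R v" "pathstart g = - (l *\<^sub>R w)" "pathfinish g = 1 *\<^sub>R w"
      using f g k l by (simp_all add: v_def w_def)
    have Fno: False if A: "z \<in> path_image f" "z = c *\<^sub>R lg m e" "c \<ge> 1" "e \<in> {r, s}" for z c e
    proof -
      obtain y x where y: "y \<in> S" "x \<in> {p,q}" "bt a y x" "lg m y = z" "d m y < 2 * \<tau>" using f(4)[OF A(1)] by blast
      show False using y A a b ne mn ma dm near_P m(1)
        by (intro prolongation_outside[of a x e m y c]) auto
    qed
    have Gno: False if A: "z \<in> path_image g" "z = c *\<^sub>R lg m e" "c \<ge> 1" "e \<in> {p, q}" for z c e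
    proof -
      obtain y x where y: "y \<in> S" "x \<in> {r,s}" "bt b y x" "lg m y = z" "d m y < 2 * \<tau>" using g(4)[OF A(1)] by blast
      show False using y A a b ne mn mb dm near_P m(1)
        by (intro prolongation_outside[of b x e m y c]) auto
    qed
    consider (I) "path_image f \<inter> path_image g \<noteq> {}" | (1) c where "c \<ge> 1" "c *\<^sub>R w \<in> path_image f" | (2) c where "c \<ge> l" "- (c *\<^sub>R w) \<in> path_image f"
      | (3) c where "c \<ge> 1" "c *\<^sub>R v \<in> path_image g" | (4) c where "c \<ge> k" "- (c *\<^sub>R v) \<in> path_image g"
      using rays_cross[OF ind f(1) g(1) ends zero_less_one k(1) zero_less_one l(1)] by blast
    then have False
    proof cases
      case I
      then obtain z where z: "z \<in> path_image f" "z \<in> path_image g" by blast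
      obtain y x where y: "y \<in> S" "x \<in> {p,q}" "bt a y x" "lg m y = z" "d m y < 2 * \<tau>" using f(4)[OF z(1)] by blast
      obtain y' x' where y': "y' \<in> S" "x' \<in> {r,s}" "bt b y' x'" "lg m y' = z" "d m y' < 2 * \<tau>" using g(4)[OF z(2)] by blast
      have "y' = y" using lg_inj[OF m(1) y'(1,5) y(1,5)] y(4) y'(4) by simp
      have xn: "x \<in> near a" "x' \<in> near b" using y(2) y'(2) a b by auto
      have "x = x' \<or> a = b"
        by (rule radii_disjoint[OF a(1) b(1) near_S[OF xn(1)] near_S[OF xn(2)] y(1) y(3) _ near_le[OF xn(1) near_P[OF xn(2)]] near_le[OF xn(2) near_P[OF xn(1)]] near_lt(3)[OF a(1) xn(1)] near_lt(3)[OF b(1) xn(2)]])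
           (use y' \<open>y' = y\<close> in simp)
      moreover have "x \<noteq> x'" using y(2) y'(2) ne by auto
      ultimately have "{p, q, r, s} \<subseteq> near a" using a b by auto
      then have "card {p, q, r, s} \<le> 3" using near_card[OF a(1)] card_mono[OF near_fin] le_trans by blast
      then show False using ne by simp
    next
      case 1 then show False using Fno[of _ c s] by (auto simp: w_def)
    next
      case 2
      then have "- (c *\<^sub>R w) = (c / l) *\<^sub>R lg m r" "c / l \<ge> 1" using l by simp_all
      then show False using Fno[OF 2(2)] by blast
    next
      case 3 then show False using Gno[of _ c q] by (auto simp: v_def)
    next
      case 4
      then have "- (c *\<^sub>R v) = (c / k) *\<^sub>R lg m p" "c / k \<ge> 1" using k by simp_all
      then show False using Gno[OF 4(2)] by blast
    qed
    then show ?thesis ..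
  qed
qed

end

section \<open>Circumcentres\<close>

definition ang :: "complex \<Rightarrow> complex \<Rightarrow> real" where "ang u z = Arg2pi (z / u)"

lemma ang_diff: assumes "u \<noteq> 0" "v \<noteq> 0" "x \<noteq> 0"
  shows "ang u x - ang u v = (if ang u v \<le> ang u x then ang v x else ang v x - 2 * pi)"
proof -
  have "(x / u) / (v / u) = x / v" using assms by simp
  then show ?thesis using Arg2pi_diff[of "x / u" "v / u"] assms by (simp add: ang_def)
qed

lemma ang_self: "u \<noteq> 0 \<Longrightarrow> ang u u = 0" by (simp add: ang_def Arg2pi_eq_0)

lemma ang_bounds: "0 \<le> ang u z" "ang u z < 2 * pi" by (auto simp: ang_def Arg2pi_ge_0 Arg2pi_lt_2pi)

lemma ang_eq: assumes "u \<noteq> 0" "v \<noteq> 0" "z \<noteq> 0" "ang u z = ang u v"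
  obtains k where "k > 0" "z = k *\<^sub>R v"
proof -
  obtain k where "0 < k" "z / u = of_real k * (v / u)" using Arg2pi_eq_iff[of "z/u" "v/u"] assms by (auto simp: ang_def)
  then have "z = k *\<^sub>R v" using assms(1) by (simp add: scaleR_conv_of_real field_simps)
  then show ?thesis using that \<open>0 < k\<close> by blast
qed

lemma ang_0: assumes "u \<noteq> 0" "ang u z = 0" obtains k where "k \<ge> 0" "z = k *\<^sub>R u"
proof (cases "z = 0")
  case True then show ?thesis using that[of 0] by simp
next
  case False
  then show ?thesis using ang_eq[of u u z] assms ang_self that by (metis less_imp_le)
qed

text \<open>The angle from \<open>u\<close> is continuous off the ray of \<open>u\<close>. Along a
  path that also avoids the ray of \<open>v\<close> it never takes the value \<open>ang u v\<close>,
  so it stays on one side of that value.\<close>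

lemma ang_separates:
  assumes g: "path g" and u: "u \<noteq> 0" "v \<noteq> 0"
    and avoid: "\<And>z k. z \<in> path_image g \<Longrightarrow> k \<ge> 0 \<Longrightarrow> z \<noteq> k *\<^sub>R u" "\<And>z k. z \<in> path_image g \<Longrightarrow> k \<ge> 0 \<Longrightarrow> z \<noteq> k *\<^sub>R v"
  shows "ang u (pathstart g) < ang u v \<longleftrightarrow> ang u (pathfinish g) < ang u v"
proof -
  have "continuous (at (z / u)) Arg2pi" if z: "z \<in> path_image g" for z
  proof (rule continuous_at_Arg2pi)
    show "z / u \<notin> \<real>\<^sub>\<ge>\<^sub>0"
    proof
      assume "z / u \<in> \<real>\<^sub>\<ge>\<^sub>0"
      then obtain k where "k \<ge> 0" "z / u = of_real k" by (elim nonneg_Reals_cases) auto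
      then have "z = k *\<^sub>R u" using u by (simp add: scaleR_conv_of_real field_simps)
      then show False using avoid(1)[OF z \<open>k \<ge> 0\<close>] by simp
    qed
  qed
  then have "isCont (\<lambda>z. Arg2pi (z / u)) z" if "z \<in> path_image g" for z
    by (intro isCont_o2[of z "\<lambda>z. z / u" Arg2pi]) (use that u in \<open>auto intro!: continuous_intros\<close>)
  then have "continuous_on (path_image g) (ang u)"
    unfolding ang_def by (intro continuous_at_imp_continuous_on) blast
  then have c: "connected (ang u ` path_image g)" using connected_path_image[OF g] by (rule connected_continuous_image)
  have ne: "ang u v \<notin> ang u ` path_image g"
  proof
    assume "ang u v \<in> ang u ` path_image g"
    then obtain z where z: "z \<in> path_image g" "ang u z = ang u v" by auto
    have "z \<noteq> 0" using avoid(1)[OF z(1), of 0] by simp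
    then obtain k where "k > 0" "z = k *\<^sub>R v" using ang_eq[OF u _ z(2)] by blast
    then show False using avoid(2)[OF z(1), of k] by simp
  qed
  have "pathstart g \<in> path_image g" "pathfinish g \<in> path_image g"
    by (rule pathstart_in_path_image, rule pathfinish_in_path_image)
  then show ?thesis using connectedD_interval[OF c, of "ang u (pathstart g)" "ang u (pathfinish g)" "ang u v"]
      connectedD_interval[OF c, of "ang u (pathfinish g)" "ang u (pathstart g)" "ang u v"] ne
    by (meson image_eqI not_le order_less_imp_le)
qed

context sites begin

lemma lg_nonzero: "a \<in> S \<Longrightarrow> x \<in> S \<Longrightarrow> d a x < 2 * \<tau> \<Longrightarrow> x \<noteq> a \<Longrightarrow> lg a x \<noteq> 0"
  using lg_norm[of a x] dpos[of a x] by auto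

lemma same_direction: assumes "a \<in> S" "x \<in> S" "y \<in> S" "d a x < 2 * \<tau>" "d a x = d a y" "lg a x = k *\<^sub>R lg a y" "k \<ge> 0"
  shows "x = y"
proof -
  have y: "d a y < 2 * \<tau>" using assms(4,5) by simp
  have n: "cmod (lg a x) = d a x" "cmod (lg a y) = d a y" using lg_norm[OF assms(1,2,4)] lg_norm[OF assms(1,3) y] by auto
  have "lg a x = lg a y"
  proof (cases "d a y = 0")
    case True then show ?thesis using n assms(5) by simp
  next
    case False
    have "k * d a y = d a y" using n assms(5-7) by simp
    then have "k = 1" using False by simp
    then show ?thesis using assms(6) by simp
  qed
  then show ?thesis by (rule lg_inj[OF assms(1,2,4,3) y])
qed

text \<open>A point \<open>n\<close> common to the radius from \<open>b\<close> to \<open>x\<close>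
  and the ray from \<open>a\<close> through \<open>y\<close> is either on the radius to
  \<open>y\<close>, which \<open>radii_disjoint\<close> excludes, or beyond \<open>y\<close>. In the
  latter case comparing distances puts \<open>x\<close> between \<open>a\<close> and
  \<open>n\<close> as well, so \<open>x\<close> and \<open>y\<close> have the same direction and
  distance from \<open>a\<close>.\<close>

lemma ray_avoids:
  assumes a: "a \<in> S" "x \<in> near a" "y \<in> near a" and b: "b \<in> S" "x \<in> near b" "y \<in> near b" and ne: "a \<noteq> b" "x \<noteq> y"
    and n: "n \<in> S" "bt b n x" "lg a n = k *\<^sub>R lg a y" "k \<ge> 0"
  shows False
proof -
  have S: "x \<in> S" "y \<in> S" using near_S a by blast+
  have l: "d a x < \<tau>" "d a y < 2 * \<tau>" "d b x < 2 * \<tau>" "d b x < \<tau>" using near_lt a b by blast+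
  have e: "d a x = d a y" "d b x = d b y" using near_eq a b by blast+
  have nx: "d n x < \<tau>" using bt_le(2)[OF n(2)] l by simp
  have an: "d a n < 2 * \<tau>" using tri[OF a(1) S(1) n(1)] dsym[of x n] l nx by simp
  show False
  proof (cases "d a n \<le> d a y")
    case True
    have "bt a n y" by (rule lg_bt[OF a(1) n(1) S(2) l(2) True n(3,4)])
    then show False using radii_disjoint[OF a(1) b(1) S(2,1) n(1) _ n(2)] e l ne by auto
  next
    case False
    have k: "k > 0"
    proof (rule ccontr)
      assume "\<not> k > 0"
      then have "lg a n = 0" using n by simp
      then have "d a n = 0" using lg_norm[OF a(1) n(1) an] by simp
      then show False using False dnn[of a y] by simp
    qed
    have "bt a y n" by (rule lg_bt[OF a(1) S(2) n(1) an, of "1 / k"]) (use False n(3) k in auto)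
    then have y: "d a n = d a y + d y n" by (simp add: bt_def)
    have "d n x \<le> d n y" using n(2) e(2) tri[OF b(1) n(1) S(2)] by (simp add: bt_def)
    moreover have "d y n \<le> d x n" using y e(1) tri[OF a(1) S(1) n(1)] by simp
    ultimately have "bt a x n" using y e(1) dsym[of x n] dsym[of y n] by (simp add: bt_def)
    then obtain t where t: "t \<in> {0..1}" "lg a x = t *\<^sub>R lg a n" using bt_lg[OF a(1) S(1) n(1) an] by blast
    then have "lg a x = (t * k) *\<^sub>R lg a y" using n(3) by simp
    moreover have "d a x < 2 * \<tau>" "0 \<le> t * k" using l(2) e(1) t(1) k by simp_all
    ultimately have "x = y" using same_direction[OF a(1) S _ e(1)] by blast
    then show False using ne(2) by simp
  qed
qed

text \<open>Seen from \<open>a\<close>, the centre \<open>b\<close> lies in one of the three sectors cut out by the radii, and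
  the radius from \<open>b\<close> to the site opposite would have to cross a radius.\<close>

lemma circumcentre_unique:
  assumes a: "a \<in> S" "{p, q, r} \<subseteq> near a" and b: "b \<in> S" "{p, q, r} \<subseteq> near b" and ne: "p \<noteq> q" "p \<noteq> r" "q \<noteq> r"
  shows "a = b"
proof (rule ccontr)
  assume ab: "a \<noteq> b"
  have *: False if T: "{p, q, r} \<subseteq> near a" "{p, q, r} \<subseteq> near b" and ne: "p \<noteq> q" "p \<noteq> r" "q \<noteq> r"
    and o: "ang (lg a p) (lg a q) < ang (lg a p) (lg a r)" for p q r
  proof -
    have nr: "p \<in> near a" "q \<in> near a" "r \<in> near a" "p \<in> near b" "q \<in> near b" "r \<in> near b" using T by auto
    have S: "p \<in> S" "q \<in> S" "r \<in> S" using near_S nr by blast+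
    have avoid: "z \<noteq> k *\<^sub>R lg a y" if A: "z \<in> path_image (\<lambda>t. lg a (G b x t))" "k \<ge> 0" "x \<in> {p,q,r}" "y \<in> {p,q,r}" "x \<noteq> y" for z k x y
    proof
      assume e: "z = k *\<^sub>R lg a y"
      obtain t where t: "t \<in> {0..1}" "z = lg a (G b x t)" using A(1) by (auto simp: path_image_def)
      have x: "x \<in> S" "d b x < 2 * \<tau>" "x \<in> near a" "x \<in> near b" "y \<in> near a" "y \<in> near b" using A(3,4) S nr near_lt(3)[OF b(1)] by auto
      show False
        by (rule ray_avoids[OF a(1) x(3,5) b(1) x(4,6) ab A(5) G_mem[OF b(1) x(1,2) t(1)] bt_G[OF b(1) x(1,2) t(1)] _ A(2)])
           (use e t in simp)
    qed
    have lt: "d a x < 2 * \<tau>" "d a x < \<tau>" "d b x < 2 * \<tau>" "d b x < \<tau>" if "x \<in> {p,q,r}" for x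
      using that nr near_lt a(1) b(1) by blast+
    have dab: "d a b < 2 * \<tau>" using tri[OF a(1) S(1) b(1)] lt(2,4)[of p] dsym[of p b] by simp
    have path: "path (\<lambda>t. lg a (G b x t))" if x: "x \<in> {p,q,r}" for x
    proof (rule lg_path[OF a(1) b(1)])
      show xS: "x \<in> S" "d b x < 2 * \<tau>" using x S lt by auto
      fix t :: real assume t: "t \<in> {0..1}"
      have "d (G b x t) x \<le> d b x" using bt_le(2)[OF bt_G[OF b(1) xS t]] .
      then show "d a (G b x t) < 2 * \<tau>"
        using tri[OF a(1) xS(1) G_mem[OF b(1) xS t]] dsym[of x "G b x t"] lt(2)[OF x] lt(4)[OF x] by simp
    qed
    have ends: "pathstart (\<lambda>t. lg a (G b x t)) = lg a b" "pathfinish (\<lambda>t. lg a (G b x t)) = lg a x" if "x \<in> {p,q,r}" for x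
      using that S lt G0[OF b(1)] G1[OF b(1)] by (auto simp: pathstart_def pathfinish_def)
    have ne0: "x \<noteq> a" if "x \<in> {p, q, r}" for x
    proof
      assume "x = a"
      then have "d a y = 0" if "y \<in> {p, q, r}" for y using near_eq[of y a x] that \<open>x \<in> {p,q,r}\<close> nr dself a(1) by auto
      then have "p = a" "q = a" using d0 a(1) S by auto
      then show False using ne by simp
    qed
    have nz: "lg a x \<noteq> 0" if "x \<in> {p,q,r}" for x using that S lt ne0 by (intro lg_nonzero[OF a(1)]) auto
    have nzp: "lg a p \<noteq> 0" "lg a q \<noteq> 0" "lg a r \<noteq> 0" using nz by auto
    \<comment> \<open>The radius from \<open>b\<close> to \<open>x\<close> avoids the rays from
      \<open>a\<close> through the other two sites, so \<open>b\<close> and \<open>x\<close> appear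
      from \<open>a\<close> in the same sector between those rays.\<close>
    have sep: "ang (lg a y) (lg a b) < ang (lg a y) (lg a z) \<longleftrightarrow> ang (lg a y) (lg a x) < ang (lg a y) (lg a z)"
      if "x \<in> {p,q,r}" "y \<in> {p,q,r}" "z \<in> {p,q,r}" "x \<noteq> y" "x \<noteq> z" for x y z
      using ang_separates[OF path[OF that(1)] nz[OF that(2)] nz[OF that(3)]] avoid[where x=x and y=y] avoid[where x=x and y=z] ends[OF that(1)] that by auto
    have lb: "lg a b \<noteq> 0" using lg_nonzero[OF a(1) b(1) dab] ab by simp
    define A where "A x = ang (lg a p) (lg a x)" for x
    have o': "A q < A r" using o by (simp add: A_def)
    have "A p = 0" using ang_self nzp by (simp add: A_def)
    have bnd: "0 \<le> A x" "A x < 2 * pi" for x using ang_bounds by (auto simp: A_def)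
    \<comment> \<open>With the angles measured from \<open>p\<close>, the centre \<open>b\<close>
      lies in the sector from \<open>q\<close> to \<open>r\<close>, which does not contain
      \<open>p\<close>.\<close>
    have 1: "A b < A r" using sep[of q p r] ne o' by (auto simp: A_def)
    have 2: "A q \<le> A b" using sep[of r p q] ne o' by (auto simp: A_def not_less)
    have q0: "A q > 0"
    proof (rule ccontr)
      assume "\<not> A q > 0"
      then have "ang (lg a p) (lg a q) = 0" using bnd[of q] by (simp add: A_def)
      then obtain k where k: "k \<ge> 0" "lg a q = k *\<^sub>R lg a p" using ang_0[OF nzp(1)] by blast
      have "d a q < 2 * \<tau>" using lt(1)[of q] by simp
      from same_direction[OF a(1) S(2,1) this near_eq[OF nr(2,1)] k(2,1)] show False using ne by simp
    qed
    \<comment> \<open>Measured from \<open>q\<close> instead, the sector is bounded by the angle of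
      \<open>r\<close>, and the radius from \<open>b\<close> to \<open>p\<close> forces
      \<open>p\<close> into it.\<close>
    have ab': "ang (lg a q) (lg a b) = A b - A q" using ang_diff[OF nzp(1,2) lb] 2 by (simp add: A_def)
    have ar: "ang (lg a q) (lg a r) = A r - A q" using ang_diff[OF nzp(1,2,3)] o' by (simp add: A_def)
    have ap: "ang (lg a q) (lg a p) = 2 * pi - A q" using ang_diff[OF nzp(1,2,1)] q0 \<open>A p = 0\<close> by (simp add: A_def)
    have "ang (lg a q) (lg a p) < ang (lg a q) (lg a r)"
      using sep[of p q r] ne 1 unfolding ab' ar by auto
    then show False unfolding ap ar using bnd(2)[of r] by simp
  qed
  show False
  proof (cases "ang (lg a p) (lg a q) < ang (lg a p) (lg a r)")
    case True then show False using *[OF a(2) b(2) ne] by blast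
  next
    case False
    have S: "p \<in> S" "q \<in> S" "r \<in> S" using near_S a by auto
    have "ang (lg a p) (lg a q) \<noteq> ang (lg a p) (lg a r)"
    proof
      assume e: "ang (lg a p) (lg a q) = ang (lg a p) (lg a r)"
      have l: "d a p < 2 * \<tau>" "d a q < 2 * \<tau>" "d a r < 2 * \<tau>" using near_lt(3)[OF a(1)] a(2) by auto
      have eq: "d a q = d a r" "d a p = d a q" using near_eq[of q a r] near_eq[of p a q] a(2) by auto
      have "p \<noteq> a \<and> q \<noteq> a \<and> r \<noteq> a"
      proof -
        have "d a p \<noteq> 0"
        proof
          assume "d a p = 0"
          then have "d a p = 0 \<and> d a q = 0" using eq by simp
          then have "a = p" "a = q" using d0 a(1) S by blast+
          then show False using ne by simp
        qed
        then show ?thesis using eq dself[OF a(1)] by auto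
      qed
      then have nz: "lg a p \<noteq> 0" "lg a q \<noteq> 0" "lg a r \<noteq> 0" using lg_nonzero[OF a(1)] S l by auto
      obtain k where k: "k > 0" "lg a q = k *\<^sub>R lg a r" using ang_eq[OF nz(1,3,2) e] by blast
      have "q = r" by (rule same_direction[OF a(1) S(2,3) l(2) eq(1) k(2)]) (use k in simp)
      then show False using ne by simp
    qed
    then have "ang (lg a p) (lg a r) < ang (lg a p) (lg a q)" using False by simp
    then show False using *[of p r q] a(2) b(2) ne by auto
  qed
qed

lemma lg_path_back: assumes c: "c \<in> S" and x: "x \<in> S" "y \<in> S" "d x y < \<tau>" "d c x < \<tau>"
  shows "path (\<lambda>t. lg c (G x y t))"
proof -
  have xy: "d x y < 2 * \<tau>" using x tau by simp
  show ?thesis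
  proof (rule lg_path[OF c x(1,2) xy])
    fix t :: real assume t: "t \<in> {0..1}"
    show "d c (G x y t) < 2 * \<tau>"
      using tri[OF c x(1) G_mem[OF x(1,2) xy t]] bt_le(1)[OF bt_G[OF x(1,2) xy t]] x by simp
  qed
qed

text \<open>On a small circle about \<open>c\<close>, in the sector from \<open>p\<close> to
  \<open>r\<close> that does not contain \<open>q\<close>, the intermediate value theorem yields a
  point equidistant from \<open>p\<close> and \<open>r\<close>. The site \<open>q\<close> is not
  nearest there: the geodesic to it would have to leave the sector through the ray of
  \<open>p\<close> or of \<open>r\<close>.\<close>

lemma accumulates_aux:
  assumes c: "c \<in> S" "near c = {p, q, r}" and ne: "p \<noteq> q" "p \<noteq> r" "q \<noteq> r" and e: "e > 0"
    and o: "ang (lg c p) (lg c r) < ang (lg c p) (lg c q)"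
  shows "\<exists>x\<in>S. x \<noteq> c \<and> d c x < e \<and> near x = {p, r}"
proof -
  have nr: "p \<in> near c" "q \<in> near c" "r \<in> near c" using c by auto
  have S: "p \<in> S" "q \<in> S" "r \<in> S" using near_S nr by blast+
  have l: "d c p < \<tau>" "d c q < \<tau>" "d c r < \<tau>" "d c p < 2 * \<tau>" "d c q < 2 * \<tau>" "d c r < 2 * \<tau>" using near_lt c(1) nr by blast+
  have eq: "d c q = d c p" "d c r = d c p" using near_eq nr by blast+
  have p0: "d c p > 0"
  proof (rule ccontr)
    assume "\<not> d c p > 0"
    then have "d c p = 0 \<and> d c q = 0" using dnn[of c p] eq by linarith
    then have "c = p" "c = q" using d0 c(1) S by blast+
    then show False using ne by simp
  qed
  define u v w where "u = lg c p" and "v = lg c r" and "w = lg c q"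
  have nrm: "cmod u = d c p" "cmod v = d c p" "cmod w = d c p"
    using lg_norm[OF c(1)] S l eq by (auto simp: u_def v_def w_def)
  have nz: "u \<noteq> 0" "v \<noteq> 0" "w \<noteq> 0" using nrm p0 by auto
  define A where "A = ang u v"
  have Aw: "A < ang u w" using o by (simp add: A_def u_def v_def w_def)
  have A0: "0 < A"
  proof (rule ccontr)
    assume "\<not> 0 < A"
    then have "ang u v = 0" using ang_bounds(1)[of u v] by (simp add: A_def)
    then obtain k where k: "k \<ge> 0" "v = k *\<^sub>R u" using ang_0[OF nz(1)] by blast
    have "r = p" by (rule same_direction[OF c(1) S(3,1) l(6) eq(2) _ k(1)]) (use k(2) in \<open>simp add: u_def v_def\<close>)
    then show False using ne by simp
  qed
  obtain r0 where r0: "r0 > 0" "\<And>y. y \<in> S \<Longrightarrow> d c y < r0 \<Longrightarrow> near y \<subseteq> near c" using near_local[OF c(1)] by blast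
  \<comment> \<open>Below \<open>r0\<close> only \<open>p\<close>, \<open>q\<close> and
    \<open>r\<close> can be nearest; below \<open>d c p\<close> the circle meets the radii before
    they reach the sites.\<close>
  obtain \<rho> where \<rho>: "0 < \<rho>" "\<rho> < e" "\<rho> < r0" "\<rho> < d c p"
    using dense_order_class.dense[of 0 "min (min e r0) (d c p)"] e r0 p0 by auto
  define U where "U = u / of_real (cmod u)"
  have U1: "cmod U = 1" using nz by (simp add: U_def norm_divide)
  define z where "z \<theta> = of_real \<rho> * (cis \<theta> * U)" for \<theta>
  have zn: "cmod (z \<theta>) = \<rho>" for \<theta> using U1 \<rho> by (simp add: z_def norm_mult)
  have zb: "cmod (z \<theta>) < 2 * \<tau>" for \<theta> using zn \<rho> l by simp
  define x where "x \<theta> = ex c (z \<theta>)" for \<theta>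
  have x: "x \<theta> \<in> S" "lg c (x \<theta>) = z \<theta>" "d c (x \<theta>) = \<rho>" for \<theta>
    using ex[OF c(1) zb] zn by (simp_all add: x_def)
  have xne: "x \<theta> \<noteq> c" for \<theta> using x(3)[of \<theta>] \<rho> dself[OF c(1)] by auto
  have az: "ang u (z \<theta>) = \<theta>" if t: "0 \<le> \<theta>" "\<theta> < 2 * pi" for \<theta>
    unfolding ang_def
  proof (rule Arg2pi_unique[of "\<rho> / cmod u"])
    show "of_real (\<rho> / cmod u) * exp (\<i> * of_real \<theta>) = z \<theta> / u"
      using nz by (simp add: z_def U_def cis_conv_exp field_simps)
  qed (use t \<rho> nz in auto)
  have z0: "z 0 = (\<rho> / d c p) *\<^sub>R u" using nrm by (simp add: z_def U_def scaleR_conv_of_real)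
  have zA: "z A = (\<rho> / d c p) *\<^sub>R v"
  proof -
    have "v / u = of_real (cmod (v / u)) * exp (\<i> * of_real A)" using Arg2pi_eq[of "v / u"] by (simp add: A_def ang_def)
    moreover have "cmod (v / u) = 1" using nrm p0 by (simp add: norm_divide)
    ultimately have "v = cis A * u" using nz by (simp add: cis_conv_exp field_simps)
    then show ?thesis using nrm by (simp add: z_def U_def scaleR_conv_of_real)
  qed
  have end_near: "d (x \<theta>) s < d (x \<theta>) s'" if s: "s \<in> near c" "z \<theta> = (\<rho> / d c p) *\<^sub>R lg c s" "s' \<in> near c" "s' \<noteq> s" for \<theta> s s'
  proof -
    have "bt c (x \<theta>) s"
      by (rule lg_bt[OF c(1) x(1) near_S[OF s(1)] near_lt(3)[OF c(1) s(1)], of _ "\<rho> / d c p"])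
         (use x s \<rho> near_eq[OF s(1) nr(1)] in auto)
    then have "bt s (x \<theta>) c" using bt_sym by blast
    from near_strict(2)[OF c(1) s(1) x(1) this xne near_P[OF s(3)] s(4)] show ?thesis .
  qed
  \<comment> \<open>At angle \<open>0\<close> the circle crosses the radius to \<open>p\<close>, at
    angle \<open>A\<close> the radius to \<open>r\<close>. There the respective site is strictly
    nearest, so the difference of the two distances changes sign in between.\<close>
  have h0: "d (x 0) p < d (x 0) r" by (rule end_near[OF nr(1) _ nr(3)]) (use z0 ne in \<open>auto simp: u_def\<close>)
  have hA: "d (x A) r < d (x A) p" by (rule end_near[OF nr(3) _ nr(1)]) (use zA ne in \<open>auto simp: v_def\<close>)
  have cont: "continuous_on {0..A} (\<lambda>\<theta>. d (x \<theta>) s)" if s: "s \<in> S" for s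
  proof -
    have "continuous_map (top_of_set {0..A}) (top_of_set (ball 0 (2 * \<tau>))) z"
      using zb by (auto simp: continuous_map_in_subtopology z_def cis_conv_exp intro!: continuous_intros)
    from continuous_map_compose[OF continuous_map_compose[OF this ex_cont[OF c(1)]] dist_cont[OF s]]
    show ?thesis by (simp add: o_def x_def dsym[of s])
  qed
  have "continuous_on {0..A} (\<lambda>\<theta>. d (x \<theta>) p - d (x \<theta>) r)" using cont S by (intro continuous_on_diff) auto
  then obtain \<theta> where \<theta>: "0 \<le> \<theta>" "\<theta> \<le> A" "d (x \<theta>) p - d (x \<theta>) r = 0"
    using IVT'[of "\<lambda>\<theta>. d (x \<theta>) p - d (x \<theta>) r" 0 0 A] h0 hA A0 by auto
  have "\<theta> \<noteq> 0" "\<theta> \<noteq> A" using \<theta>(3) h0 hA by auto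
  then have \<theta>': "0 < \<theta>" "\<theta> < A" using \<theta> by auto
  have A2: "A < 2 * pi" using ang_bounds(2) by (simp add: A_def)
  define y where "y = x \<theta>"
  have y: "y \<in> S" "lg c y = z \<theta>" "d c y = \<rho>" "y \<noteq> c" using x xne by (auto simp: y_def)
  have ay: "ang u (lg c y) = \<theta>" using az \<theta>' A2 y by simp
  have sub: "near y \<subseteq> {p, q, r}" using r0(2)[OF y(1)] y \<rho> c by simp
  have "q \<notin> near y"
  proof
    assume q: "q \<in> near y"
    have yq: "d y q < \<tau>" "d y q < 2 * \<tau>" using near_lt[OF y(1) q] by auto
    let ?g = "\<lambda>t. lg c (G y q t)"
    have path: "path ?g" by (rule lg_path_back[OF c(1) y(1) S(2) yq(1)]) (use y \<rho> l in simp)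
    have ends: "pathstart ?g = lg c y" "pathfinish ?g = w"
      using G0[OF y(1) S(2) yq(2)] G1[OF y(1) S(2) yq(2)] by (auto simp: pathstart_def pathfinish_def w_def)
    \<comment> \<open>A common point of the geodesic to \<open>q\<close> and the ray of
      \<open>s\<close> has \<open>q\<close> as its only nearest site. On the radius to
      \<open>s\<close> that contradicts \<open>near_strict\<close>; beyond \<open>s\<close> the
      triangle inequality through \<open>q\<close> makes \<open>s\<close> no farther than
      \<open>q\<close>.\<close>
    have av: "\<zeta> \<noteq> k *\<^sub>R lg c s" if A: "\<zeta> \<in> path_image ?g" "k \<ge> 0" "s \<in> {p, r}" for \<zeta> k s
    proof
      assume e: "\<zeta> = k *\<^sub>R lg c s"
      obtain t where t: "t \<in> {0..1}" "\<zeta> = lg c (G y q t)" using A(1) by (auto simp: path_image_def)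
      define n where "n = G y q t"
      have n: "n \<in> S" "bt y n q" "lg c n = k *\<^sub>R lg c s"
        using G_mem[OF y(1) S(2) yq(2) t(1)] bt_G[OF y(1) S(2) yq(2) t(1)] t(2) e by (auto simp: n_def)
      have s: "s \<in> near c" "s \<noteq> q" "s \<in> S" "d c s = d c p" using A(3) nr ne S eq by auto
      have lgs: "lg c s \<noteq> 0" "ang u (lg c s) \<in> {0, A}" using A(3) nz ang_self[of u] by (auto simp: A_def u_def v_def)
      have "n \<noteq> y"
      proof
        assume "n = y"
        then have ey: "lg c y = k *\<^sub>R lg c s" using n by simp
        have "lg c y \<noteq> 0" using zn[of \<theta>] y \<rho> by auto
        then have "k > 0" using ey A(2) by (cases "k = 0") auto
        have "ang u (lg c y) = ang u (lg c s)"
        proof -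
          have "lg c y / u = of_real k * (lg c s / u)" using ey by (simp add: scaleR_conv_of_real)
          then show ?thesis unfolding ang_def using Arg2pi_times_of_real[OF \<open>k > 0\<close>] by metis
        qed
        then show False using ay lgs \<theta>' by auto
      qed
      have nq: "near n = {q}" "\<And>s. s \<in> P \<Longrightarrow> s \<noteq> q \<Longrightarrow> d n q < d n s"
        using near_strict[OF y(1) q n(1) _ \<open>n \<noteq> y\<close>] n(2) bt_sym by blast+
      have cn: "d c n < 2 * \<tau>" using tri[OF c(1) y(1) n(1)] bt_le(1)[OF n(2)] yq y \<rho> l by simp
      show False
      proof (cases "d c n \<le> d c s")
        case True
        have "bt c n s" by (rule lg_bt[OF c(1) n(1) s(3) _ True n(3) A(2)]) (use s l in simp)
        then have "bt s n c" using bt_sym by blast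
        then have "n = c \<or> near n = {s}" using near_strict(1)[OF c(1) s(1) n(1)] by blast
        then show False using nq(1) c(2) s(2) ne by auto
      next
        case False
        have k: "k > 0"
        proof (rule ccontr)
          assume "\<not> k > 0"
          then have "lg c n = 0" using n A(2) by simp
          then show False using lg_norm[OF c(1) n(1) cn] False dnn[of c s] by simp
        qed
        have "bt c s n" by (rule lg_bt[OF c(1) s(3) n(1) cn, of "1 / k"]) (use False n(3) k in auto)
        then have "d c n = d c s + d s n" by (simp add: bt_def)
        moreover have "d n q < d n s" using nq(2) near_P[OF s(1)] s(2) by blast
        ultimately show False using tri[OF c(1) S(2) n(1)] eq s(4) dsym[of q n] dsym[of s n] by simp
      qed
    qed
    have "ang u (pathstart ?g) < ang u v \<longleftrightarrow> ang u (pathfinish ?g) < ang u v"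
      by (rule ang_separates[OF path nz(1,2)]) (use av in \<open>auto simp: u_def v_def\<close>)
    then show False unfolding ends ay using \<theta>' Aw by (simp add: A_def)
  qed
  then have sub': "near y \<subseteq> {p, r}" using sub by auto
  moreover have "d y p = d y r" using \<theta>(3) by (simp add: y_def)
  moreover obtain s where "s \<in> near y" using near_ne[OF y(1)] by blast
  ultimately have "near y = {p, r}" using near_P[OF nr(1)] near_P[OF nr(3)] by (auto simp: near_def)
  then show ?thesis using y \<rho> by auto
qed

text \<open>\<open>accumulates_aux\<close> wants \<open>q\<close> outside the counterclockwise
  sector from \<open>p\<close> to \<open>r\<close>. If it is inside, exchanging \<open>p\<close> and
  \<open>r\<close> selects the complementary sector.\<close>

lemma voronoi_edge_accumulates:
  assumes c: "c \<in> S" "near c = {p, q, r}" and ne: "p \<noteq> q" "p \<noteq> r" "q \<noteq> r" and e: "e > 0"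
  shows "\<exists>x\<in>S. x \<noteq> c \<and> d c x < e \<and> near x = {p, r}"
proof (cases "ang (lg c p) (lg c r) < ang (lg c p) (lg c q)")
  case True then show ?thesis by (rule accumulates_aux[OF assms])
next
  case False
  have nr: "p \<in> near c" "q \<in> near c" "r \<in> near c" using c by auto
  have S: "p \<in> S" "q \<in> S" "r \<in> S" using near_S nr by blast+
  have l: "d c p < 2 * \<tau>" "d c q < 2 * \<tau>" "d c r < 2 * \<tau>" using near_lt c(1) nr by blast+
  have eq: "d c q = d c p" "d c r = d c p" "d c q = d c r" using near_eq nr by blast+
  have "p \<noteq> c \<and> q \<noteq> c \<and> r \<noteq> c"
  proof -
    have "d c p \<noteq> 0"
    proof
      assume "d c p = 0"
      then have "d c p = 0 \<and> d c q = 0" using eq by simp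
      then have "c = p" "c = q" using d0 c(1) S by blast+
      then show False using ne by simp
    qed
    then show ?thesis using eq dself[OF c(1)] by auto
  qed
  then have nz: "lg c p \<noteq> 0" "lg c q \<noteq> 0" "lg c r \<noteq> 0" using lg_nonzero[OF c(1)] S l by auto
  have "ang (lg c p) (lg c q) \<noteq> ang (lg c p) (lg c r)"
  proof
    assume e: "ang (lg c p) (lg c q) = ang (lg c p) (lg c r)"
    obtain k where k: "k > 0" "lg c q = k *\<^sub>R lg c r" using ang_eq[OF nz(1,3,2) e] by blast
    have "q = r" by (rule same_direction[OF c(1) S(2,3) l(2) eq(3) k(2)]) (use k in simp)
    then show False using ne by simp
  qed
  then have lt: "ang (lg c p) (lg c q) < ang (lg c p) (lg c r)" using False by simp
  have q0: "ang (lg c p) (lg c q) > 0"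
  proof (rule ccontr)
    assume "\<not> ang (lg c p) (lg c q) > 0"
    then have "ang (lg c p) (lg c q) = 0" using ang_bounds(1)[of "lg c p" "lg c q"] by simp
    then obtain k where k: "k \<ge> 0" "lg c q = k *\<^sub>R lg c p" using ang_0[OF nz(1)] by blast
    have "q = p" by (rule same_direction[OF c(1) S(2,1) l(2) eq(1) k(2,1)])
    then show False using ne by simp
  qed
  have "ang (lg c r) (lg c q) = 2 * pi + ang (lg c p) (lg c q) - ang (lg c p) (lg c r)"
    using ang_diff[OF nz(1,3,2)] lt by simp
  moreover have "ang (lg c r) (lg c p) = 2 * pi - ang (lg c p) (lg c r)"
    using ang_diff[OF nz(1,3,1)] lt q0 ang_self[OF nz(1)] by simp
  ultimately have "ang (lg c r) (lg c p) < ang (lg c r) (lg c q)" using q0 by simp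
  moreover have "near c = {r, q, p}" using c by auto
  ultimately show ?thesis using accumulates_aux[OF c(1), of r q p e] ne e by (auto simp: insert_commute)
qed

section \<open>Voronoi cells\<close>

lemma site_near_self: assumes "p \<in> P" shows "near p = {p}"
proof -
  have pS: "p \<in> S" using assms PS by blast
  have "d p q > 0" if "q \<in> P" "q \<noteq> p" for q using dpos pS that PS by blast
  then show ?thesis using assms dself[OF pS] dnn by (fastforce simp: near_def)
qed

text \<open>The boundary of the Voronoi cell of \<open>p\<close>.\<close>

definition bd :: "'a \<Rightarrow> 'a set" where "bd p = {x\<in>S. p \<in> near x \<and> near x \<noteq> {p}}"

lemma near_closed: assumes l: "l \<in> S" and ap: "\<And>e. e > 0 \<Longrightarrow> \<exists>x\<in>S. d l x < e \<and> p \<in> near x" shows "p \<in> near l"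
proof -
  obtain r where "r > 0" "\<And>y. y \<in> S \<Longrightarrow> d l y < r \<Longrightarrow> near y \<subseteq> near l" using near_local[OF l] by blast
  then show ?thesis using ap by blast
qed

lemma bd_closed: assumes l: "l \<in> S" and ap: "\<And>e. e > 0 \<Longrightarrow> \<exists>x\<in>bd p. d l x < e" shows "l \<in> bd p"
proof -
  obtain r where r: "r > 0" "\<And>y. y \<in> S \<Longrightarrow> d l y < r \<Longrightarrow> near y \<subseteq> near l" using near_local[OF l] by blast
  obtain x where x: "x \<in> bd p" "d l x < r" using ap[OF r(1)] by blast
  then have "near x \<subseteq> near l" "p \<in> near x" "near x \<noteq> {p}" using r(2) by (auto simp: bd_def)
  then show ?thesis using l by (auto simp: bd_def)
qed

lemma bd_ne: assumes "p \<in> P" "x \<in> bd p" shows "x \<noteq> p" using site_near_self[OF assms(1)] assms(2) by (auto simp: bd_def)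

text \<open>Of two boundary points on one ray, the nearer would have \<open>p\<close> as its only
  nearest site by \<open>near_strict\<close>.\<close>

lemma bd_unique:
  assumes p: "p \<in> P" and x: "x \<in> bd p" "y \<in> bd p" and k: "lg p x = k *\<^sub>R lg p y" "k \<ge> 0"
  shows "x = y"
proof (rule ccontr)
  assume ne: "x \<noteq> y"
  have pS: "p \<in> S" using p PS by blast
  have xS: "x \<in> S" "p \<in> near x" "near x \<noteq> {p}" and yS: "y \<in> S" "p \<in> near y" "near y \<noteq> {p}" using x by (auto simp: bd_def)
  have l: "d p x < 2 * \<tau>" "d p y < 2 * \<tau>" using near_lt(3) xS yS dsym by metis+
  have no: False if "bt p u v" "u \<noteq> v" "u \<in> bd p" "v \<in> bd p" for u v
    using near_strict(1)[of v p u] that by (auto simp: bd_def)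
  show False
  proof (cases "d p x \<le> d p y")
    case True
    then have "bt p x y" using lg_bt[OF pS xS(1) yS(1) l(2) _ k] by blast
    then show False using no[OF _ ne x] by blast
  next
    case False
    have "lg p x \<noteq> 0" using lg_nonzero[OF pS xS(1) l(1) bd_ne[OF p x(1)]] .
    then have "k > 0" using k by (cases "k = 0") auto
    then have "lg p y = (1/k) *\<^sub>R lg p x" using k by simp
    then have "bt p y x" using lg_bt[OF pS yS(1) xS(1) l(1), of "1/k"] False \<open>k > 0\<close> by simp
    then show False using no[of y x] ne x by blast
  qed
qed

text \<open>The exit is the supremum of the parameters at which \<open>p\<close> is nearest. There
  \<open>p\<close> is still nearest by closedness, but not alone, since \<open>near_local\<close>
  would allow going on; density bounds the parameter by \<open>\<delta>\<close>. The ray starts at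
  \<open>m\<close> and passes \<open>p\<close> at distance \<open>h0\<close>, because one
  application follows a geodesic through \<open>p\<close> that issues from elsewhere.\<close>

lemma ray_exit:
  assumes m: "m \<in> S" and p: "p \<in> P" and u: "cmod u = 1" and h0: "0 \<le> h0" "h0 + \<delta> < 2 * \<tau>" and st: "ex m (of_real h0 * u) = p"
  obtains s where "0 \<le> s" "s < \<delta>" "ex m (of_real (h0 + s) * u) \<in> bd p" "d p (ex m (of_real (h0 + s) * u)) = s"
proof -
  define y where "y s = ex m (of_real (h0 + s) * u)" for s
  have pS: "p \<in> S" using p PS by blast
  have zb: "cmod (of_real (h0 + s) * u) = h0 + s" if "0 \<le> s" for s unfolding norm_mult norm_of_real u using that h0 by simp
  have yS: "y s \<in> S" "lg m (y s) = of_real (h0 + s) * u" "d m (y s) = h0 + s" if s: "0 \<le> s" "s \<le> \<delta>" for s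
    using ex[OF m, of "of_real (h0 + s) * u"] zb[OF s(1)] s h0 by (auto simp: y_def)
  have bt: "bt m (y s) (y t)" if s: "0 \<le> s" "s \<le> t" "t \<le> \<delta>" for s t
  proof (cases "h0 + t = 0")
    case True
    then have "s = t" using s h0(1) by linarith
    then show ?thesis using dself yS(1)[of t] s by (simp add: bt_def)
  next
    case False
    have "lg m (y s) = ((h0 + s) / (h0 + t)) *\<^sub>R lg m (y t)"
    proof -
      have "of_real ((h0 + s) / (h0 + t)) * of_real (h0 + t) = (of_real (h0 + s) :: complex)"
        unfolding of_real_mult[symmetric] using False by simp
      then show ?thesis using yS(2)[of s] yS(2)[of t] s by (simp only: scaleR_conv_of_real mult.assoc[symmetric] order_trans[OF s(1,2)] order_trans[OF s(2,3)])
    qed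
    then show ?thesis
      using s h0 yS[of s] yS[of t] by (intro lg_bt[OF m, of _ _ "(h0 + s) / (h0 + t)"]) auto
  qed
  have dst: "d (y s) (y t) = t - s" if s: "0 \<le> s" "s \<le> t" "t \<le> \<delta>" for s t
    using bt[OF s] yS(3)[of s] yS(3)[of t] s by (simp add: bt_def)
  have y0: "y 0 = p" using st by (simp add: y_def)
  have dp: "d p (y s) = s" if "0 \<le> s" "s \<le> \<delta>" for s using dst[of 0 s] that y0 by simp
  define H where "H = {s\<in>{0..\<delta>}. p \<in> near (y s)}"
  have H0: "0 \<in> H" using site_near_self[OF p] y0 delta by (simp add: H_def)
  have bdd: "bdd_above H" by (rule bdd_aboveI[of _ \<delta>]) (auto simp: H_def)
  define s where "s = Sup H"
  have s: "0 \<le> s" "s \<le> \<delta>" unfolding s_def using cSup_upper[OF H0 bdd] H0 by (auto intro!: cSup_least simp: H_def)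
  have "p \<in> near (y s)"
  proof (rule near_closed[OF yS(1)[OF s]])
    fix e :: real assume e: "e > 0"
    obtain t where t: "t \<in> H" "s - e < t" using less_cSup_iff[of H "s - e"] H0 bdd e by (auto simp: s_def)
    have "t \<le> s" using cSup_upper[OF t(1) bdd] by (simp add: s_def)
    then have "d (y s) (y t) < e" using dst[of t s] t s dsym[of "y s"] by (auto simp: H_def)
    then show "\<exists>x\<in>S. d (y s) x < e \<and> p \<in> near x" using t yS(1)[of t] by (auto simp: H_def)
  qed
  then have "d (y s) p < \<delta>" using near_lt(1)[OF yS(1)[OF s]] by blast
  then have sd: "s < \<delta>" using dp[OF s] dsym[of "y s" p] by linarith
  have "near (y s) \<noteq> {p}"
  proof
    assume n: "near (y s) = {p}"
    obtain r where r: "r > 0" "\<And>x. x \<in> S \<Longrightarrow> d (y s) x < r \<Longrightarrow> near x \<subseteq> {p}" using near_local[OF yS(1)[OF s]] n by metis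
    define t where "t = s + min (r / 2) (\<delta> - s)"
    have t: "s < t" "t \<le> \<delta>" "t < s + r" using r sd by (auto simp: t_def)
    then have "near (y t) \<subseteq> {p}" using r(2)[OF yS(1)[of t]] dst[of s t] s by auto
    moreover obtain q where "q \<in> near (y t)" using near_ne[OF yS(1)[of t]] t s by auto
    ultimately have "t \<in> H" using t s by (auto simp: H_def)
    then show False using cSup_upper[OF _ bdd, of t] t by (simp add: s_def)
  qed
  then have "y s \<in> bd p" using \<open>p \<in> near (y s)\<close> yS(1)[OF s] by (simp add: bd_def)
  then show ?thesis using that[OF s(1) sd] dp[OF s] by (simp add: y_def)
qed

definition bp :: "'a \<Rightarrow> real \<Rightarrow> 'a" where "bp p \<theta> = (SOME x. x \<in> bd p \<and> (\<exists>s>0. lg p x = of_real s * cis \<theta>))"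

text \<open>Existence is \<open>ray_exit\<close> with \<open>m = p\<close> and
  \<open>h0 = 0\<close>; uniqueness is \<open>bd_unique\<close>.\<close>

lemma bp: assumes p: "p \<in> P"
  shows "bp p \<theta> \<in> bd p" "\<exists>s>0. lg p (bp p \<theta>) = of_real s * cis \<theta>"
    "\<And>x s. x \<in> bd p \<Longrightarrow> s \<ge> 0 \<Longrightarrow> lg p x = of_real s * cis \<theta> \<Longrightarrow> x = bp p \<theta>"
proof -
  have pS: "p \<in> S" using p PS by blast
  have "ex p (of_real 0 * cis \<theta>) = p" using ex_lg[OF pS pS] lg_self[OF pS] dself[OF pS] tau by simp
  then obtain s where s: "0 \<le> s" "s < \<delta>" "ex p (of_real (0 + s) * cis \<theta>) \<in> bd p"
    using ray_exit[OF pS p norm_cis, of 0 \<theta>] delta tau by auto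
  have z: "cmod (of_real s * cis \<theta>) < 2 * \<tau>" using s delta tau by (simp add: norm_mult)
  have lgx: "lg p (ex p (of_real s * cis \<theta>)) = of_real s * cis \<theta>" using ex(2)[OF pS z] .
  have "s \<noteq> 0"
  proof
    assume "s = 0"
    then have "ex p (of_real 0 * cis \<theta>) \<in> bd p" using s by simp
    then show False using bd_ne[OF p] \<open>ex p (of_real 0 * cis \<theta>) = p\<close> by metis
  qed
  then have "\<exists>x. x \<in> bd p \<and> (\<exists>s>0. lg p x = of_real s * cis \<theta>)" using s lgx by (intro exI[of _ "ex p (of_real s * cis \<theta>)"]) auto
  from someI_ex[OF this] show b: "bp p \<theta> \<in> bd p" "\<exists>s>0. lg p (bp p \<theta>) = of_real s * cis \<theta>" unfolding bp_def by auto
  then obtain t where t: "t > 0" "lg p (bp p \<theta>) = of_real t * cis \<theta>" by blast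
  show "x = bp p \<theta>" if "x \<in> bd p" "s \<ge> 0" "lg p x = of_real s * cis \<theta>" for x s
    by (rule bd_unique[OF p that(1) b(1), of "s / t"]) (use t that in \<open>auto simp: scaleR_conv_of_real\<close>)
qed

lemma bp_periodic: assumes p: "p \<in> P" shows "bp p (\<theta> + 2 * pi) = bp p \<theta>"
proof -
  obtain s where s: "s > 0" "lg p (bp p (\<theta> + 2 * pi)) = of_real s * cis (\<theta> + 2 * pi)" using bp(2)[OF p] by blast
  have "cis (\<theta> + 2 * pi) = cis \<theta>" by (simp add: complex_eq_iff)
  then have "lg p (bp p (\<theta> + 2 * pi)) = of_real s * cis \<theta>" using s(2) by simp
  from bp(3)[OF p bp(1)[OF p] _ this] show ?thesis using s(1) by linarith
qed

lemma bp_inj: assumes p: "p \<in> P" and e: "bp p \<theta> = bp p \<phi>" and lt: "\<bar>\<theta> - \<phi>\<bar> < 2 * pi" shows "\<theta> = \<phi>"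
proof -
  obtain s where s: "s > 0" "lg p (bp p \<theta>) = of_real s * cis \<theta>" using bp(2)[OF p] by blast
  obtain t where t: "t > 0" "lg p (bp p \<phi>) = of_real t * cis \<phi>" using bp(2)[OF p] by blast
  have eq: "of_real s * cis \<theta> = of_real t * cis \<phi>" using s t e by simp
  then have "cmod (of_real s * cis \<theta>) = cmod (of_real t * cis \<phi>)" by simp
  then have "s = t" using s t by (simp add: norm_mult)
  then have "cis \<theta> = cis \<phi>" using eq t by simp
  then have "cis (\<theta> - \<phi>) = 1" by (simp add: cis_divide[symmetric])
  then have "cos (\<theta> - \<phi>) = 1" by (simp add: complex_eq_iff)
  then obtain n :: int where "\<theta> - \<phi> = n * 2 * pi" by (auto simp: cos_one_2pi_int)
  moreover have "\<bar>real_of_int n * (2 * pi)\<bar> < 2 * pi \<Longrightarrow> n = 0"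
  proof -
    assume "\<bar>real_of_int n * (2 * pi)\<bar> < 2 * pi"
    then have "\<bar>real_of_int n\<bar> < 1" by (simp add: abs_mult)
    then show "n = 0" by linarith
  qed
  ultimately show ?thesis using lt by (simp add: mult.assoc)
qed

text \<open>By compactness: a limit of boundary points whose angles tend to \<open>\<theta>\<close>
  lies in the closed set \<open>bd p\<close> and in the direction \<open>\<theta>\<close>, so it is
  \<open>bp p \<theta>\<close>.\<close>

lemma bp_cont: assumes p: "p \<in> P" and e: "e > 0"
  shows "\<exists>r>0. \<forall>\<phi>. \<bar>\<phi> - \<theta>\<bar> < r \<longrightarrow> d (bp p \<theta>) (bp p \<phi>) < e"
proof (rule ccontr)
  assume n: "\<not> ?thesis"
  have pS: "p \<in> S" using p PS by blast
  have "\<exists>\<phi>. \<bar>\<phi> - \<theta>\<bar> < 1 / Suc n \<and> \<not> d (bp p \<theta>) (bp p \<phi>) < e" for n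
  proof -
    have "(0::real) < 1 / Suc n" by simp
    then show ?thesis using n by blast
  qed
  then obtain f where f: "\<And>n. \<bar>f n - \<theta>\<bar> < 1 / Suc n" "\<And>n. \<not> d (bp p \<theta>) (bp p (f n)) < e" by metis
  have bS: "bp p \<phi> \<in> S" for \<phi> using bp(1)[OF p] by (auto simp: bd_def)
  obtain l and s :: "nat \<Rightarrow> nat" where l: "l \<in> S" "strict_mono s" "\<And>e. e > 0 \<Longrightarrow> \<exists>N. \<forall>n\<ge>N. d l (bp p (f (s n))) < e"
    using seq_compact[of "\<lambda>n. bp p (f n)"] bS by blast
  have lb: "l \<in> bd p" by (rule bd_closed[OF l(1)]) (use l(3) bp(1)[OF p] in blast)
  have B: "bp p \<phi> \<in> B p" "l \<in> B p" for \<phi>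
    using near_lt(3)[OF bS] bp(1)[OF p] lb near_lt(3)[OF l(1)] l(1) bS dsym by (auto simp: B_iff bd_def) metis+
  have BS: "B p \<subseteq> S" by (auto simp: B_iff)
  have lim: "(\<lambda>n. lg p (bp p (f (s n)))) \<longlonglongrightarrow> lg p l"
  proof (rule LIMSEQ_I)
    fix e :: real assume "e > 0"
    then obtain r where r: "r > 0" "\<forall>y\<in>B p. d l y < r \<longrightarrow> dist (lg p l) (lg p y) < e"
      using lg_cont[OF pS] B(2) unfolding cont_from[OF BS] by blast
    obtain N where "\<forall>n\<ge>N. d l (bp p (f (s n))) < r" using l(3)[OF r(1)] by blast
    then show "\<exists>N. \<forall>n\<ge>N. norm (lg p (bp p (f (s n))) - lg p l) < e"
      using r(2) B(1) by (intro exI[of _ N]) (auto simp: dist_norm norm_minus_commute)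
  qed
  have "f \<longlonglongrightarrow> \<theta>"
  proof (rule LIMSEQ_I)
    fix e :: real assume "e > 0"
    then obtain K where K: "1 / Suc K < e" by (metis nat_approx_posE)
    have "norm (f n - \<theta>) < e" if "n \<ge> K" for n
    proof -
      have "1 / real (Suc n) \<le> 1 / Suc K" using that by (simp add: frac_le)
      then show ?thesis using f(1)[of n] K by simp
    qed
    then show "\<exists>N. \<forall>n\<ge>N. norm (f n - \<theta>) < e" by blast
  qed
  then have "(\<lambda>n. f (s n)) \<longlonglongrightarrow> \<theta>" using LIMSEQ_subseq_LIMSEQ[OF _ l(2)] by (simp add: o_def)
  then have "(\<lambda>n. cis (f (s n))) \<longlonglongrightarrow> cis \<theta>" unfolding cis_conv_exp by (intro tendsto_intros)
  moreover have "(\<lambda>n. of_real (cmod (lg p (bp p (f (s n)))))) \<longlonglongrightarrow> (of_real (cmod (lg p l)) :: complex)"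
    using lim by (intro tendsto_intros)
  ultimately have "(\<lambda>n. of_real (cmod (lg p (bp p (f (s n))))) * cis (f (s n))) \<longlonglongrightarrow> of_real (cmod (lg p l)) * cis \<theta>"
    by (intro tendsto_mult)
  moreover have "of_real (cmod (lg p (bp p \<phi>))) * cis \<phi> = lg p (bp p \<phi>)" for \<phi>
  proof -
    obtain s where "s > 0" "lg p (bp p \<phi>) = of_real s * cis \<phi>" using bp(2)[OF p] by blast
    then show ?thesis by (simp add: norm_mult)
  qed
  ultimately have "(\<lambda>n. lg p (bp p (f (s n)))) \<longlonglongrightarrow> of_real (cmod (lg p l)) * cis \<theta>" by simp
  then have "lg p l = of_real (cmod (lg p l)) * cis \<theta>" using lim LIMSEQ_unique by blast
  then have "l = bp p \<theta>" using bp(3)[OF p lb, of "cmod (lg p l)"] by simp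
  then show False using l(3)[OF e] f(2) by blast
qed

text \<open>Otherwise all points of the boundary of the cell of \<open>p\<close> would be equidistant from \<open>p\<close> and \<open>q\<close>. The
  ray from the midpoint \<open>m\<close> of \<open>pq\<close> through \<open>p\<close> leaves the cell at a point \<open>x\<close> with \<open>d x m > d x p\<close>,
  against the convexity of the disk about \<open>x\<close> through \<open>p\<close> and \<open>q\<close>.\<close>

lemma bd_not_one_edge:
  assumes a: "a \<in> S" "p \<in> near a" "q \<in> near a" and ne: "p \<noteq> q"
  shows "\<exists>x\<in>bd p. q \<notin> near x"
proof (rule ccontr)
  assume all: "\<not> ?thesis"
  have S: "p \<in> S" "q \<in> S" "p \<in> P" using near_S near_P a by blast+
  have pq: "d p q < 2 * \<tau>" "d p q < 2 * \<delta>" using near_dist2 a by blast+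
  have pos: "d p q > 0" using dpos S ne by blast
  define m where "m = G p q (1/2)"
  have m: "m \<in> S" "d m p = d p q / 2"
    using G_mem[OF S(1,2) pq(1), of "1/2"] G_dl[OF S(1,2) pq(1), of "1/2"] dsym[of m p] by (auto simp: m_def)
  have mp: "d m p < 2 * \<tau>" using m pq dnn[of p q] tau by simp
  define u where "u = lg m p / of_real (d m p)"
  have nm: "cmod (lg m p) = d m p" by (rule lg_norm[OF m(1) S(1) mp])
  have u1: "cmod u = 1" using nm m pos by (simp add: u_def norm_divide)
  have "of_real (d m p) * u = lg m p" using m pos by (simp add: u_def)
  then have st: "ex m (of_real (d m p) * u) = p" using ex_lg[OF m(1) S(1) mp] by simp
  have "d m p + \<delta> < 2 * \<tau>" using m pq delta by simp
  then obtain s where s: "0 \<le> s" "s < \<delta>" "ex m (of_real (d m p + s) * u) \<in> bd p" "d p (ex m (of_real (d m p + s) * u)) = s"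
    using ray_exit[OF m(1) S(3) u1 _ _ st] dnn[of m p] by blast
  define x where "x = ex m (of_real (d m p + s) * u)"
  have x: "x \<in> S" "p \<in> near x" "q \<in> near x" using s(3) all by (auto simp: x_def bd_def)
  have "d m x = d m p + s"
  proof -
    have "cmod (of_real (d m p + s) * u) = d m p + s" unfolding norm_mult norm_of_real u1 using s dnn[of m p] by simp
    moreover have "d m p + s < 2 * \<tau>" using s m pq delta by linarith
    ultimately show ?thesis unfolding x_def using ex(3)[OF m(1), of "of_real (d m p + s) * u"] by linarith
  qed
  moreover have "d x p = s" using s(4) dsym[of x p] by (simp add: x_def)
  moreover have "d x m < d x p"
    unfolding m_def using near_eq[OF x(3,2)] by (intro G_convex[OF x(1) S(1,2) ne near_lt(2)[OF x(1,2)]]) auto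
  ultimately show False using m pos dsym[of x m] by simp
qed

text \<open>The first angle is left free so that the turn can be made to begin at a prescribed
  boundary point.\<close>

lemma bp_surj_from: assumes p: "p \<in> P" and x: "x \<in> bd p"
  obtains t where "\<theta> \<le> t" "t < \<theta> + 2 * pi" "x = bp p t"
proof (rule that)
  define z where "z = lg p x * cis (- \<theta>)"
  show "\<theta> \<le> \<theta> + Arg2pi z" "\<theta> + Arg2pi z < \<theta> + 2 * pi" using Arg2pi_ge_0 Arg2pi_lt_2pi by auto
  have "lg p x = z * cis \<theta>" by (simp add: z_def mult.assoc cis_mult)
  also have "z = of_real (norm z) * cis (Arg2pi z)" unfolding cis_conv_exp by (rule Arg2pi_eq)
  finally have "lg p x = of_real (norm z) * cis (\<theta> + Arg2pi z)" by (simp only: mult.assoc cis_mult add.commute)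
  from bp(3)[OF p x norm_ge_zero this] show "x = bp p (\<theta> + Arg2pi z)" .
qed

lemma bp_near: assumes p: "p \<in> P" shows "bp p t \<in> S" "p \<in> near (bp p t)" "near (bp p t) \<noteq> {p}"
  using bp(1)[OF p] by (auto simp: bd_def)

lemma bp_near_local: assumes p: "p \<in> P"
  obtains r where "r > 0" "\<And>s. \<bar>s - t\<bar> < r \<Longrightarrow> near (bp p s) \<subseteq> near (bp p t)"
proof -
  obtain e where e: "e > 0" "\<And>y. y \<in> S \<Longrightarrow> d (bp p t) y < e \<Longrightarrow> near y \<subseteq> near (bp p t)"
    using near_local[OF bp_near(1)[OF p]] by blast
  obtain r where r: "r > 0" "\<forall>s. \<bar>s - t\<bar> < r \<longrightarrow> d (bp p t) (bp p s) < e" using bp_cont[OF p e(1)] by blast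
  show ?thesis by (rule that[OF r(1)]) (use e(2) r(2) bp_near(1)[OF p] in blast)
qed

lemma near_three:
  assumes "x \<in> S" "p \<in> near x" "q \<in> near x" "p \<noteq> q" "near x \<noteq> {p, q}"
  obtains r where "r \<noteq> p" "r \<noteq> q" "near x = {p, q, r}"
proof -
  obtain r where r: "r \<in> near x" "r \<noteq> p" "r \<noteq> q" using assms by blast
  have "card {p, q, r} = 3" using assms r by auto
  then have "{p, q, r} = near x" using near_card[OF assms(1)] by (intro card_seteq[OF near_fin]) (use assms r in auto)
  then show ?thesis using that r by blast
qed

lemma two_faces:
  assumes a: "a \<in> S" "p \<in> near a" "q \<in> near a" and ne: "p \<noteq> q"
  shows "\<exists>c1\<in>S. \<exists>c2\<in>S. \<exists>r1 r2. r1 \<noteq> r2 \<and> r1 \<notin> {p, q} \<and> r2 \<notin> {p, q} \<and> near c1 = {p, q, r1} \<and> near c2 = {p, q, r2}"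
proof -
  have p: "p \<in> P" using near_P a by blast
  define Q where "Q t = (q \<in> near (bp p t))" for t
  have clo: "\<exists>r>0. \<forall>s. \<bar>s - t\<bar> < r \<longrightarrow> \<not> Q s" if "\<not> Q t" for t
  proof -
    obtain r where "r > 0" "\<And>s. \<bar>s - t\<bar> < r \<Longrightarrow> near (bp p s) \<subseteq> near (bp p t)" using bp_near_local[OF p] by blast
    then show ?thesis using that by (intro exI[of _ r]) (auto simp: Q_def)
  qed
  \<comment> \<open>Close to \<open>t\<close> there is a boundary point not nearest to
    \<open>q\<close>. It has a nearest site besides \<open>p\<close>, and by semicontinuity that
    site is nearest to \<open>bp p t\<close> as well.\<close>
  have fin: "\<exists>r. r \<noteq> p \<and> r \<noteq> q \<and> near (bp p t) = {p, q, r}" if q: "Q t" and acc: "\<And>e. e > 0 \<Longrightarrow> \<exists>s. \<bar>s - t\<bar> < e \<and> \<not> Q s" for t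
  proof -
    obtain r where r: "r > 0" "\<And>s. \<bar>s - t\<bar> < r \<Longrightarrow> near (bp p s) \<subseteq> near (bp p t)" using bp_near_local[OF p] by blast
    obtain s where s: "\<bar>s - t\<bar> < r" "\<not> Q s" using acc[OF r(1)] by blast
    have "near (bp p t) \<noteq> {p, q}" using r(2)[OF s(1)] bp_near[OF p, of s] s(2) by (auto simp: Q_def)
    then show ?thesis using near_three[OF bp_near(1,2)[OF p] _ ne] q unfolding Q_def by blast
  qed
  have "a \<in> bd p" using a ne by (auto simp: bd_def)
  then obtain \<theta> where \<theta>: "a = bp p \<theta>" using bp_surj_from[OF p] by metis
  obtain x where x: "x \<in> bd p" "q \<notin> near x" using bd_not_one_edge[OF a ne] by blast
  obtain u where u: "\<theta> \<le> u" "u < \<theta> + 2 * pi" "x = bp p u" using bp_surj_from[OF p x(1)] by metis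
  have Q: "Q \<theta>" "Q (\<theta> + 2 * pi)" "\<not> Q u" using a x u(3) \<theta> bp_periodic[OF p] by (auto simp: Q_def)
  \<comment> \<open>The turn begins and ends at \<open>a\<close>. On either side of
    \<open>u\<close>, where \<open>q\<close> is not nearest, the last and the first parameter with
    \<open>q\<close> nearest bound a gap.\<close>
  define H1 where "H1 = {t. \<theta> \<le> t \<and> t \<le> u \<and> Q t}"
  define H2 where "H2 = {t. u \<le> t \<and> t \<le> \<theta> + 2 * pi \<and> Q t}"
  have H1: "\<theta> \<in> H1" "bdd_above H1" using u Q by (auto simp: H1_def intro!: bdd_aboveI[of _ u])
  have H2: "\<theta> + 2 * pi \<in> H2" "bdd_below H2" using u Q by (auto simp: H2_def intro!: bdd_belowI[of _ u])
  define t1 where "t1 = Sup H1"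
  define t2 where "t2 = Inf H2"
  have b1: "\<theta> \<le> t1" "t1 \<le> u" unfolding t1_def by (rule cSup_upper[OF H1]) (rule cSup_least, use H1(1) in \<open>auto simp: H1_def\<close>)
  have b2: "t2 \<le> \<theta> + 2 * pi" "u \<le> t2" unfolding t2_def by (rule cInf_lower[OF H2]) (rule cInf_greatest, use H2(1) in \<open>auto simp: H2_def\<close>)
  have q1: "Q t1"
  proof (rule ccontr)
    assume "\<not> Q t1"
    then obtain r where r: "r > 0" "\<forall>s. \<bar>s - t1\<bar> < r \<longrightarrow> \<not> Q s" using clo by blast
    obtain t where t: "t \<in> H1" "t1 - r < t" using less_cSup_iff[of H1 "t1 - r"] H1 r(1) by (auto simp: t1_def)
    have "t \<le> t1" unfolding t1_def by (rule cSup_upper[OF t(1) H1(2)])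
    then have "\<bar>t - t1\<bar> < r" using t by simp
    then show False using r t(1) unfolding H1_def by blast
  qed
  have q2: "Q t2"
  proof (rule ccontr)
    assume "\<not> Q t2"
    then obtain r where r: "r > 0" "\<forall>s. \<bar>s - t2\<bar> < r \<longrightarrow> \<not> Q s" using clo by blast
    obtain t where t: "t \<in> H2" "t < t2 + r" using cInf_less_iff[of H2 "t2 + r"] H2 r(1) by (auto simp: t2_def)
    have "t2 \<le> t" unfolding t2_def by (rule cInf_lower[OF t(1) H2(2)])
    then have "\<bar>t - t2\<bar> < r" using t by simp
    then show False using r t(1) unfolding H2_def by blast
  qed
  have gap: "\<not> Q s" if "t1 < s" "s < t2" for s
  proof
    assume qs: "Q s"
    show False
    proof (cases "s \<le> u")
      case True
      then have "s \<in> H1" using qs that b1 by (simp add: H1_def)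
      then have "s \<le> t1" unfolding t1_def by (rule cSup_upper[OF _ H1(2)])
      then show False using that by simp
    next
      case False
      then have "s \<in> H2" using qs that b2 by (simp add: H2_def)
      then have "t2 \<le> s" unfolding t2_def by (rule cInf_lower[OF _ H2(2)])
      then show False using that by simp
    qed
  qed
  have "t1 \<noteq> u" "t2 \<noteq> u" using q1 q2 Q(3) by auto
  then have lt: "t1 < u" "u < t2" using b1 b2 by auto
  have "\<exists>s. \<bar>s - t1\<bar> < e \<and> \<not> Q s" if "e > 0" for e
    using gap[of "t1 + min (e / 2) (u - t1)"] that lt by (intro exI[of _ "t1 + min (e / 2) (u - t1)"]) auto
  then obtain r1 where r1: "r1 \<noteq> p" "r1 \<noteq> q" "near (bp p t1) = {p, q, r1}" using fin[OF q1] by blast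
  have "\<exists>s. \<bar>s - t2\<bar> < e \<and> \<not> Q s" if "e > 0" for e
    using gap[of "t2 - min (e / 2) (t2 - u)"] that lt by (intro exI[of _ "t2 - min (e / 2) (t2 - u)"]) auto
  then obtain r2 where r2: "r2 \<noteq> p" "r2 \<noteq> q" "near (bp p t2) = {p, q, r2}" using fin[OF q2] by blast
  \<comment> \<open>Equal third sites would have the same circumcentre, so the gap would be the
    whole turn apart from one point. But \<open>voronoi_edge_accumulates\<close> supplies a further
    boundary point nearest to \<open>q\<close>.\<close>
  have "r1 \<noteq> r2"
  proof
    assume r: "r1 = r2"
    have eq: "bp p t1 = bp p t2"
      by (rule circumcentre_unique[of _ p q r1]) (use bp_near(1)[OF p] r1 r2 r ne in auto)
    have "t2 - t1 = 2 * pi"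
    proof (rule ccontr)
      assume "t2 - t1 \<noteq> 2 * pi"
      then have "\<bar>t1 - t2\<bar> < 2 * pi" using lt b1 b2 by simp
      then show False using bp_inj[OF p eq] lt by simp
    qed
    then have t: "t1 = \<theta>" "t2 = \<theta> + 2 * pi" using b1 b2 by auto
    have n: "near (bp p t1) = {p, r1, q}" using r1(3) by auto
    obtain y where y: "y \<in> S" "y \<noteq> bp p t1" "near y = {p, q}"
      using voronoi_edge_accumulates[OF bp_near(1)[OF p] n r1(1)[symmetric] ne r1(2), of 1] by auto
    have "y \<in> bd p" using y ne by (auto simp: bd_def)
    then obtain s where s: "\<theta> \<le> s" "s < \<theta> + 2 * pi" "y = bp p s" using bp_surj_from[OF p] by metis
    have "Q s" using y s by (auto simp: Q_def)
    then have "s = \<theta>" using gap[of s] s t by (cases "\<theta> < s") auto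
    then show False using s y t by simp
  qed
  then show ?thesis using r1 r2 bp_near(1)[OF p] by blast
qed

lemma site_has_edge: assumes "p \<in> P" obtains a q where "a \<in> S" "p \<in> near a" "q \<in> near a" "p \<noteq> q"
  using bp_near[OF assms, of 0] by blast

end

context geosurf begin

section \<open>Geodesic triangles\<close>

definition seg :: "'a \<Rightarrow> 'a \<Rightarrow> 'a set" where "seg x y = {m\<in>S. bt x m y}"

lemma seg_sym: "seg x y = seg y x" by (auto simp: seg_def bt_sym)

lemma seg_G: assumes "x \<in> S" "y \<in> S" "d x y < 2 * \<tau>" shows "seg x y = G x y ` {0..1}"
proof
  show "seg x y \<subseteq> G x y ` {0..1}" using bt_obtain[OF assms(1) _ assms(2,3)] unfolding seg_def by blast
  show "G x y ` {0..1} \<subseteq> seg x y" using bt_G[OF assms] G_mem[OF assms] unfolding seg_def by blast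
qed

lemma G_inj: assumes "x \<in> S" "y \<in> S" "d x y < 2 * \<tau>" "x \<noteq> y" "s \<in> {0..1}" "t \<in> {0..1}" "G x y s = G x y t" shows "s = t"
  using G_d[OF assms(1-3) assms(5,6)] G_mem[OF assms(1-3) assms(6)] dself dpos[OF assms(1,2,4)] assms(7) by auto

lemma convex_strict:
  assumes "a \<in> S" "x \<in> S" "y \<in> S" "d a x \<le> \<rho>" "d a y \<le> \<rho>" "\<rho> < \<tau>" "x \<noteq> y" "m \<in> S" "bt x m y" "m \<noteq> x" "m \<noteq> y"
  shows "d a m < \<rho>"
proof -
  have xy: "d x y < 2 * \<tau>" using tri[OF assms(2,1,3)] dsym[of x a] assms by simp
  obtain t where t: "t \<in> {0..1}" "m = G x y t" using bt_obtain[OF assms(2,8,3) xy assms(9)] by metis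
  have "t \<noteq> 0" "t \<noteq> 1" using t(2) assms G0[OF assms(2,3) xy] G1[OF assms(2,3) xy] by auto
  then show ?thesis unfolding t(2) using t(1) by (intro G_convex assms) auto
qed

end

definition (in geosurf) T :: "'a \<Rightarrow> 'a \<Rightarrow> 'a \<Rightarrow> real \<Rightarrow> real \<Rightarrow> 'a" where "T p q r s h = G p (G q r s) h"

definition (in geosurf) sides :: "'a \<Rightarrow> 'a \<Rightarrow> 'a \<Rightarrow> 'a set" where "sides p q r = seg p q \<union> seg q r \<union> seg p r"

text \<open>The two parameters are packed into a complex number so that invariance of domain applies
  to the parametrisation.\<close>

definition (in geosurf) open_triangle :: "'a \<Rightarrow> 'a \<Rightarrow> 'a \<Rightarrow> 'a set" where
  "open_triangle p q r = (\<lambda>z. T p q r (Re z) (Im z)) ` {z. 0 < Re z \<and> Re z < 1 \<and> 0 < Im z \<and> Im z < 1}"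

locale triangle = sites +
  fixes a p q r
  assumes a: "a \<in> topspace X" and nr: "p \<in> near a" "q \<in> near a" "r \<in> near a" and ne: "p \<noteq> q" "p \<noteq> r" "q \<noteq> r"
begin

lemma mem: "p \<in> S" "q \<in> S" "r \<in> S" "p \<in> P" "q \<in> P" "r \<in> P" using nr near_S near_P by blast+

lemma side: "d q r < 2 * \<tau>" "d p q < 2 * \<tau>" "d p r < 2 * \<tau>" using near_dist2[OF a] nr by blast+

abbreviation \<rho> :: real where "\<rho> \<equiv> d a p"

lemma rad: "d a q = \<rho>" "d a r = \<rho>" "\<rho> < \<tau>" using near_eq nr near_lt[OF a nr(1)] by blast+

abbreviation base :: "real \<Rightarrow> 'a" where "base s \<equiv> G q r s"

lemma base:
  assumes s: "s \<in> {0..1}"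
  shows "base s \<in> S" "base s \<noteq> p" "d a (base s) \<le> \<rho>" "d p (base s) < 2 * \<tau>" "lg p (base s) \<noteq> 0"
proof -
  show S: "base s \<in> S" using G_mem[OF mem(2,3) side(1) s] .
  have bt: "bt q (base s) r" by (rule bt_G[OF mem(2,3) side(1) s])
  show ne: "base s \<noteq> p" using edge_inside(2)[OF a nr(2,3) S bt] ne mem(4) by auto
  show le: "d a (base s) \<le> \<rho>"
  proof (cases "base s = q \<or> base s = r")
    case True then show ?thesis using rad by auto
  next
    case False then show ?thesis using edge_inside(1)[OF a nr(2,3) S bt] rad by auto
  qed
  show lt: "d p (base s) < 2 * \<tau>" using tri[OF mem(1) a S] dsym[of p a] le rad by simp
  show "lg p (base s) \<noteq> 0" by (rule lg_nonzero[OF mem(1) S lt ne])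
qed

lemma T01: "s \<in> {0..1} \<Longrightarrow> T p q r s 0 = p" "s \<in> {0..1} \<Longrightarrow> T p q r s 1 = base s"
  "T p q r 0 h = G p q h" "T p q r 1 h = G p r h"
  using base G0 G1 mem side by (auto simp: T_def)

lemma T:
  assumes s: "s \<in> {0..1}" and h: "h \<in> {0..1}"
  shows "T p q r s h \<in> S" "lg p (T p q r s h) = h *\<^sub>R lg p (base s)" "d p (T p q r s h) = h * d p (base s)"
    "T p q r s h = ex p (h *\<^sub>R lg p (base s))"
  using G_mem[OF mem(1) base(1,4)[OF s] h] lg_ray[OF mem(1) base(1,4)[OF s] h] G_dl[OF mem(1) base(1,4)[OF s] h] G_ex[OF mem(1) base(1,4)[OF s] h]
  by (auto simp: T_def)

text \<open>Let \<open>?x\<close> lie between \<open>p\<close> and \<open>?y\<close>, both on the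
  base. Then \<open>?x\<close> also lies between \<open>?y\<close> and an end \<open>e\<close> of
  the base, so \<open>p\<close> and \<open>e\<close> appear from \<open>?y\<close> in the same
  direction. The nearer of the two sites lies inside the segment from \<open>?y\<close> to the
  other, and strict convexity places it in the empty disk.\<close>

lemma base_ray_aux:
  assumes s: "s \<in> {0..1}" "s' \<in> {0..1}" and k: "bt p (base s) (base s')"
  shows "s = s'"
proof (rule ccontr)
  assume n: "s \<noteq> s'"
  let ?x = "base s" let ?y = "base s'"
  have ne': "?x \<noteq> ?y" using G_inj[OF mem(2,3) side(1) ne(3) s] n by auto
  have x: "?x \<in> S" "?y \<in> S" using base s by auto
  have "\<exists>e\<in>{q, r}. bt e ?x ?y"
  proof (cases "s < s'")
    case True
    have "d q ?x + d ?x ?y = d q ?y" unfolding G_dl[OF mem(2,3) side(1) s(1)] G_dl[OF mem(2,3) side(1) s(2)] G_d[OF mem(2,3) side(1) s]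
      using True by (simp add: algebra_simps)
    then show ?thesis by (simp add: bt_def)
  next
    case False
    have "d ?x r + d ?y ?x = d ?y r" unfolding G_dr[OF mem(2,3) side(1) s(1)] G_dr[OF mem(2,3) side(1) s(2)] G_d[OF mem(2,3) side(1) s(2,1)]
      using False n by (simp add: algebra_simps)
    then have "d r ?x + d ?x ?y = d r ?y" using dsym[of r ?x] dsym[of r ?y] dsym[of ?x ?y] by simp
    then show ?thesis by (simp add: bt_def)
  qed
  then obtain e where e: "e \<in> {q, r}" "bt e ?x ?y" by blast
  have eS: "e \<in> S" "e \<in> near a" "e \<noteq> p" "d a e = \<rho>" using e(1) mem nr ne rad by auto
  have ey: "e \<noteq> ?y" using e(2) x ne' d0[of ?x ?y] dself[of ?y] dnn[of ?x ?y] dnn[of ?y ?x] by (auto simp: bt_def)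
  have dye: "d ?y e < 2 * \<tau>" using tri[OF x(2) a eS(1)] dsym[of ?y a] base(3)[OF s(2)] eS(4) rad by simp
  have dyp: "d ?y p < 2 * \<tau>" using base(4)[OF s(2)] dsym[of ?y p] by simp
  obtain t where t: "t \<in> {0..1}" "lg ?y ?x = t *\<^sub>R lg ?y e" using bt_lg[OF x(2,1) eS(1) dye] e(2) bt_sym by metis
  obtain u where u: "u \<in> {0..1}" "lg ?y ?x = u *\<^sub>R lg ?y p" using bt_lg[OF x(2,1) mem(1) dyp] k bt_sym by metis
  have "d ?y ?x < 2 * \<tau>" using bt_le(2)[OF k] dsym[of ?x ?y] base(4)[OF s(2)] by simp
  then have "lg ?y ?x \<noteq> 0" using lg_nonzero[OF x(2,1)] ne' by blast
  then have pos: "t > 0" "u > 0" using t u by (auto simp: less_le)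
  have tu: "t *\<^sub>R lg ?y e = u *\<^sub>R lg ?y p" using t(2) u(2) by simp
  have "(1 / t) *\<^sub>R (t *\<^sub>R lg ?y e) = (u / t) *\<^sub>R lg ?y p" unfolding tu by simp
  moreover have "(t / u) *\<^sub>R lg ?y e = (1 / u) *\<^sub>R (u *\<^sub>R lg ?y p)" unfolding tu[symmetric] by simp
  ultimately have A: "lg ?y e = (u / t) *\<^sub>R lg ?y p" "lg ?y p = (t / u) *\<^sub>R lg ?y e" using pos by simp_all
  show False
  proof (cases "d ?y e \<le> d ?y p")
    case True
    then have "bt ?y e p" using lg_bt[OF x(2) eS(1) mem(1) dyp True A(1)] pos by simp
    then have "d a e < \<rho>" using base(2)[OF s(2)] ey eS by (intro convex_strict[OF a x(2) mem(1) base(3)[OF s(2)] _ rad(3)]) auto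
    then show False using eS by simp
  next
    case False
    then have "bt ?y p e" using lg_bt[OF x(2) mem(1) eS(1) dye _ A(2)] pos by simp
    then have "d a p < \<rho>" using base(2)[OF s(2)] ey eS mem by (intro convex_strict[OF a x(2) eS(1) base(3)[OF s(2)] _ rad(3)]) auto
    then show False by simp
  qed
qed

lemma base_ray:
  assumes s: "s \<in> {0..1}" "s' \<in> {0..1}" and k: "lg p (base s) = k *\<^sub>R lg p (base s')" "k \<ge> 0"
  shows "s = s'"
proof (cases "d p (base s) \<le> d p (base s')")
  case True
  then show ?thesis using base_ray_aux[OF s] lg_bt[OF mem(1) base(1)[OF s(1)] base(1,4)[OF s(2)] True k] by blast
next
  case False
  have "k \<noteq> 0" using base(5)[OF s(1)] k by auto
  then have "lg p (base s') = (1 / k) *\<^sub>R lg p (base s)" using k by simp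
  then have "bt p (base s') (base s)" using False k(2)
    by (intro lg_bt[OF mem(1) base(1)[OF s(2)] base(1,4)[OF s(1)], of "1/k"]) auto
  then show ?thesis using base_ray_aux[OF s(2,1)] by simp
qed

lemma T_inj:
  assumes s: "s \<in> {0..1}" "s' \<in> {0..1}" and h: "h \<in> {0..1}" "h' \<in> {0..1}" and e: "T p q r s h = T p q r s' h'"
  shows "h = h'" "h \<noteq> 0 \<Longrightarrow> s = s'"
proof -
  have l: "h *\<^sub>R lg p (base s) = h' *\<^sub>R lg p (base s')" using T(2)[OF s(1) h(1)] T(2)[OF s(2) h(2)] e by simp
  have z: "h = 0 \<longleftrightarrow> h' = 0" using l base(5)[OF s(1)] base(5)[OF s(2)] by (auto simp: scaleR_eq_0_iff)
  have ss: "s = s'" if "h \<noteq> 0"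
  proof (rule base_ray[OF s])
    have "(1 / h) *\<^sub>R (h *\<^sub>R lg p (base s)) = (1 / h) *\<^sub>R (h' *\<^sub>R lg p (base s'))" using l by simp
    then show "lg p (base s) = (h' / h) *\<^sub>R lg p (base s')" using that by simp
  qed (use h in auto)
  show "h \<noteq> 0 \<Longrightarrow> s = s'" by (rule ss)
  show "h = h'"
  proof (cases "h = 0")
    case True then show ?thesis using z by simp
  next
    case False
    then have "h *\<^sub>R lg p (base s) = h' *\<^sub>R lg p (base s)" using l ss by simp
    then show ?thesis using base(5)[OF s(1)] by simp
  qed
qed

lemma T_side: assumes "m \<in> sides p q r"
  obtains s h where "s \<in> {0..1}" "h \<in> {0..1}" "m = T p q r s h" "s \<in> {0, 1} \<or> h = 1"
proof -
  consider "m \<in> seg p q" | "m \<in> seg q r" | "m \<in> seg p r" using assms by (auto simp: sides_def)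
  then show ?thesis
  proof cases
    case 1
    then obtain h where "h \<in> {0..1}" "m = G p q h" using seg_G[OF mem(1,2) side(2)] by blast
    then show ?thesis using that[of 0 h] T01(3)[of h] by simp
  next
    case 2
    then obtain s where s: "s \<in> {0..1}" "m = G q r s" using seg_G[OF mem(2,3) side(1)] by blast
    then show ?thesis using that[of s 1] T01(2)[OF s(1)] by simp
  next
    case 3
    then obtain h where "h \<in> {0..1}" "m = G p r h" using seg_G[OF mem(1,3) side(3)] by blast
    then show ?thesis using that[of 1 h] T01(4)[of h] by simp
  qed
qed

lemma side_T: assumes "s \<in> {0..1}" "h \<in> {0..1}" "s \<in> {0, 1} \<or> h = 1 \<or> h = 0" shows "T p q r s h \<in> sides p q r"
proof -
  have "p \<in> seg p q" using G0[OF mem(1,2) side(2)] unfolding seg_G[OF mem(1,2) side(2)] by force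
  then show ?thesis
    using assms T01 seg_G[OF mem(1,2) side(2)] seg_G[OF mem(2,3) side(1)] seg_G[OF mem(1,3) side(3)] by (auto simp: sides_def)
qed

lemma T_inside: assumes s: "0 < s" "s < 1" and h: "0 < h" "h < 1"
  shows "d a (T p q r s h) < \<rho>" "T p q r s h \<notin> sides p q r"
proof -
  have 01: "s \<in> {0..1}" "h \<in> {0..1}" using s h by auto
  show "d a (T p q r s h) < \<rho>"
    unfolding T_def using base[OF 01(1)] by (intro G_convex[OF a mem(1) _ _ rad(3) _ _ h]) auto
  show "T p q r s h \<notin> sides p q r"
  proof
    assume "T p q r s h \<in> sides p q r"
    then obtain s' h' where s': "s' \<in> {0..1}" "h' \<in> {0..1}" "T p q r s h = T p q r s' h'" "s' \<in> {0, 1} \<or> h' = 1"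
      using T_side by metis
    then have "h = h'" "s = s'" using T_inj[OF 01(1) s'(1) 01(2) s'(2,3)] h by auto
    then show False using s' s h by auto
  qed
qed

text \<open>In the tangent plane at \<open>p\<close> the fan is a rescaling of the curve
  \<open>lg p (base s)\<close>, so joint continuity reduces to that of this curve and of
  \<open>ex p\<close>.\<close>

lemma T_cont: "continuous_map (top_of_set {z. 0 \<le> Re z \<and> Re z \<le> 1 \<and> 0 \<le> Im z \<and> Im z \<le> 1}) X (\<lambda>z. T p q r (Re z) (Im z))"
  (is "continuous_map (top_of_set ?W) X ?f")
proof -
  let ?g = "\<lambda>z. Im z *\<^sub>R lg p (base (Re z))"
  have "continuous_on {0..1} (\<lambda>t. lg p (base t))"
    using lg_path[OF mem(1,2,3) side(1)] base(4) by (simp add: path_def)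
  then have "continuous_on ?W (\<lambda>z. lg p (base (Re z)))"
    by (rule continuous_on_compose2[of "{0..1}" "\<lambda>t. lg p (base t)"]) (auto intro!: continuous_intros)
  then have "continuous_on ?W ?g" by (intro continuous_intros)
  moreover have "?g z \<in> ball 0 (2 * \<tau>)" if "z \<in> ?W" for z
  proof -
    have s: "Re z \<in> {0..1}" using that by auto
    have "cmod (lg p (base (Re z))) = d p (base (Re z))" by (rule lg_norm[OF mem(1) base(1,4)[OF s]])
    then have "Im z * cmod (lg p (base (Re z))) \<le> 1 * d p (base (Re z))" using that dnn by (intro mult_mono) auto
    then show ?thesis using base(4)[OF s] that by simp
  qed
  ultimately have "continuous_map (top_of_set ?W) (top_of_set (ball 0 (2 * \<tau>))) ?g" by (auto simp: continuous_map_in_subtopology)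
  from continuous_map_compose[OF this ex_cont[OF mem(1)]]
  show ?thesis by (rule continuous_map_eq) (use T(4) in auto)
qed

definition K :: "'a set" where "K = (\<lambda>z. T p q r (Re z) (Im z)) ` {z. 0 \<le> Re z \<and> Re z \<le> 1 \<and> 0 \<le> Im z \<and> Im z \<le> 1}"

lemma K_iff: "m \<in> K \<longleftrightarrow> (\<exists>s\<in>{0..1}. \<exists>h\<in>{0..1}. m = T p q r s h)"
proof
  assume "\<exists>s\<in>{0..1}. \<exists>h\<in>{0..1}. m = T p q r s h"
  then obtain s h where "s \<in> {0..1}" "h \<in> {0..1}" "m = T p q r s h" by blast
  then show "m \<in> K" unfolding K_def by (intro image_eqI[of _ _ "Complex s h"]) auto
next
  assume "m \<in> K"
  then obtain z where "0 \<le> Re z" "Re z \<le> 1" "0 \<le> Im z" "Im z \<le> 1" "m = T p q r (Re z) (Im z)" by (auto simp: K_def)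
  then show "\<exists>s\<in>{0..1}. \<exists>h\<in>{0..1}. m = T p q r s h" by (intro bexI[of _ "Re z"] bexI[of _ "Im z"]) auto
qed

lemma inner_iff: "m \<in> open_triangle p q r \<longleftrightarrow> (\<exists>s h. 0 < s \<and> s < 1 \<and> 0 < h \<and> h < 1 \<and> m = T p q r s h)"
proof
  assume "\<exists>s h. 0 < s \<and> s < 1 \<and> 0 < h \<and> h < 1 \<and> m = T p q r s h"
  then obtain s h where "0 < s" "s < 1" "0 < h" "h < 1" "m = T p q r s h" by blast
  then show "m \<in> open_triangle p q r" unfolding open_triangle_def by (intro image_eqI[of _ _ "Complex s h"]) auto
qed (auto simp: open_triangle_def)

lemma K_eq: "K = sides p q r \<union> open_triangle p q r"
proof (intro equalityI subsetI)
  fix m assume "m \<in> K"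
  then obtain s h where m: "s \<in> {0..1}" "h \<in> {0..1}" "m = T p q r s h" by (auto simp: K_iff)
  show "m \<in> sides p q r \<union> open_triangle p q r"
  proof (cases "s \<in> {0, 1} \<or> h = 1 \<or> h = 0")
    case True then show ?thesis using side_T[OF m(1,2)] m(3) by simp
  next
    case False
    then have "0 < s" "s < 1" "0 < h" "h < 1" using m by auto
    then show ?thesis using inner_iff m(3) by blast
  qed
next
  fix m assume "m \<in> sides p q r \<union> open_triangle p q r"
  then show "m \<in> K"
  proof
    assume "m \<in> sides p q r"
    then show ?thesis using T_side K_iff by metis
  next
    assume "m \<in> open_triangle p q r"
    then obtain s h where "0 < s" "s < 1" "0 < h" "h < 1" "m = T p q r s h" unfolding inner_iff by blast
    then show ?thesis unfolding K_iff by (intro bexI[of _ s] bexI[of _ h]) auto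
  qed
qed

lemma K_S: "K \<subseteq> S" using T(1) by (auto simp: K_iff)

lemma K_closed: "closedin X K"
proof -
  have "{z. 0 \<le> Re z \<and> Re z \<le> 1 \<and> 0 \<le> Im z \<and> Im z \<le> 1} = cbox 0 (Complex 1 1)"
    by (auto simp: in_cbox_complex_iff)
  then have "compact {z. 0 \<le> Re z \<and> Re z \<le> 1 \<and> 0 \<le> Im z \<and> Im z \<le> 1}" by simp
  then have "compactin X K" unfolding K_def by (intro image_compactin[OF _ T_cont]) (simp add: compactin_subtopology)
  moreover have "Hausdorff_space X" using Metric_space.Hausdorff_space_mtopology[OF metric] mtop by simp
  ultimately show ?thesis by (rule compactin_imp_closedin[rotated])
qed

lemma inner_props: "openin X (open_triangle p q r)" "connectedin X (open_triangle p q r)" "open_triangle p q r \<inter> sides p q r = {}" "open_triangle p q r \<subseteq> {x\<in>S. d a x < \<rho>}"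
  "open_triangle p q r \<noteq> {}"
proof -
  let ?W = "{z. 0 < Re z \<and> Re z < 1 \<and> 0 < Im z \<and> Im z < 1}" let ?f = "\<lambda>z. T p q r (Re z) (Im z)"
  have c: "continuous_map (top_of_set ?W) X ?f" by (rule continuous_map_from_subtopology_mono[OF T_cont]) auto
  have box: "?W = box 0 (Complex 1 1)" by (auto simp: in_box_complex_iff)
  have "inj_on ?f ?W"
  proof (rule inj_onI)
    fix z w assume z: "z \<in> ?W" "w \<in> ?W" "?f z = ?f w"
    then have 01: "Re z \<in> {0..1}" "Re w \<in> {0..1}" "Im z \<in> {0..1}" "Im w \<in> {0..1}" "Im z \<noteq> 0" by auto
    show "z = w" using T_inj[OF 01(1-4) z(3)] 01(5) by (simp add: complex_eq_iff)
  qed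
  then show "openin X (open_triangle p q r)" unfolding open_triangle_def by (intro invariance_of_domain_X[OF c]) (simp add: box open_box)
  have "connectedin (top_of_set ?W) ?W" using box convex_connected[OF convex_box(2)] by (simp add: connectedin_subtopology)
  then show "connectedin X (open_triangle p q r)" unfolding open_triangle_def by (rule connectedin_continuous_map_image[OF c])
  show "open_triangle p q r \<inter> sides p q r = {}" using T_inside(2) by (auto simp: inner_iff)
  show "open_triangle p q r \<subseteq> {x\<in>S. d a x < \<rho>}"
  proof
    fix m assume m: "m \<in> open_triangle p q r"
    then have "m \<in> S" using K_eq K_S by auto
    then show "m \<in> {x\<in>S. d a x < \<rho>}" using m T_inside(1) by (auto simp: inner_iff)
  qed
  have "T p q r (1/2) (1/2) \<in> open_triangle p q r" unfolding inner_iff by (intro exI[of _ "1/2"]) auto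
  then show "open_triangle p q r \<noteq> {}" by blast
qed

text \<open>The open triangle is connected, open by invariance of domain, and closed in the
  complement of the sides, where it is the trace of the closed set \<open>K\<close>.\<close>

lemma inner_component: "open_triangle p q r \<in> connected_components_of (subtopology X (S - sides p q r))"
proof -
  let ?Y = "subtopology X (S - sides p q r)"
  have sub: "open_triangle p q r \<subseteq> S - sides p q r" using inner_props(3,4) by auto
  have con: "connectedin ?Y (open_triangle p q r)" using inner_props(2) sub by (simp add: connectedin_subtopology)
  obtain x where x: "x \<in> open_triangle p q r" using inner_props(5) by blast
  define C where "C = connected_component_of_set ?Y x"
  have C: "C \<in> connected_components_of ?Y" unfolding C_def connected_components_of_def using x sub by auto
  have xC: "x \<in> C" unfolding C_def using x sub by (auto simp: connected_component_of_refl)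
  have 1: "open_triangle p q r \<subseteq> C" by (rule connected_components_of_maximal[OF C con]) (use x xC in \<open>auto simp: disjnt_def\<close>)
  have "connectedin ?Y C" by (rule connectedin_connected_components_of[OF C])
  moreover have "openin ?Y (open_triangle p q r)" using inner_props(1) sub unfolding openin_subtopology by blast
  moreover have "open_triangle p q r = K \<inter> (S - sides p q r)" using K_eq sub by auto
  then have "closedin ?Y (open_triangle p q r)" using K_closed unfolding closedin_subtopology by blast
  ultimately have "C \<subseteq> open_triangle p q r \<or> disjnt C (open_triangle p q r)" by (intro connectedin_clopen_cases)
  then have "C = open_triangle p q r" using 1 x xC by (auto simp: disjnt_def)
  then show ?thesis using C by simp
qed

text \<open>A component that leaves \<open>K\<close> contains a point whose ray from \<open>p\<close> does not meet the sides again, so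
  it reaches the outside of the disk.\<close>

lemma component_unique:
  assumes C: "C \<in> connected_components_of (subtopology X (S - sides p q r))" and sub: "C \<subseteq> {x\<in>S. d a x < \<rho>}"
  shows "C = open_triangle p q r"
proof (rule ccontr)
  assume n: "C \<noteq> open_triangle p q r"
  let ?Y = "subtopology X (S - sides p q r)"
  have dj: "disjnt C (open_triangle p q r)"
    using pairwise_disjoint_connected_components_of[of ?Y] C inner_component n unfolding pairwise_def by blast
  obtain w where w: "w \<in> C" using nonempty_connected_components_of[OF C] by blast
  have CY: "C \<subseteq> S - sides p q r" using connected_components_of_subset[OF C] by auto
  have wS: "w \<in> S" "w \<notin> sides p q r" "d a w < \<rho>" using w CY sub by auto
  have "w \<notin> open_triangle p q r" using w dj by (auto simp: disjnt_iff)
  then have wK: "w \<notin> K" using wS K_eq by blast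
  have wp: "w \<noteq> p" using wS by auto
  have dw: "d p w < 2 * \<rho>" using tri[OF mem(1) a wS(1)] dsym[of p a] wS by simp
  have dw0: "d p w > 0" using dpos[OF mem(1) wS(1)] wp by auto
  have dw2: "d p w < 2 * \<tau>" using dw rad by simp
  \<comment> \<open>At parameter \<open>L\<close> the ray is at distance
    \<open>\<rho> + \<tau> < 2 * \<tau>\<close> from \<open>p\<close>, still in the range of
    \<open>ex p\<close>, and hence at distance at least \<open>\<tau> > \<rho>\<close> from
    \<open>a\<close>.\<close>
  define L where "L = (\<rho> + \<tau>) / d p w"
  have L: "1 < L" "L * d p w = \<rho> + \<tau>" using dw dw0 rad by (auto simp: L_def)
  let ?y = "\<lambda>k. ex p (k *\<^sub>R lg p w)"
  have nw: "cmod (lg p w) = d p w" by (rule lg_norm[OF mem(1) wS(1) dw2])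
  have nk: "cmod (k *\<^sub>R lg p w) < 2 * \<tau>" if "k \<in> {1..L}" for k
  proof -
    have "k * d p w \<le> L * d p w" using that dw0 by simp
    then show ?thesis using that nw L rad by simp
  qed
  have "continuous_map (top_of_set {1..L}) (top_of_set (ball 0 (2 * \<tau>))) (\<lambda>k. k *\<^sub>R lg p w)"
    using nk by (auto simp: continuous_map_in_subtopology intro!: continuous_intros)
  from continuous_map_compose[OF this ex_cont[OF mem(1)]] have c: "continuous_map (top_of_set {1..L}) X ?y" by (simp add: o_def)
  have "connectedin (top_of_set {1..L}) {1..L}" by (simp add: connectedin_subtopology)
  then have con: "connectedin X (?y ` {1..L})" by (rule connectedin_continuous_map_image[OF c])
  have y1: "?y 1 = w" using ex_lg[OF mem(1) wS(1) dw2] by simp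
  have out: "?y L \<notin> {x\<in>S. d a x < \<rho>}"
  proof -
    have "d p (?y L) = \<rho> + \<tau>" using ex(3)[OF mem(1) nk[of L]] nw L by simp
    moreover have "d p (?y L) \<le> d p a + d a (?y L)" using tri[OF mem(1) a] ex(1)[OF mem(1) nk[of L]] L(1) by simp
    ultimately show ?thesis using dsym[of p a] rad by simp
  qed
  have "\<exists>k\<in>{1..L}. ?y k \<in> sides p q r"
  proof (rule ccontr)
    assume "\<not> ?thesis"
    then have "?y ` {1..L} \<subseteq> S - sides p q r" using ex(1)[OF mem(1) nk] by auto
    then have "connectedin ?Y (?y ` {1..L})" using con by (simp add: connectedin_subtopology)
    moreover have "?y 1 \<in> ?y ` {1..L}" using L by (intro imageI) auto
    ultimately have "?y ` {1..L} \<subseteq> C" using y1 w by (intro connected_components_of_maximal[OF C]) (auto simp: disjnt_iff)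
    moreover have "?y L \<in> ?y ` {1..L}" using L by (intro imageI) auto
    ultimately show False using sub out by blast
  qed
  then obtain k where k: "k \<in> {1..L}" "?y k \<in> sides p q r" by blast
  then obtain s h where sh: "s \<in> {0..1}" "h \<in> {0..1}" "?y k = T p q r s h" using T_side by metis
  have "k *\<^sub>R lg p w = h *\<^sub>R lg p (base s)" using ex(2)[OF mem(1) nk[OF k(1)]] sh(3) T(2)[OF sh(1,2)] by simp
  then have "(1 / k) *\<^sub>R (k *\<^sub>R lg p w) = (1 / k) *\<^sub>R (h *\<^sub>R lg p (base s))" by simp
  then have lw: "lg p w = (h / k) *\<^sub>R lg p (base s)" using k(1) by simp
  have hk: "h / k \<in> {0..1}" using sh(2) k(1) by (simp add: divide_simps)
  have "w = T p q r s (h / k)" using y1 T(4)[OF sh(1) hk] lw by simp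
  then have "w \<in> K" using K_iff sh(1) hk by blast
  then show False using wK by simp
qed

lemma K_near: "K \<inter> P = {p, q, r}"
proof -
  have "m \<in> {p, q, r}" if "m \<in> K" "m \<in> P" for m
  proof -
    have "m \<in> S" using that K_S by blast
    have "m \<notin> open_triangle p q r" using inner_props(4) near_le[OF nr(1) that(2)] by auto
    then have "m \<in> sides p q r" using that K_eq by blast
    then show ?thesis
      using edge_inside(2)[OF a nr(1,2)] edge_inside(2)[OF a nr(2,3)] edge_inside(2)[OF a nr(1,3)] that(2)
      by (auto simp: sides_def seg_def)
  qed
  moreover have "{p, q, r} \<subseteq> K"
  proof -
    have "p = T p q r 0 0" "q = T p q r 0 1" "r = T p q r 1 1" using T01 G0 G1 mem side by auto
    moreover have "T p q r s h \<in> K" if "s \<in> {0..1}" "h \<in> {0..1}" for s h using that K_iff by blast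
    then have "T p q r 0 0 \<in> K" "T p q r 0 1 \<in> K" "T p q r 1 1 \<in> K" by simp_all
    ultimately show ?thesis by simp
  qed
  ultimately show ?thesis using mem by blast
qed

text \<open>Lets an inclusion of open triangles pass to their vertices, and finds covered points
  close to each site.\<close>

lemma apex_closure: assumes e: "e > 0" shows "\<exists>x\<in>open_triangle p q r. d p x < e"
proof -
  define h where "h = min (1/2) (e / (4 * \<tau>))"
  have h: "0 < h" "h < 1" "h * (2 * \<tau>) < e" using e tau by (auto simp: h_def min_def field_simps)
  have s: "1/2 \<in> {0..1::real}" by simp
  have "d p (T p q r (1/2) h) = h * d p (base (1/2))" using T(3)[OF s, of h] h by simp
  also have "\<dots> \<le> h * (2 * \<tau>)" using base(4)[OF s] h by (intro mult_left_mono) auto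
  finally have "d p (T p q r (1/2) h) < e" using h by simp
  moreover have "T p q r (1/2) h \<in> open_triangle p q r" unfolding inner_iff using h by (intro exI[of _ "1/2"] exI[of _ h]) auto
  ultimately show ?thesis by blast
qed

end

section \<open>Incidence of sites, edges and triangles\<close>

context sites begin

definition faces :: "'a set set" where "faces = {F. F \<subseteq> P \<and> card F = 3 \<and> (\<exists>a\<in>S. F \<subseteq> near a)}"

definition edges :: "'a set set" where "edges = {e. e \<subseteq> P \<and> card e = 2 \<and> (\<exists>a\<in>S. e \<subseteq> near a)}"

definition sd :: "'a set \<Rightarrow> 'a set" where "sd F = (\<Union>x\<in>F. \<Union>y\<in>F - {x}. seg x y)"

text \<open>The union over all orderings avoids a choice of the apex; all of them give the same set
  (\<open>inner_unique\<close>).\<close>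

definition inn :: "'a set \<Rightarrow> 'a set" where "inn F = \<Union>{open_triangle p q r | p q r. F = {p, q, r}}"

definition kt :: "'a set \<Rightarrow> 'a set" where "kt F = sd F \<union> inn F"

lemma triangleI: "a \<in> S \<Longrightarrow> p \<in> near a \<Longrightarrow> q \<in> near a \<Longrightarrow> r \<in> near a \<Longrightarrow> p \<noteq> q \<Longrightarrow> p \<noteq> r \<Longrightarrow> q \<noteq> r \<Longrightarrow> triangle X d \<tau> G lg P \<delta> a p q r"
  using sites_axioms by (auto simp: triangle_def triangle_axioms_def)

lemma face_triangle: assumes F: "F \<in> faces" "p \<in> F"
  obtains a q r where "F = {p, q, r}" "triangle X d \<tau> G lg P \<delta> a p q r"
proof -
  obtain a where a: "a \<in> S" "F \<subseteq> near a" "card F = 3" using F by (auto simp: faces_def)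
  have "card (F - {p}) = 2" using a F(2) by simp
  then obtain q r where "F - {p} = {q, r}" "q \<noteq> r" by (auto simp: card_2_iff)
  then have "F = {p, q, r}" "p \<noteq> q" "p \<noteq> r" "q \<noteq> r" using F(2) by auto
  moreover from this a(2) have "triangle X d \<tau> G lg P \<delta> a p q r" by (intro triangleI[OF a(1)]) simp_all
  ultimately show ?thesis using that by simp
qed

lemma sd_three: assumes "p \<noteq> q" "p \<noteq> r" "q \<noteq> r" shows "sd {p, q, r} = sides p q r"
  using assms seg_sym[of p q] seg_sym[of q r] seg_sym[of p r] by (auto simp: sd_def sides_def)

text \<open>Whatever the apex, the open triangle is the only component of the complement of the
  sides that lies in the disk, and neither the sides nor the disk depend on the ordering.\<close>

lemma inner_unique:
  assumes "triangle X d \<tau> G lg P \<delta> a p q r" "{p', q', r'} = {p, q, r}" shows "open_triangle p' q' r' = open_triangle p q r"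
proof -
  interpret t: triangle X d \<tau> G lg P \<delta> a p q r by fact
  have "card {p', q', r'} = 3" "{p', q', r'} \<subseteq> near a" unfolding assms(2) using t.ne t.nr by simp_all
  then have n: "p' \<noteq> q'" "p' \<noteq> r'" "q' \<noteq> r'" "p' \<in> near a" "q' \<in> near a" "r' \<in> near a"
    by (auto simp: card_insert_if split: if_splits)
  interpret u: triangle X d \<tau> G lg P \<delta> a p' q' r' by (rule triangleI[OF t.a n(4-6,1-3)])
  have s: "sides p' q' r' = sides p q r" using sd_three[OF n(1-3)] sd_three[OF t.ne] assms(2) by simp
  have "d a p' = d a p" using near_eq[OF n(4) t.nr(1)] .
  then show ?thesis using t.component_unique[of "open_triangle p' q' r'"] u.inner_component u.inner_props(4) s by simp
qed

lemma inn_inner: assumes "triangle X d \<tau> G lg P \<delta> a p q r" shows "inn {p, q, r} = open_triangle p q r"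
proof -
  have "open_triangle p' q' r' = open_triangle p q r" if "{p, q, r} = {p', q', r'}" for p' q' r' by (rule inner_unique[OF assms that[symmetric]])
  then show ?thesis unfolding inn_def by blast
qed

lemma kt_K: assumes "triangle X d \<tau> G lg P \<delta> a p q r" shows "kt {p, q, r} = triangle.K G p q r"
proof -
  interpret t: triangle X d \<tau> G lg P \<delta> a p q r by fact
  show ?thesis unfolding kt_def t.K_eq inn_inner[OF assms] sd_three[OF t.ne] ..
qed

lemma face_S: assumes F: "F \<in> faces" shows "F \<subseteq> S" "finite F" "F \<noteq> {}" "F \<subseteq> P"
proof -
  show "F \<subseteq> P" "F \<subseteq> S" using F PS by (auto simp: faces_def)
  then show "finite F" using finP finite_subset by blast
  show "F \<noteq> {}" using F by (auto simp: faces_def)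
qed

text \<open>Transfers the properties of \<open>triangle\<close> to unordered faces. Any apex will do
  except for the last property, where the given vertex is taken as the apex.\<close>

lemma face_props:
  assumes F: "F \<in> faces"
  shows "openin X (inn F)" "connectedin X (inn F)" "inn F \<inter> sd F = {}" "inn F \<noteq> {}" "inn F \<inter> P = {}" "closedin X (kt F)" "kt F \<inter> P = F" "kt F \<subseteq> S"
    "inn F \<in> connected_components_of (subtopology X (S - sd F))"
    "\<And>p e. p \<in> F \<Longrightarrow> e > 0 \<Longrightarrow> \<exists>x\<in>inn F. d p x < e"
proof -
  obtain p where "p \<in> F" using face_S[OF F] by blast
  then obtain a q r where t: "F = {p, q, r}" "triangle X d \<tau> G lg P \<delta> a p q r" using face_triangle[OF F] by metis
  interpret t: triangle X d \<tau> G lg P \<delta> a p q r by fact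
  have eq: "inn F = open_triangle p q r" "sd F = sides p q r" "kt F = t.K" using inn_inner[OF t(2)] sd_three[OF t.ne] kt_K[OF t(2)] t(1) by auto
  show "openin X (inn F)" "connectedin X (inn F)" "inn F \<inter> sd F = {}" "inn F \<noteq> {}" unfolding eq using t.inner_props by auto
  show "closedin X (kt F)" "kt F \<inter> P = F" "kt F \<subseteq> S" unfolding eq using t.K_closed t.K_near[folded t(1)] t.K_S by auto
  show "inn F \<inter> P = {}" unfolding eq using t.inner_props(4) near_le[OF t.nr(1)] by fastforce
  show "inn F \<in> connected_components_of (subtopology X (S - sd F))" unfolding eq by (rule t.inner_component)
  show "\<exists>x\<in>inn F. d p' x < e" if "p' \<in> F" "e > 0" for p' e
  proof -
    obtain a' q' r' where t': "F = {p', q', r'}" "triangle X d \<tau> G lg P \<delta> a' p' q' r'" using face_triangle[OF F \<open>p' \<in> F\<close>] by metis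
    show ?thesis using triangle.apex_closure[OF t'(2) that(2)] inn_inner[OF t'(2)] t'(1) by simp
  qed
qed

lemma edge_dist: assumes "{p, q} \<in> edges" shows "p \<in> S" "q \<in> S" "p \<noteq> q" "d p q < 2 * \<tau>" "p \<in> P" "q \<in> P"
  using assms near_dist2 PS by (auto simp: edges_def card_2_iff doubleton_eq_iff)

lemma sd_cases: assumes F: "F \<in> faces" "m \<in> sd F"
  obtains (vertex) "m \<in> F" | (edge) x y where "x \<in> F" "y \<in> F" "{x, y} \<in> edges" "m \<in> seg x y - {x, y}"
proof -
  obtain x y where xy: "x \<in> F" "y \<in> F" "x \<noteq> y" "m \<in> seg x y" using F by (auto simp: sd_def)
  have "{x, y} \<in> edges" using F xy by (auto simp: faces_def edges_def)
  then show ?thesis using xy vertex edge by (cases "m = x \<or> m = y") auto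
qed

lemma oe_site: assumes "{p, q} \<in> edges" "m \<in> seg p q - {p, q}" shows "m \<notin> P"
proof -
  obtain a where "a \<in> S" "p \<in> near a" "q \<in> near a" using assms(1) by (auto simp: edges_def)
  then show ?thesis using edge_inside(2)[of a p q m] assms(2) by (auto simp: seg_def)
qed

lemma oe_disjoint: assumes e: "{p, q} \<in> edges" "{r, s} \<in> edges" and m: "m \<in> seg p q - {p, q}" "m \<in> seg r s - {r, s}" shows "{p, q} = {r, s}"
proof -
  obtain a where a: "a \<in> S" "p \<in> near a" "q \<in> near a" using e by (auto simp: edges_def)
  obtain b where b: "b \<in> S" "r \<in> near b" "s \<in> near b" using e by (auto simp: edges_def)
  show ?thesis by (rule edges_cross[OF a b, of m]) (use m in \<open>auto simp: seg_def\<close>)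
qed

lemma oe_connected: assumes e: "{p, q} \<in> edges" shows "connectedin X (seg p q - {p, q})" "\<And>e. e > 0 \<Longrightarrow> \<exists>m\<in>seg p q - {p, q}. d p m < e"
proof -
  note D = edge_dist[OF e]
  have im: "seg p q - {p, q} = G p q ` {0<..<1}"
  proof (intro equalityI subsetI)
    fix m assume m: "m \<in> seg p q - {p, q}"
    then obtain t where t: "t \<in> {0..1}" "m = G p q t" using seg_G[OF D(1,2,4)] by blast
    have "t \<noteq> 0" "t \<noteq> 1" using m t G0[OF D(1,2,4)] G1[OF D(1,2,4)] by auto
    then show "m \<in> G p q ` {0<..<1}" using t by auto
  next
    fix m assume "m \<in> G p q ` {0<..<1}"
    then obtain t where t: "0 < t" "t < 1" "m = G p q t" by auto
    have "m \<in> seg p q" using t seg_G[OF D(1,2,4)] by auto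
    moreover have "m \<noteq> p" using G_inj[OF D(1,2,4,3), of t 0] G0[OF D(1,2,4)] t by auto
    moreover have "m \<noteq> q" using G_inj[OF D(1,2,4,3), of t 1] G1[OF D(1,2,4)] t by auto
    ultimately show "m \<in> seg p q - {p, q}" by simp
  qed
  have "continuous_map (top_of_set {0<..<1}) X (G p q)"
    by (rule continuous_map_from_subtopology_mono[OF G_path_cont[OF D(1,2,4)]]) auto
  moreover have "connectedin (top_of_set {0<..<1::real}) {0<..<1}" by (simp add: connectedin_subtopology)
  ultimately show "connectedin X (seg p q - {p, q})" unfolding im by (rule connectedin_continuous_map_image)
  show "\<exists>m\<in>seg p q - {p, q}. d p m < e" if "e > 0" for e
  proof -
    define t where "t = min (1/2) (e / (4 * \<tau>))"
    have t: "0 < t" "t < 1" "t * (2 * \<tau>) < e" using that tau by (auto simp: t_def min_def field_simps)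
    have "d p (G p q t) = t * d p q" using G_dl[OF D(1,2,4)] t by simp
    also have "\<dots> \<le> t * (2 * \<tau>)" using D(4) t by (intro mult_left_mono) auto
    finally have "d p (G p q t) < e" using t by simp
    then show ?thesis unfolding im using t by auto
  qed
qed

lemma closedin_limit: assumes "closedin X C" "x \<in> S" "\<And>e. e > 0 \<Longrightarrow> \<exists>y\<in>C. d x y < e" shows "x \<in> C"
proof (rule ccontr)
  assume "x \<notin> C"
  then have "x \<in> S - C" using assms by blast
  moreover have "openin X (S - C)" using assms(1) by blast
  ultimately obtain r where "r > 0" "\<forall>y\<in>S. d x y < r \<longrightarrow> y \<in> S - C" unfolding openin_d by blast
  then show False using assms(3)[of r] closedin_subset[OF assms(1)] by blast
qed

text \<open>An edge that is not a side of \<open>F\<close> avoids the sides of \<open>F\<close>, so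
  by connectedness it would lie inside the open triangle once it meets it. Its ends would then be
  sites in the closed triangle, hence vertices of \<open>F\<close>.\<close>

lemma oe_inn: assumes e: "{p, q} \<in> edges" and F: "F \<in> faces" shows "(seg p q - {p, q}) \<inter> inn F = {}"
proof (cases "{p, q} \<subseteq> F")
  case True
  then have "seg p q \<subseteq> sd F" using edge_dist(3)[OF e] by (auto simp: sd_def)
  then show ?thesis using face_props(3)[OF F] by blast
next
  case False
  let ?o = "seg p q - {p, q}"
  note D = edge_dist[OF e]
  have "?o \<inter> sd F = {}"
  proof (rule ccontr)
    assume "?o \<inter> sd F \<noteq> {}"
    then obtain m where m: "m \<in> ?o" "m \<in> sd F" by blast
    show False using F m(2)
    proof (cases rule: sd_cases)
      case vertex
      then show ?thesis using oe_site[OF e m(1)] face_S[OF F] by blast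
    next
      case (edge x y)
      have "{p, q} = {x, y}" by (rule oe_disjoint[OF e edge(3) m(1) edge(4)])
      then have "{p, q} \<subseteq> F" using edge(1,2) by simp
      then show ?thesis using False by simp
    qed
  qed
  moreover have "?o \<subseteq> S" by (auto simp: seg_def)
  ultimately have con: "connectedin (subtopology X (S - sd F)) ?o" using oe_connected(1)[OF e] by (auto simp: connectedin_subtopology)
  show ?thesis
  proof (rule ccontr)
    assume "?o \<inter> inn F \<noteq> {}"
    then have "?o \<subseteq> inn F" using connected_components_of_maximal[OF face_props(9)[OF F] con] by (auto simp: disjnt_def)
    then have sub: "?o \<subseteq> kt F" by (auto simp: kt_def)
    have e': "{q, p} \<in> edges" using e by (simp add: insert_commute)
    have sub': "seg q p - {q, p} \<subseteq> kt F" using sub seg_sym by blast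
    have "p \<in> kt F" using oe_connected(2)[OF e] sub by (intro closedin_limit[OF face_props(6)[OF F] D(1)]) blast
    moreover have "q \<in> kt F" using oe_connected(2)[OF e'] sub' by (intro closedin_limit[OF face_props(6)[OF F] D(2)]) blast
    ultimately show False using face_props(7)[OF F] D False by blast
  qed
qed

lemma sd_inn: assumes F: "F \<in> faces" "F' \<in> faces" shows "sd F \<inter> inn F' = {}"
proof -
  have "m \<notin> inn F'" if "m \<in> sd F" for m
    using F(1) that
  proof (cases rule: sd_cases)
    case vertex then show ?thesis using face_props(5)[OF F(2)] face_S[OF F(1)] by blast
  next
    case (edge x y) then show ?thesis using oe_inn[OF edge(3) F(2)] by blast
  qed
  then show ?thesis by blast
qed

text \<open>Each open triangle avoids the sides of the other and is connected, so two that meet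
  contain each other. Passing to closures, the vertices of each are vertices of the other.\<close>

lemma inn_disjoint: assumes F: "F \<in> faces" "F' \<in> faces" and ne: "inn F \<inter> inn F' \<noteq> {}" shows "F = F'"
proof -
  have sub: "inn F1 \<subseteq> inn F2" if "F1 \<in> faces" "F2 \<in> faces" "inn F1 \<inter> inn F2 \<noteq> {}" for F1 F2
  proof -
    have "inn F1 \<subseteq> S - sd F2" using sd_inn[OF that(2,1)] face_props(8)[OF that(1)] by (auto simp: kt_def)
    then have "connectedin (subtopology X (S - sd F2)) (inn F1)" using face_props(2)[OF that(1)] by (auto simp: connectedin_subtopology)
    then show ?thesis using connected_components_of_maximal[OF face_props(9)[OF that(2)]] that(3) by (auto simp: disjnt_def)
  qed
  have sub2: "F1 \<subseteq> F2" if "F1 \<in> faces" "F2 \<in> faces" "inn F1 \<subseteq> inn F2" for F1 F2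
  proof
    fix p assume p: "p \<in> F1"
    have "p \<in> kt F2"
    proof (rule closedin_limit[OF face_props(6)[OF that(2)]])
      show "p \<in> S" using p face_S[OF that(1)] by blast
      show "\<exists>y\<in>kt F2. d p y < e" if e: "e > 0" for e
      proof -
        obtain x where "x \<in> inn F1" "d p x < e" using face_props(10)[OF \<open>F1 \<in> faces\<close> p e] by blast
        then show ?thesis using \<open>inn F1 \<subseteq> inn F2\<close> by (auto simp: kt_def)
      qed
    qed
    then show "p \<in> F2" using face_props(7)[OF that(2)] p face_S[OF that(1)] by blast
  qed
  have "F \<subseteq> F'" "F' \<subseteq> F" using sub sub2 F ne by (simp_all add: Int_commute)
  then show ?thesis by simp
qed

lemma edge_faces: assumes e: "{p, q} \<in> edges"
  obtains r1 r2 where "{p, q, r1} \<in> faces" "{p, q, r2} \<in> faces" "r1 \<noteq> r2" "r1 \<notin> {p, q}" "r2 \<notin> {p, q}"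
proof -
  obtain a where a: "a \<in> S" "p \<in> near a" "q \<in> near a" using e by (auto simp: edges_def)
  obtain c1 c2 r1 r2 where c: "c1 \<in> S" "c2 \<in> S" "r1 \<noteq> r2" "r1 \<notin> {p, q}" "r2 \<notin> {p, q}" "near c1 = {p, q, r1}" "near c2 = {p, q, r2}"
    using two_faces[OF a edge_dist(3)[OF e]] by blast
  have f: "{p, q, r} \<in> faces" if "c \<in> S" "near c = {p, q, r}" "r \<notin> {p, q}" for c r
  proof -
    have "{p, q, r} \<subseteq> P" using that(2) near_P[of _ c] by blast
    moreover have "card {p, q, r} = 3" using that(3) edge_dist(3)[OF e] by (auto simp: card_insert_if)
    ultimately show ?thesis using that(1,2) unfolding faces_def by blast
  qed
  show ?thesis using that[OF f[OF c(1,6,4)] f[OF c(2,7,5)] c(3,4,5)] .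
qed

lemma site_face: assumes "p \<in> P" obtains F where "F \<in> faces" "p \<in> F"
proof -
  obtain a q where a: "a \<in> S" "p \<in> near a" "q \<in> near a" "p \<noteq> q" using site_has_edge[OF assms] by blast
  then have "{p, q} \<in> edges" using near_P by (auto simp: edges_def)
  then obtain r1 r2 where "{p, q, r1} \<in> faces" using edge_faces by metis
  then show ?thesis using that by blast
qed

lemma finite_faces: "finite faces" "finite edges"
proof -
  have f: "finite A" if "A \<subseteq> Pow P" for A using finite_subset[OF that] finP by simp
  show "finite faces" "finite edges" by (rule f, auto simp: faces_def edges_def)+
qed

section \<open>The triangles cover the surface\<close>

definition cov :: "'a set" where "cov = (\<Union>F\<in>faces. kt F)"

lemma cov_closed: "closedin X cov" unfolding cov_def using finite_faces face_props(6) by (intro closedin_Union) auto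

lemma P_cov: "P \<subseteq> cov"
proof
  fix p assume p: "p \<in> P"
  then obtain F where "F \<in> faces" "p \<in> F" using site_face by metis
  then show "p \<in> cov" unfolding cov_def using face_props(7) by blast
qed

text \<open>The two triangles on an edge, glued along that edge, form an open set.\<close>

lemma edge_neighbourhood: assumes e: "{p, q} \<in> edges" and m: "m \<in> seg p q - {p, q}"
  obtains W where "openin X W" "m \<in> W" "W \<subseteq> cov"
proof -
  obtain r1 r2 where r: "{p, q, r1} \<in> faces" "{p, q, r2} \<in> faces" "r1 \<noteq> r2" "r1 \<notin> {p, q}" "r2 \<notin> {p, q}" using edge_faces[OF e] .
  note D = edge_dist[OF e]
  have t: "\<exists>a. triangle X d \<tau> G lg P \<delta> a r p q" if fc: "{p, q, r} \<in> faces" "r \<notin> {p, q}" for r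
  proof -
    obtain a where "a \<in> S" "{p, q, r} \<subseteq> near a" using fc(1) unfolding faces_def by blast
    then show ?thesis using fc(2) D(3) by (intro exI[of _ a] triangleI) auto
  qed
  obtain a1 where t1: "triangle X d \<tau> G lg P \<delta> a1 r1 p q" using t[OF r(1,4)] by blast
  obtain a2 where t2: "triangle X d \<tau> G lg P \<delta> a2 r2 p q" using t[OF r(2,5)] by blast
  interpret t1: triangle X d \<tau> G lg P \<delta> a1 r1 p q by fact
  interpret t2: triangle X d \<tau> G lg P \<delta> a2 r2 p q by fact
  have F: "{r1, p, q} \<in> faces" "{r2, p, q} \<in> faces" using r by (simp_all add: insert_commute)
  \<comment> \<open>The upper half of the rectangle parametrises the triangle with apex
    \<open>r1\<close>, the lower half the one with apex \<open>r2\<close>; on the real axis both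
    reach height one, that is, the common base \<open>pq\<close>.\<close>
  define V where "V = {z. 0 < Re z \<and> Re z < 1 \<and> -1 < Im z \<and> Im z < 1}"
  define f where "f z = T r1 p q (Re z) (1 - Im z)" for z
  define g where "g z = T r2 p q (Re z) (1 + Im z)" for z
  define h where "h z = (if 0 \<le> Im z then f z else g z)" for z
  have "V = box (Complex 0 (-1)) (Complex 1 1)" by (auto simp: in_box_complex_iff V_def)
  then have Vo: "open V" by (simp add: open_box)
  have c: "continuous_map (top_of_set V) X h"
    unfolding h_def
  proof (rule continuous_map_cases_le)
    show "continuous_map (top_of_set V) euclideanreal (\<lambda>z. 0)" "continuous_map (top_of_set V) euclideanreal Im"
      by (auto intro: continuous_intros)
    let ?Q = "{z. 0 \<le> Re z \<and> Re z \<le> 1 \<and> 0 \<le> Im z \<and> Im z \<le> 1}"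
    have "continuous_map (top_of_set {z\<in>V. 0 \<le> Im z}) (top_of_set ?Q) (\<lambda>z. Complex (Re z) (1 - Im z))"
      by (auto simp: continuous_map_in_subtopology V_def Complex_eq intro!: continuous_intros)
    from continuous_map_compose[OF this t1.T_cont]
    show "continuous_map (subtopology (top_of_set V) {x \<in> topspace (top_of_set V). 0 \<le> Im x}) X f"
      by (simp add: subtopology_subtopology f_def[abs_def] o_def Collect_conj_eq[symmetric] Int_def conj_ac)
    have "continuous_map (top_of_set {z\<in>V. Im z \<le> 0}) (top_of_set ?Q) (\<lambda>z. Complex (Re z) (1 + Im z))"
      by (auto simp: continuous_map_in_subtopology V_def Complex_eq intro!: continuous_intros)
    from continuous_map_compose[OF this t2.T_cont]
    show "continuous_map (subtopology (top_of_set V) {x \<in> topspace (top_of_set V). Im x \<le> 0}) X g"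
      by (simp add: subtopology_subtopology g_def[abs_def] o_def Collect_conj_eq[symmetric] Int_def conj_ac)
    show "f x = g x" if "x \<in> topspace (top_of_set V)" "0 = Im x" for x
      using that t1.T01(2)[of "Re x"] t2.T01(2)[of "Re x"] by (auto simp: f_def g_def V_def)
  qed
  have up: "h z \<in> kt {r1, p, q}" if "z \<in> V" "0 \<le> Im z" for z
    using that unfolding kt_K[OF t1] t1.K_iff by (intro bexI[of _ "Re z"] bexI[of _ "1 - Im z"]) (auto simp: h_def f_def V_def)
  have lo: "h z \<in> inn {r2, p, q}" if "z \<in> V" "Im z < 0" for z
    using that unfolding inn_inner[OF t2] t2.inner_iff by (intro exI[of _ "Re z"] exI[of _ "1 + Im z"]) (auto simp: h_def g_def V_def)
  have dj: "kt {r1, p, q} \<inter> inn {r2, p, q} = {}"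
  proof -
    have "{r1, p, q} \<noteq> {r2, p, q}" using r by (auto simp: insert_eq_iff)
    then show ?thesis using sd_inn[OF F] inn_disjoint[OF F] unfolding kt_def by blast
  qed
  have inj: "inj_on h V"
  proof (rule inj_onI)
    fix z w assume z: "z \<in> V" "w \<in> V" and e: "h z = h w"
    have zw: "Re z \<in> {0..1}" "Re w \<in> {0..1}" using z by (auto simp: V_def)
    consider "0 \<le> Im z" "0 \<le> Im w" | "0 \<le> Im z" "Im w < 0" | "Im z < 0" "0 \<le> Im w" | "Im z < 0" "Im w < 0" by linarith
    then show "z = w"
    proof cases
      case 1
      then have i: "1 - Im z \<in> {0..1}" "1 - Im w \<in> {0..1}" "1 - Im z \<noteq> 0" using z by (auto simp: V_def)
      show ?thesis using t1.T_inj[OF zw i(1,2)] i(3) e 1 by (auto simp: h_def f_def complex_eq_iff)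
    next
      case 2 then show ?thesis using up lo dj z e by (metis disjoint_iff)
    next
      case 3 then show ?thesis using up lo dj z e by (metis disjoint_iff)
    next
      case 4
      then have i: "1 + Im z \<in> {0..1}" "1 + Im w \<in> {0..1}" "1 + Im z \<noteq> 0" using z by (auto simp: V_def)
      show ?thesis using t2.T_inj[OF zw i(1,2)] i(3) e 4 by (auto simp: h_def g_def complex_eq_iff)
    qed
  qed
  show ?thesis
  proof
    show "openin X (h ` V)" by (rule invariance_of_domain_X[OF c Vo inj])
    show "h ` V \<subseteq> cov"
    proof
      fix y assume "y \<in> h ` V"
      then obtain z where z: "z \<in> V" "y = h z" by blast
      then have "y \<in> kt {r1, p, q} \<or> y \<in> kt {r2, p, q}" using up[of z] lo[of z] by (cases "0 \<le> Im z") (auto simp: kt_def)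
      then show "y \<in> cov" using F by (auto simp: cov_def)
    qed
    obtain s where s: "s \<in> {0..1}" "m = G p q s" using m seg_G[OF D(1,2,4)] by blast
    have "s \<noteq> 0" "s \<noteq> 1" using s m G0[OF D(1,2,4)] G1[OF D(1,2,4)] by auto
    then have "of_real s \<in> V" using s by (auto simp: V_def)
    moreover have "h (of_real s) = m" using t1.T01(2)[OF s(1)] s(2) by (simp add: h_def f_def)
    ultimately show "m \<in> h ` V" by blast
  qed
qed

lemma cov_open: "openin X (cov - P)"
proof (subst openin_subopen, intro ballI)
  fix m assume m: "m \<in> cov - P"
  then obtain F where F: "F \<in> faces" "m \<in> kt F" by (auto simp: cov_def)
  have clP: "closedin X P"
  proof -
    have "Hausdorff_space X" using Metric_space.Hausdorff_space_mtopology[OF metric] mtop by simp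
    then show ?thesis using finP PS by (simp add: closedin_Hausdorff_finite)
  qed
  have "\<exists>W. openin X W \<and> m \<in> W \<and> W \<subseteq> cov"
  proof (cases "m \<in> inn F")
    case True
    then show ?thesis using face_props(1)[OF F(1)] F(1) by (intro exI[of _ "inn F"]) (auto simp: cov_def kt_def)
  next
    case False
    then have "m \<in> sd F" using F by (simp add: kt_def)
    with F(1) show ?thesis
    proof (cases rule: sd_cases)
      case vertex then show ?thesis using m face_S[OF F(1)] by auto
    next
      case (edge x y)
      then show ?thesis using edge_neighbourhood[OF edge(3,4)] by metis
    qed
  qed
  then obtain W where W: "openin X W" "m \<in> W" "W \<subseteq> cov" by blast
  have "openin X (W - P)" using openin_diff[OF W(1) clP] .
  then show "\<exists>T. openin X T \<and> m \<in> T \<and> T \<subseteq> cov - P" using W m by blast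
qed

text \<open>The set \<open>cov - P\<close> is open and closed in \<open>S - P\<close>. A connected subset of \<open>S - P\<close> leads from any
  point close to its nearest site \<open>p\<close>, and a small disk about \<open>p\<close> stays connected without \<open>p\<close>.\<close>

lemma clopen_connected: assumes C: "connectedin X C" "C \<inter> P = {}" "C \<inter> cov \<noteq> {}" shows "C \<subseteq> cov"
proof -
  let ?Y = "subtopology X (S - P)"
  have "C \<subseteq> S" using C(1) connectedin_subset_topspace by blast
  then have "connectedin ?Y C" using C by (auto simp: connectedin_subtopology)
  moreover have "openin ?Y (cov - P)" using cov_open openin_subset[OF cov_open] unfolding openin_subtopology by blast
  moreover have "closedin ?Y (cov - P)" unfolding closedin_subtopology using cov_closed closedin_subset[OF cov_closed] by (intro exI[of _ cov]) auto
  ultimately have "C \<subseteq> cov - P \<or> disjnt C (cov - P)" by (intro connectedin_clopen_cases)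
  then show ?thesis using C by (auto simp: disjnt_def)
qed

lemma cov_near_site: assumes p: "p \<in> P" obtains e where "e > 0" "\<And>y. y \<in> S \<Longrightarrow> d p y < e \<Longrightarrow> y \<in> cov"
proof -
  have pS: "p \<in> S" using p PS by blast
  define e where "e = Min (insert (2 * \<tau>) (d p ` (P - {p})))"
  have e: "e > 0" "e \<le> 2 * \<tau>" "\<And>q. q \<in> P \<Longrightarrow> q \<noteq> p \<Longrightarrow> e \<le> d p q"
  proof -
    show "e > 0" unfolding e_def using finP tau dpos[OF pS] PS by (subst Min_gr_iff) auto
    show "e \<le> 2 * \<tau>" unfolding e_def using finP by (intro Min_le) auto
    show "\<And>q. q \<in> P \<Longrightarrow> q \<noteq> p \<Longrightarrow> e \<le> d p q" unfolding e_def using finP by (intro Min_le) auto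
  qed
  define A where "A = ball (0::complex) e - {0}"
  have "continuous_map (top_of_set A) X (ex p)"
    by (rule continuous_map_from_subtopology_mono[OF ex_cont[OF pS]]) (use e in \<open>auto simp: A_def\<close>)
  moreover have "connected A" unfolding A_def by (rule connected_open_delete) auto
  then have "connectedin (top_of_set A) A" by (simp add: connectedin_subtopology)
  ultimately have con: "connectedin X (ex p ` A)" by (rule connectedin_continuous_map_image)
  have im: "y \<in> ex p ` A" if "y \<in> S" "d p y < e" "y \<noteq> p" for y
  proof -
    have l: "d p y < 2 * \<tau>" using that e by simp
    have "lg p y \<in> A" using lg_nonzero[OF pS that(1) l that(3)] lg_norm[OF pS that(1) l] that by (simp add: A_def)
    then show ?thesis using ex_lg[OF pS that(1) l] by (metis imageI)
  qed
  have P: "ex p ` A \<inter> P = {}"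
  proof -
    have "ex p z \<notin> P" if z: "z \<in> A" for z
    proof
      assume zP: "ex p z \<in> P"
      have "cmod z < 2 * \<tau>" using z e by (simp add: A_def)
      then have "d p (ex p z) = cmod z" using ex(3)[OF pS] by blast
      then have "0 < d p (ex p z)" "d p (ex p z) < e" using z by (auto simp: A_def)
      then show False using e(3)[OF zP] dself[OF pS] by force
    qed
    then show ?thesis by blast
  qed
  obtain F where F: "F \<in> faces" "p \<in> F" using site_face[OF p] .
  obtain x where x: "x \<in> inn F" "d p x < e" using face_props(10)[OF F e(1)] by blast
  have xc: "x \<in> cov" "x \<in> S" "x \<noteq> p" using x F face_props(5)[OF F(1)] face_props(8)[OF F(1)] p by (auto simp: cov_def kt_def)
  then have "ex p ` A \<inter> cov \<noteq> {}" using im x by blast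
  then have "ex p ` A \<subseteq> cov" by (rule clopen_connected[OF con P])
  then have "y \<in> cov" if "y \<in> S" "d p y < e" for y using im[OF that] P_cov p by (cases "y = p") auto
  then show ?thesis using that e(1) by blast
qed

lemma cov_all: "cov = S"
proof (intro equalityI subsetI)
  fix x assume x: "x \<in> S"
  show "x \<in> cov"
  proof (cases "x \<in> P")
    case True then show ?thesis using P_cov by blast
  next
    case xP: False
    obtain p where p: "p \<in> near x" using near_ne[OF x] .
    have pS: "p \<in> S" "p \<in> P" using p near_S near_P by blast+
    have l: "d x p < 2 * \<tau>" using near_lt(3)[OF x p] .
    obtain e where e: "e > 0" "\<And>y. y \<in> S \<Longrightarrow> d p y < e \<Longrightarrow> y \<in> cov" using cov_near_site[OF pS(2)] by blast
    have xp: "x \<noteq> p" using xP pS by blast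
    let ?C = "G x p ` {0..<1}"
    have "continuous_map (top_of_set {0..<1}) X (G x p)"
      by (rule continuous_map_from_subtopology_mono[OF G_path_cont[OF x pS(1) l]]) auto
    moreover have "connectedin (top_of_set {0..<1::real}) {0..<1}" by (simp add: connectedin_subtopology)
    ultimately have con: "connectedin X ?C" by (rule connectedin_continuous_map_image)
    have noP: "?C \<inter> P = {}"
    proof -
      have "G x p t \<notin> P" if t: "0 \<le> t" "t < 1" for t
      proof
        assume GP: "G x p t \<in> P"
        have 01: "t \<in> {0..1}" using t by simp
        have g: "G x p t \<in> S" "bt p (G x p t) x" using G_mem[OF x pS(1) l 01] bt_G[OF x pS(1) l 01] bt_sym by auto
        have "G x p t \<noteq> x" using GP xP by auto
        then have "near (G x p t) = {p}" using near_strict(1)[OF x p g] by simp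
        then have "G x p t = p" using site_near_self[OF GP] by simp
        then have "t = 1" using G_inj[OF x pS(1) l xp 01, of 1] G1[OF x pS(1) l] by simp
        then show False using t by simp
      qed
      then show ?thesis by auto
    qed
    define t where "t = max 0 (1 - e / (4 * \<tau>))"
    have t: "0 \<le> t" "t < 1" "(1 - t) * (2 * \<tau>) < e" using e(1) tau by (auto simp: t_def max_def field_simps)
    have 01: "t \<in> {0..1}" using t by simp
    have "d (G x p t) p = (1 - t) * d x p" by (rule G_dr[OF x pS(1) l 01])
    also have "\<dots> \<le> (1 - t) * (2 * \<tau>)" using l t by (intro mult_left_mono) auto
    finally have "d p (G x p t) < e" using t dsym[of p] by simp
    then have "G x p t \<in> cov" using e(2) G_mem[OF x pS(1) l 01] by blast
    moreover have "G x p t \<in> ?C" using t by (intro imageI) auto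
    ultimately have "?C \<inter> cov \<noteq> {}" by blast
    then have "?C \<subseteq> cov" by (rule clopen_connected[OF con noP])
    moreover have "x \<in> ?C" using G0[OF x pS(1) l] by (intro image_eqI[of _ _ 0]) auto
    ultimately show ?thesis by blast
  qed
qed (use closedin_subset[OF cov_closed] in auto)

end

lemma Hausdorff_space_fun: "Hausdorff_space (euclidean :: ('b \<Rightarrow> real) topology)"
  unfolding euclidean_product_topology[symmetric] by (simp add: Hausdorff_space_product_topology)

lemma (in geosurf) Hausdorff_X: "Hausdorff_space X"
  using Metric_space.Hausdorff_space_mtopology[OF metric] mtop by simp

context sites begin

section \<open>The natural map\<close>

definition cplx :: "'a set set" where "cplx = (\<lambda>p. {p}) ` P \<union> edges \<union> faces"

lemma subset_face: assumes F: "F \<in> faces" "\<sigma> \<subseteq> F" "\<sigma> \<noteq> {}" shows "\<sigma> \<in> cplx"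
proof -
  have f: "finite F" "F \<subseteq> P" using face_S[OF F(1)] by auto
  have "card \<sigma> \<le> 3" using card_mono[OF f(1) F(2)] F(1) by (simp add: faces_def)
  moreover have "card \<sigma> \<noteq> 0" using finite_subset[OF F(2) f(1)] F(3) by simp
  ultimately consider "card \<sigma> = 1" | "card \<sigma> = 2" | "card \<sigma> = 3" by linarith
  then show ?thesis
  proof cases
    case 1
    then obtain x where "\<sigma> = {x}" by (rule card_1_singletonE)
    then show ?thesis using F f by (auto simp: cplx_def)
  next
    case 2
    then have "\<sigma> \<in> edges" using F f unfolding edges_def faces_def by blast
    then show ?thesis by (simp add: cplx_def)
  next
    case 3
    then have "\<sigma> = F" using card_subset_eq[OF f(1) F(2)] F(1) by (simp add: faces_def)
    then show ?thesis using F by (simp add: cplx_def)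
  qed
qed

lemma simplex_face: assumes "\<sigma> \<in> cplx" obtains F where "F \<in> faces" "\<sigma> \<subseteq> F"
proof -
  consider p where "\<sigma> = {p}" "p \<in> P" | "\<sigma> \<in> edges" | "\<sigma> \<in> faces" using assms by (auto simp: cplx_def)
  then show ?thesis
  proof cases
    case 1
    then show ?thesis using site_face[of p] that by auto
  next
    case 2
    then obtain p q where pq: "\<sigma> = {p, q}" by (auto simp: edges_def card_2_iff)
    then obtain r where "{p, q, r} \<in> faces" using edge_faces 2 by metis
    then show ?thesis using that[of "{p, q, r}"] pq by blast
  next
    case 3 then show ?thesis using that by blast
  qed
qed

lemma closed_simplex_face: assumes F: "F \<in> faces"
  shows "closed_simplex cplx F = {b. (\<forall>v. 0 \<le> b v) \<and> {v. b v \<noteq> 0} \<subseteq> F \<and> sum b F = 1}"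
proof -
  have s: "sum b {v. b v \<noteq> 0} = sum b F" if "{v. b v \<noteq> 0} \<subseteq> F" for b :: "'a \<Rightarrow> real"
    using face_S(2)[OF F] that by (intro sum.mono_neutral_left) auto
  have "{v. b v \<noteq> 0} \<in> cplx" if "{v. b v \<noteq> 0} \<subseteq> F" "sum b F = 1" for b :: "'a \<Rightarrow> real"
  proof -
    have "{v. b v \<noteq> 0} \<noteq> {}"
    proof
      assume "{v. b v \<noteq> 0} = {}"
      then have "sum b {v. b v \<noteq> 0} = 0" by (simp only: sum.empty)
      then show False using s[OF that(1)] that(2) by simp
    qed
    then show ?thesis using subset_face[OF F that(1)] by blast
  qed
  then show ?thesis using s by (auto simp: closed_simplex_def realization_def)
qed

lemma realization_face: assumes "b \<in> realization cplx" obtains F where "F \<in> faces" "b \<in> closed_simplex cplx F"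
proof -
  have "{v. b v \<noteq> 0} \<in> cplx" using assms by (simp add: realization_def)
  then obtain F where "F \<in> faces" "{v. b v \<noteq> 0} \<subseteq> F" using simplex_face by metis
  then show ?thesis using that assms by (simp add: closed_simplex_def)
qed

end

section \<open>The fan as a map on a simplex\<close>

context triangle begin

lemma face: "{p, q, r} \<in> faces"
proof -
  have "card {p, q, r} = 3" using ne by simp
  then show ?thesis using mem a nr by (auto simp: faces_def)
qed

definition bary :: "complex \<Rightarrow> 'a \<Rightarrow> real" where
  "bary z = (\<lambda>v. if v = p then 1 - Im z else if v = q then (1 - Re z) * Im z else if v = r then Re z * Im z else 0)"

text \<open>At the vertex \<open>p\<close> the quotient is \<open>0 / 0 = 0\<close>, and at height
  zero \<open>T\<close> is \<open>p\<close> whatever its first parameter.\<close>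

definition fan :: "('a \<Rightarrow> real) \<Rightarrow> 'a" where "fan b = T p q r (b r / (b q + b r)) (b q + b r)"

abbreviation \<Delta> :: "('a \<Rightarrow> real) set" where "\<Delta> \<equiv> closed_simplex cplx {p, q, r}"

abbreviation (input) sq :: "complex set" where "sq \<equiv> {z. 0 \<le> Re z \<and> Re z \<le> 1 \<and> 0 \<le> Im z \<and> Im z \<le> 1}"

lemma simplex_iff: "b \<in> \<Delta> \<longleftrightarrow> (\<forall>v. 0 \<le> b v) \<and> (\<forall>v. v \<noteq> p \<longrightarrow> v \<noteq> q \<longrightarrow> v \<noteq> r \<longrightarrow> b v = 0) \<and> b p + b q + b r = 1"
  unfolding closed_simplex_face[OF face] using ne by (auto simp: add.assoc)

lemma simplexD: assumes "b \<in> \<Delta>" shows "0 \<le> b v" "b p + b q + b r = 1" "v \<noteq> p \<Longrightarrow> v \<noteq> q \<Longrightarrow> v \<noteq> r \<Longrightarrow> b v = 0"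
    "b q + b r \<in> {0..1}" "b r / (b q + b r) \<in> {0..1}"
proof -
  show A: "0 \<le> b v" "b p + b q + b r = 1" "v \<noteq> p \<Longrightarrow> v \<noteq> q \<Longrightarrow> v \<noteq> r \<Longrightarrow> b v = 0" for v using assms unfolding simplex_iff by blast+
  show "b q + b r \<in> {0..1}" using A(1)[of p] A(1)[of q] A(1)[of r] A(2) by simp
  show "b r / (b q + b r) \<in> {0..1}" using A(1)[of q] A(1)[of r] by (auto simp: divide_simps)
qed

lemma bary_image: "bary ` sq = \<Delta>"
proof (intro equalityI subsetI)
  fix b assume "b \<in> bary ` sq"
  then obtain z where z: "0 \<le> Re z" "Re z \<le> 1" "0 \<le> Im z" "Im z \<le> 1" "b = bary z" by blast
  show "b \<in> \<Delta>" unfolding simplex_iff z(5) bary_def using z(1-4) ne mult_right_le_one_le[of "Im z" "Re z"] by (auto simp: algebra_simps)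
next
  fix b assume b: "b \<in> \<Delta>"
  note D = simplexD[OF b]
  let ?z = "Complex (b r / (b q + b r)) (b q + b r)"
  have "b v = bary ?z v" for v
  proof (cases "b q + b r = 0")
    case True
    then have "b q = 0" "b r = 0" using D(1)[of q] D(1)[of r] by auto
    then show ?thesis using D(2) D(3)[of v] by (auto simp: bary_def)
  next
    case False
    then show ?thesis using D(2) D(3)[of v] by (auto simp: bary_def divide_simps)
  qed
  then have "b = bary ?z" by blast
  moreover have "?z \<in> sq" using D(4,5) by simp
  ultimately show "b \<in> bary ` sq" by blast
qed

lemma simplex_Hausdorff: "Hausdorff_space (top_of_set \<Delta>)"
  by (rule Hausdorff_space_subtopology[OF Hausdorff_space_fun])

lemma bary_cont: "continuous_map (top_of_set sq) (top_of_set \<Delta>) bary"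
proof -
  have "continuous_on sq (\<lambda>z. bary z v)" for v
    unfolding bary_def by (cases "v = p"; cases "v = q"; cases "v = r") (auto intro!: continuous_intros)
  then have "continuous_on sq bary" by (rule continuous_on_coordinatewise_then_product)
  then show ?thesis using bary_image unfolding continuous_map_in_subtopology by auto
qed

lemma sq_compact: "compact_space (top_of_set sq)"
proof -
  have "sq = cbox 0 (Complex 1 1)" by (auto simp: in_cbox_complex_iff)
  then have "compact sq" by simp
  then show ?thesis by (simp add: compact_space_subtopology)
qed

text \<open>\<open>bary\<close> collapses the side \<open>Im z = 0\<close> of the square to the
  vertex \<open>p\<close>, so it is not injective. The quotient property still transfers continuity
  from \<open>T\<close> to \<open>fan\<close>, also at that vertex.\<close>

lemma bary_quotient: "quotient_map (top_of_set sq) (top_of_set \<Delta>) bary"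
  by (rule T1_Spaces.continuous_imp_quotient_map[OF bary_cont sq_compact simplex_Hausdorff]) (use bary_image in auto)

lemma simplex_compact: "compact_space (top_of_set \<Delta>)"
  using image_compactin[OF _ bary_cont, of sq] sq_compact bary_image by (simp add: compact_space_def)

lemma fan_bary: assumes "z \<in> sq" shows "fan (bary z) = T p q r (Re z) (Im z)"
proof -
  have "bary z q + bary z r = Im z" "bary z r = Re z * Im z" using ne by (auto simp: bary_def algebra_simps)
  then have e: "fan (bary z) = T p q r (Re z * Im z / Im z) (Im z)" by (simp add: fan_def)
  show ?thesis
  proof (cases "Im z = 0")
    case True
    then show ?thesis using e assms T01(1)[of "Re z"] T01(1)[of 0] by simp
  qed (use e in simp)
qed

lemma fan_cont: "continuous_map (top_of_set \<Delta>) X fan"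
proof -
  have "continuous_map (top_of_set sq) X (fan \<circ> bary)" by (rule continuous_map_eq[OF T_cont]) (use fan_bary in auto)
  then show ?thesis using continuous_compose_quotient_map_eq[OF bary_quotient] by blast
qed

lemma fan_inj: "inj_on fan \<Delta>"
proof (rule inj_onI)
  fix b c assume b: "b \<in> \<Delta>" and c: "c \<in> \<Delta>" and e: "fan b = fan c"
  note B = simplexD[OF b] and C = simplexD[OF c]
  have h: "b q + b r = c q + c r" using T_inj(1)[OF B(5) C(5) B(4) C(4)] e by (simp add: fan_def)
  have "b q = c q \<and> b r = c r"
  proof (cases "b q + b r = 0")
    case True
    then show ?thesis using h B(1)[of q] B(1)[of r] C(1)[of q] C(1)[of r] by simp
  next
    case False
    then have "b r / (b q + b r) = c r / (c q + c r)" using T_inj(2)[OF B(5) C(5) B(4) C(4)] e by (simp add: fan_def)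
    then show ?thesis using False h by simp
  qed
  then show "b = c" using B(2,3) C(2,3) by (intro ext) (metis add_right_cancel add.assoc)
qed

lemma fan_homeo: "homeomorphic_map (top_of_set \<Delta>) (subtopology X (kt {p, q, r})) fan"
proof -
  have kt: "kt {p, q, r} = K" by (rule kt_K[OF triangle_axioms])
  have im: "fan ` \<Delta> = K" unfolding bary_image[symmetric] K_def image_image using fan_bary by (intro image_cong) auto
  show ?thesis unfolding kt
  proof (rule continuous_imp_homeomorphic_map[OF _ simplex_compact])
    show "continuous_map (top_of_set \<Delta>) (subtopology X K) fan" using fan_cont im by (auto simp: continuous_map_in_subtopology)
    show "Hausdorff_space (subtopology X K)" by (rule Hausdorff_space_subtopology[OF Hausdorff_X])
    show "fan ` topspace (top_of_set \<Delta>) = topspace (subtopology X K)" using im K_S by auto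
    show "inj_on fan (topspace (top_of_set \<Delta>))" using fan_inj by simp
  qed
qed

text \<open>On the sides the fan does not depend on the apex, so the maps of two faces agree on a
  common edge.\<close>

lemma fan_edge: assumes b: "b \<in> \<Delta>" and xy: "x \<in> {p, q, r}" "y \<in> {p, q, r}" "x \<noteq> y" "b x + b y = 1"
  shows "fan b = G x y (b y)"
proof -
  note D = simplexD[OF b]
  have 1: "fan b = G p q (b q)" if "b p + b q = 1" using that D(2) T01(3)[of "b q"] by (simp add: fan_def)
  have 2: "fan b = G p r (b r)" if "b p + b r = 1"
  proof -
    have "b q = 0" using that D(2) by simp
    then show ?thesis using T01(4)[of "b r"] T01(1)[of 0] G0[OF mem(1,3) side(3)] by (cases "b r = 0") (auto simp: fan_def)
  qed
  have 3: "fan b = G q r (b r)" if "b q + b r = 1"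
    using that T01(2)[of "b r"] D(1)[of q] D(1)[of r] by (simp add: fan_def)
  have "b v \<in> {0..1}" for v
  proof (cases "v \<in> {p, q, r}")
    case True then show ?thesis using D(1)[of p] D(1)[of q] D(1)[of r] D(2) by auto
  next
    case False then show ?thesis using D(3)[of v] by simp
  qed
  note v01 = this
  have rev: "G v u (b u) = G u v (b v)" if "u \<in> S" "v \<in> S" "d u v < 2 * \<tau>" "b u + b v = 1" for u v
  proof -
    have "1 - b u = b v" using that(4) by simp
    then show ?thesis using G_rev[OF that(1-3) v01[of u]] by simp
  qed
  consider "x = p" "y = q" | "x = q" "y = p" | "x = p" "y = r" | "x = r" "y = p" | "x = q" "y = r" | "x = r" "y = q" using xy by auto
  then show ?thesis
    using 1 2 3 xy(4) rev[OF mem(1,2) side(2)] rev[OF mem(2,3) side(1)] rev[OF mem(1,3) side(3)] by cases (simp_all add: add.commute)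
qed

end

context sites begin

text \<open>\<open>natural_map\<close> in terms of \<open>G\<close> and \<open>kt\<close>;
  \<open>natural_map_nmap\<close> shows the equivalence.\<close>

definition nmap :: "(('a \<Rightarrow> real) \<Rightarrow> 'a) \<Rightarrow> bool" where
  "nmap R \<longleftrightarrow> continuous_map (top_of_set (realization cplx)) X R \<and> (\<forall>p\<in>P. R (vertex_point p) = p) \<and>
     (\<forall>p q. {p, q} \<in> edges \<longrightarrow> (\<forall>t\<in>{0..1}. R (edge_point p q t) = G p q t)) \<and>
     (\<forall>F\<in>faces. homeomorphic_map (top_of_set (closed_simplex cplx F)) (subtopology X (kt F)) R)"

lemma vertex_simplex: assumes "F \<in> faces" "x \<in> F" shows "vertex_point x \<in> closed_simplex cplx F"
  unfolding closed_simplex_face[OF assms(1)] using assms(2) face_S(2)[OF assms(1)] by (auto simp: vertex_point_def)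

lemma edge_simplex: assumes "F \<in> faces" "x \<in> F" "y \<in> F" "t \<in> {0..1}" shows "edge_point x y t \<in> closed_simplex cplx F"
proof -
  have "sum (edge_point x y t) F = (1 - t) * sum (vertex_point x) F + t * sum (vertex_point y) F"
    by (simp add: edge_point_def sum.distrib sum_distrib_left)
  also have "\<dots> = 1" using assms face_S(2)[OF assms(1)] by (simp add: vertex_point_def)
  finally show ?thesis
    unfolding closed_simplex_face[OF assms(1)] using assms(2-4) by (auto simp: edge_point_def vertex_point_def)
qed

lemma face_compact: assumes F: "F \<in> faces" shows "compactin euclidean (closed_simplex cplx F)"
proof -
  obtain p where "p \<in> F" using face_S[OF F] by blast
  then obtain a q r where t: "F = {p, q, r}" "triangle X d \<tau> G lg P \<delta> a p q r" using face_triangle[OF F] by metis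
  show ?thesis using triangle.simplex_compact[OF t(2)] t(1) by (simp add: compact_space_subtopology compactin_subspace)
qed

lemma realization_eq: "realization cplx = (\<Union>F\<in>faces. closed_simplex cplx F)"
proof -
  have "closed_simplex cplx F \<subseteq> realization cplx" for F by (auto simp: closed_simplex_def)
  moreover have "realization cplx \<subseteq> (\<Union>F\<in>faces. closed_simplex cplx F)" using realization_face by blast
  ultimately show ?thesis by blast
qed

lemma support_cases:
  assumes b: "b \<in> realization cplx"
  obtains (vertex) p where "p \<in> P" "b = vertex_point p"
  | (edge) p q t where "{p, q} \<in> edges" "{v. b v \<noteq> 0} = {p, q}" "0 < t" "t < 1" "b = edge_point p q t"
  | (face) "{v. b v \<noteq> 0} \<in> faces"
proof -
  have B: "\<And>v. 0 \<le> b v" "{v. b v \<noteq> 0} \<in> cplx" "sum b {v. b v \<noteq> 0} = 1" using b by (auto simp: realization_def)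
  consider p where "p \<in> P" "{v. b v \<noteq> 0} = {p}" | "{v. b v \<noteq> 0} \<in> edges" | "{v. b v \<noteq> 0} \<in> faces" using B(2) by (auto simp: cplx_def)
  then show ?thesis
  proof cases
    case 1
    have "b v = vertex_point p v" for v
      using 1(2) B(3) by (cases "v = p") (auto simp: vertex_point_def)
    then have "b = vertex_point p" by blast
    then show ?thesis by (rule vertex[OF 1(1)])
  next
    case 2
    then obtain p q where pq: "{v. b v \<noteq> 0} = {p, q}" "p \<noteq> q" by (auto simp: edges_def card_2_iff)
    have s: "b p + b q = 1" "b p \<noteq> 0" "b q \<noteq> 0" using B(3) pq by auto
    have "b v = edge_point p q (b q) v" for v
    proof (cases "v \<in> {p, q}")
      case True then show ?thesis using s pq(2) by (auto simp: edge_point_def vertex_point_def)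
    next
      case False
      then have "b v = 0" using pq(1) by blast
      then show ?thesis using False by (simp add: edge_point_def vertex_point_def)
    qed
    then have e: "b = edge_point p q (b q)" by blast
    have "{p, q} \<in> edges" using 2 pq(1) by simp
    then show ?thesis by (rule edge[OF _ pq(1) _ _ e]) (use s B(1)[of p] B(1)[of q] in auto)
  next
    case 3 then show ?thesis by (rule face)
  qed
qed

text \<open>The fans of the faces agree on common edges and vertices, and the pasting lemma glues
  them over the finitely many closed simplices.\<close>

lemma nmap_exists: "\<exists>R. nmap R"
proof -
  have "\<forall>F\<in>faces. \<exists>f. homeomorphic_map (top_of_set (closed_simplex cplx F)) (subtopology X (kt F)) f \<and>
      (\<forall>b x y. b \<in> closed_simplex cplx F \<longrightarrow> x \<in> F \<longrightarrow> y \<in> F \<longrightarrow> x \<noteq> y \<longrightarrow> b x + b y = 1 \<longrightarrow> f b = G x y (b y))"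
  proof
    fix F assume F: "F \<in> faces"
    obtain p where "p \<in> F" using face_S[OF F] by blast
    then obtain a q r where t: "F = {p, q, r}" "triangle X d \<tau> G lg P \<delta> a p q r" using face_triangle[OF F] by metis
    show "\<exists>f. homeomorphic_map (top_of_set (closed_simplex cplx F)) (subtopology X (kt F)) f \<and>
      (\<forall>b x y. b \<in> closed_simplex cplx F \<longrightarrow> x \<in> F \<longrightarrow> y \<in> F \<longrightarrow> x \<noteq> y \<longrightarrow> b x + b y = 1 \<longrightarrow> f b = G x y (b y))"
      unfolding t(1) using triangle.fan_homeo[OF t(2)] triangle.fan_edge[OF t(2)] by blast
  qed
  from bchoice[OF this] obtain f where
      f: "\<And>F. F \<in> faces \<Longrightarrow> homeomorphic_map (top_of_set (closed_simplex cplx F)) (subtopology X (kt F)) (f F)"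
    and e: "\<And>F b x y. F \<in> faces \<Longrightarrow> b \<in> closed_simplex cplx F \<Longrightarrow> x \<in> F \<Longrightarrow> y \<in> F \<Longrightarrow> x \<noteq> y \<Longrightarrow> b x + b y = 1 \<Longrightarrow> f F b = G x y (b y)"
    by blast
  have vx: "f F (vertex_point x) = x" if F: "F \<in> faces" "x \<in> F" for F x
  proof -
    obtain a q r where t: "F = {x, q, r}" "triangle X d \<tau> G lg P \<delta> a x q r" using face_triangle[OF F] by metis
    interpret t: triangle X d \<tau> G lg P \<delta> a x q r by fact
    have "f F (vertex_point x) = G x q (vertex_point x q)"
      by (rule e[OF F(1) vertex_simplex[OF F] F(2)]) (use t(1) t.ne in \<open>auto simp: vertex_point_def\<close>)
    then show ?thesis using G0[OF t.mem(1,2) t.side(2)] t.ne by (simp add: vertex_point_def)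
  qed
  have eg: "f F (edge_point x y t) = G x y t" if F: "F \<in> faces" "x \<in> F" "y \<in> F" "x \<noteq> y" "t \<in> {0..1}" for F x y t
    using e[OF F(1) edge_simplex[OF F(1-3,5)] F(2-4)] F(4) by (simp add: edge_point_def vertex_point_def)
  have agree: "f F1 b = f F2 b" if F: "F1 \<in> faces" "F2 \<in> faces" and b: "b \<in> closed_simplex cplx F1" "b \<in> closed_simplex cplx F2" for F1 F2 b
  proof (cases "F1 = F2")
    case False
    have br: "b \<in> realization cplx" "{v. b v \<noteq> 0} \<subseteq> F1" "{v. b v \<noteq> 0} \<subseteq> F2" using b by (auto simp: closed_simplex_def)
    from br(1) show ?thesis
    proof (cases rule: support_cases)
      case (vertex p)
      then have "p \<in> F1" "p \<in> F2" using br(2,3) by (auto simp: vertex_point_def)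
      then show ?thesis using vx F vertex(2) by simp
    next
      case (edge p q t)
      have m: "p \<in> F1" "q \<in> F1" "p \<in> F2" "q \<in> F2" using br(2,3) unfolding edge(2) by auto
      have t: "p \<noteq> q" "t \<in> {0..1}" using edge_dist(3)[OF edge(1)] edge(3,4) by auto
      show ?thesis using eg[OF F(1) m(1,2) t] eg[OF F(2) m(3,4) t] unfolding edge(5) by simp
    next
      case face
      have "{v. b v \<noteq> 0} = F" if "F \<in> faces" "{v. b v \<noteq> 0} \<subseteq> F" for F
        using card_subset_eq[OF face_S(2)[OF that(1)] that(2)] that(1) face by (simp add: faces_def)
      from this[OF F(1) br(2)] this[OF F(2) br(3)] show ?thesis by simp
    qed
  qed simp
  obtain R where R: "continuous_map (top_of_set (realization cplx)) X R"
      "\<And>b F. F \<in> faces \<Longrightarrow> b \<in> topspace (top_of_set (realization cplx)) \<inter> closed_simplex cplx F \<Longrightarrow> R b = f F b"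
  proof (rule pasting_lemma_exists_closed[of faces "top_of_set (realization cplx)" "closed_simplex cplx" X f])
    show "finite faces" by (rule finite_faces)
    show "topspace (top_of_set (realization cplx)) \<subseteq> \<Union> (closed_simplex cplx ` faces)" using realization_eq by simp
    fix F assume F: "F \<in> faces"
    have sub: "closed_simplex cplx F \<subseteq> realization cplx" by (auto simp: closed_simplex_def)
    have "closedin euclidean (closed_simplex cplx F)" by (rule compactin_imp_closedin[OF Hausdorff_space_fun face_compact[OF F]])
    then show "closedin (top_of_set (realization cplx)) (closed_simplex cplx F)" using sub unfolding closedin_subtopology by blast
    have "continuous_map (top_of_set (closed_simplex cplx F)) X (f F)"
      using homeomorphic_imp_continuous_map[OF f[OF F]] by (simp add: continuous_map_in_subtopology)
    then show "continuous_map (subtopology (top_of_set (realization cplx)) (closed_simplex cplx F)) X (f F)"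
      using sub by (simp add: subtopology_subtopology Int_absorb1)
  qed (use agree in blast)+
  have RF: "R b = f F b" if "F \<in> faces" "b \<in> closed_simplex cplx F" for F b
    using R(2)[OF that(1)] that(2) by (simp add: closed_simplex_def)
  have "R (vertex_point p) = p" if "p \<in> P" for p
  proof -
    obtain F where F: "F \<in> faces" "p \<in> F" using site_face[OF \<open>p \<in> P\<close>] .
    then show ?thesis using RF[OF F(1) vertex_simplex[OF F]] vx[OF F] by simp
  qed
  moreover have "R (edge_point p q t) = G p q t" if pq: "{p, q} \<in> edges" "t \<in> {0..1}" for p q t
  proof -
    obtain r where F: "{p, q, r} \<in> faces" using edge_faces[OF pq(1)] by metis
    show ?thesis using RF[OF F edge_simplex[OF F _ _ pq(2)]] eg[OF F _ _ edge_dist(3)[OF pq(1)] pq(2)] by simp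
  qed
  moreover have "homeomorphic_map (top_of_set (closed_simplex cplx F)) (subtopology X (kt F)) R" if "F \<in> faces" for F
    by (rule homeomorphic_map_eq[OF f[OF that]]) (use RF[OF that] in auto)
  ultimately show ?thesis using R(1) by (auto simp: nmap_def)
qed

text \<open>Vertices, open edges and open simplices go to sites, open edges and open triangles,
  which are pairwise disjoint. So points with equal images have equal supports and lie in one closed
  simplex, where the map is injective. Surjectivity is \<open>cov_all\<close>.\<close>

lemma nmap_homeo: assumes R: "nmap R" shows "homeomorphic_map (top_of_set (realization cplx)) X R"
proof -
  have cR: "continuous_map (top_of_set (realization cplx)) X R" and vx: "\<And>p. p \<in> P \<Longrightarrow> R (vertex_point p) = p"
    and eg: "\<And>p q t. {p, q} \<in> edges \<Longrightarrow> t \<in> {0..1} \<Longrightarrow> R (edge_point p q t) = G p q t"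
    and h: "\<And>F. F \<in> faces \<Longrightarrow> homeomorphic_map (top_of_set (closed_simplex cplx F)) (subtopology X (kt F)) R"
    using R by (auto simp: nmap_def)
  have im: "R ` closed_simplex cplx F = kt F" if F: "F \<in> faces" for F
    using homeomorphic_imp_surjective_map[OF h[OF F]] face_props(8)[OF F] by (simp add: Int_absorb1)
  have inj: "inj_on R (closed_simplex cplx F)" if F: "F \<in> faces" for F
    using homeomorphic_imp_injective_map[OF h[OF F]] by simp
  have cv: "R b = p \<and> p \<in> P" if "p \<in> P" "b = vertex_point p" for b p using vx that by simp
  have ce: "R b \<in> seg p q - {p, q}" if e: "{p, q} \<in> edges" "0 < t" "t < 1" "b = edge_point p q t" for b p q t
  proof -
    note D = edge_dist[OF e(1)]
    have t: "t \<in> {0..1}" using e by simp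
    have "R b = G p q t" using eg[OF e(1) t] e(4) by simp
    moreover have "G p q t \<in> seg p q" using seg_G[OF D(1,2,4)] t by blast
    moreover have "G p q t \<noteq> p" using G_inj[OF D(1,2,4,3) t, of 0] G0[OF D(1,2,4)] e by auto
    moreover have "G p q t \<noteq> q" using G_inj[OF D(1,2,4,3) t, of 1] G1[OF D(1,2,4)] e by auto
    ultimately show ?thesis by simp
  qed
  \<comment> \<open>The sides of the triangle are already the images of boundary points of the
    simplex, so injectivity on the closed simplex keeps a point of full support off them.\<close>
  have cf: "R b \<in> inn F" if b: "b \<in> realization cplx" and F: "{v. b v \<noteq> 0} = F" "F \<in> faces" for b F
  proof (rule ccontr)
    assume n: "R b \<notin> inn F"
    have bF: "b \<in> closed_simplex cplx F" using b F(1) by (simp add: closed_simplex_def)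
    then have "R b \<in> sd F" using n im[OF F(2)] by (auto simp: kt_def)
    have c3: "card F = 3" using F by (simp add: faces_def)
    from F(2) \<open>R b \<in> sd F\<close> show False
    proof (cases rule: sd_cases)
      case vertex
      have "R b \<in> P" using vertex face_S[OF F(2)] by blast
      then have "b = vertex_point (R b)" using inj_onD[OF inj[OF F(2)] _ bF vertex_simplex[OF F(2) vertex]] vx by simp
      then have "{v. b v \<noteq> 0} = {R b}" by (auto simp: vertex_point_def fun_eq_iff)
      then show False using F(1) c3 by simp
    next
      case (edge x y)
      note D = edge_dist[OF edge(3)]
      obtain t where t: "t \<in> {0..1}" "R b = G x y t" using edge(4) seg_G[OF D(1,2,4)] by blast
      then have "b = edge_point x y t"
        using inj_onD[OF inj[OF F(2)] _ bF edge_simplex[OF F(2) edge(1,2) t(1)]] eg[OF edge(3) t(1)] by simp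
      then have "{v. b v \<noteq> 0} \<subseteq> {x, y}" by (auto simp: edge_point_def vertex_point_def split: if_splits)
      then have "card F \<le> card {x, y}" unfolding F(1) by (intro card_mono) auto
      then show False using c3 card_insert_le_m1[of 2 "{y}" x] by (simp add: card_insert_if split: if_splits)
    qed
  qed
  have injR: "inj_on R (realization cplx)"
  proof (rule inj_onI)
    fix b c assume b: "b \<in> realization cplx" and c: "c \<in> realization cplx" and e: "R b = R c"
    have same: "b = c" if s: "{v. b v \<noteq> 0} = {v. c v \<noteq> 0}"
    proof -
      obtain F where F: "F \<in> faces" "b \<in> closed_simplex cplx F" using realization_face[OF b] .
      have "c \<in> closed_simplex cplx F" using F(2) c s by (simp add: closed_simplex_def)
      then show ?thesis using inj_onD[OF inj[OF F(1)] e F(2)] by blast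
    qed
    have noP: "R x \<notin> P" if "{p, q} \<in> edges" "0 < t" "t < 1" "x = edge_point p q t" for x p q t
      using ce[OF that] oe_site[OF that(1)] by blast
    have noP': "R x \<notin> P" if "x \<in> realization cplx" "{v. x v \<noteq> 0} \<in> faces" for x
      using cf[OF that(1) refl that(2)] face_props(5)[OF that(2)] by blast
    from b show "b = c"
    proof (cases rule: support_cases)
      case b: (vertex p)
      from c show ?thesis
      proof (cases rule: support_cases)
        case (vertex q) then show ?thesis using b cv e by metis
      next
        case (edge q r t) then show ?thesis using noP[OF edge(1,3-5)] cv[OF b] e by metis
      next
        case face then show ?thesis using noP'[OF c] cv[OF b] e by metis
      qed
    next
      case b: (edge p q t)
      note Rb = ce[OF b(1,3-5)]
      from c show ?thesis
      proof (cases rule: support_cases)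
        case (vertex r) then show ?thesis using noP[OF b(1,3-5)] cv[OF vertex] e by metis
      next
        case (edge r s u)
        have "{p, q} = {r, s}" using oe_disjoint[OF b(1) edge(1) Rb] ce[OF edge(1,3-5)] e by simp
        then show ?thesis using same b(2) edge(2) by simp
      next
        case face then show ?thesis using cf[OF c refl face] Rb oe_inn[OF b(1) face] e by (metis disjoint_iff)
      qed
    next
      case bf: face
      note Rb = cf[OF b refl bf]
      from c show ?thesis
      proof (cases rule: support_cases)
        case (vertex r) then show ?thesis using noP'[OF b bf] cv[OF vertex] e by metis
      next
        case (edge r s u) then show ?thesis using ce[OF edge(1,3-5)] Rb oe_inn[OF edge(1) bf] e by (metis disjoint_iff)
      next
        case face
        have "inn {v. b v \<noteq> 0} \<inter> inn {v. c v \<noteq> 0} \<noteq> {}" using cf[OF c refl face] Rb e by (metis disjoint_iff)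
        then show ?thesis using same inn_disjoint[OF bf face] by blast
      qed
    qed
  qed
  have "R ` realization cplx = (\<Union>F\<in>faces. kt F)" unfolding realization_eq image_UN using im by simp
  then have sur: "R ` realization cplx = S" using cov_all by (simp add: cov_def)
  have "compactin euclidean (realization cplx)"
    unfolding realization_eq using finite_faces(1) face_compact by (intro compactin_Union) auto
  then have "compact_space (top_of_set (realization cplx))" by (simp add: compact_space_subtopology)
  then show ?thesis using continuous_imp_homeomorphic_map[OF cR _ Hausdorff_X] sur injR by simp
qed

end

section \<open>Back to Riemannian surfaces\<close>

context rsurf_conv begin

lemma geosurf: assumes "compact_space (surf M)" shows "geosurf (surf M) dd r G lg"
proof (rule geosurf.intro)
  show "\<exists>U (\<phi> :: 'a \<Rightarrow> complex) t0 C. continuous_map (subtopology (surf M) U) euclidean \<phi> \<and> 0 < t0 \<and> t0 \<le> 1 \<and>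
       openin (surf M) U \<and> (\<forall>x t. x \<in> points M \<longrightarrow> dd a x < 2 * r \<longrightarrow> t \<in> {0..t0} \<longrightarrow>
          G a x t \<in> U \<and> cmod (\<phi> (G a x t) - t *\<^sub>R lg a x) \<le> C * t\<^sup>2)" if a: "a \<in> points M" for a
  proof -
    obtain U and \<phi> :: "'a \<Rightarrow> complex" and t0 C where "continuous_map (subtopology (surf M) U) euclidean \<phi>" "0 < t0" "t0 \<le> 1"
      "openin (surf M) U"
      "\<And>x t. x \<in> points M \<Longrightarrow> dd a x < 2 * r \<Longrightarrow> t \<in> {0..t0} \<Longrightarrow> G a x t \<in> U \<and> cmod (\<phi> (G a x t) - t *\<^sub>R lg a x) \<le> C * t\<^sup>2"
      using lg_approx[OF a] by metis
    then show ?thesis by (intro exI[of _ U] exI[of _ \<phi>] exI[of _ t0] exI[of _ C]) blast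
  qed
  show "\<exists>U (h :: 'a \<Rightarrow> complex). openin (surf M) U \<and> a \<in> U \<and> open (h ` U) \<and>
       homeomorphic_map (subtopology (surf M) U) (top_of_set (h ` U)) h" if a: "a \<in> points M" for a
    using complex_chart[OF a] by metis
  show "G (G x y s) (G x y t) u = G x y ((t - s) * u + s)"
    if "x \<in> points M" "y \<in> points M" "dd x y < 2 * r" "s \<in> {0..1}" "t \<in> {0..1}" "u \<in> {0..1}" for x y s t u
    by (rule G_sub[OF that])
  show "dd a (G x y t) < s" if "a \<in> points M" "x \<in> points M" "y \<in> points M" "x \<noteq> y" "s < r" "dd a x \<le> s" "dd a y \<le> s" "0 < t" "t < 1" for a x y s t
    by (rule G_convex[OF that])
  show "x = y" if "a \<in> points M" "x \<in> points M" "dd a x < 2 * r" "y \<in> points M" "dd a y < 2 * r" "lg a x = lg a y" for a x y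
    by (rule lg_inj[OF that])
  show "t *\<^sub>R lg (G x y t) y = - ((1 - t) *\<^sub>R lg (G x y t) x)"
    if "x \<in> points M" "y \<in> points M" "dd x y < 2 * r" "t \<in> {0..1}" for x y t
    by (rule lg_opp[OF that])
qed (use assms dd_metric dd_topology r0 G_points G_dist G_ends lg_norm lg_ray in blast)+

end

context rsurf begin

text \<open>For a good radius the distance takes all values below twice that radius, while by compactness the
  finite distances from a point are bounded. So the strong convexity radius is attained.\<close>

lemma conv_good_bounded: assumes c: "compact_space (surf M)" and a: "a \<in> points M"
  obtains b where "\<And>r. conv_good r \<Longrightarrow> r \<le> b"
proof -
  define V where "V = {x\<in>points M. rdist M a x = \<infinity>}"
  have "openin (surf M) V" unfolding openin_disk
  proof (intro conjI ballI)
    fix x assume x: "x \<in> V"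
    have "disk M x 1 \<subseteq> V"
    proof
      fix y assume y: "y \<in> disk M x 1"
      have "rdist M a x \<le> rdist M a y + rdist M y x" by (rule rdist_triangle)
      then have "rdist M a y + rdist M y x = \<infinity>" using x by (simp add: V_def)
      moreover have "rdist M y x \<noteq> \<infinity>" using y rdist_sym[of y x] by (auto simp: disk_def)
      ultimately have "rdist M a y = \<infinity>" using rdist_nonneg[of a y] rdist_nonneg[of y x] by auto
      then show "y \<in> V" using y by (simp add: V_def disk_def)
    qed
    then show "\<exists>r>0. disk M x r \<subseteq> V" by (intro exI[of _ 1]) simp
  qed (auto simp: V_def)
  then have op: "\<forall>U\<in>insert V (range (\<lambda>n::nat. disk M a n)). openin (surf M) U" using disk_open by auto
  have co: "points M \<subseteq> \<Union>(insert V (range (\<lambda>n::nat. disk M a n)))"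
  proof
    fix x assume x: "x \<in> points M"
    show "x \<in> \<Union>(insert V (range (\<lambda>n::nat. disk M a n)))"
    proof (cases "rdist M a x")
      case (real e)
      obtain n :: nat where "e < n" using reals_Archimedean2 by blast
      then have "x \<in> disk M a n" using x real by (simp add: disk_def)
      then show ?thesis by blast
    next
      case PInf then show ?thesis using x by (simp add: V_def)
    next
      case MInf then show ?thesis using rdist_nonneg[of a x] by simp
    qed
  qed
  from c[unfolded compact_space_alt, THEN spec, THEN mp, OF conjI[OF op co]]
  obtain \<F> where F: "finite \<F>" "\<F> \<subseteq> insert V (range (\<lambda>n::nat. disk M a n))" "points M \<subseteq> \<Union>\<F>"
    by blast
  have "finite (\<F> - {V})" "\<F> - {V} \<subseteq> range (\<lambda>n::nat. disk M a n)" using F by auto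
  then obtain I where I: "finite I" "\<F> - {V} = (\<lambda>n::nat. disk M a n) ` I" using finite_subset_image by metis
  define N where "N = Max (insert 1 I)"
  have N: "n \<le> N" if "n \<in> I" for n unfolding N_def using I(1) that by simp
  have N1: "1 \<le> N" unfolding N_def using I(1) by simp
  have bd: "rdist M a x = \<infinity> \<or> rdist M a x < ereal N" if x: "x \<in> points M" for x
  proof -
    obtain U where U: "U \<in> \<F>" "x \<in> U" using F(3) x by blast
    show ?thesis
    proof (cases "U = V")
      case True then show ?thesis using U by (simp add: V_def)
    next
      case False
      then obtain n where n: "n \<in> I" "U = disk M a n" using I(2) U by blast
      have "rdist M a x < ereal n" using U(2) n(2) by (simp add: disk_def)
      also have "ereal n \<le> ereal N" using N[OF n(1)] by simp
      finally show ?thesis by simp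
    qed
  qed
  have "r \<le> real N / 2" if g: "conv_good r" for r
  proof (rule ccontr)
    assume "\<not> ?thesis"
    then have r: "real N < 2 * r" by simp
    then have r0: "0 < r" by (metis le_less_trans mult_pos_pos of_nat_0_le_iff zero_less_mult_pos zero_less_numeral)
    interpret c: rsurf_conv M r by unfold_locales (use g r0 in auto)
    interpret g: geosurf "surf M" c.dd r c.G c.lg by (rule c.geosurf[OF c])
    have z: "cmod (of_real (real N)) < 2 * r" using r by simp
    let ?x = "g.ex a (of_real (real N))"
    have x: "?x \<in> points M" "c.dd a ?x = real N" using g.ex(1,3)[OF a z] by auto
    then have "rdist M a ?x = ereal (real N)" using c.dd_rdist[of a ?x] r by simp
    then show False using bd[OF x(1)] by simp
  qed
  then show ?thesis using that by blast
qed

text \<open>\<open>conv_good r\<close> concerns only radii \<open>s < r\<close>, so it passes to the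
  supremum of the good radii. Zero is good because disks of negative radius are empty, which makes
  the supremum meaningful.\<close>

lemma conv_good_radius: assumes c: "compact_space (surf M)" and a: "a \<in> points M"
  shows "conv_good (strong_convexity_radius M)"
proof -
  obtain b where b: "\<And>r. conv_good r \<Longrightarrow> r \<le> b" using conv_good_bounded[OF c a] by blast
  define R where "R = Sup {r. conv_good r}"
  have bdd: "bdd_above {r. conv_good r}" using b by (intro bdd_aboveI[of _ b]) auto
  have "disk M x s = {}" if "s < 0" for x s
  proof -
    have "\<not> rdist M x y < ereal s" for y
    proof
      assume "rdist M x y < ereal s"
      then have "0 < ereal s" using rdist_nonneg[of x y] le_less_trans by blast
      then show False using that by simp
    qed
    then show ?thesis by (auto simp: disk_def)
  qed
  then have 0: "conv_good 0" by (auto simp: conv_good_def)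
  have up: "r \<le> R" if "conv_good r" for r unfolding R_def using that by (intro cSup_upper[OF _ bdd]) simp
  have "conv_good R"
  proof -
    have "\<exists>r>s. conv_good r" if "s < R" for s
      using less_cSup_iff[of "{r. conv_good r}" s] bdd 0 that unfolding R_def by blast
    then show ?thesis unfolding conv_good_def by meson
  qed
  then have "(GREATEST r. conv_good r) = R" using up by (intro Greatest_equality)
  then show ?thesis using \<open>conv_good R\<close> by (simp add: strong_convexity_radius_def conv_good_def)
qed

end

context rsurf_conv begin

text \<open>The closure of the open disk is the closed ball, since geodesics from the centre
  approach every point at distance \<open>s\<close>; hence the topological boundary is the full
  distance circle.\<close>

lemma circle_eq: assumes c: "compact_space (surf M)" and a: "a \<in> points M" and s: "0 < s" "s < 2 * r"
  shows "circle M a s = {x\<in>points M. dd a x = s}"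
proof -
  interpret g: geosurf "surf M" dd r G lg by (rule geosurf[OF c])
  have disk: "disk M a s = {x\<in>points M. dd a x < s}" using dd_less[of s a] s by (auto simp: disk_def)
  have "points M - {x\<in>points M. dd a x \<le> s} = {x\<in>points M. s < dd a x}" by auto
  moreover have "openin (surf M) {x\<in>points M. s < dd a x}"
    unfolding g.openin_d
  proof (intro conjI ballI)
    fix x assume x: "x \<in> {x\<in>points M. s < dd a x}"
    show "\<exists>e>0. \<forall>y\<in>points M. dd x y < e \<longrightarrow> y \<in> {x\<in>points M. s < dd a x}"
    proof (intro exI[of _ "dd a x - s"] conjI ballI impI)
      fix y assume y: "y \<in> points M" "dd x y < dd a x - s"
      have "\<bar>dd a x - dd a y\<bar> \<le> dd x y" using g.dist_abs[OF a, of x y] x y by simp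
      then show "y \<in> {x\<in>points M. s < dd a x}" using y by simp
    qed (use x in auto)
  qed auto
  ultimately have "closedin (surf M) {x\<in>points M. dd a x \<le> s}" by (simp add: closedin_def)
  then have "surf M closure_of disk M a s \<subseteq> {x\<in>points M. dd a x \<le> s}" by (intro closure_of_minimal) (auto simp: disk)
  moreover have "{x\<in>points M. dd a x \<le> s} \<subseteq> surf M closure_of disk M a s" using in_closure_disk[OF a _ _ s] by blast
  ultimately have "surf M closure_of disk M a s = {x\<in>points M. dd a x \<le> s}" by blast
  moreover have "surf M interior_of disk M a s = disk M a s" using disk_open by (simp add: interior_of_openin)
  ultimately show ?thesis unfolding circle_def frontier_of_def disk by auto
qed

lemma circle_empty: assumes "s \<le> 0" shows "circle M a s = {}"
proof -
  have "\<not> rdist M a x < ereal s" for x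
  proof
    assume "rdist M a x < ereal s"
    also have "ereal s \<le> 0" using assms by (simp add: zero_ereal_def)
    finally show False using rdist_nonneg[of a x] by simp
  qed
  then have "disk M a s = {}" by (auto simp: disk_def)
  then show ?thesis by (simp add: circle_def)
qed

end

section \<open>The complex and the natural map of the theorem in terms of nearest sites\<close>

locale delaunay = rsurf_conv + fixes P :: "'a set" and \<delta> :: real
  assumes compact_M: "compact_space (surf M)" and finite_P: "finite P" and P_M: "P \<subseteq> points M"
    and delta_r: "0 < \<delta>" "\<delta> \<le> r" and dense_P: "\<And>a. a \<in> points M \<Longrightarrow> disk M a \<delta> \<inter> P \<noteq> {}"
    and four: "\<And>T a s. T \<subseteq> P \<Longrightarrow> card T = 4 \<Longrightarrow> a \<in> points M \<Longrightarrow> s < \<delta> \<Longrightarrow> \<not> T \<subseteq> circle M a s"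

sublocale delaunay \<subseteq> sites "surf M" dd r G lg P \<delta>
proof -
  interpret g: geosurf "surf M" dd r G lg by (rule geosurf[OF compact_M])
  show "sites (surf M) dd r G lg P \<delta>"
  proof unfold_locales
    show "\<exists>p\<in>P. dd x p < \<delta>" if x: "x \<in> points M" for x
      using dense_P[OF x] dd_less[of \<delta> x] delta_r r0 by (auto simp: disk_def)
    show "\<not> (\<forall>p\<in>T. dd a p = s)" if T: "T \<subseteq> P" "card T = 4" "a \<in> points M" "s < \<delta>" for T a s
    proof
      assume e: "\<forall>p\<in>T. dd a p = s"
      have "T \<noteq> {}" using T(2) by auto
      then obtain p where p: "p \<in> T" by blast
      have "s > 0"
      proof (rule ccontr)
        assume s: "\<not> s > 0"
        have "q = a" if q: "q \<in> T" for q
        proof -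
          have "dd a q = 0" using e q s g.dnn[of a q] by auto
          then show ?thesis using g.d0[OF T(3), of q] T(1) P_M q by auto
        qed
        then have "T \<subseteq> {a}" by blast
        then have "card T \<le> card {a}" by (intro card_mono) auto
        then show False using T(2) by simp
      qed
      then have "circle M a s = {x\<in>points M. dd a x = s}" using T(4) delta_r by (intro circle_eq[OF compact_M T(3)]) auto
      then show False using four[OF T] e T(1) P_M by blast
    qed
  qed (use finite_P P_M delta_r in auto)
qed

context delaunay begin

text \<open>A disk whose interior contains no site and whose boundary contains \<open>A\<close> is
  one whose centre has \<open>A\<close> among its nearest sites. Two distinct elements exclude
  radius zero, for which \<open>circle\<close> is empty.\<close>

lemma empty_circumdisk_near: assumes A: "A \<subseteq> P" "p \<in> A" "q \<in> A" "p \<noteq> q"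
  shows "empty_circumdisk M \<delta> P A a s \<longleftrightarrow> a \<in> points M \<and> A \<subseteq> near a \<and> s = dd a p"
proof
  have TM: "A \<subseteq> points M" using A(1) P_M by blast
  assume e: "empty_circumdisk M \<delta> P A a s"
  then have a: "a \<in> points M" "s < \<delta>" "A \<subseteq> circle M a s" "P \<inter> (surf M interior_of disk M a s) = {}"
    by (auto simp: empty_circumdisk_def)
  have s: "0 < s" using circle_empty[of s a] a(3) A(2) by fastforce
  have ci: "circle M a s = {x\<in>points M. dd a x = s}" using s a(2) delta_r by (intro circle_eq[OF compact_M a(1)]) auto
  have eq: "dd a x = s" if "x \<in> A" for x using a(3) ci that by blast
  have "surf M interior_of disk M a s = disk M a s" using disk_open by (simp add: interior_of_openin)
  then have "P \<inter> disk M a s = {}" using a(4) by simp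
  then have "\<not> dd a x < s" if "x \<in> P" for x using dd_less[of s a x] that P_M s a(2) delta_r by (auto simp: disk_def)
  then have "A \<subseteq> near a" using eq A(1) unfolding near_def by force
  then show "a \<in> points M \<and> A \<subseteq> near a \<and> s = dd a p" using a(1) eq[OF A(2)] by simp
next
  assume h: "a \<in> points M \<and> A \<subseteq> near a \<and> s = dd a p"
  then have a: "a \<in> points M" "A \<subseteq> near a" "s = dd a p" by auto
  have pq: "p \<in> near a" "q \<in> near a" using a(2) A by auto
  have eq: "dd a x = s" if "x \<in> A" for x using near_eq[OF _ pq(1)] a(2,3) that by blast
  have s: "s < \<delta>" using near_lt(1)[OF a(1) pq(1)] a(3) by simp
  have "0 < s"
  proof (rule ccontr)
    assume "\<not> 0 < s"
    then have "dd a p = 0" "dd a q = 0" using eq A dnn[of a p] by auto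
    then show False using d0[OF a(1)] near_S[OF pq(1)] near_S[OF pq(2)] A(4) by auto
  qed
  then have ci: "circle M a s = {x\<in>points M. dd a x = s}" using s delta_r by (intro circle_eq[OF compact_M a(1)]) auto
  have "surf M interior_of disk M a s = disk M a s" using disk_open by (simp add: interior_of_openin)
  moreover have "P \<inter> disk M a s = {}"
  proof -
    have "\<not> rdist M a x < ereal s" if "x \<in> P" for x using near_le[OF pq(1) that] a(3) dd_less[of s a x] s delta_r by simp
    then show ?thesis by (auto simp: disk_def)
  qed
  ultimately show "empty_circumdisk M \<delta> P A a s" unfolding empty_circumdisk_def using a(1) s ci eq A(1) P_M by auto
qed

lemma delaunay_sets: "delaunay_edges M \<delta> P = edges" "delaunay_faces M \<delta> P = faces" "delaunay_complex M \<delta> P = cplx"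
proof -
  have two: "(\<exists>a s. empty_circumdisk M \<delta> P A a s) \<longleftrightarrow> (\<exists>a\<in>points M. A \<subseteq> near a)" if A: "A \<subseteq> P" "card A = n" "2 \<le> n" for A n
  proof -
    obtain p where p: "p \<in> A" using A by (metis card.empty ex_in_conv not_numeral_le_zero)
    obtain q where q: "q \<in> A" "p \<noteq> q"
    proof (rule ccontr)
      assume "\<not> thesis"
      then have "A \<subseteq> {p}" using that by blast
      then have "card A \<le> card {p}" by (intro card_mono) auto
      then show False using A by simp
    qed
    show ?thesis using empty_circumdisk_near[OF A(1) p q] by blast
  qed
  show e: "delaunay_edges M \<delta> P = edges" unfolding delaunay_edges_def edges_def by (intro Collect_cong conj_cong refl) (rule two[of _ 2]; simp)
  show f: "delaunay_faces M \<delta> P = faces" unfolding delaunay_faces_def faces_def by (intro Collect_cong conj_cong refl) (rule two[of _ 3]; simp)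
  show "delaunay_complex M \<delta> P = cplx" by (simp add: delaunay_complex_def cplx_def e f)
qed

lemma minimal_segment_seg: assumes "x \<in> points M" "y \<in> points M" "x \<noteq> y" "dd x y < 2 * r" shows "minimal_segment M x y = seg x y"
proof -
  have "\<gamma> ` {0..1} = G x y ` {0..1}" if "minimal_geodesic M x y \<gamma>" for \<gamma>
    by (rule image_cong[OF refl]) (rule G_minimal(3)[OF assms that])
  then have "minimal_segment M x y = G x y ` {0..1}"
    unfolding minimal_segment_def using G_minimal(1)[OF assms] by blast
  then show ?thesis using seg_G[OF assms(1,2,4)] by simp
qed

lemma triangle_sides_sd: assumes F: "F \<in> faces" shows "triangle_sides M F = sd F"
proof -
  have "minimal_segment M x y = seg x y" if "x \<in> F" "y \<in> F - {x}" for x y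
  proof -
    have "{x, y} \<in> edges" using F that by (auto simp: faces_def edges_def)
    then show ?thesis using minimal_segment_seg[OF edge_dist(1-4)] by blast
  qed
  then show ?thesis by (simp add: triangle_sides_def sd_def)
qed

text \<open>By \<open>component_unique\<close> the union in \<open>geodesic_triangle\<close> has
  exactly one member, the open triangle.\<close>

lemma geodesic_triangle_kt: assumes F: "F \<in> faces" and e: "empty_circumdisk M \<delta> P F a s" shows "geodesic_triangle M F (disk M a s) = kt F"
proof -
  have c: "card F = 3" "F \<subseteq> P" using F by (auto simp: faces_def)
  then obtain p q t where pqt: "F = {p, q, t}" "p \<noteq> q" "p \<noteq> t" "q \<noteq> t" by (auto simp: card_3_iff)
  have a: "a \<in> points M" "F \<subseteq> near a" "s = dd a p" using empty_circumdisk_near[OF c(2) _ _ pqt(2)] e pqt(1) by auto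
  have tr: "triangle (surf M) dd r G lg P \<delta> a p q t" by (rule triangleI[OF a(1) _ _ _ pqt(2-4)]) (use a(2) pqt(1) in auto)
  interpret t: triangle "surf M" dd r G lg P \<delta> a p q t by (rule tr)
  have s: "sd F = sides p q t" "inn F = open_triangle p q t" using sd_three[OF pqt(2-4)] inn_inner[OF tr] pqt(1) by auto
  have disk: "disk M a s = {x\<in>points M. dd a x < dd a p}"
    using dd_less[of s a] near_lt(3)[OF a(1) t.nr(1)] a(3) by (auto simp: disk_def)
  have "{U \<in> connected_components_of (subtopology (surf M) (points M - sides p q t)). U \<subseteq> disk M a s} = {open_triangle p q t}"
    unfolding disk using t.component_unique t.inner_component t.inner_props(4) by blast
  then show ?thesis unfolding geodesic_triangle_def triangle_sides_sd[OF F] kt_def s by simp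
qed

text \<open>The existential quantifier over disks does no harm: every empty circumdisk of a face
  leads to the same triangle \<open>kt F\<close>.\<close>

lemma natural_map_nmap: "natural_map M \<delta> P R \<longleftrightarrow> nmap R"
proof -
  have E: "(\<exists>\<gamma>. is_unique_curve (minimal_geodesic M p q) \<gamma> \<and> (\<forall>t\<in>{0..1}. R (edge_point p q t) = \<gamma> t)) \<longleftrightarrow>
      (\<forall>t\<in>{0..1}. R (edge_point p q t) = G p q t)" if "{p, q} \<in> edges" for p q
  proof -
    note m = G_minimal[OF edge_dist(1-4)[OF that]]
    show ?thesis
    proof
      assume "\<exists>\<gamma>. is_unique_curve (minimal_geodesic M p q) \<gamma> \<and> (\<forall>t\<in>{0..1}. R (edge_point p q t) = \<gamma> t)"
      then obtain \<gamma> where g: "minimal_geodesic M p q \<gamma>" "\<forall>t\<in>{0..1}. R (edge_point p q t) = \<gamma> t" by (auto simp: is_unique_curve_def)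
      then show "\<forall>t\<in>{0..1}. R (edge_point p q t) = G p q t" using m(3)[OF g(1)] by simp
    next
      assume "\<forall>t\<in>{0..1}. R (edge_point p q t) = G p q t"
      then show "\<exists>\<gamma>. is_unique_curve (minimal_geodesic M p q) \<gamma> \<and> (\<forall>t\<in>{0..1}. R (edge_point p q t) = \<gamma> t)"
        using m(2) by blast
    qed
  qed
  have F: "(\<exists>a s. empty_circumdisk M \<delta> P F a s \<and> homeomorphic_map (top_of_set (closed_simplex cplx F))
           (subtopology (surf M) (geodesic_triangle M F (disk M a s))) R) \<longleftrightarrow>
      homeomorphic_map (top_of_set (closed_simplex cplx F)) (subtopology (surf M) (kt F)) R" if F: "F \<in> faces" for F
  proof -
    have "F \<in> delaunay_faces M \<delta> P" using F delaunay_sets by simp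
    then obtain a s where "empty_circumdisk M \<delta> P F a s" by (auto simp: delaunay_faces_def)
    then show ?thesis using geodesic_triangle_kt[OF F] by metis
  qed
  show ?thesis unfolding natural_map_def delaunay_sets Let_def nmap_def using E F by simp
qed

lemma delaunay_triangulation: "forms_delaunay_triangulation M \<delta> P"
  unfolding forms_delaunay_triangulation_def natural_map_nmap delaunay_sets using nmap_exists nmap_homeo by blast

end

text \<open>Treated apart because on the empty surface every radius is good, so that no greatest one
  exists.\<close>

lemma empty_surface:
  assumes "points M = {}" "P \<subseteq> points M" shows "forms_delaunay_triangulation M \<delta> P"
proof -
  have P: "P = {}" using assms by simp
  have K: "delaunay_edges M \<delta> P = {}" "delaunay_faces M \<delta> P = {}" by (auto simp: P delaunay_edges_def delaunay_faces_def)
  then have C: "delaunay_complex M \<delta> P = {}" by (simp add: delaunay_complex_def P)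
  have R: "realization {} = ({} :: ('a \<Rightarrow> real) set)" by (simp add: realization_def)
  have "homeomorphic_map (top_of_set {}) (surf M) R" for R :: "('a \<Rightarrow> real) \<Rightarrow> 'a"
  proof (rule continuous_imp_homeomorphic_map)
    show "continuous_map (top_of_set {}) (surf M) R" by (simp add: continuous_map_def)
    show "Hausdorff_space (surf M)" using assms(1) by (simp add: Hausdorff_space_def)
  qed (auto simp: assms(1) compact_space_subtopology)
  moreover have "natural_map M \<delta> P R" for R
    unfolding natural_map_def Let_def C K R by (simp add: P continuous_map_def)
  ultimately show ?thesis unfolding forms_delaunay_triangulation_def C R by blast
qed

theorem theorem1:
  fixes M :: "'a riemannian_data" and \<delta> :: real and P :: "'a set"
  assumes "riemannian_surface M" and "compact_space (surf M)"
    and "0 < \<delta>" and "\<delta> \<le> min (injectivity_radius M / 6) (strong_convexity_radius M)"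
    and "finite P" and "P \<subseteq> points M" and "delta_dense M \<delta> P"
  shows "forms_delaunay_triangulation M \<delta> P"
proof (cases "points M = {}")
  case True
  then show ?thesis using empty_surface assms(6) by blast
next
  case False
  then obtain a where a: "a \<in> points M" by blast
  interpret rsurf M by unfold_locales (rule assms(1))
  have "conv_good (strong_convexity_radius M)" by (rule conv_good_radius[OF assms(2) a])
  moreover have \<delta>: "\<delta> \<le> strong_convexity_radius M" using assms(4) by simp
  moreover have "\<not> T \<subseteq> circle M a s" if "T \<subseteq> P" "card T = 4" "a \<in> points M" "s < \<delta>" for T a s
  proof -
    have "s < min (injectivity_radius M / 6) (strong_convexity_radius M)" using that(4) assms(4) by simp
    then show ?thesis using assms(7) that unfolding delta_dense_def by blast
  qed
  moreover have "disk M a \<delta> \<inter> P \<noteq> {}" if "a \<in> points M" for a using assms(7) that by (simp add: delta_dense_def)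
  ultimately interpret delaunay M "strong_convexity_radius M" P \<delta>
    by unfold_locales (use assms(2,3,5,6) in auto)
  show ?thesis by (rule delaunay_triangulation)
qed

end
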